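(* Let $\delta\in\mathbb C$ with $\Re\,\delta>-1/2$, $\beta>0$, $\beta'=\beta/2$. Let $U$ be a random unitary matrix of size $n$ with law $\mathrm{CJ}^{(n)}_{\delta,\beta}$ (circular Jacobi ensemble) and let $Z_n=\det(\mathrm{Id}-U)$ be its characteristic polynomial evaluated at $1$. Then $Z_n$ can be written as a product of $n$ independent complex random variables $$Z_n=\prod_{k=0}^{n-1}(1-\gamma_k),$$ where the $\gamma_k$ are independent and: for $0\le k\le n-2$, $\gamma_k$ has density $c_{k,n}(\delta)(1-|z|^2)^{\beta'(n-k-1)-1}(1-z)^{\bar\delta}(1-\bar z)^{\delta}$ on $\mathbb D$ with respect to Lebesgue measure, with $c_{k,n}(\delta)=\frac{\Gamma(\beta'(n-k-1)+1+\delta)\Gamma(\beta'(n-k-1)+1+\bar\delta)}{\pi\Gamma(\beta'(n-k-1))\Gamma(\beta'(n-k-1)+1+\delta+\bar\delta)}$; and $\gamma_{n-1}$ has density $\frac{\Gamma(1+\delta)\Gamma(1+\bar\delta)}{\Gamma(1+\delta+\bar\delta)}(1-\zeta)^{\bar\delta}(1-\bar\zeta)^{\delta}$ with respect to normalized Haar measure on $\mathbb T$. Consequently, for any $s,t\in\mathbb C$ with $\Re(t)>-\frac12$, the Mellin–Fourier transform of $Z_n$ is $$\mathbb E\big[|Z_n|^te^{\mathrm is\arg Z_n}\big]=\prod_{k=0}^{n-1}\frac{\Gamma(\beta'k+1+\delta)\,\Gamma(\beta'k+1+\bar\delta)\,\Gamma(\beta'k+1+\delta+\bar\delta+t)}{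\Gamma(\beta'k+1+\delta+\bar\delta)\,\Gamma(\beta'k+1+\delta+\frac{t-s}{2})\,\Gamma(\beta'k+1+\bar\delta+\frac{t+s}{2})}.$$
   Context: $\mathbb D=\{|z|<1\}$, $\mathbb T=\{|z|=1\}$. Complex powers use the principal logarithm, and $\arg Z_n=\sum_{k=0}^{n-1}\arg(1-\gamma_k)$ with $\arg(1-\gamma_k)\in(-\pi/2,\pi/2)$. For a probability measure $\mu$ on $\mathbb T$ supported at $n$ points $e^{\mathrm i\theta_1},\dots,e^{\mathrm i\theta_n}$, let $\Phi_0,\dots,\Phi_{n-1}$ be its monic orthogonal polynomials, $\Phi_n(z)=\prod_j(z-e^{\mathrm i\theta_j})$, $\Phi_j^*(z)=z^j\overline{\Phi_j(1/\bar z)}$; its Verblunsky coefficients $(\alpha_0,\dots,\alpha_{n-1})\in\mathbb D^{n-1}\times\mathbb T$ are given by $\Phi_{j+1}(z)=z\Phi_j(z)-\bar\alpha_j\Phi_j^*(z)$, and this is a bijection. The GGT matrix $\mathcal G(\alpha_0,\dots,\alpha_{n-1})$ is the matrix of $f(z)\mapsto zf(z)$ on $L^2(\mathbb T,\mu)$ in the basis of orthonormal polynomials $\Phi_j/\|\Phi_j\|$, $0\le j\le n-1$. The deformed Verblunsky coefficients are $\gamma_k=1-\Phi_{k+1}(1)/\Phi_k(1)$; in the proposition the $\gamma_k$ are those of the spectral measure of $(U,e_1)$ (the probability measure $\mu$ on $\mathbb T$ with $\langle e_1,U^ke_1\rangle=\int z^kd\mu$, $k\in\mathbb Z$). For $s>1$,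 $\nu_s$ is the probability measure on $\mathbb D$ with density $\frac{s-1}{2\pi}(1-|z|^2)^{(s-3)/2}$, and $\nu_1$ is uniform on $\mathbb T$. $\mathrm{CJ}^{(n)}_{0,\beta}$ is the law of $\mathcal G(\alpha_0,\dots,\alpha_{n-1})$ when the $\alpha_k$ are independent with $\alpha_k\sim\nu_{\beta(n-k-1)+1}$. $\mathrm{CJ}^{(n)}_{\delta,\beta}$ is the probability measure whose density with respect to $\mathrm{CJ}^{(n)}_{0,\beta}$ is proportional to $\det_\delta(U)=\det(\mathrm{Id}-U)^{\bar\delta}\det(\mathrm{Id}-\overline U)^{\delta}$, i.e. the product over the eigenvalues $\zeta$ of $U$ of $(1-\zeta)^{\bar\delta}(1-\bar\zeta)^{\delta}$.
   Formalization: The Mellin–Fourier formula is stated under the additional condition Re(δ+δ̄+t) > −1, which is exactly when the expectation exists; for instance at δ = t = −0.4, s = 0 the expectation is infinite although Re t > −1/2. *)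

theory Defs
  imports
    "HOL-Probability.Probability"
    "HOL-Computational_Algebra.Computational_Algebra"
    "Jordan_Normal_Form.Char_Poly"
    "Jordan_Normal_Form.Schur_Decomposition"
begin

subsection \<open>Orthogonal polynomials on the unit circle\<close>

text \<open>Probability measures on the unit circle are regarded as Borel measures on the complex
  plane giving full mass to the circle.\<close>

definition circle_prob :: "complex measure \<Rightarrow> bool" where
  "circle_prob \<mu> \<longleftrightarrow> prob_space \<mu> \<and> sets \<mu> = sets borel \<and> (AE z in \<mu>. z \<in> sphere 0 1)"

definition atoms :: "complex measure \<Rightarrow> complex set" where
  "atoms \<mu> = {z. measure \<mu> {z} > 0}"

definition supported_at :: "nat \<Rightarrow> complex measure \<Rightarrow> bool" where
  "supported_at n \<mu> \<longleftrightarrow>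
     circle_prob \<mu> \<and> finite (atoms \<mu>) \<and> card (atoms \<mu>) = n \<and> (AE z in \<mu>. z \<in> atoms \<mu>)"

definition L2_inner :: "complex measure \<Rightarrow> complex poly \<Rightarrow> complex poly \<Rightarrow> complex" where
  "L2_inner \<mu> p q = (\<integral>z. cnj (poly p z) * poly q z \<partial>\<mu>)"

definition L2_norm :: "complex measure \<Rightarrow> complex poly \<Rightarrow> real" where
  "L2_norm \<mu> p = sqrt (\<integral>z. (cmod (poly p z))\<^sup>2 \<partial>\<mu>)"

text \<open>For a measure with exactly \<open>n\<close> atoms this is meaningful for indices \<open>j \<le> n\<close>; the value at
  larger indices is irrelevant.\<close>

definition Phi :: "complex measure \<Rightarrow> nat \<Rightarrow> complex poly" where
  "Phi \<mu> j =
     (if j < card (atoms \<mu>)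
      then THE p. degree p = j \<and> lead_coeff p = 1 \<and>
                  (\<forall>q. degree q < j \<longrightarrow> L2_inner \<mu> q p = 0)
      else \<Prod>a\<in>atoms \<mu>. [:- a, 1:])"

text \<open>If \<open>p\<close> has degree \<open>j\<close>, then \<open>poly (reversed p) z = z ^ j * cnj (poly p (1 / cnj z))\<close>
  for \<open>z \<noteq> 0\<close>.\<close>

definition reversed :: "complex poly \<Rightarrow> complex poly" where
  "reversed p = reflect_poly (map_poly cnj p)"

definition has_verblunsky :: "nat \<Rightarrow> complex measure \<Rightarrow> (nat \<Rightarrow> complex) \<Rightarrow> bool" where
  "has_verblunsky n \<mu> \<alpha> \<longleftrightarrow>
     (\<forall>j<n. Phi \<mu> (Suc j) = pCons 0 (Phi \<mu> j) - Polynomial.smult (cnj (\<alpha> j)) (reversed (Phi \<mu> j)))"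

definition verblunsky_measure :: "nat \<Rightarrow> (nat \<Rightarrow> complex) \<Rightarrow> complex measure" where
  "verblunsky_measure n \<alpha> = (THE \<mu>. supported_at n \<mu> \<and> has_verblunsky n \<mu> \<alpha>)"

definition deformed_verblunsky :: "complex measure \<Rightarrow> nat \<Rightarrow> complex" where
  "deformed_verblunsky \<mu> k = 1 - poly (Phi \<mu> (Suc k)) 1 / poly (Phi \<mu> k) 1"

subsection \<open>Unitary matrices\<close>

definition unitary_mats :: "nat \<Rightarrow> complex mat set" where
  "unitary_mats n = {A \<in> carrier_mat n n. mat_adjoint A * A = 1\<^sub>m n}"

definition unitary_borel :: "nat \<Rightarrow> complex mat measure" where
  "unitary_borel n =
     vimage_algebra (unitary_mats n) (\<lambda>A. \<lambda>p\<in>{..<n} \<times> {..<n}. A $$ p)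
       (PiM ({..<n} \<times> {..<n}) (\<lambda>_. borel))"

text \<open>Integer powers of a unitary matrix, whose inverse is its adjoint.\<close>

definition unitary_powi :: "complex mat \<Rightarrow> int \<Rightarrow> complex mat" where
  "unitary_powi A k =
     (if 0 \<le> k then A ^\<^sub>m nat k else mat_adjoint A ^\<^sub>m nat (- k))"

text \<open>The cyclic vector is the first vector \<open>unit_vec n 0\<close> of the standard basis. Since
  \<open>u \<bullet>c v\<close> is conjugate linear in \<open>v\<close>, the inner product \<open>\<langle>u, v\<rangle>\<close>, which is linear in \<open>v\<close>,
  is written \<open>v \<bullet>c u\<close>.\<close>

definition spectral_measure :: "complex mat \<Rightarrow> complex measure" where
  "spectral_measure A =
     (THE \<mu>. circle_prob \<mu> \<and>
        (\<forall>k::int. (unitary_powi A k *\<^sub>v unit_vec (dim_row A) 0) \<bullet>c unit_vec (dim_row A) 0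
                  = (\<integral>z. z powi k \<partial>\<mu>)))"

definition GGT :: "nat \<Rightarrow> (nat \<Rightarrow> complex) \<Rightarrow> complex mat" where
  "GGT n \<alpha> =
     (let \<mu> = verblunsky_measure n \<alpha>;
          \<phi> = (\<lambda>j. Polynomial.smult (of_real (inverse (L2_norm \<mu> (Phi \<mu> j)))) (Phi \<mu> j))
      in Matrix.mat n n (\<lambda>(i, j). L2_inner \<mu> (\<phi> i) (pCons 0 (\<phi> j))))"

subsection \<open>The circular Jacobi ensemble\<close>

definition uniform_circle :: "complex measure" where
  "uniform_circle = distr (uniform_measure lborel {0..1}) borel (\<lambda>x. cis (2 * pi * x))"

text \<open>The underlying set of \<open>nu s\<close> is the open disc for \<open>s > 1\<close> and the unit circle for
  \<open>s = 1\<close>.\<close>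

definition nu :: "real \<Rightarrow> complex measure" where
  "nu s =
     (if s = 1 then restrict_space uniform_circle (sphere 0 1)
      else density (restrict_space lborel (ball 0 1))
             (\<lambda>z. ennreal ((s - 1) / (2 * pi) * (1 - (cmod z)\<^sup>2) powr ((s - 3) / 2))))"

definition CJ0 :: "nat \<Rightarrow> real \<Rightarrow> complex mat measure" where
  "CJ0 n \<beta> =
     distr (PiM {..<n} (\<lambda>k. nu (\<beta> * real (n - k - 1) + 1))) (unitary_borel n) (GGT n)"

definition det_delta :: "complex \<Rightarrow> complex mat \<Rightarrow> complex" where
  "det_delta \<delta> A =
     (\<Prod>\<zeta>\<in>#proots (char_poly A). (1 - \<zeta>) powr cnj \<delta> * (1 - cnj \<zeta>) powr \<delta>)"

text \<open>The two factors attached to an eigenvalue of a unitary matrix are complex conjugates of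
  each other, so \<open>det_delta\<close> is real and nonnegative there, and \<open>Re\<close> is only a type
  conversion.\<close>

definition CJ :: "nat \<Rightarrow> complex \<Rightarrow> real \<Rightarrow> complex mat measure" where
  "CJ n \<delta> \<beta> =
     density (CJ0 n \<beta>)
       (\<lambda>A. ennreal (Re (det_delta \<delta> A)) / (\<integral>\<^sup>+B. ennreal (Re (det_delta \<delta> B)) \<partial>CJ0 n \<beta>))"

end

theory Submission
  imports Defs "HOL-Complex_Analysis.Complex_Analysis"
begin

text \<open>Evaluating the Szego recursion at \<open>1\<close> shows that \<open>\<gamma>\<^sub>k\<close> is the conjugate of \<open>\<alpha>\<^sub>k\<close> multiplied by
  a phase that depends only on \<open>\<alpha>\<^sub>0, \<dots>, \<alpha>\<^sub>k\<^sub>-\<^sub>1\<close>. The laws \<^const>\<open>nu\<close> are invariant under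
  rotations and conjugation, so for \<open>\<delta> = 0\<close> the \<open>\<gamma>\<^sub>k\<close> are independent with the same laws as the
  \<open>\<alpha>\<^sub>k\<close>. Comparing continuous logarithms along \<open>[0, 1]\<close> shows that the eigenvalues \<open>\<zeta>\<close> and the
  \<open>\<gamma>\<^sub>k\<close> satisfy \<open>\<Sum> Ln (1 - \<zeta>) = \<Sum> Ln (1 - \<gamma>\<^sub>k)\<close>; hence \<^const>\<open>det_delta\<close> is a product of
  functions of the individual \<open>\<gamma>\<^sub>k\<close>, and passing to general \<open>\<delta>\<close> tilts each law separately.

  The remaining integrals of \<open>(1 - z)^p (1 - cnj z)^q\<close> separate in polar coordinates around \<open>1\<close> into a
  Beta integral and Cauchy's integral of \<open>cos^a y exp (i c y)\<close>. Each of the two satisfies a recursion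
  in its exponent and is identified by its asymptotics as the exponent tends to infinity.\<close>

subsection \<open>Cauchy's cosine integral\<close>

text \<open>\<open>Phi\<close>, \<open>verblunsky_measure\<close> and
  \<open>spectral_measure\<close> are definite descriptions, so each use rests on existence and
  uniqueness. Existence is finite algebra: the measure with given coefficients sits at the zeros of
  the last polynomial with Christoffel weights, and orthogonality is read off from the
  Christoffel-Darboux formula. Uniqueness among all measures on the circle works because a vanishing
  norm is visible in the moments.

  \<open>U\<close> takes arbitrary unitary values, so gamma_k has to be measurable on all of
  \<open>unitary_borel n\<close>, including matrices whose spectral measure has fewer than n atoms.
  Hence the spectral theorem for arbitrary unitary matrices, and the habit of expressing everything
  through moments, which are plainly measurable in the matrix while eigenvalues are not.

  The factorization of Z_n fixes the sum of the logarithms of its factors only modulo 2 pi i,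
  whereas powers with complex delta depend on the branch; this is the gap that the comparison of
  logarithms closes.\<close>

lemma peak_ratio_tendsto_1:
  fixes g :: "'a \<Rightarrow> complex" and u w :: "'a \<Rightarrow> real"
  assumes w [measurable]: "w \<in> borel_measurable M"
    and w01: "\<And>x. x \<in> space M \<Longrightarrow> 0 \<le> w x \<and> w x \<le> 1"
    and g: "integrable M g" and u: "integrable M u"
    and u0: "\<And>x. x \<in> space M \<Longrightarrow> 0 \<le> u x"
    and near: "\<And>e. e > 0 \<Longrightarrow> \<exists>r. 0 < r \<and> r < 1 \<and> (\<forall>x\<in>space M. r \<le> w x \<longrightarrow> cmod (g x - of_real (u x)) \<le> e * u x)"
    and mass: "\<And>r. 0 < r \<Longrightarrow> r < 1 \<Longrightarrow> 0 < (\<integral>x. indicator {x. r \<le> w x} x * u x \<partial>M)"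
  shows "(\<lambda>N. (\<integral>x. of_real (w x ^ N) * g x \<partial>M) / of_real (\<integral>x. w x ^ N * u x \<partial>M)) \<longlonglongrightarrow> 1"
proof -
  note [measurable] = borel_measurable_integrable[OF g] borel_measurable_integrable[OF u]
  have wN: "0 \<le> w x ^ N" "w x ^ N \<le> 1" if "x \<in> space M" for x N
    using w01[OF that] by (auto simp: power_le_one)
  have ig: "integrable M (\<lambda>x. of_real (w x ^ N) * g x)" for N
    by (rule Bochner_Integration.integrable_bound[OF g])
       (auto intro!: AE_I2 mult_left_le_one_le simp: norm_mult norm_power w01 abs_of_nonneg power_le_one)
  have iu: "integrable M (\<lambda>x. w x ^ N * u x)" for N
    by (rule Bochner_Integration.integrable_bound[OF u])
       (auto intro!: AE_I2 mult_left_le_one_le simp: abs_mult power_abs w01 u0 abs_of_nonneg power_le_one)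
  define d where "d = (\<lambda>x. cmod (g x - of_real (u x)))"
  have id: "integrable M d" unfolding d_def
    by (intro integrable_norm Bochner_Integration.integrable_diff g integrable_of_real u)
  have id0: "0 \<le> (\<integral>x. d x \<partial>M)" by (simp add: d_def)
  have idN: "integrable M (\<lambda>x. w x ^ N * d x)" for N
    by (rule Bochner_Integration.integrable_bound[OF id])
       (auto intro!: AE_I2 mult_left_le_one_le simp: d_def abs_mult power_abs w01 abs_of_nonneg power_le_one)
  \<comment> \<open>The set \<open>s \<le> w\<close> alone bounds the denominator from below, so it
    decays no faster than a constant times s^N, for any s < 1.\<close>
  have low: "s ^ N * (\<integral>x. indicator {x. s \<le> w x} x * u x \<partial>M) \<le> (\<integral>x. w x ^ N * u x \<partial>M)"
    if s: "0 < s" "s < 1" for s N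
  proof -
    have "s ^ N * (\<integral>x. indicator {x. s \<le> w x} x * u x \<partial>M) = (\<integral>x. s ^ N * (indicator {x. s \<le> w x} x * u x) \<partial>M)"
      by simp
    also have "\<dots> \<le> (\<integral>x. w x ^ N * u x \<partial>M)"
    proof (rule integral_mono[OF _ iu])
      show "integrable M (\<lambda>x. s ^ N * (indicator {x. s \<le> w x} x * u x))"
        by (intro integrable_mult_right Bochner_Integration.integrable_bound[OF u])
           (auto intro!: AE_I2 simp: indicator_def)
    qed (use s in \<open>auto simp: indicator_def u0 intro!: mult_right_mono power_mono mult_nonneg_nonneg\<close>, use w01 u0 in auto)
    finally show ?thesis .
  qed
  have pos: "0 < (\<integral>x. w x ^ N * u x \<partial>M)" for N
    using low[of "1/2" N] mass[of "1/2"] by (smt (verit) half_gt_zero zero_less_one zero_less_power mult_pos_pos field_sum_of_halves)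
  show ?thesis
  proof (rule LIMSEQ_I)
    fix e :: real assume e: "0 < e"
    then obtain r where r: "0 < r" "r < 1"
      and nr: "\<And>x. x \<in> space M \<Longrightarrow> r \<le> w x \<Longrightarrow> d x \<le> (e/2) * u x"
      using near[of "e/2"] unfolding d_def by auto
    \<comment> \<open>Any s strictly between r and 1 works: the part \<open>w < r\<close> of the
      error is at most r^N times a constant, the denominator is at least s^N times \<open>m\<close>,
      and (r / s)^N tends to 0.\<close>
    define s where "s = (1 + r) / 2"
    have s: "0 < s" "s < 1" "r < s" using r by (auto simp: s_def)
    define m where "m = (\<integral>x. indicator {x. s \<le> w x} x * u x \<partial>M)"
    have m: "m > 0" using mass[of s] s unfolding m_def by simp
    define D where "D = (\<integral>x. d x \<partial>M)"
    have "(\<lambda>N. (r / s) ^ N * (D / m)) \<longlonglongrightarrow> 0 * (D/m)"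
      by (intro tendsto_mult_right LIMSEQ_realpow_zero) (use r s in auto)
    then obtain N0 where N0: "\<And>N. N \<ge> N0 \<Longrightarrow> \<bar>(r / s) ^ N * (D / m)\<bar> < e / 2"
      using e unfolding lim_sequentially dist_real_def by (metis diff_zero half_gt_zero mult_zero_left)
    show "\<exists>no. \<forall>n\<ge>no. cmod ((\<integral>x. of_real (w x ^ n) * g x \<partial>M) / of_real (\<integral>x. w x ^ n * u x \<partial>M) - 1) < e"
    proof (intro exI allI impI)
      fix N assume N: "N \<ge> N0"
      define I where "I = (\<integral>x. w x ^ N * u x \<partial>M)"
      have I: "I > 0" using pos by (simp add: I_def)
      have Ic: "(\<integral>x. complex_of_real (w x ^ N * u x) \<partial>M) = of_real I"
        unfolding I_def by (rule integral_complex_of_real)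
      have "(\<integral>x. of_real (w x ^ N) * g x \<partial>M) - of_real I = (\<integral>x. of_real (w x ^ N) * g x - of_real (w x ^ N * u x) \<partial>M)"
        by (subst Bochner_Integration.integral_diff[OF ig]) (auto intro!: integrable_of_real iu simp: Ic[symmetric] simp del: of_real_mult of_real_power)
      also have "cmod \<dots> \<le> (\<integral>x. w x ^ N * d x \<partial>M)"
      proof (rule order.trans[OF integral_norm_bound])
        have "(\<integral>x. cmod (of_real (w x ^ N) * g x - of_real (w x ^ N * u x)) \<partial>M) = (\<integral>x. w x ^ N * d x \<partial>M)"
        proof (rule Bochner_Integration.integral_cong[OF refl])
          fix x assume "x \<in> space M"
          have "of_real (w x ^ N) * g x - of_real (w x ^ N * u x) = of_real (w x ^ N) * (g x - of_real (u x))"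
            by (simp add: algebra_simps)
          thus "cmod (of_real (w x ^ N) * g x - of_real (w x ^ N * u x)) = w x ^ N * d x"
            using wN(1)[OF \<open>x \<in> space M\<close>, of N] by (simp only: norm_mult norm_of_real d_def abs_of_nonneg)
        qed
        thus "(\<integral>x. cmod (of_real (w x ^ N) * g x - of_real (w x ^ N * u x)) \<partial>M) \<le> (\<integral>x. w x ^ N * d x \<partial>M)" by simp
      qed
      also have "\<dots> \<le> (\<integral>x. e/2 * (w x ^ N * u x) + r ^ N * d x \<partial>M)"
      proof (rule integral_mono[OF idN])
        show "integrable M (\<lambda>x. e/2 * (w x ^ N * u x) + r ^ N * d x)"
          by (intro Bochner_Integration.integrable_add integrable_mult_right iu id)
        fix x assume x: "x \<in> space M"
        have d0: "d x \<ge> 0" by (simp add: d_def)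
        show "w x ^ N * d x \<le> e/2 * (w x ^ N * u x) + r ^ N * d x"
        proof (cases "r \<le> w x")
          case True
          have "w x ^ N * d x \<le> w x ^ N * (e/2 * u x)"
            using nr[OF x True] wN[OF x] by (intro mult_left_mono) auto
          moreover have "0 \<le> r ^ N * d x" using r d0 by simp
          ultimately show ?thesis by (simp add: algebra_simps)
        next
          case False
          have "w x ^ N * d x \<le> r ^ N * d x"
            using False w01[OF x] d0 by (intro mult_right_mono power_mono) auto
          moreover have "0 \<le> e/2 * (w x ^ N * u x)" using e wN[OF x] u0[OF x] by simp
          ultimately show ?thesis by linarith
        qed
      qed
      also have "\<dots> = e/2 * I + r ^ N * D"
        unfolding I_def D_def
        by (subst Bochner_Integration.integral_add) (auto intro!: integrable_mult_right iu id)
      finally have 1: "cmod ((\<integral>x. of_real (w x ^ N) * g x \<partial>M) - of_real I) \<le> e/2 * I + r ^ N * D" .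
      have "r ^ N * D / I \<le> r ^ N * D / (s ^ N * m)"
        using low[of s N] s m I r id0 unfolding I_def m_def D_def
        by (intro divide_left_mono) auto
      also have "\<dots> = (r / s) ^ N * (D / m)" by (simp add: power_divide)
      also have "\<dots> < e / 2" using N0[OF N] by linarith
      finally have 2: "r ^ N * D / I < e / 2" .
      have "(\<integral>x. of_real (w x ^ N) * g x \<partial>M) / of_real I - 1 = ((\<integral>x. of_real (w x ^ N) * g x \<partial>M) - of_real I) / of_real I"
        using I by (simp add: diff_divide_distrib)
      also have "cmod \<dots> = cmod ((\<integral>x. of_real (w x ^ N) * g x \<partial>M) - of_real I) / I"
        using I by (simp add: norm_divide)
      also have "\<dots> \<le> (e/2 * I + r ^ N * D) / I" using 1 I by (intro divide_right_mono) auto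
      also have "\<dots> = e/2 + r ^ N * D / I" using I by (simp add: add_divide_distrib)
      also have "\<dots> < e" using 2 by linarith
      finally show "cmod ((\<integral>x. of_real (w x ^ N) * g x \<partial>M) / of_real (\<integral>x. w x ^ N * u x \<partial>M) - 1) < e"
        unfolding I_def .
    qed
  qed
qed

text \<open>Stated for the reciprocal in order to include the nonpositive integers: there
  \<open>Gamma_series'\<close> is eventually 0 (division by 0), and so is its inverse, in agreement
  with \<open>rGamma\<close>. The arguments 1 + (a + c) / 2 and 1 + (a - c) / 2 met below can be
  such integers.\<close>

lemma inverse_Gamma_series'_LIMSEQ:
  fixes z :: complex
  shows "(\<lambda>n. inverse (Gamma_series' z n)) \<longlonglongrightarrow> rGamma z"
proof (cases "z \<in> \<int>\<^sub>\<le>\<^sub>0")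
  case True
  then obtain k where k: "z = - of_nat k" by (elim nonpos_Ints_cases')
  have "eventually (\<lambda>n. inverse (Gamma_series' z n) = rGamma z) sequentially"
    using Gamma_series'_minus_of_nat[of k] True
    by (auto simp: k elim!: eventually_mono)
  thus ?thesis by (rule tendsto_eventually)
next
  case False
  thus ?thesis unfolding rGamma_inverse_Gamma
    by (intro tendsto_inverse Gamma_series'_LIMSEQ) (simp add: Gamma_eq_zero_iff)
qed

text \<open>A zero Pochhammer symbol is allowed: then \<open>Gamma_series'\<close> divides by 0 and
  both sides vanish.\<close>

lemma pochhammer_conv_Gamma_series':
  fixes z :: complex
  assumes "n > 0"
  shows "pochhammer z n = fact (n - 1) * exp (z * of_real (ln (of_nat n))) * inverse (Gamma_series' z n)"
  using assms by (cases "pochhammer z n = 0") (auto simp: Gamma_series'_def field_simps)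

text \<open>For r < 0 the integrand is unbounded at both ends. The derivative of cos^(r+1) sin is
  (r+2) cos^(r+2) - (r+1) cos^r, and both cos^(r+1) sin and cos^(r+2) are continuous up to the ends,
  so integrability of cos^r follows.\<close>

lemma cos_powr_set_integrable:
  fixes r :: real
  assumes r: "r > -1"
  shows "set_integrable lborel {- pi/2<..<pi/2} (\<lambda>y. cos y powr r)"
proof -
  have cpos: "cos y > 0" if "y \<in> {- pi/2<..<pi/2}" for y
    using that by (intro cos_gt_zero_pi) auto
  have cpos0: "cos y \<ge> 0" if "y \<in> {- pi/2..pi/2}" for y
    using that by (intro cos_ge_zero) auto
  have 1: "((\<lambda>y. (r + 2) * cos y powr (r + 2) - (r + 1) * cos y powr r) has_integral
        cos (pi/2) powr (r + 1) * sin (pi/2) - cos (-pi/2) powr (r + 1) * sin (-pi/2)) {-pi/2..pi/2}"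
  proof (rule fundamental_theorem_of_calculus_interior)
    show "- pi / 2 \<le> pi / 2" by simp
    show "continuous_on {- pi / 2..pi / 2} (\<lambda>a. cos a powr (r + 1) * sin a)"
      by (intro continuous_intros continuous_on_powr') (use cpos0 r in auto)
    fix y :: real assume y: "y \<in> {- pi / 2<..<pi / 2}"
    note c = cpos[OF y]
    have e: "cos y powr (r + 2) = cos y powr r * (cos y)\<^sup>2" "cos y powr (r+1) = cos y powr r * cos y"
      using c by (simp_all add: powr_add)
    have s: "sin y * sin y = 1 - (cos y)\<^sup>2" by (simp add: sin_squared_eq flip: power2_eq_square)
    have "((\<lambda>a. cos a powr (r + 1) * sin a) has_real_derivative
       (r + 1) * cos y powr r * (- sin y) * sin y + cos y powr (r+1) * cos y) (at y)"
      using c by (auto intro!: derivative_eq_intros simp: powr_diff)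
    also have "(r + 1) * cos y powr r * (- sin y) * sin y + cos y powr (r+1) * cos y
       = (r + 2) * cos y powr (r + 2) - (r + 1) * cos y powr r"
    proof -
      have "(r + 1) * P * (- S) * S + P * C * C = (r + 2) * (P * C\<^sup>2) - (r + 1) * P"
        if "S * S = 1 - C\<^sup>2" for P S C :: real
      proof -
        have "(r + 1) * P * (- S) * S + P * C * C - ((r + 2) * (P * C\<^sup>2) - (r + 1) * P)
          = - (r + 1) * P * (S * S - (1 - C\<^sup>2))" by (simp add: algebra_simps power2_eq_square)
        thus ?thesis using that by simp
      qed
      thus ?thesis unfolding e using s by blast
    qed
    finally show "((\<lambda>a. cos a powr (r + 1) * sin a) has_vector_derivative
          (r + 2) * cos y powr (r + 2) - (r + 1) * cos y powr r) (at y)"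
      by (simp add: has_real_derivative_iff_has_vector_derivative)
  qed
  have "(\<lambda>y. cos y powr (r + 2)) integrable_on {-pi/2..pi/2}"
    by (intro integrable_continuous_interval continuous_on_powr' continuous_intros) (use cpos0 r in auto)
  hence "(\<lambda>y. (r + 2) * cos y powr (r + 2)) integrable_on {-pi/2..pi/2}"
    using integrable_cmul[of "\<lambda>y. cos y powr (r + 2)" _ "r + 2"] by simp
  from integrable_diff[OF this has_integral_integrable[OF 1]]
  have "(\<lambda>y. (r + 1) * cos y powr r) integrable_on {-pi/2..pi/2}" by simp
  from integrable_cmul[OF this, of "inverse (r + 1)"]
  have "(\<lambda>y. cos y powr r) integrable_on {-pi/2..pi/2}" using r by (simp flip: mult.assoc)
  hence "(\<lambda>y. cos y powr r) absolutely_integrable_on {-pi/2..pi/2}"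
    by (intro nonnegative_absolutely_integrable_1) auto
  hence "(\<lambda>y. cos y powr r) absolutely_integrable_on {-pi/2<..<pi/2}"
    by (rule set_integrable_subset) auto
  thus ?thesis
    unfolding set_integrable_def by (subst (asm) integrable_completion) auto
qed

definition cauchy_cos_integral :: "complex \<Rightarrow> complex \<Rightarrow> complex" where
  "cauchy_cos_integral a c =
     (LINT y:{- pi/2<..<pi/2}|lborel. of_real (cos y) powr a * exp (\<i> * c * of_real y))"

lemma norm_exp_i_mult_le: "cmod (exp (\<i> * c * of_real y)) \<le> exp (\<bar>Im c\<bar> * \<bar>y\<bar>)"
proof -
  have "- (Im c * y) \<le> \<bar>Im c\<bar> * \<bar>y\<bar>" by (metis abs_ge_minus_self abs_mult)
  thus ?thesis by simp
qed

lemma cauchy_cos_set_integrable: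
  assumes "Re a > -1"
  shows "set_integrable lborel {- pi/2<..<pi/2} (\<lambda>y. of_real (cos y) powr a * exp (\<i> * c * of_real y))"
  unfolding set_integrable_def
proof (rule Bochner_Integration.integrable_bound)
  show "integrable lborel (\<lambda>y. exp (\<bar>Im c\<bar> * pi) * (indicator {- pi/2<..<pi/2} y *\<^sub>R cos y powr Re a))"
    using cos_powr_set_integrable[OF assms] unfolding set_integrable_def by (rule integrable_mult_right)
  show "AE x in lborel.
       norm (indicat_real {- pi / 2<..<pi / 2} x *\<^sub>R (complex_of_real (cos x) powr a * exp (\<i> * c * complex_of_real x)))
       \<le> norm (exp (\<bar>Im c\<bar> * pi) * indicat_real {- pi / 2<..<pi / 2} x *\<^sub>R cos x powr Re a)"
  proof (rule AE_I2)
    fix y :: real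
    show "norm (indicat_real {- pi / 2<..<pi / 2} y *\<^sub>R (complex_of_real (cos y) powr a * exp (\<i> * c * complex_of_real y)))
       \<le> norm (exp (\<bar>Im c\<bar> * pi) * indicat_real {- pi / 2<..<pi / 2} y *\<^sub>R cos y powr Re a)"
    proof (cases "y \<in> {- pi / 2<..<pi / 2}")
      case True
      have c: "cos y > 0" using True by (intro cos_gt_zero_pi) auto
      have "\<bar>Im c\<bar> * \<bar>y\<bar> \<le> \<bar>Im c\<bar> * pi" using True by (intro mult_left_mono) auto
      hence "cmod (exp (\<i> * c * of_real y)) \<le> exp (\<bar>Im c\<bar> * pi)"
        using norm_exp_i_mult_le[of c y] by (meson exp_le_cancel_iff order_trans)
      thus ?thesis using True c
        by (auto simp: norm_mult norm_powr_real_powr mult.commute[of "exp (\<bar>Im c\<bar> * pi)"] intro!: mult_left_mono)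
    qed auto
  qed
qed measurable

text \<open>Passes from the Lebesgue integral over the open interval to the gauge integral over the
  closed one, whose fundamental theorem asks only for continuity of the antiderivative at the
  ends.\<close>

lemma has_integral_of_set_integrable_Ioo:
  fixes f :: "real \<Rightarrow> complex"
  assumes "set_integrable lborel {a<..<b} f"
  shows "(f has_integral (LINT y:{a<..<b}|lborel. f y)) {a..b}"
  using has_integral_set_lebesgue[of "{a<..<b}" f] assms
  by (subst has_integral_Icc_iff_Ioo)
     (auto simp: set_integrable_def set_lebesgue_integral_def integrable_completion integral_completion)

text \<open>In the derivative of \<open>?F\<close> the two terms with cos^(a+1) sin cancel, which is
  what fixes the ratio of its two summands; sin^2 = 1 - cos^2 then leaves only the exponents a and a
  + 2. \<open>?F\<close> vanishes at both ends.\<close>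

lemma cauchy_cos_integral_rec:
  assumes a: "Re a > -1"
  shows "cauchy_cos_integral a c * ((a + 1) * (a + 2)) = ((a + 2)\<^sup>2 - c\<^sup>2) * cauchy_cos_integral (a + 2) c"
proof -
  let ?E = "\<lambda>z. exp (\<i> * c * z)"
  let ?F = "\<lambda>z::complex. (a + 2) * cos z powr (a + 1) * sin z * ?E z + \<i> * c * (cos z powr (a + 2) * ?E z)"
  let ?f = "\<lambda>a y. complex_of_real (cos y) powr a * ?E (of_real y)"
  have ne: "a + 2 \<noteq> 0" using a by (auto simp: complex_eq_iff)
  have "((\<lambda>y. ((a + 2)\<^sup>2 - c\<^sup>2) * ?f (a + 2) y - (a + 1) * (a + 2) * ?f a y) has_integral
          ?F (of_real (pi/2)) - ?F (of_real (-pi/2))) {-pi/2..pi/2}"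
  proof (rule fundamental_theorem_of_calculus_interior)
    show "- pi / 2 \<le> pi / 2" by simp
    have *: "Re (cos (complex_of_real y)) \<ge> 0" if "y \<in> {- pi/2..pi/2}" for y
      using that cos_ge_zero[of y] by (auto simp flip: cos_of_real)
    show "continuous_on {- pi / 2..pi / 2} (\<lambda>y. ?F (of_real y))"
      by (intro continuous_intros continuous_on_powr_complex) (use * a in auto)
    fix y :: real assume y: "y \<in> {- pi / 2<..<pi / 2}"
    have c: "cos y > 0" using y by (intro cos_gt_zero_pi) auto
    define C where "C = cos (complex_of_real y)"
    define S where "S = sin (complex_of_real y)"
    have C: "C \<notin> \<real>\<^sub>\<le>\<^sub>0" "C \<noteq> 0" using c by (auto simp: C_def cos_of_real)
    have e: "C powr (a + 2) = C powr a * C\<^sup>2" "C powr (a + 1) = C powr a * C"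
      using C by (simp_all add: powr_add power2_eq_square flip: powr_numeral)
    have SC: "S\<^sup>2 = 1 - C\<^sup>2" by (simp add: S_def C_def sin_squared_eq)
    have "(?F has_field_derivative
          (a + 2) * ((a + 1) * C powr a * (- S) * S * ?E (of_real y) + C powr (a + 1) * C * ?E (of_real y)
             + C powr (a + 1) * S * (\<i> * c * ?E (of_real y)))
          + \<i> * c * ((a + 2) * C powr (a + 1) * (- S) * ?E (of_real y) + C powr (a + 2) * (\<i> * c * ?E (of_real y)))) (at (of_real y))"
      using C unfolding C_def S_def
      by (auto intro!: derivative_eq_intros simp: algebra_simps powr_diff)
    also have "(a + 2) * ((a + 1) * C powr a * (- S) * S * ?E (of_real y) + C powr (a + 1) * C * ?E (of_real y)
             + C powr (a + 1) * S * (\<i> * c * ?E (of_real y)))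
          + \<i> * c * ((a + 2) * C powr (a + 1) * (- S) * ?E (of_real y) + C powr (a + 2) * (\<i> * c * ?E (of_real y)))
       = ((a + 2)\<^sup>2 - c\<^sup>2) * (C powr (a + 2) * ?E (of_real y)) - (a + 1) * (a + 2) * (C powr a * ?E (of_real y))"
    proof -
      have "(a + 2) * ((a + 1) * P * (- S) * S * E + P * C * C * E + P * C * S * (I * c * E))
          + I * c * ((a + 2) * (P * C) * (- S) * E + P * C\<^sup>2 * (I * c * E))
       = ((a + 2)\<^sup>2 - c\<^sup>2) * (P * C\<^sup>2 * E) - (a + 1) * (a + 2) * (P * E)"
        if "S\<^sup>2 = 1 - C\<^sup>2" "I * I = -1" for P S C E I :: complex
      proof -
        have "(a + 2) * ((a + 1) * P * (- S) * S * E + P * C * C * E + P * C * S * (I * c * E))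
          + I * c * ((a + 2) * (P * C) * (- S) * E + P * C\<^sup>2 * (I * c * E))
          - (((a + 2)\<^sup>2 - c\<^sup>2) * (P * C\<^sup>2 * E) - (a + 1) * (a + 2) * (P * E))
          = c\<^sup>2 * P * C\<^sup>2 * E * (I * I + 1) - (a + 1) * (a + 2) * P * E * (S\<^sup>2 - (1 - C\<^sup>2))"
          by (simp add: algebra_simps power2_eq_square)
        thus ?thesis using that by simp
      qed
      thus ?thesis unfolding e using SC i_squared by blast
    qed
    finally show "((\<lambda>y. ?F (of_real y)) has_vector_derivative
          ((a + 2)\<^sup>2 - c\<^sup>2) * ?f (a + 2) y - (a + 1) * (a + 2) * ?f a y) (at y)"
      unfolding C_def by (intro has_vector_derivative_real_field) (simp add: cos_of_real)
  qed
  moreover have "?F (of_real (pi/2)) - ?F (of_real (-pi/2)) = 0"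
    using a ne by (simp flip: cos_of_real)
  moreover have "((\<lambda>y. ((a + 2)\<^sup>2 - c\<^sup>2) * ?f (a + 2) y - (a + 1) * (a + 2) * ?f a y) has_integral
     ((a + 2)\<^sup>2 - c\<^sup>2) * cauchy_cos_integral (a + 2) c - (a + 1) * (a + 2) * cauchy_cos_integral a c) {-pi/2..pi/2}"
    unfolding cauchy_cos_integral_def
    by (intro has_integral_diff has_integral_mult_right has_integral_of_set_integrable_Ioo cauchy_cos_set_integrable)
       (use a in auto)
  ultimately show ?thesis
    by (metis (no_types, lifting) has_integral_unique eq_iff_diff_eq_0 mult.commute)
qed

lemma cauchy_cos_integral_0_0: "cauchy_cos_integral 0 0 = of_real pi"
proof -
  have "cauchy_cos_integral 0 0 = (LINT y:{- pi/2<..<pi/2}|lborel. 1)"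
    unfolding cauchy_cos_integral_def
  proof (intro set_lebesgue_integral_cong allI impI)
    fix y :: real assume "y \<in> {- pi/2<..<pi/2}"
    hence "cos y > 0" by (intro cos_gt_zero_pi) auto
    thus "complex_of_real (cos y) powr 0 * exp (\<i> * 0 * complex_of_real y) = 1" by auto
  qed auto
  also have "\<dots> = of_real pi" by (simp add: set_lebesgue_integral_def scaleR_conv_of_real)
  finally show ?thesis .
qed

lemma cauchy_cos_integral_iterate:
  assumes a: "Re a > -1"
  shows "cauchy_cos_integral a c * pochhammer (a + 1) (2 * N) =
    4 ^ N * pochhammer (1 + (a + c) / 2) N * pochhammer (1 + (a - c) / 2) N * cauchy_cos_integral (a + 2 * of_nat N) c"
proof (induction N)
  case (Suc N)
  define x where "x = a + 2 * of_nat N"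
  have x: "Re x > -1" using a by (simp add: x_def)
  have p1: "pochhammer (a + 1) (2 * Suc N) = pochhammer (a + 1) (2 * N) * ((x + 1) * (x + 2))"
    by (simp add: pochhammer_Suc x_def algebra_simps)
  have p2: "pochhammer (1 + (a + c) / 2) (Suc N) = pochhammer (1 + (a + c) / 2) N * ((x + 2 + c) / 2)"
    "pochhammer (1 + (a - c) / 2) (Suc N) = pochhammer (1 + (a - c) / 2) N * ((x + 2 - c) / 2)"
    by (simp_all add: pochhammer_Suc x_def field_simps)
  have "cauchy_cos_integral a c * pochhammer (a + 1) (2 * Suc N) =
     4 ^ N * pochhammer (1 + (a + c) / 2) N * pochhammer (1 + (a - c) / 2) N * (cauchy_cos_integral x c * ((x + 1) * (x + 2)))"
    unfolding p1 using Suc.IH by (simp add: x_def mult_ac)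
  also have "\<dots> = 4 ^ N * pochhammer (1 + (a + c) / 2) N * pochhammer (1 + (a - c) / 2) N * (((x + 2)\<^sup>2 - c\<^sup>2) * cauchy_cos_integral (x + 2) c)"
    by (simp add: cauchy_cos_integral_rec[OF x])
  also have "\<dots> = 4 ^ Suc N * pochhammer (1 + (a + c) / 2) (Suc N) * pochhammer (1 + (a - c) / 2) (Suc N) * cauchy_cos_integral (x + 2) c"
    unfolding p2 by (simp add: power2_eq_square field_simps)
  also have "x + 2 = a + 2 * of_nat (Suc N)" by (simp add: x_def)
  finally show ?case .
qed auto

lemma cos_ge_imp_near_0:
  assumes "d > 0"
  obtains r where "0 < r" "r < 1" "\<And>y. y \<in> {-pi/2<..<pi/2} \<Longrightarrow> r \<le> cos y \<Longrightarrow> \<bar>y\<bar> < d"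
proof
  define e where "e = min d (pi/2) / 2"
  have e: "0 < e" "e < pi/2" "e < d" using assms pi_gt_zero unfolding e_def by linarith+
  show "0 < cos e" using e by (intro cos_gt_zero) auto
  show "cos e < 1" using cos_monotone_0_pi[of 0 e] e by auto
  fix y assume y: "y \<in> {-pi/2<..<pi/2}" "cos e \<le> cos y"
  show "\<bar>y\<bar> < d"
  proof (rule ccontr)
    assume "\<not> ?thesis"
    hence "e < \<bar>y\<bar>" using e by simp
    hence "cos \<bar>y\<bar> < cos e" using y e by (intro cos_monotone_0_pi) auto
    thus False using y by simp
  qed
qed

text \<open>cos^N concentrates at y = 0, where the remaining factor cos^a exp(i c y) is 1. Dividing
  by the integral with a = c = 0 avoids computing the rate of decay.\<close>

lemma cauchy_cos_integral_ratio:
  assumes a: "Re a > -1"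
  shows "(\<lambda>N. cauchy_cos_integral (a + of_nat N) c / cauchy_cos_integral (of_nat N) 0) \<longlonglongrightarrow> 1"
proof -
  let ?I = "{- pi/2<..<pi/2}"
  define u :: "real \<Rightarrow> real" where "u = indicator ?I"
  define w :: "real \<Rightarrow> real" where "w = (\<lambda>y. indicator ?I y * cos y)"
  define g :: "real \<Rightarrow> complex" where "g = (\<lambda>y. indicator ?I y *\<^sub>R (of_real (cos y) powr a * exp (\<i> * c * of_real y)))"
  have cpos: "cos y > 0" if "y \<in> ?I" for y using that by (intro cos_gt_zero_pi) auto
  have "(\<lambda>N. (\<integral>y. of_real (w y ^ N) * g y \<partial>lborel) / of_real (\<integral>y. w y ^ N * u y \<partial>lborel)) \<longlonglongrightarrow> 1"
  proof (rule peak_ratio_tendsto_1)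
    show "w \<in> borel_measurable lborel" unfolding w_def by measurable
    show "0 \<le> w y \<and> w y \<le> 1" for y using cpos[of y] by (auto simp: w_def indicator_def)
    show "integrable lborel g" using cauchy_cos_set_integrable[OF a, of c] unfolding g_def set_integrable_def .
    show "integrable lborel u" unfolding u_def by simp
    show "0 \<le> u y" for y by (simp add: u_def)
  next
    fix e :: real assume e: "e > 0"
    have "isCont (\<lambda>y. of_real (cos y) powr a * exp (\<i> * c * of_real y)) 0"
      by (intro continuous_intros) auto
    then obtain d where d: "d > 0" "\<And>y. \<bar>y\<bar> < d \<Longrightarrow> cmod (of_real (cos y) powr a * exp (\<i> * c * of_real y) - 1) < e"
      using e unfolding continuous_at_eps_delta by (fastforce simp: dist_norm)
    obtain r where r: "0 < r" "r < 1" "\<And>y. y \<in> ?I \<Longrightarrow> r \<le> cos y \<Longrightarrow> \<bar>y\<bar> < d"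
      using cos_ge_imp_near_0[OF d(1)] by blast
    have "cmod (g y - of_real (u y)) \<le> e * u y" if "r \<le> w y" for y
    proof (cases "y \<in> ?I")
      case True
      thus ?thesis using d(2)[OF r(3)[OF True]] that by (simp add: g_def u_def w_def)
    qed (auto simp: g_def u_def)
    thus "\<exists>r>0. r < 1 \<and> (\<forall>y\<in>space lborel. r \<le> w y \<longrightarrow> cmod (g y - of_real (u y)) \<le> e * u y)"
      using r by blast
  next
    fix r :: real assume r: "0 < r" "r < 1"
    have "isCont cos (0::real)" by simp
    then obtain d where d: "d > 0" "\<And>y. \<bar>y\<bar> < d \<Longrightarrow> \<bar>cos y - 1\<bar> < 1 - r"
      using r unfolding continuous_at_eps_delta
      by (metis cos_zero diff_gt_0_iff_gt diff_zero dist_real_def)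
    define e where "e = min d (pi/2)"
    have e: "e > 0" using d by (simp add: e_def)
    have "0 < (\<integral>y. indicator {-e<..<e} y \<partial>lborel :: real)" using e by simp
    also have "\<dots> \<le> (\<integral>y. indicator {y. r \<le> w y} y * u y \<partial>lborel)"
    proof (rule integral_mono)
      have [measurable]: "w \<in> borel_measurable borel" unfolding w_def by measurable
      have "integrable lborel (\<lambda>y. indicator ({y. r \<le> w y} \<inter> ?I) y :: real)"
      proof (rule integrable_real_indicator)
        show "{y. r \<le> w y} \<inter> ?I \<in> sets lborel" by measurable
        have "emeasure lborel ({y. r \<le> w y} \<inter> ?I) \<le> emeasure lborel ?I" by (intro emeasure_mono) auto
        thus "emeasure lborel ({y. r \<le> w y} \<inter> ?I) < \<infinity>" by (auto simp: less_top[symmetric] top_unique)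
      qed
      thus "integrable lborel (\<lambda>y. indicator {y. r \<le> w y} y * u y)" by (simp add: u_def indicator_inter_arith)
      fix y :: real
      show "indicator {-e<..<e} y \<le> indicator {y. r \<le> w y} y * u y"
      proof (cases "y \<in> {-e<..<e}")
        case True
        hence "\<bar>y\<bar> < d" "y \<in> ?I" by (auto simp: e_def)
        thus ?thesis using d(2)[of y] True by (auto simp: u_def w_def)
      qed (auto simp: u_def)
    qed (use e in auto)
    finally show "0 < (\<integral>y. indicator {y. r \<le> w y} y * u y \<partial>lborel)" .
  qed
  moreover have "(\<integral>y. of_real (w y ^ N) * g y \<partial>lborel) = cauchy_cos_integral (a + of_nat N) c" for N
    unfolding cauchy_cos_integral_def set_lebesgue_integral_def
  proof (intro Bochner_Integration.integral_cong refl)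
    fix y :: real
    show "of_real (w y ^ N) * g y = indicator ?I y *\<^sub>R (of_real (cos y) powr (a + of_nat N) * exp (\<i> * c * of_real y))"
    proof (cases "y \<in> ?I")
      case True
      thus ?thesis using cpos[OF True] by (auto simp: w_def g_def powr_add powr_nat')
    qed (auto simp: g_def)
  qed
  moreover have "of_real (\<integral>y. w y ^ N * u y \<partial>lborel) = cauchy_cos_integral (of_nat N) 0" for N
    unfolding cauchy_cos_integral_def set_lebesgue_integral_def integral_complex_of_real[symmetric]
  proof (intro Bochner_Integration.integral_cong refl)
    fix y :: real
    show "of_real (w y ^ N * u y) = indicator ?I y *\<^sub>R (of_real (cos y) powr (of_nat N) * exp (\<i> * 0 * of_real y))"
    proof (cases "y \<in> ?I")
      case True
      thus ?thesis using cpos[OF True] by (auto simp: w_def u_def powr_nat')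
    qed (auto simp: u_def)
  qed
  ultimately show ?thesis by simp
qed

text \<open>Iteration moves a to a + 2N, where the integral is comparable to the reference one with
  a = c = 0; the Pochhammer symbols left behind become Gamma functions in the limit. Written with
  \<open>Gamma_series'\<close>, the expression in \<open>lim\<close> is eventually constant.\<close>

theorem cauchy_cos_integral_eq:
  assumes a: "Re a > -1"
  shows "cauchy_cos_integral a c =
    of_real pi * 2 powr (- a) * Gamma (a + 1) * rGamma (1 + (a + c) / 2) * rGamma (1 + (a - c) / 2)"
proof -
  let ?x = "1 + (a + c) / 2" and ?y = "1 + (a - c) / 2"
  let ?J = "cauchy_cos_integral"
  let ?G = "Gamma_series' :: complex \<Rightarrow> nat \<Rightarrow> complex"
  have sub: "strict_mono (\<lambda>N::nat. 2 * N)" by (auto intro: strict_monoI)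
  have a1: "a + 1 \<notin> \<int>\<^sub>\<le>\<^sub>0" using a by (auto elim!: nonpos_Ints_cases simp: complex_eq_iff)
  have p0: "pochhammer (a + 1) n \<noteq> 0" for n
    using a1 by (auto simp: pochhammer_eq_0_iff)
  have p1: "pochhammer (1::complex) n \<noteq> 0" for n by (simp add: pochhammer_fact[symmetric])
  have lim: "(\<lambda>N. of_real pi * 2 powr (- a) * ?G (a + 1) (2 * N) * inverse (?G ?x N) * inverse (?G ?y N)
         * (?G 1 N) ^ 2 * inverse (?G 1 (2 * N)) * (?J (a + of_nat (2 * N)) c / ?J (of_nat (2 * N)) 0))
       \<longlonglongrightarrow> of_real pi * 2 powr (- a) * Gamma (a + 1) * rGamma ?x * rGamma ?y * (Gamma 1) ^ 2 * rGamma 1 * 1"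
    by (intro tendsto_intros inverse_Gamma_series'_LIMSEQ
          LIMSEQ_subseq_LIMSEQ[OF cauchy_cos_integral_ratio[OF a, of c] sub, unfolded o_def]
          LIMSEQ_subseq_LIMSEQ[OF Gamma_series'_LIMSEQ sub, unfolded o_def]
          LIMSEQ_subseq_LIMSEQ[OF inverse_Gamma_series'_LIMSEQ sub, unfolded o_def] Gamma_series'_LIMSEQ)
  have "eventually (\<lambda>N. of_real pi * 2 powr (- a) * ?G (a + 1) (2 * N) * inverse (?G ?x N) * inverse (?G ?y N)
         * (?G 1 N) ^ 2 * inverse (?G 1 (2 * N)) * (?J (a + of_nat (2 * N)) c / ?J (of_nat (2 * N)) 0) = ?J a c) sequentially"
    using eventually_gt_at_top[of 0]
  proof eventually_elim
    case (elim N)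
    define L where "L = complex_of_real (ln (real N))"
    define l2 where "l2 = complex_of_real (ln 2)"
    have ln2: "complex_of_real (ln (real (2 * N))) = l2 + L" "complex_of_real (ln (real N * 2)) = l2 + L"
      using elim by (simp_all add: L_def l2_def ln_mult)
    have G: "?G z n * pochhammer z n = fact (n - 1) * exp (z * of_real (ln (of_nat n)))" if "pochhammer z n \<noteq> 0" for z n
      using that by (simp add: Gamma_series'_def)
    define F where "F = (fact (N - 1) :: complex)"
    define F2 where "F2 = (fact (2 * N - 1) :: complex)"
    have F: "F \<noteq> 0" "F2 \<noteq> 0" by (simp_all add: F_def F2_def)
    \<comment> \<open>The reference integral obeys the same recursion, started from the value pi at
      a = c = 0; this also shows that it is nonzero.\<close>
    have J00: "of_real pi * pochhammer 1 (2 * N) = 4 ^ N * (pochhammer 1 N)\<^sup>2 * ?J (of_nat (2 * N)) 0"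
      using cauchy_cos_integral_iterate[of 0 0 N] by (simp add: cauchy_cos_integral_0_0 power2_eq_square)
    have Jn: "?J (of_nat (2 * N)) 0 \<noteq> 0" using J00 p1[of "2*N"] by auto
    have Ja: "?J a c * pochhammer (a + 1) (2 * N) = 4 ^ N * pochhammer ?x N * pochhammer ?y N * ?J (a + of_nat (2 * N)) c"
      using cauchy_cos_integral_iterate[OF a, of c N] by simp
    define g1 where "g1 = ?G (a + 1) (2 * N)"
    define g2 where "g2 = ?G 1 (2 * N)"
    define g3 where "g3 = ?G 1 N"
    have gs: "pochhammer (a + 1) (2 * N) * g1 = F2 * exp ((a + 1) * (l2 + L))"
         "pochhammer 1 (2 * N) * g2 = F2 * exp (l2 + L)"
         "pochhammer 1 N * g3 = F * exp L"
         "pochhammer ?x N = F * exp (?x * L) * inverse (?G ?x N)"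
         "pochhammer ?y N = F * exp (?y * L) * inverse (?G ?y N)"
      using G[OF p0, of "2*N"] G[OF p1, of "2*N"] G[OF p1, of N] elim
      unfolding F_def F2_def g1_def g2_def g3_def
      by (simp_all add: ln2 L_def[symmetric] mult.commute pochhammer_conv_Gamma_series')
    have gn: "g1 \<noteq> 0" "g2 \<noteq> 0" "g3 \<noteq> 0" using gs(1-3) F by auto
    have "2 powr (- a) = exp (- a * l2)" by (simp add: powr_def l2_def Ln_of_real[of 2, simplified])
    \<comment> \<open>Both sides carry exp((a + 3) L). The index 2N adds (a + 1) ln 2 on the left
      but only ln 2 on the right, and \<open>2 powr (- a)\<close> makes up the difference.\<close>
    have ee: "2 powr (- a) * exp ((a + 1) * (l2 + L)) * (exp L)\<^sup>2 = exp (?x * L) * exp (?y * L) * exp (l2 + L)"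
      unfolding \<open>2 powr (- a) = exp (- a * l2)\<close> power2_eq_square exp_add[symmetric]
      by (rule arg_cong[of _ _ exp]) (simp add: field_simps)
    define X where "X = inverse (?G ?x N)"
    define Y where "Y = inverse (?G ?y N)"
    define j where "j = ?J (of_nat (2 * N)) 0"
    define j' where "j' = ?J (a + of_nat (2 * N)) c"
    have calc1: "?J a c * (F2 * exp ((a + 1) * (l2 + L))) = g1 * 4 ^ N * (F * exp (?x * L) * X) * (F * exp (?y * L) * Y) * j'"
      using Ja unfolding gs(1)[symmetric] gs(4,5) X_def Y_def j'_def by simp
    have calc2: "of_real pi * (F2 * exp (l2 + L)) * g3\<^sup>2 = g2 * 4 ^ N * (F * exp L)\<^sup>2 * j"
      using J00 unfolding gs(2,3)[symmetric] j_def power_mult_distrib by (simp add: algebra_simps)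
    have "of_real pi * 2 powr (- a) * g1 * X * Y * g3 ^ 2 * inverse g2 * (j' / j) = ?J a c"
    proof -
      have gen: "p * P * g1 * X * Y * g3 ^ 2 * inverse g2 * (j' / j) = J"
        if "J * (F2 * E1) = g1 * Q * (F * ex * X) * (F * ey * Y) * j'"
           "p * (F2 * E2) * g3\<^sup>2 = g2 * Q * (F * eL)\<^sup>2 * j"
           "P * E1 * eL\<^sup>2 = ex * ey * E2" and "F2 \<noteq> 0" "E1 \<noteq> 0" "E2 \<noteq> 0" "eL \<noteq> 0" "g2 \<noteq> 0" "j \<noteq> 0"
        for p P J ex ey E1 E2 Q eL :: complex
      proof -
        have "p * P * g1 * X * Y * g3 ^ 2 * inverse g2 * (j' / j) * (F2 * E1 * E2)
          = (p * (F2 * E2) * g3\<^sup>2) * P * E1 * g1 * X * Y * j' / (g2 * j)"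
          by (simp add: field_simps)
        also have "\<dots> = (P * E1 * eL\<^sup>2) * Q * F\<^sup>2 * g1 * X * Y * j'"
          unfolding that(2) using that by (simp add: field_simps power_mult_distrib)
        also have "\<dots> = (J * (F2 * E1)) * E2"
          unfolding that(1,3) by (simp add: field_simps power2_eq_square)
        finally have "p * P * g1 * X * Y * g3 ^ 2 * inverse g2 * (j' / j) * (F2 * E1 * E2) = J * (F2 * E1 * E2)"
          by (simp only: mult.assoc)
        thus ?thesis using that(4-6) by (metis mult_cancel_right mult_eq_0_iff)
      qed
      show ?thesis
        by (rule gen[OF calc1 calc2 ee]) (use F gn Jn in \<open>auto simp: j_def\<close>)
    qed
    thus ?case unfolding g1_def g2_def g3_def X_def Y_def j_def j'_def .
  qed
  from Lim_transform_eventually[OF lim this] show ?thesis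
    by (simp add: LIMSEQ_const_iff)
qed

subsection \<open>The Beta integral with a complex exponent\<close>

lemma powr_mult_powr_set_integrable:
  fixes a b :: real
  assumes "a > 0" "b > 0"
  shows "set_integrable lborel {0<..<1} (\<lambda>x. x powr (a - 1) * (1 - x) powr (b - 1))"
proof -
  have "(\<lambda>t. t powr (a - 1) * (1 - t) powr (b - 1)) integrable_on {0..1}"
    using has_integral_Beta_real[OF assms] by (rule has_integral_integrable)
  hence "(\<lambda>t. t powr (a - 1) * (1 - t) powr (b - 1)) absolutely_integrable_on {0..1}"
    by (intro nonnegative_absolutely_integrable_1) auto
  hence "(\<lambda>t. t powr (a - 1) * (1 - t) powr (b - 1)) absolutely_integrable_on {0<..<1}"
    by (rule set_integrable_subset) auto
  thus ?thesis unfolding set_integrable_def by (subst (asm) integrable_completion) auto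
qed

definition beta_integral :: "complex \<Rightarrow> real \<Rightarrow> complex" where
  "beta_integral p b = (LINT x:{0<..<1}|lborel. of_real x powr (p - 1) * of_real ((1 - x) powr (b - 1)))"

lemma beta_integral_set_integrable:
  assumes "Re p > 0" "b > 0"
  shows "set_integrable lborel {0<..<1} (\<lambda>x. of_real x powr (p - 1) * complex_of_real ((1 - x) powr (b - 1)))"
  unfolding set_integrable_def
proof (rule Bochner_Integration.integrable_bound)
  show "integrable lborel (\<lambda>x. indicator {0<..<1} x *\<^sub>R (x powr (Re p - 1) * (1 - x) powr (b - 1)))"
    using powr_mult_powr_set_integrable[OF assms] unfolding set_integrable_def .
qed (auto simp: norm_mult norm_powr_real_powr indicator_def)

text \<open>The antiderivative is x^p (1 - x)^b, which vanishes at both ends; splitting one factor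
  off x^p and off (1 - x)^b leaves the two integrands.\<close>

lemma beta_integral_rec:
  assumes p: "Re p > 0" and b: "b > 0"
  shows "beta_integral p b * p = (p + of_real b) * beta_integral (p + 1) b"
proof -
  let ?f = "\<lambda>p x. of_real x powr (p - 1) * complex_of_real ((1 - x) powr (b - 1))"
  let ?F = "\<lambda>x::real. of_real x powr p * complex_of_real ((1 - x) powr b)"
  have "((\<lambda>x. p * ?f p x - (p + of_real b) * ?f (p + 1) x) has_integral ?F 1 - ?F 0) {0..1}"
  proof (rule fundamental_theorem_of_calculus_interior)
    show "continuous_on {0..1} ?F"
      by (intro continuous_intros continuous_on_powr_complex continuous_on_powr') (use p b in auto)
    fix x :: real assume x: "x \<in> {0<..<1}"
    have x': "complex_of_real x \<notin> \<real>\<^sub>\<le>\<^sub>0" "complex_of_real x \<noteq> 0" using x by auto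
    have e: "of_real x powr p = of_real x powr (p - 1) * complex_of_real x" "(1 - x) powr b = (1 - x) powr (b - 1) * (1 - x)"
      using x by (simp_all add: powr_diff)
    have "((\<lambda>x. of_real x powr p) has_vector_derivative p * of_real x powr (p - 1)) (at x)"
      by (rule has_vector_derivative_real_field) (use x' in \<open>auto intro!: derivative_eq_intros\<close>)
    moreover have "((\<lambda>x. (1 - x) powr b) has_real_derivative - b * (1 - x) powr (b - 1)) (at x)"
      using x by (auto intro!: derivative_eq_intros)
    hence "((\<lambda>x. complex_of_real ((1 - x) powr b)) has_vector_derivative of_real (- b * (1 - x) powr (b - 1))) (at x)"
      by (intro has_vector_derivative_of_real) (simp add: has_real_derivative_iff_has_vector_derivative)
    ultimately have "(?F has_vector_derivative of_real x powr p * of_real (- b * (1 - x) powr (b - 1)) +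
        p * of_real x powr (p - 1) * of_real ((1 - x) powr b)) (at x)"
      by (rule has_vector_derivative_mult)
    also have "of_real x powr p * of_real (- b * (1 - x) powr (b - 1)) + p * of_real x powr (p - 1) * of_real ((1 - x) powr b)
      = p * ?f p x - (p + of_real b) * ?f (p + 1) x"
      by (simp add: e algebra_simps)
    finally show "(?F has_vector_derivative p * ?f p x - (p + of_real b) * ?f (p + 1) x) (at x)" .
  qed auto
  moreover have "?F 1 - ?F 0 = 0" using p b by auto
  moreover have "((\<lambda>x. p * ?f p x - (p + of_real b) * ?f (p + 1) x) has_integral
      p * beta_integral p b - (p + of_real b) * beta_integral (p + 1) b) {0..1}"
    unfolding beta_integral_def
    by (intro has_integral_diff has_integral_mult_right has_integral_of_set_integrable_Ioo beta_integral_set_integrable)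
       (use p b in auto)
  ultimately show ?thesis
    by (metis (no_types, lifting) has_integral_unique eq_iff_diff_eq_0 mult.commute)
qed

lemma beta_integral_iterate:
  assumes p: "Re p > 0" and b: "b > 0"
  shows "beta_integral p b * pochhammer p N = pochhammer (p + of_real b) N * beta_integral (p + of_nat N) b"
proof (induction N)
  case (Suc N)
  have "beta_integral p b * pochhammer p (Suc N) = pochhammer (p + of_real b) N * (beta_integral (p + of_nat N) b * (p + of_nat N))"
    using Suc.IH by (simp add: pochhammer_Suc mult_ac)
  also have "\<dots> = pochhammer (p + of_real b) N * ((p + of_nat N + of_real b) * beta_integral (p + of_nat N + 1) b)"
    using p b by (subst beta_integral_rec) auto
  finally show ?case by (simp add: pochhammer_Suc algebra_simps)
qed auto

text \<open>x^N concentrates at x = 1, where x^(p - 1) is 1. The factor (1 - x)^(b - 1) is singular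
  there for b < 1 and therefore stays in the reference density \<open>u\<close>.\<close>

lemma beta_integral_ratio:
  assumes p: "Re p > 0" and b: "b > 0"
  shows "(\<lambda>N. beta_integral (p + of_nat N) b / beta_integral (1 + of_nat N) b) \<longlonglongrightarrow> 1"
proof -
  let ?I = "{0<..<1::real}"
  define u :: "real \<Rightarrow> real" where "u = (\<lambda>x. indicator ?I x * (1 - x) powr (b - 1))"
  define w :: "real \<Rightarrow> real" where "w = (\<lambda>x. indicator ?I x * x)"
  define g :: "real \<Rightarrow> complex" where
    "g = (\<lambda>x. indicator ?I x *\<^sub>R (of_real x powr (p - 1) * of_real ((1 - x) powr (b - 1))))"
  have [measurable]: "w \<in> borel_measurable borel" unfolding w_def by measurable
  have iu: "integrable lborel u"
  proof -
    have "integrable lborel (\<lambda>x. indicator ?I x *\<^sub>R (x powr (1 - 1) * (1 - x) powr (b - 1)))"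
      using powr_mult_powr_set_integrable[of 1 b] b unfolding set_integrable_def by simp
    also have "(\<lambda>x. indicator ?I x *\<^sub>R (x powr (1 - 1) * (1 - x) powr (b - 1))) = u"
      by (auto simp: u_def fun_eq_iff indicator_def)
    finally show ?thesis .
  qed
  have "(\<lambda>N. (\<integral>y. of_real (w y ^ N) * g y \<partial>lborel) / of_real (\<integral>y. w y ^ N * u y \<partial>lborel)) \<longlonglongrightarrow> 1"
  proof (rule peak_ratio_tendsto_1)
    show "w \<in> borel_measurable lborel" unfolding w_def by measurable
    show "0 \<le> w y \<and> w y \<le> 1" for y by (auto simp: w_def indicator_def)
    show "integrable lborel g" using beta_integral_set_integrable[OF p b] unfolding g_def set_integrable_def .
    show "integrable lborel u" by fact
    show "0 \<le> u y" for y by (simp add: u_def)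
  next
    fix e :: real assume e: "e > 0"
    have "isCont (\<lambda>y. of_real y powr (p - 1)) (1::real)"
      by (intro continuous_intros) auto
    then obtain d where d: "d > 0" "\<And>y::real. \<bar>y - 1\<bar> < d \<Longrightarrow> cmod (of_real y powr (p - 1) - 1) < e"
      using e unfolding continuous_at_eps_delta by (fastforce simp: dist_norm)
    define r where "r = max (1/2) (1 - d / 2)"
    have r: "0 < r" "r < 1" "\<And>y. y \<in> ?I \<Longrightarrow> r \<le> y \<Longrightarrow> \<bar>y - 1\<bar> < d"
    proof -
      show "0 < r" "r < 1" using d(1) by (auto simp: r_def)
      fix y assume "y \<in> ?I" "r \<le> y"
      moreover have "r \<ge> 1 - d / 2" by (simp add: r_def)
      ultimately show "\<bar>y - 1\<bar> < d" using d(1) by auto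
    qed
    have "cmod (g y - of_real (u y)) \<le> e * u y" if "r \<le> w y" for y
    proof (cases "y \<in> ?I")
      case True
      have "g y - of_real (u y) = (of_real y powr (p - 1) - 1) * of_real (u y)"
        using True by (simp add: g_def u_def algebra_simps)
      moreover have "u y \<ge> 0" by (simp add: u_def)
      ultimately show ?thesis using d(2)[OF r(3)[OF True]] that True
        by (auto simp: w_def norm_mult intro!: mult_right_mono)
    qed (auto simp: g_def u_def)
    thus "\<exists>r>0. r < 1 \<and> (\<forall>y\<in>space lborel. r \<le> w y \<longrightarrow> cmod (g y - of_real (u y)) \<le> e * u y)"
      using r by blast
  next
    fix r :: real assume r: "0 < r" "r < 1"
    have "(\<integral>x. indicator {x. r \<le> w x} x * u x \<partial>lborel) \<noteq> 0"
    proof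
      assume 0: "(\<integral>x. indicator {x. r \<le> w x} x * u x \<partial>lborel) = 0"
      have "integrable lborel (\<lambda>x. indicator {x. r \<le> w x} x * u x)"
        by (rule Bochner_Integration.integrable_bound[OF iu]) (auto simp: u_def indicator_def)
      hence "AE x in lborel. indicator {x. r \<le> w x} x * u x = 0"
        using 0 by (subst (asm) integral_nonneg_eq_0_iff_AE) (auto simp: u_def)
      hence "AE x in lborel. x \<notin> {r<..<1}"
        by eventually_elim (use r in \<open>auto simp: u_def w_def indicator_def split: if_splits\<close>)
      hence "emeasure lborel {r<..<1} = 0" by (subst (asm) AE_iff_null) (auto simp: null_sets_def greaterThanLessThan_def Collect_conj_eq greaterThan_def lessThan_def)
      thus False using r by simp
    qed
    moreover have "(\<integral>x. indicator {x. r \<le> w x} x * u x \<partial>lborel) \<ge> 0"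
      by (intro integral_nonneg_AE AE_I2) (auto simp: u_def)
    ultimately show "0 < (\<integral>x. indicator {x. r \<le> w x} x * u x \<partial>lborel)" by simp
  qed
  moreover have "(\<integral>y. of_real (w y ^ N) * g y \<partial>lborel) = beta_integral (p + of_nat N) b" for N
    unfolding beta_integral_def set_lebesgue_integral_def
  proof (intro Bochner_Integration.integral_cong refl)
    fix y :: real
    have e: "p + of_nat N - 1 = (p - 1) + of_nat N" by simp
    show "of_real (w y ^ N) * g y = indicator ?I y *\<^sub>R (of_real y powr (p + of_nat N - 1) * of_real ((1 - y) powr (b - 1)))"
      unfolding e by (cases "y \<in> ?I") (auto simp: w_def g_def powr_add powr_nat')
  qed
  moreover have "of_real (\<integral>y. w y ^ N * u y \<partial>lborel) = beta_integral (1 + of_nat N) b" for N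
    unfolding beta_integral_def set_lebesgue_integral_def integral_complex_of_real[symmetric]
  proof (intro Bochner_Integration.integral_cong refl)
    fix y :: real
    show "of_real (w y ^ N * u y) = indicator ?I y *\<^sub>R (of_real y powr (1 + of_nat N - 1) * complex_of_real ((1 - y) powr (b - 1)))"
      by (cases "y \<in> ?I") (auto simp: w_def u_def powr_nat')
  qed
  ultimately show ?thesis by simp
qed

text \<open>The recursion moves only the complex exponent p, so one reference value suffices: the
  integral at p = 1, a real Beta value equal to 1 / b.\<close>

theorem beta_integral_eq:
  assumes p: "Re p > 0" and b: "b > 0"
  shows "beta_integral p b = Beta p (of_real b)"
proof -
  let ?G = "Gamma_series' :: complex \<Rightarrow> nat \<Rightarrow> complex"
  let ?b = "complex_of_real b"
  have np: "z \<notin> \<int>\<^sub>\<le>\<^sub>0" if "Re z > 0" for z using that by (auto elim!: nonpos_Ints_cases simp: complex_eq_iff)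
  have p0: "pochhammer z n \<noteq> 0" if "Re z > 0" for z n
    using np[OF that] by (auto simp: pochhammer_eq_0_iff)
  have B1: "beta_integral 1 b = 1 / ?b"
  proof -
    have "((\<lambda>t. t powr (1 - 1) * (1 - t) powr (b - 1)) has_integral Beta 1 b) {0<..<1}"
      using has_integral_Beta_real[of 1 b] b by (simp add: has_integral_Icc_iff_Ioo)
    hence "((\<lambda>t. complex_of_real (t powr (1 - 1) * (1 - t) powr (b - 1))) has_integral of_real (Beta 1 b)) {0<..<1}"
      by (rule has_integral_of_real)
    moreover have "((\<lambda>t. of_real t powr (1 - 1) * complex_of_real ((1 - t) powr (b - 1))) has_integral beta_integral 1 b) {0<..<1}"
      unfolding beta_integral_def using has_integral_of_set_integrable_Ioo[OF beta_integral_set_integrable[of 1 b]] b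
      by (simp add: has_integral_Icc_iff_Ioo)
    hence "((\<lambda>t. complex_of_real (t powr (1 - 1) * (1 - t) powr (b - 1))) has_integral beta_integral 1 b) {0<..<1}"
      by (rule has_integral_eq[rotated]) auto
    ultimately have "beta_integral 1 b = of_real (Beta 1 b)" using has_integral_unique by blast
    also have "Beta 1 b = 1 / b"
    proof -
      have "Gamma b > 0" "b \<notin> \<int>\<^sub>\<le>\<^sub>0" using b by (auto simp: Gamma_real_pos elim!: nonpos_Ints_cases)
      thus ?thesis using Gamma_plus1[of b] b by (simp add: Beta_def add.commute Gamma_eq_zero_iff)
    qed
    finally show ?thesis by simp
  qed
  have lim: "(\<lambda>N. ?G p N * ?G (1 + ?b) N * inverse (?G (p + ?b) N) * inverse (?G 1 N) / ?b
      * (beta_integral (p + of_nat N) b / beta_integral (1 + of_nat N) b))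
     \<longlonglongrightarrow> Gamma p * Gamma (1 + ?b) * rGamma (p + ?b) * rGamma 1 / ?b * 1"
    by (intro tendsto_intros inverse_Gamma_series'_LIMSEQ Gamma_series'_LIMSEQ beta_integral_ratio p b) (use b in auto)
  have "eventually (\<lambda>N. ?G p N * ?G (1 + ?b) N * inverse (?G (p + ?b) N) * inverse (?G 1 N) / ?b
      * (beta_integral (p + of_nat N) b / beta_integral (1 + of_nat N) b) = beta_integral p b) sequentially"
    using eventually_gt_at_top[of 0]
  proof eventually_elim
    case (elim N)
    define L where "L = complex_of_real (ln (real N))"
    define F where "F = (fact (N - 1) :: complex)"
    have G: "?G z N = F * exp (z * L) / pochhammer z N" for z
      by (simp add: Gamma_series'_def F_def L_def)
    have e: "exp (p * L) * exp ((1 + ?b) * L) = exp ((p + ?b) * L) * exp L"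
      unfolding exp_add[symmetric] by (rule arg_cong[of _ _ exp]) (simp add: algebra_simps)
    have *: "pochhammer (1 + ?b) N * beta_integral (1 + of_nat N) b = pochhammer 1 N / ?b"
      using beta_integral_iterate[of 1 b N] b by (simp add: B1)
    have j: "beta_integral (1 + of_nat N) b \<noteq> 0" using * p0[of 1 N] b by auto
    have nz: "pochhammer (1 + ?b) N \<noteq> 0" "pochhammer (p + ?b) N \<noteq> 0" "pochhammer p N \<noteq> 0" "pochhammer 1 N \<noteq> (0::complex)" "F \<noteq> 0" "?b \<noteq> 0"
      using p0 p b by (auto simp: F_def)
    have B: "beta_integral p b = pochhammer (p + ?b) N * beta_integral (p + of_nat N) b / pochhammer p N"
      using beta_integral_iterate[OF p b, of N] nz by (simp add: field_simps)
    have J: "beta_integral (1 + of_nat N) b = pochhammer 1 N / (?b * pochhammer (1 + ?b) N)"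
      using * nz by (simp add: field_simps)
    have "?G p N * ?G (1 + ?b) N * inverse (?G (p + ?b) N) * inverse (?G 1 N) =
        (exp (p * L) * exp ((1 + ?b) * L)) * pochhammer (p + ?b) N * pochhammer 1 N /
         (exp ((p + ?b) * L) * exp L * pochhammer p N * pochhammer (1 + ?b) N)"
      unfolding G using nz by (simp add: field_simps)
    also have "\<dots> = pochhammer (p + ?b) N * pochhammer 1 N / (pochhammer p N * pochhammer (1 + ?b) N)"
      unfolding e by simp
    finally have Q: "?G p N * ?G (1 + ?b) N * inverse (?G (p + ?b) N) * inverse (?G 1 N) =
      pochhammer (p + ?b) N * pochhammer 1 N / (pochhammer p N * pochhammer (1 + ?b) N)" .
    show ?case unfolding Q B J using nz by (simp add: field_simps)
  qed
  from Lim_transform_eventually[OF lim this]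
  have "beta_integral p b = Gamma p * Gamma (1 + ?b) * rGamma (p + ?b) / ?b"
    by (simp add: LIMSEQ_const_iff)
  also have "Gamma (1 + ?b) = ?b * Gamma ?b" using Gamma_plus1[of ?b] np[of ?b] b by (simp add: add.commute)
  finally show ?thesis using b by (simp add: Beta_altdef)
qed

subsection \<open>Polar coordinates in the half plane\<close>

lemma lborel_complex: "(lborel :: complex measure) = distr (lborel \<Otimes>\<^sub>M lborel) borel (\<lambda>(x, y). Complex x y)"
proof (rule lborel_eqI)
  have [measurable]: "(\<lambda>(x, y). Complex x y) \<in> borel \<Otimes>\<^sub>M borel \<rightarrow>\<^sub>M borel"
    unfolding case_prod_beta Complex_eq by measurable
  fix l u :: complex
  assume le: "\<And>b. b \<in> Basis \<Longrightarrow> l \<bullet> b \<le> u \<bullet> b"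
  have le': "Re l \<le> Re u" "Im l \<le> Im u" using le[of 1] le[of \<i>] by (auto simp: Basis_complex_def)
  have "emeasure (distr (lborel \<Otimes>\<^sub>M lborel) borel (\<lambda>(x, y). Complex x y)) (box l u) =
     emeasure (lborel \<Otimes>\<^sub>M lborel) ({Re l<..<Re u} \<times> {Im l<..<Im u})"
    by (subst emeasure_distr) (auto intro!: arg_cong[of _ _ "emeasure (lborel \<Otimes>\<^sub>M lborel)"] simp: space_pair_measure in_box_complex_iff)
  also have "\<dots> = ennreal (Re u - Re l) * ennreal (Im u - Im l)"
    using le' by (subst lborel.emeasure_pair_measure_Times) auto
  also have "\<dots> = (\<Prod>b\<in>Basis. (u - l) \<bullet> b)"
    using le' by (simp add: Basis_complex_def ennreal_mult)
  finally show "emeasure (distr (lborel \<Otimes>\<^sub>M lborel) borel (\<lambda>(x, y). Complex x y)) (box l u) = (\<Prod>b\<in>Basis. (u - l) \<bullet> b)" .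
qed simp

lemma measurable_Complex [measurable]: "(\<lambda>(x, y). Complex x y) \<in> borel \<Otimes>\<^sub>M borel \<rightarrow>\<^sub>M borel"
  unfolding case_prod_beta Complex_eq by measurable

lemma nn_integral_lborel_complex:
  assumes [measurable]: "f \<in> borel_measurable borel"
  shows "(\<integral>\<^sup>+z. f z \<partial>lborel) = (\<integral>\<^sup>+x. \<integral>\<^sup>+y. f (Complex x y) \<partial>lborel \<partial>lborel)"
  by (subst lborel_complex, subst nn_integral_distr)
     (auto simp: lborel.nn_integral_fst[symmetric] case_prod_beta)

text \<open>The substitution u = tan y as an equality of measures, checked on intervals, where it is
  the fundamental theorem for tan.\<close>

lemma nn_integral_tan:
  assumes f [measurable]: "f \<in> borel_measurable borel"
  shows "(\<integral>\<^sup>+u. f u \<partial>lborel) = (\<integral>\<^sup>+y. indicator {-pi/2<..<pi/2} y * ennreal (inverse ((cos y)\<^sup>2)) * f (tan y) \<partial>lborel)"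
proof -
  let ?D = "density lborel (\<lambda>y. indicator {-pi/2<..<pi/2} y * ennreal (inverse ((cos y)\<^sup>2)))"
  have tm [measurable]: "(tan :: real \<Rightarrow> real) \<in> borel \<rightarrow>\<^sub>M borel" unfolding tan_def by measurable
  have "lborel = distr ?D borel tan"
  proof (rule lborel_eqI)
    fix l u :: real assume "\<And>b. b \<in> Basis \<Longrightarrow> l \<bullet> b \<le> u \<bullet> b"
    hence lu: "l \<le> u" by simp
    have iff: "y \<in> {-pi/2<..<pi/2} \<and> tan y \<in> {l<..<u} \<longleftrightarrow> y \<in> {arctan l<..<arctan u}" for y
    proof -
      have "y \<in> {arctan l<..<arctan u} \<Longrightarrow> y \<in> {-pi/2<..<pi/2}"
        using arctan_bounded[of l] arctan_bounded[of u] by auto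
      moreover have "tan y \<in> {l<..<u} \<longleftrightarrow> y \<in> {arctan l<..<arctan u}" if y: "y \<in> {-pi/2<..<pi/2}"
      proof -
        have "arctan (tan y) = y" using y by (intro arctan_tan) auto
        thus ?thesis by (metis arctan_less_iff greaterThanLessThan_iff)
      qed
      ultimately show ?thesis by blast
    qed
    have le: "arctan l \<le> arctan u" using lu by (rule arctan_monotone')
    have "emeasure (distr ?D borel tan) (box l u) = emeasure ?D (tan -` {l<..<u})"
      by (subst emeasure_distr) (auto simp: box_real)
    also have "\<dots> = (\<integral>\<^sup>+y. indicator {-pi/2<..<pi/2} y * ennreal (inverse ((cos y)\<^sup>2)) * indicator (tan -` {l<..<u}) y \<partial>lborel)"
      by (subst emeasure_density) (auto intro: measurable_sets_borel[OF tm])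
    also have "\<dots> = (\<integral>\<^sup>+y. ennreal (inverse ((cos y)\<^sup>2)) * indicator {arctan l<..<arctan u} y \<partial>lborel)"
      using iff by (intro nn_integral_cong) (auto simp: indicator_def)
    also have "\<dots> = (\<integral>\<^sup>+y. ennreal (inverse ((cos y)\<^sup>2)) * indicator {arctan l..arctan u} y \<partial>lborel)"
    proof (rule nn_integral_cong_AE)
      have "AE y in lborel. y \<noteq> arctan l" "AE y in lborel. y \<noteq> arctan u"
        by (rule AE_lborel_singleton)+
      thus "AE y in lborel. ennreal (inverse ((cos y)\<^sup>2)) * indicator {arctan l<..<arctan u} y = ennreal (inverse ((cos y)\<^sup>2)) * indicator {arctan l..arctan u} y"
        by eventually_elim (auto simp: indicator_def)
    qed
    also have "\<dots> = ennreal (tan (arctan u) - tan (arctan l))"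
    proof (rule nn_integral_FTC_Icc)
      fix y assume "y \<in> {arctan l..arctan u}"
      hence "cos y > 0" using arctan_bounded[of l] arctan_bounded[of u] by (intro cos_gt_zero_pi) auto
      thus "DERIV tan y :> inverse ((cos y)\<^sup>2)" by (intro DERIV_tan) auto
    qed (use le in auto)
    finally show "emeasure (distr ?D borel tan) (box l u) = ennreal (\<Prod>b\<in>Basis. (u - l) \<bullet> b)"
      by (simp add: tan_arctan)
  qed simp
  hence "(\<integral>\<^sup>+u. f u \<partial>lborel) = (\<integral>\<^sup>+u. f u \<partial>distr ?D borel tan)" by simp
  also have "\<dots> = (\<integral>\<^sup>+y. f (tan y) \<partial>?D)" by (subst nn_integral_distr) auto
  also have "\<dots> = (\<integral>\<^sup>+y. indicator {-pi/2<..<pi/2} y * ennreal (inverse ((cos y)\<^sup>2)) * f (tan y) \<partial>lborel)"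
    by (subst nn_integral_density) auto
  finally show ?thesis .
qed

lemma nn_integral_real_scale:
  fixes c :: real
  assumes [measurable]: "f \<in> borel_measurable borel" and c: "c > 0"
  shows "(\<integral>\<^sup>+x. f x \<partial>lborel) = (\<integral>\<^sup>+x. ennreal c * f (c * x) \<partial>lborel)"
  using nn_integral_real_affine[of f c 0] c by (subst nn_integral_cmult) auto

text \<open>Polar coordinates by one-dimensional substitutions under Fubini: y = x u, then u = tan
  of the angle, then x = r cos of the angle. Their Jacobians x, 1 / cos^2 and cos multiply to
  r.\<close>

lemma nn_integral_half_plane_polar:
  fixes f :: "complex \<Rightarrow> ennreal"
  assumes f [measurable]: "f \<in> borel_measurable borel"
  shows "(\<integral>\<^sup>+w. indicator {w. Re w > 0} w * f w \<partial>lborel) =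
    (\<integral>\<^sup>+y. \<integral>\<^sup>+r. indicator {-pi/2<..<pi/2} y * indicator {0<..} r * ennreal r * f (of_real r * cis y) \<partial>lborel \<partial>lborel)"
proof -
  have [measurable]: "cis \<in> borel \<rightarrow>\<^sub>M borel"
    by (intro borel_measurable_continuous_onI continuous_intros)
  have m1: "(\<lambda>x. Complex (x * a) (x * b)) \<in> borel_measurable borel" for a b :: real
    unfolding Complex_eq by measurable
  have C1: "Complex x (x * u) = of_real x * (1 + \<i> * of_real u)" for x u :: real
    by (simp add: complex_eq_iff)
  have "(\<integral>\<^sup>+w. indicator {w. Re w > 0} w * f w \<partial>lborel) =
     (\<integral>\<^sup>+x. \<integral>\<^sup>+y. indicator {0<..} x * f (Complex x y) \<partial>lborel \<partial>lborel)"
    by (subst nn_integral_lborel_complex) (auto intro!: nn_integral_cong simp: indicator_def)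
  also have "\<dots> = (\<integral>\<^sup>+x. \<integral>\<^sup>+u. indicator {0<..} x * (ennreal x * f (of_real x * (1 + \<i> * of_real u))) \<partial>lborel \<partial>lborel)"
  proof (rule nn_integral_cong)
    fix x :: real
    show "(\<integral>\<^sup>+y. indicator {0<..} x * f (Complex x y) \<partial>lborel) = (\<integral>\<^sup>+u. indicator {0<..} x * (ennreal x * f (of_real x * (1 + \<i> * of_real u))) \<partial>lborel)"
    proof (cases "x > 0")
      case True
      have [measurable]: "Complex x \<in> borel \<rightarrow>\<^sub>M borel" unfolding Complex_eq by measurable
      show ?thesis using True by (subst nn_integral_real_scale[OF _ True]) (auto simp: C1)
    qed auto
  qed
  also have "\<dots> = (\<integral>\<^sup>+u. \<integral>\<^sup>+x. indicator {0<..} x * (ennreal x * f (of_real x * (1 + \<i> * of_real u))) \<partial>lborel \<partial>lborel)"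
    by (rule lborel_pair.Fubini') measurable
  also have "\<dots> = (\<integral>\<^sup>+y. indicator {-pi/2<..<pi/2} y * ennreal (inverse ((cos y)\<^sup>2)) *
     (\<integral>\<^sup>+x. indicator {0<..} x * (ennreal x * f (of_real x * (1 + \<i> * of_real (tan y)))) \<partial>lborel) \<partial>lborel)"
    by (subst nn_integral_tan) auto
  also have "\<dots> = (\<integral>\<^sup>+y. \<integral>\<^sup>+r. indicator {-pi/2<..<pi/2} y * indicator {0<..} r * ennreal r * f (of_real r * cis y) \<partial>lborel \<partial>lborel)"
  proof (rule nn_integral_cong)
    fix y :: real
    show "indicator {-pi/2<..<pi/2} y * ennreal (inverse ((cos y)\<^sup>2)) *
     (\<integral>\<^sup>+x. indicator {0<..} x * (ennreal x * f (of_real x * (1 + \<i> * of_real (tan y)))) \<partial>lborel) =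
      (\<integral>\<^sup>+r. indicator {-pi/2<..<pi/2} y * indicator {0<..} r * ennreal r * f (of_real r * cis y) \<partial>lborel)"
    proof (cases "y \<in> {-pi/2<..<pi/2}")
      case True
      have c: "cos y > 0" using True by (intro cos_gt_zero_pi) auto
      have ci: "of_real (cos y * r) * (1 + \<i> * of_real (tan y)) = of_real r * cis y" for r
        using c by (simp add: complex_eq_iff tan_def)
      have "(\<integral>\<^sup>+x. indicator {0<..} x * (ennreal x * f (of_real x * (1 + \<i> * of_real (tan y)))) \<partial>lborel) =
        (\<integral>\<^sup>+r. ennreal (cos y) * (indicator {0<..} (cos y * r) * (ennreal (cos y * r) * f (of_real (cos y * r) * (1 + \<i> * of_real (tan y))))) \<partial>lborel)"
        by (rule nn_integral_real_scale[OF _ c]) measurable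
      also have "\<dots> = (\<integral>\<^sup>+r. ennreal ((cos y)\<^sup>2) * (indicator {0<..} r * ennreal r * f (of_real r * cis y)) \<partial>lborel)"
        unfolding ci using c
        by (intro nn_integral_cong) (auto simp: indicator_def zero_less_mult_iff ennreal_mult power2_eq_square mult_ac)
      also have "\<dots> = ennreal ((cos y)\<^sup>2) * (\<integral>\<^sup>+r. indicator {0<..} r * ennreal r * f (of_real r * cis y) \<partial>lborel)"
        by (rule nn_integral_cmult) measurable
      finally have *: "(\<integral>\<^sup>+x. indicator {0<..} x * (ennreal x * f (of_real x * (1 + \<i> * of_real (tan y)))) \<partial>lborel) =
         ennreal ((cos y)\<^sup>2) * (\<integral>\<^sup>+r. indicator {0<..} r * ennreal r * f (of_real r * cis y) \<partial>lborel)" .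
      have "ennreal (inverse ((cos y)\<^sup>2)) * ennreal ((cos y)\<^sup>2) = 1"
        using c by (simp add: ennreal_mult[symmetric])
      thus ?thesis using True unfolding * by (simp add: mult.assoc[symmetric])
    qed auto
  qed
  finally show ?thesis .
qed

text \<open>The angle lies in (-pi/2, pi/2), so the principal logarithms of the number and of its
  conjugate are ln r + i y and ln r - i y, without branch correction.\<close>

lemma polar_powr_mult_cnj_powr:
  assumes r: "r > 0" and y: "y \<in> {-pi/2<..<pi/2}"
  shows "(of_real r * cis y) powr p * cnj (of_real r * cis y) powr q =
    of_real r powr (p + q) * exp (\<i> * (p - q) * of_real y)"
proof -
  have "Ln (of_real r * cis y) = of_real (ln r) + \<i> * of_real y"
    using r y by (intro Ln_unique) (auto simp: exp_add cis_conv_exp exp_of_real)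
  moreover have "Ln (cnj (of_real r * cis y)) = of_real (ln r) - \<i> * of_real y"
    using r y unfolding complex_cnj_mult cis_cnj
    by (intro Ln_unique) (auto simp: cis_conv_exp exp_of_real exp_diff exp_minus field_simps)
  moreover have "Ln (of_real r) = of_real (ln r)" using r by (simp add: Ln_of_real)
  ultimately have "(of_real r * cis y) powr p * cnj (of_real r * cis y) powr q =
     exp (p * (of_real (ln r) + \<i> * of_real y) + q * (of_real (ln r) - \<i> * of_real y))"
    using r by (simp add: powr_def exp_add)
  also have "p * (of_real (ln r) + \<i> * of_real y) + q * (of_real (ln r) - \<i> * of_real y) =
     (p + q) * of_real (ln r) + \<i> * (p - q) * of_real y" by (simp add: algebra_simps)
  finally show ?thesis using r by (simp add: powr_def exp_add Ln_of_real)
qed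

text \<open>An equality of measures, so that it applies to Bochner integrals of complex functions as
  well.\<close>

lemma half_plane_polar:
  "density lborel (indicator {w::complex. Re w > 0}) =
   distr (density (lborel \<Otimes>\<^sub>M lborel) (\<lambda>(y, r). ennreal (indicator ({-pi/2<..<pi/2} \<times> {0<..}) (y, r) * r))) borel (\<lambda>(y, r). of_real r * cis y)"
  (is "?L = distr ?D borel ?T")
proof (rule measure_eqI)
  have [measurable]: "cis \<in> borel \<rightarrow>\<^sub>M borel"
    by (intro borel_measurable_continuous_onI continuous_intros)
  fix A assume "A \<in> sets ?L"
  hence A [measurable]: "A \<in> sets borel" by simp
  have "emeasure (distr ?D borel ?T) A = (\<integral>\<^sup>+w. indicator A w \<partial>distr ?D borel ?T)" by simp
  also have "\<dots> = (\<integral>\<^sup>+z. indicator A (?T z) \<partial>?D)" by (rule nn_integral_distr) measurable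
  also have "\<dots> = (\<integral>\<^sup>+z. (case z of (y, r) \<Rightarrow> ennreal (indicator ({-pi/2<..<pi/2} \<times> {0<..}) (y, r) * r)) * indicator A (?T z) \<partial>(lborel \<Otimes>\<^sub>M lborel))"
    by (rule nn_integral_density) measurable
  also have "\<dots> = (\<integral>\<^sup>+y. \<integral>\<^sup>+r. indicator {-pi/2<..<pi/2} y * indicator {0<..} r * ennreal r * indicator A (of_real r * cis y) \<partial>lborel \<partial>lborel)"
    by (subst lborel.nn_integral_fst[symmetric]) (auto intro!: nn_integral_cong simp: indicator_def)
  also have "\<dots> = (\<integral>\<^sup>+w. indicator {w. Re w > 0} w * indicator A w \<partial>lborel)"
    by (subst nn_integral_half_plane_polar) auto
  also have "\<dots> = emeasure ?L A" by (simp add: emeasure_density)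
  finally show "emeasure ?L A = emeasure (distr ?D borel ?T) A" ..
qed simp

lemma lborel_distr_one_minus: "(lborel :: complex measure) = distr lborel borel (\<lambda>w. 1 - w)"
  using lborel_affine[of "-1" "1::complex"] by (simp add: density_1)

definition disc_kernel :: "complex \<Rightarrow> complex \<Rightarrow> real \<Rightarrow> complex \<Rightarrow> complex" where
  "disc_kernel p q b z = (1 - z) powr p * (1 - cnj z) powr q * of_real ((1 - (cmod z)\<^sup>2) powr (b - 1))"

lemma cnj_borel_measurable [measurable]: "cnj \<in> borel \<rightarrow>\<^sub>M borel"
  by (intro borel_measurable_continuous_onI continuous_intros)

lemma disc_kernel_measurable [measurable]: "disc_kernel p q b \<in> borel_measurable borel"
  unfolding disc_kernel_def[abs_def] by measurable

text \<open>With w = 1 - z = r cis y the disc is 0 < r < 2 cos y. Scaling r = 2 cos y * x gives 1 -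
  |z|^2 = (2 cos y)^2 x (1 - x), and the kernel becomes a function of y times a function of
  x.\<close>

lemma disc_kernel_integral:
  assumes b: "b > 0" and pq: "Re (p + q) + b + 1 > 0"
  shows "integrable lborel (\<lambda>z. indicator (ball 0 1) z *\<^sub>R disc_kernel p q b z)"
    and "(LINT z|lborel. indicator (ball 0 1) z *\<^sub>R disc_kernel p q b z) =
      of_real pi * Gamma (of_real b) * Gamma (p + q + of_real b + 1) * rGamma (of_real b + 1 + p) * rGamma (of_real b + 1 + q)"
proof -
  have cism [measurable]: "cis \<in> borel \<rightarrow>\<^sub>M borel"
    by (intro borel_measurable_continuous_onI continuous_intros)
  let ?I = "{-pi/2<..<pi/2}"
  let ?a = "p + q + 2 * of_real b"
  define f where "f = (\<lambda>z. indicator (ball 0 1) z *\<^sub>R disc_kernel p q b z)"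
  define g where "g = (\<lambda>w. f (1 - w))"
  define T where "T = (\<lambda>(y, r). of_real r * cis y)"
  define d where "d = (\<lambda>(y::real, r::real). indicator (?I \<times> {0<..}) (y, r) * r)"
  define K where "K = (\<lambda>z. d z *\<^sub>R g (T z))"
  define h where "h = (\<lambda>x. indicator {0<..<1} x *\<^sub>R (of_real x powr (p + q + of_real b + 1 - 1) * complex_of_real ((1 - x) powr (b - 1))))"
  define e where "e = (\<lambda>y. indicator ?I y *\<^sub>R (of_real (cos y) powr ?a * exp (\<i> * (p - q) * of_real y)))"
  have fm [measurable]: "f \<in> borel_measurable borel"
  proof -
    have [measurable]: "ball 0 1 \<in> sets (borel :: complex measure)" by simp
    show ?thesis unfolding f_def by measurable
  qed
  have gm [measurable]: "g \<in> borel_measurable borel" unfolding g_def by measurable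
  have Tm [measurable]: "T \<in> borel \<Otimes>\<^sub>M borel \<rightarrow>\<^sub>M borel" unfolding T_def by measurable
  have dm [measurable]: "d \<in> borel_measurable (borel \<Otimes>\<^sub>M borel)" unfolding d_def by measurable
  have Km [measurable]: "K \<in> borel_measurable (borel \<Otimes>\<^sub>M borel)" unfolding K_def by measurable
  have d0: "d z \<ge> 0" for z unfolding d_def by (auto simp: indicator_def split: prod.split)
  have pb: "Re (p + q + of_real b + 1) > 0" using pq by simp
  have hi: "integrable lborel h"
    using beta_integral_set_integrable[OF pb b] unfolding h_def set_integrable_def .
  have hint: "integral\<^sup>L lborel h = Beta (p + q + of_real b + 1) (of_real b)"
    using beta_integral_eq[OF pb b] unfolding h_def beta_integral_def set_lebesgue_integral_def .
  have ae: "Re ?a > -1" using pq b by simp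
  have ei: "integrable lborel e"
    using cauchy_cos_set_integrable[OF ae, of "p - q"] unfolding e_def set_integrable_def .
  have eint: "integral\<^sup>L lborel e = cauchy_cos_integral ?a (p - q)"
    unfolding e_def cauchy_cos_integral_def set_lebesgue_integral_def ..
  have supp: "Re w > 0" if "g w \<noteq> 0" for w
  proof -
    have "cmod (1 - w) < 1" using that by (auto simp: g_def f_def indicator_def split: if_splits)
    moreover have "Re (1 - w) \<le> cmod (1 - w)" by (rule complex_Re_le_cmod)
    ultimately show ?thesis by simp
  qed
  have g_half: "indicator {w. Re w > 0} w *\<^sub>R g w = g w" for w
    using supp[of w] by (cases "g w = 0") auto
  have D: "density lborel (\<lambda>w::complex. ennreal (indicator {w. Re w > 0} w)) = distr (density (lborel \<Otimes>\<^sub>M lborel) (\<lambda>z. ennreal (d z))) borel T"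
    using half_plane_polar unfolding T_def d_def by (simp add: case_prod_beta' ennreal_indicator)
  \<comment> \<open>\<open>e\<close> holds the dependence on y and \<open>h\<close> that on x. The
    factor 1 / (2 cos y) anticipates the Jacobian of r = 2 cos y * x and disappears when r is
    integrated.\<close>
  have KE: "K (y, 2 * cos y * x) = (2 powr ?a / (2 * of_real (cos y))) * e y * h x" if "cos y > 0" for x y
  proof (cases "y \<in> ?I \<and> 0 < x")
    case True
    define c where "c = cos y"
    have c: "c > 0" using that by (simp add: c_def)
    have r: "2 * c * x > 0" using c True by simp
    have nsq: "1 - (cmod (1 - of_real (2 * c * x) * cis y))\<^sup>2 = (2 * c)\<^sup>2 * x * (1 - x)"
    proof -
      have "1 - (cmod (1 - of_real (2 * c * x) * cis y))\<^sup>2 = 1 - ((1 - 2 * c * x * c)\<^sup>2 + (2 * c * x * sin y)\<^sup>2)"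
        unfolding cmod_power2 by (simp add: c_def)
      also have "\<dots> = (2 * c)\<^sup>2 * x - (2 * c)\<^sup>2 * x\<^sup>2 * ((sin y)\<^sup>2 + c\<^sup>2)"
        by (simp add: power2_eq_square algebra_simps)
      also have "(sin y)\<^sup>2 + c\<^sup>2 = 1" by (simp add: c_def)
      finally show ?thesis by (simp add: power2_eq_square algebra_simps)
    qed
    have inball: "1 - of_real (2 * c * x) * cis y \<in> ball 0 1 \<longleftrightarrow> x < 1"
    proof -
      have "1 - of_real (2 * c * x) * cis y \<in> ball 0 1 \<longleftrightarrow> 0 < 1 - (cmod (1 - of_real (2 * c * x) * cis y))\<^sup>2"
        using abs_square_less_1[of "cmod (1 - of_real (2 * c * x) * cis y)"] by (simp only: dist_norm mem_ball) (simp add: norm_minus_commute)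
      also have "\<dots> \<longleftrightarrow> x < 1"
      proof -
        have "(2 * c)\<^sup>2 * x > 0" using c True by simp
        from mult_less_cancel_left_pos[OF this, of 0 "1 - x"] show ?thesis unfolding nsq by simp
      qed
      finally show ?thesis .
    qed
    show ?thesis
    proof (cases "x < 1")
      case x1: True
      have "K (y, 2 * cos y * x) = of_real (2 * c * x) * ((of_real (2 * c * x) * cis y) powr p * cnj (of_real (2 * c * x) * cis y) powr q
         * of_real (((2 * c)\<^sup>2 * x * (1 - x)) powr (b - 1)))"
      proof -
        define z where "z = of_real (2 * c * x) * cis y"
        have "T (y, 2 * cos y * x) = z" by (simp add: T_def c_def z_def)
        moreover have "d (y, 2 * cos y * x) = 2 * c * x" using True r by (simp add: d_def c_def)
        moreover have "g z = z powr p * cnj z powr q * of_real ((1 - (cmod (1 - z))\<^sup>2) powr (b - 1))"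
          using inball x1 unfolding g_def f_def disc_kernel_def z_def[symmetric] by simp
        ultimately show ?thesis using nsq unfolding K_def scaleR_conv_of_real z_def[symmetric] by simp
      qed
      also have "\<dots> = of_real (2 * c * x) * (of_real (2 * c * x) powr (p + q) * exp (\<i> * (p - q) * of_real y)
         * of_real (((2 * c)\<^sup>2 * x * (1 - x)) powr (b - 1)))"
        using True r by (subst polar_powr_mult_cnj_powr) auto
      also have "of_real (2 * c * x) powr (p + q) = 2 powr (p + q) * of_real c powr (p + q) * of_real x powr (p + q)"
        using c True by (simp add: powr_times_real)
      also have "((2 * c)\<^sup>2 * x * (1 - x)) powr (b - 1) = 2 powr (2 * b - 2) * c powr (2 * b - 2) * x powr (b - 1) * (1 - x) powr (b - 1)"
      proof -
        have "(2 * c)\<^sup>2 = (2 * c) powr 2" using c by simp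
        hence "((2 * c)\<^sup>2) powr (b - 1) = (2 * c) powr (2 * (b - 1))" by (simp only: powr_powr)
        also have "\<dots> = 2 powr (2 * b - 2) * c powr (2 * b - 2)" using c by (simp add: powr_mult algebra_simps)
        finally show ?thesis using c True x1 by (simp add: powr_mult)
      qed
      also have "complex_of_real (2 powr (2 * b - 2) * c powr (2 * b - 2) * x powr (b - 1) * (1 - x) powr (b - 1))
         = 2 powr (2 * of_real b - 2) * of_real c powr (2 * of_real b - 2) * of_real x powr (of_real b - 1) * of_real ((1 - x) powr (b - 1))"
        using c True powr_of_real[of 2 "2 * b - 2"] powr_of_real[of c "2 * b - 2"] powr_of_real[of x "b - 1"] by simp
      also have "of_real (2 * c * x) * (2 powr (p + q) * of_real c powr (p + q) * of_real x powr (p + q) * exp (\<i> * (p - q) * of_real y)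
         * (2 powr (2 * of_real b - 2) * of_real c powr (2 * of_real b - 2) * of_real x powr (of_real b - 1) * of_real ((1 - x) powr (b - 1))))
        = (2 * (2 powr (p + q) * 2 powr (2 * of_real b - 2))) * (of_real c * (of_real c powr (p + q) * of_real c powr (2 * of_real b - 2)))
          * (of_real x * (of_real x powr (p + q) * of_real x powr (of_real b - 1))) * exp (\<i> * (p - q) * of_real y) * of_real ((1 - x) powr (b - 1))"
        by (simp add: mult_ac)
      also have "2 * (2 powr (p + q) * 2 powr (2 * of_real b - 2)) = 2 powr ?a / 2"
        by (simp add: powr_add[symmetric] powr_diff algebra_simps)
      also have "of_real c * (of_real c powr (p + q) * of_real c powr (2 * of_real b - 2)) = of_real c powr ?a / of_real c"
        using c by (simp add: powr_add powr_diff powr_numeral power2_eq_square)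
      also have "of_real x * (of_real x powr (p + q) * of_real x powr (of_real b - 1)) = of_real x powr (p + q + of_real b + 1 - 1)"
        using True by (simp add: powr_add powr_diff)
      finally show ?thesis using True x1 by (simp add: h_def e_def c_def mult_ac)
    next
      case False
      have "K (y, 2 * cos y * x) = 0" using False inball unfolding K_def T_def g_def f_def by (simp add: c_def)
      thus ?thesis using False by (simp add: h_def)
    qed
  next
    case False
    thus ?thesis using that by (auto simp: K_def d_def e_def h_def zero_less_mult_iff)
  qed
  have Kout: "K (y, r) = 0" if "y \<notin> ?I" for y r using that by (auto simp: K_def d_def indicator_def)
  have eout: "e y = 0" if "y \<notin> ?I" for y using that by (simp add: e_def)
  have cpos: "cos y > 0" if "y \<in> ?I" for y using that by (intro cos_gt_zero_pi) auto
  have Ki: "integrable lborel (\<lambda>r. K (y, r))" for y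
  proof (cases "y \<in> ?I")
    case True
    note c = cpos[OF True]
    have "integrable lborel (\<lambda>x. K (y, 0 + 2 * cos y * x))"
      unfolding add_0 KE[OF c] by (intro integrable_mult_right hi)
    thus ?thesis using c by (subst lborel_integrable_real_affine_iff[of "2 * cos y" _ 0, symmetric]) auto
  qed (simp add: Kout)
  have Kint: "(LINT r|lborel. K (y, r)) = 2 powr ?a * e y * integral\<^sup>L lborel h" for y
  proof (cases "y \<in> ?I")
    case True
    note c = cpos[OF True]
    have "(LINT r|lborel. K (y, r)) = \<bar>2 * cos y\<bar> *\<^sub>R (LINT x|lborel. K (y, 0 + 2 * cos y * x))"
      using c by (intro lborel_integral_real_affine) auto
    thus ?thesis using c unfolding add_0 KE[OF c] by (simp add: scaleR_conv_of_real)
  qed (simp add: Kout eout)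
  have Knorm: "(LINT r|lborel. norm (K (y, r))) = norm (2 powr ?a) * norm (e y) * (LINT x|lborel. norm (h x))" for y
  proof (cases "y \<in> ?I")
    case True
    note c = cpos[OF True]
    have "(LINT r|lborel. norm (K (y, r))) = \<bar>2 * cos y\<bar> *\<^sub>R (LINT x|lborel. norm (K (y, 0 + 2 * cos y * x)))"
      using c by (intro lborel_integral_real_affine) auto
    thus ?thesis using c unfolding add_0 KE[OF c] by (simp add: norm_mult norm_divide)
  qed (simp add: Kout eout)
  \<comment> \<open>The factorization holds for norms as well, which gives the absolute
    integrability required by Fubini.\<close>
  have Kpair: "integrable (lborel \<Otimes>\<^sub>M lborel) K"
  proof (rule lborel_pair.Fubini_integrable)
    show "K \<in> borel_measurable (lborel \<Otimes>\<^sub>M lborel)" by measurable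
    show "integrable lborel (\<lambda>y. LINT r|lborel. norm (K (y, r)))"
      unfolding Knorm by (intro integrable_mult_left integrable_mult_right integrable_norm ei)
    show "AE y in lborel. integrable lborel (\<lambda>r. K (y, r))" using Ki by simp
  qed
  have gi: "integrable lborel g \<and> integral\<^sup>L lborel g = (\<integral>z. K z \<partial>(lborel \<Otimes>\<^sub>M lborel))"
  proof -
    have "integrable (density lborel (\<lambda>w. ennreal (indicator {w. Re w > 0} w))) g"
      unfolding D using Kpair d0
      by (subst integrable_distr_eq; (subst integrable_density)?) (auto simp: K_def)
    moreover have "integral\<^sup>L (density lborel (\<lambda>w. ennreal (indicator {w. Re w > 0} w))) g = (\<integral>z. K z \<partial>(lborel \<Otimes>\<^sub>M lborel))"
      unfolding D using d0
      by (subst integral_distr; (subst integral_density)?) (auto simp: K_def)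
    ultimately show ?thesis
      by (subst (asm) integrable_density, simp, simp, simp, subst (asm) integral_density) (auto simp: g_half)
  qed
  have fi: "integrable lborel f \<and> integral\<^sup>L lborel f = integral\<^sup>L lborel g"
    using gi unfolding g_def by (subst (1 2) lborel_distr_one_minus) (auto simp: integrable_distr_eq integral_distr)
  show "integrable lborel (\<lambda>z. indicator (ball 0 1) z *\<^sub>R disc_kernel p q b z)"
    using fi unfolding f_def by simp
  have "(LINT z|lborel. indicator (ball 0 1) z *\<^sub>R disc_kernel p q b z) = (\<integral>z. K z \<partial>(lborel \<Otimes>\<^sub>M lborel))"
    using fi gi unfolding f_def by simp
  also have "\<dots> = (LINT y|lborel. LINT r|lborel. K (y, r))" by (rule lborel_pair.integral_fst'[OF Kpair, symmetric])
  also have "\<dots> = 2 powr ?a * cauchy_cos_integral ?a (p - q) * Beta (p + q + of_real b + 1) (of_real b)"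
    unfolding Kint hint by (simp add: eint)
  also have "\<dots> = of_real pi * Gamma (?a + 1) * rGamma (1 + (?a + (p - q)) / 2) * rGamma (1 + (?a - (p - q)) / 2) * Beta (p + q + of_real b + 1) (of_real b)"
  proof -
    have "2 powr z * 2 powr (- z) = 1" for z :: complex by (simp add: powr_minus)
    hence e: "2 powr ?a * 2 powr (- ?a) = 1" by blast
    have "2 powr ?a * (of_real pi * 2 powr (- ?a) * G * r1 * r2) * B = (2 powr ?a * 2 powr (- ?a)) * (of_real pi * G * r1 * r2 * B)"
      for G r1 r2 B by (simp only: mult_ac)
    thus ?thesis unfolding cauchy_cos_integral_eq[OF ae] e by simp
  qed
  also have "1 + (?a + (p - q)) / 2 = of_real b + 1 + p" by (simp add: field_simps)
  also have "1 + (?a - (p - q)) / 2 = of_real b + 1 + q" by (simp add: field_simps)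
  \<comment> \<open>The second parameters add up to \<open>?a + 1\<close>, so the denominator of
    Beta cancels the \<open>Gamma (?a + 1)\<close> of the cosine integral.\<close>
  also have "Beta (p + q + of_real b + 1) (of_real b) = Gamma (p + q + of_real b + 1) * Gamma (of_real b) * rGamma (?a + 1)"
    unfolding Beta_altdef by (simp add: algebra_simps)
  also have "of_real pi * Gamma (?a + 1) * rGamma (of_real b + 1 + p) * rGamma (of_real b + 1 + q) * (Gamma (p + q + of_real b + 1) * Gamma (of_real b) * rGamma (?a + 1))
    = (Gamma (?a + 1) * rGamma (?a + 1)) * (of_real pi * Gamma (of_real b) * Gamma (p + q + of_real b + 1) * rGamma (of_real b + 1 + p) * rGamma (of_real b + 1 + q))"
    by (simp add: mult_ac)
  also have "Gamma (?a + 1) * rGamma (?a + 1) = 1"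
  proof -
    have "?a + 1 \<notin> \<int>\<^sub>\<le>\<^sub>0" using ae by (auto elim!: nonpos_Ints_cases simp: complex_eq_iff)
    thus ?thesis by (simp add: rGamma_inverse_Gamma Gamma_eq_zero_iff)
  qed
  finally show "(LINT z|lborel. indicator (ball 0 1) z *\<^sub>R disc_kernel p q b z) =
      of_real pi * Gamma (of_real b) * Gamma (p + q + of_real b + 1) * rGamma (of_real b + 1 + p) * rGamma (of_real b + 1 + q)"
    by simp
qed

subsection \<open>The uniform measure on the circle\<close>

text \<open>Cut at 1 - t and move the second piece back by one period.\<close>

lemma nn_integral_unit_interval_shift:
  fixes g :: "real \<Rightarrow> ennreal"
  assumes [measurable]: "g \<in> borel_measurable borel" and per: "\<And>x. g (x + 1) = g x" and t: "0 \<le> t" "t \<le> 1"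
  shows "(\<integral>\<^sup>+x. indicator {0..<1} x * g (x + t) \<partial>lborel) = (\<integral>\<^sup>+x. indicator {0..<1} x * g x \<partial>lborel)"
proof -
  have sh: "(\<integral>\<^sup>+x. f x \<partial>lborel) = (\<integral>\<^sup>+x. f (x + c) \<partial>lborel)" if [measurable]: "f \<in> borel_measurable borel" for f :: "real \<Rightarrow> ennreal" and c
    using nn_integral_real_affine[OF that, of 1 c] by (simp add: add.commute)
  have "(\<integral>\<^sup>+x. indicator {0..<1} x * g (x + t) \<partial>lborel) =
      (\<integral>\<^sup>+x. indicator {0..<1-t} x * g (x + t) + indicator {1-t..<1} x * g (x + t) \<partial>lborel)"
    using t by (intro nn_integral_cong) (auto simp: indicator_def)
  also have "\<dots> = (\<integral>\<^sup>+x. indicator {0..<1-t} x * g (x + t) \<partial>lborel) + (\<integral>\<^sup>+x. indicator {1-t..<1} x * g (x + t) \<partial>lborel)"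
    by (rule nn_integral_add) measurable
  also have "(\<integral>\<^sup>+x. indicator {0..<1-t} x * g (x + t) \<partial>lborel) = (\<integral>\<^sup>+x. indicator {t..<1} x * g x \<partial>lborel)"
    by (subst sh[of "\<lambda>x. indicator {t..<1} x * g x" t]) (auto intro!: nn_integral_cong simp: indicator_def)
  also have "(\<integral>\<^sup>+x. indicator {1-t..<1} x * g (x + t) \<partial>lborel) = (\<integral>\<^sup>+x. indicator {0..<t} x * g x \<partial>lborel)"
  proof -
    have "(\<integral>\<^sup>+x. indicator {0..<t} x * g x \<partial>lborel) = (\<integral>\<^sup>+x. indicator {0..<t} (x + (t - 1)) * g (x + (t - 1)) \<partial>lborel)"
      by (rule sh) measurable
    also have "\<dots> = (\<integral>\<^sup>+x. indicator {1-t..<1} x * g (x + t) \<partial>lborel)"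
    proof (rule nn_integral_cong)
      fix x
      have "g (x + (t - 1)) = g (x + t)" using per[of "x + (t - 1)"] by (simp add: add.assoc)
      moreover have "x + (t - 1) \<in> {0..<t} \<longleftrightarrow> x \<in> {1-t..<1}" by auto
      ultimately show "indicator {0..<t} (x + (t - 1)) * g (x + (t - 1)) = indicator {1-t..<1} x * g (x + t)"
        by (simp add: indicator_def)
    qed
    finally show ?thesis ..
  qed
  also have "(\<integral>\<^sup>+x. indicator {t..<1} x * g x \<partial>lborel) + (\<integral>\<^sup>+x. indicator {0..<t} x * g x \<partial>lborel) = (\<integral>\<^sup>+x. indicator {t..<1} x * g x + indicator {0..<t} x * g x \<partial>lborel)"
    by (rule nn_integral_add[symmetric]) measurable
  also have "\<dots> = (\<integral>\<^sup>+x. indicator {0..<1} x * g x \<partial>lborel)"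
    using t by (intro nn_integral_cong) (auto simp: indicator_def)
  finally show ?thesis .
qed

lemma cis_borel_measurable [measurable]: "cis \<in> borel \<rightarrow>\<^sub>M borel"
  by (intro borel_measurable_continuous_onI continuous_intros)

lemma uniform_circle_altdef:
  "uniform_circle = distr (density lborel (indicator {0..1})) borel (\<lambda>x. cis (2 * pi * x))"
  unfolding uniform_circle_def uniform_measure_def by (simp add: divide_ennreal_def)

lemma sets_uniform_circle [measurable_cong, simp]: "sets uniform_circle = sets borel"
  by (simp add: uniform_circle_altdef)

lemma space_uniform_circle [simp]: "space uniform_circle = UNIV"
  by (simp add: uniform_circle_altdef)

lemma nn_integral_uniform_circle:
  assumes [measurable]: "f \<in> borel_measurable borel"
  shows "(\<integral>\<^sup>+z. f z \<partial>uniform_circle) = (\<integral>\<^sup>+x. indicator {0..<1} x * f (cis (2 * pi * x)) \<partial>lborel)"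
proof -
  have "(\<integral>\<^sup>+z. f z \<partial>uniform_circle) = (\<integral>\<^sup>+x. indicator {0..1} x * f (cis (2 * pi * x)) \<partial>lborel)"
    unfolding uniform_circle_altdef by (subst nn_integral_distr; (subst nn_integral_density)?) auto
  also have "\<dots> = (\<integral>\<^sup>+x. indicator {0..<1} x * f (cis (2 * pi * x)) \<partial>lborel)"
    using AE_lborel_singleton[of "1::real"] by (intro nn_integral_cong_AE) (auto elim!: eventually_mono simp: indicator_def)
  finally show ?thesis .
qed

lemma AE_uniform_circle_sphere: "AE z in uniform_circle. z \<in> sphere 0 1"
  unfolding uniform_circle_altdef by (subst AE_distr_iff) auto

lemma AE_uniform_circle_neq: "AE z in uniform_circle. z \<noteq> 1"
proof -
  have "AE x in lborel. x \<noteq> 0 \<and> x \<noteq> (1::real)"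
    using AE_lborel_singleton[of "0::real"] AE_lborel_singleton[of "1::real"] by eventually_elim auto
  hence "AE x in lborel. 0 < (indicator {0..1} x :: ennreal) \<longrightarrow> cis (2 * pi * x) \<noteq> 1"
  proof eventually_elim
    case (elim x)
    have "x \<in> {0<..<1}" if "x \<in> {0..1}" using that elim by auto
    moreover have "cis (2 * pi * x) \<noteq> 1" if "x \<in> {0<..<1}"
    proof
      assume "cis (2 * pi * x) = 1"
      hence "cos (2 * pi * x) = 1" by (metis cis.sel(1) one_complex.sel(1))
      then obtain k :: int where "2 * pi * x = of_int k * 2 * pi" using cos_one_2pi_int by (auto simp: mult_ac)
      hence "x = of_int k" by simp
      thus False using that by auto
    qed
    ultimately show ?case by (cases "x \<in> {0..1}") simp_all
  qed
  thus ?thesis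
    unfolding uniform_circle_altdef by (subst AE_distr_iff; (subst AE_density)?) auto
qed

text \<open>For fixed earlier coefficients, alpha_k goes to gamma_k by exactly such a map, a
  conjugation followed by a rotation. On the angle it is x to t - x modulo 1.\<close>

lemma nn_integral_uniform_circle_reflect_rotate:
  assumes f [measurable]: "f \<in> borel_measurable borel" and u: "cmod u = 1"
  shows "(\<integral>\<^sup>+z. f (cnj z * u) \<partial>uniform_circle) = (\<integral>\<^sup>+z. f z \<partial>uniform_circle)"
proof -
  obtain \<theta> where th: "0 \<le> \<theta>" "\<theta> < 2 * pi" "u = cis \<theta>"
    using Arg2pi_eq[of u] Arg2pi_ge_0[of u] Arg2pi_lt_2pi[of u] u by (auto simp: cis_conv_exp mult.commute)
  define t where "t = \<theta> / (2 * pi)"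
  have t: "0 \<le> t" "t \<le> 1" "u = cis (2 * pi * t)" using th by (auto simp: t_def field_simps)
  have per: "cis (2 * pi * (x + 1)) = cis (2 * pi * x)" for x
    by (simp add: distrib_left cis_mult[symmetric])
  define g where "g = (\<lambda>x. f (cis (2 * pi * x)))"
  have [measurable]: "g \<in> borel_measurable borel" unfolding g_def by measurable
  have gper: "g (x + 1) = g x" for x by (simp only: g_def per)
  have "(\<integral>\<^sup>+z. f (cnj z * u) \<partial>uniform_circle) = (\<integral>\<^sup>+x. indicator {0..<1} x * f (cnj (cis (2 * pi * x)) * u) \<partial>lborel)"
    by (rule nn_integral_uniform_circle) measurable
  also have "\<dots> = (\<integral>\<^sup>+x. indicator {0..<1} x * g (t - x) \<partial>lborel)"
    by (simp add: t(3) g_def cis_cnj cis_mult algebra_simps)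
  also have "\<dots> = (\<integral>\<^sup>+x. indicator {0..<1} (1 - x) * g (t - (1 - x)) \<partial>lborel)"
    by (subst nn_integral_real_affine[of _ "-1" 1]) auto
  also have "\<dots> = (\<integral>\<^sup>+x. indicator {0..<1} x * g (x + t) \<partial>lborel)"
  proof (rule nn_integral_cong_AE)
    have "AE x in lborel. x \<noteq> 0 \<and> x \<noteq> (1::real)"
      using AE_lborel_singleton[of "0::real"] AE_lborel_singleton[of "1::real"] by eventually_elim auto
    thus "AE x in lborel. indicator {0..<1} (1 - x) * g (t - (1 - x)) = indicator {0..<1} x * g (x + t)"
    proof eventually_elim
      case (elim x)
      have "g (t - (1 - x)) = g (x + t)" using gper[of "t - (1 - x)"] by (simp add: algebra_simps)
      thus ?case using elim by (auto simp: indicator_def)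
    qed
  qed
  also have "\<dots> = (\<integral>\<^sup>+x. indicator {0..<1} x * g x \<partial>lborel)"
    by (rule nn_integral_unit_interval_shift) (use gper t in auto)
  also have "\<dots> = (\<integral>\<^sup>+z. f z \<partial>uniform_circle)"
    by (subst nn_integral_uniform_circle) (auto simp: g_def)
  finally show ?thesis .
qed

text \<open>With x = 1/2 + y / pi one has 1 - cis (2 pi x) = 2 cos y cis y, so the cosine integral
  alone remains. The value is the disc formula times b / pi, taken at b = 0.\<close>

lemma circle_kernel_integral:
  assumes pq: "Re (p + q) > -1"
  shows "integrable uniform_circle (\<lambda>z. (1 - z) powr p * (1 - cnj z) powr q)"
    and "(LINT z|uniform_circle. (1 - z) powr p * (1 - cnj z) powr q) = Gamma (p + q + 1) * rGamma (1 + p) * rGamma (1 + q)"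
proof -
  let ?I = "{-pi/2<..<pi/2}"
  define f where "f = (\<lambda>z. (1 - z) powr p * (1 - cnj z) powr q)"
  have [measurable]: "f \<in> borel_measurable borel" unfolding f_def by measurable
  define K where "K = (\<lambda>x. indicator {0<..<1} x *\<^sub>R f (cis (2 * pi * x)))"
  define e where "e = (\<lambda>y. indicator ?I y *\<^sub>R (of_real (cos y) powr (p + q) * exp (\<i> * (p - q) * of_real y)))"
  have ei: "integrable lborel e"
    using cauchy_cos_set_integrable[OF pq, of "p - q"] unfolding e_def set_integrable_def .
  have eint: "integral\<^sup>L lborel e = cauchy_cos_integral (p + q) (p - q)"
    unfolding e_def cauchy_cos_integral_def set_lebesgue_integral_def ..
  have KE: "K (1/2 + (1 / pi) * y) = 2 powr (p + q) * e y" for y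
  proof (cases "y \<in> ?I")
    case True
    have c: "cos y > 0" using True by (intro cos_gt_zero_pi) auto
    have "1/2 + (1 / pi) * y \<in> {0<..<1}" using True by (auto simp: field_simps)
    moreover have "1 - cis (2 * pi * (1/2 + (1 / pi) * y)) = of_real (2 * cos y) * cis y"
      using cos_double_cos[of y] sin_double[of y]
      by (simp add: complex_eq_iff algebra_simps power2_eq_square)
    moreover have "f (cis (2 * pi * (1/2 + (1 / pi) * y))) = (1 - cis (2 * pi * (1/2 + (1 / pi) * y))) powr p *
        cnj (1 - cis (2 * pi * (1/2 + (1 / pi) * y))) powr q"
      unfolding f_def complex_cnj_diff complex_cnj_one ..
    ultimately have "K (1/2 + (1 / pi) * y) = (of_real (2 * cos y) * cis y) powr p * cnj (of_real (2 * cos y) * cis y) powr q"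
      unfolding K_def by (simp only: indicator_simps scaleR_one)
    also have "\<dots> = of_real (2 * cos y) powr (p + q) * exp (\<i> * (p - q) * of_real y)"
      using True c by (intro polar_powr_mult_cnj_powr) auto
    also have "of_real (2 * cos y) powr (p + q) = 2 powr (p + q) * of_real (cos y) powr (p + q)"
      using c by (simp add: powr_times_real)
    finally show ?thesis using True by (simp add: e_def)
  next
    case False
    hence "1/2 + (1 / pi) * y \<notin> {0<..<1}" by (auto simp: field_simps)
    thus ?thesis using False by (simp add: K_def e_def)
  qed
  have Ki: "integrable lborel K"
    by (subst lborel_integrable_real_affine_iff[of "1/pi" _ "1/2", symmetric])
       (auto simp only: KE intro!: integrable_mult_right ei, simp)
  have Kint: "integral\<^sup>L lborel K = (1 / of_real pi) * 2 powr (p + q) * cauchy_cos_integral (p + q) (p - q)"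
    using lborel_integral_real_affine[of "1/pi" K "1/2"] unfolding KE by (simp add: eint scaleR_conv_of_real)
  have [measurable]: "K \<in> borel_measurable borel" unfolding K_def by measurable
  have ae: "AE x in lborel. indicator {0..1} x *\<^sub>R f (cis (2 * pi * x)) = K x"
    using AE_lborel_singleton[of "0::real"] AE_lborel_singleton[of "1::real"]
    by eventually_elim (auto simp: K_def indicator_def)
  have i1: "integrable lborel (\<lambda>x. indicator {0..1} x *\<^sub>R f (cis (2 * pi * x)))"
    using Ki by (subst integrable_cong_AE[OF _ _ ae]) auto
  have i2: "(LINT x|lborel. indicator {0..1} x *\<^sub>R f (cis (2 * pi * x))) = integral\<^sup>L lborel K"
    by (intro integral_cong_AE ae) auto
  have dn: "density lborel (indicator {0..1::real}) = density lborel (\<lambda>x. ennreal (indicator {0..1} x))"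
    by (simp add: ennreal_indicator)
  show "integrable uniform_circle (\<lambda>z. (1 - z) powr p * (1 - cnj z) powr q)"
    unfolding f_def[symmetric] uniform_circle_altdef dn using i1
    by (subst integrable_distr_eq; (subst integrable_density)?) auto
  have "(LINT z|uniform_circle. f z) = integral\<^sup>L lborel K"
    unfolding uniform_circle_altdef dn i2[symmetric]
    by (subst integral_distr; (subst integral_density)?) auto
  also have "\<dots> = (2 powr (p + q) * 2 powr (- (p + q))) * (Gamma (p + q + 1) * rGamma (1 + (p + q + (p - q)) / 2) * rGamma (1 + (p + q - (p - q)) / 2))"
    unfolding Kint cauchy_cos_integral_eq[OF pq] by (simp add: field_simps)
  also have "2 powr (p + q) * 2 powr (- (p + q)) = (1::complex)" by (simp only: powr_minus) simp
  finally show "(LINT z|uniform_circle. (1 - z) powr p * (1 - cnj z) powr q) = Gamma (p + q + 1) * rGamma (1 + p) * rGamma (1 + q)"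
    unfolding f_def by simp
qed

text \<open>A rotation is a product of three shears, and a shear is a translation on each line
  parallel to an axis, hence preserves Lebesgue measure by Fubini.\<close>

lemma nn_integral_lborel_rotate:
  assumes f [measurable]: "f \<in> borel_measurable borel" and u: "cmod u = 1"
  shows "(\<integral>\<^sup>+z. f (z * u) \<partial>lborel) = (\<integral>\<^sup>+z. f z \<partial>lborel)"
proof -
  define S1 where "S1 = (\<lambda>t z. Complex (Re z + t * Im z) (Im z))"
  define S2 where "S2 = (\<lambda>t z. Complex (Re z) (Im z + t * Re z))"
  have [measurable]: "S1 t \<in> borel \<rightarrow>\<^sub>M borel" "S2 t \<in> borel \<rightarrow>\<^sub>M borel" for t
    unfolding S1_def S2_def Complex_eq by measurable
  have mC [measurable]: "(\<lambda>x. Complex x y) \<in> borel \<rightarrow>\<^sub>M borel" "Complex x \<in> borel \<rightarrow>\<^sub>M borel" for x y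
    unfolding Complex_eq by measurable
  have fubini: "(\<integral>\<^sup>+z. g z \<partial>lborel) = (\<integral>\<^sup>+y. \<integral>\<^sup>+x. g (Complex x y) \<partial>lborel \<partial>lborel)"
    if [measurable]: "g \<in> borel_measurable borel" for g
    by (subst nn_integral_lborel_complex[OF that], rule lborel_pair.Fubini') measurable
  have s1: "(\<integral>\<^sup>+z. g (S1 t z) \<partial>lborel) = (\<integral>\<^sup>+z. g z \<partial>lborel)" if [measurable]: "g \<in> borel_measurable borel" for g t
  proof -
    have "(\<integral>\<^sup>+z. g (S1 t z) \<partial>lborel) = (\<integral>\<^sup>+y. \<integral>\<^sup>+x. g (Complex (t * y + 1 * x) y) \<partial>lborel \<partial>lborel)"
      by (subst fubini) (auto simp: S1_def add.commute)
    also have "\<dots> = (\<integral>\<^sup>+y. \<integral>\<^sup>+x. g (Complex x y) \<partial>lborel \<partial>lborel)"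
      by (rule nn_integral_cong, subst (2) nn_integral_real_affine[where c = 1]) auto
    finally show ?thesis by (simp add: fubini)
  qed
  have s2: "(\<integral>\<^sup>+z. g (S2 t z) \<partial>lborel) = (\<integral>\<^sup>+z. g z \<partial>lborel)" if [measurable]: "g \<in> borel_measurable borel" for g t
  proof -
    have "(\<integral>\<^sup>+z. g (S2 t z) \<partial>lborel) = (\<integral>\<^sup>+x. \<integral>\<^sup>+y. g (Complex x (t * x + 1 * y)) \<partial>lborel \<partial>lborel)"
      by (subst nn_integral_lborel_complex) (auto simp: S2_def add.commute)
    also have "\<dots> = (\<integral>\<^sup>+x. \<integral>\<^sup>+y. g (Complex x y) \<partial>lborel \<partial>lborel)"
      by (rule nn_integral_cong, subst (2) nn_integral_real_affine[where c = 1]) auto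
    finally show ?thesis by (simp add: nn_integral_lborel_complex)
  qed
  have uu: "(Re u)\<^sup>2 + (Im u)\<^sup>2 = 1" using u cmod_power2[of u] by simp
  show ?thesis
  proof (cases "Im u = 0")
    case False
    \<comment> \<open>For u = cis a this is - tan (a / 2), the coefficient of the outer shears. It
      requires a nonzero imaginary part, which is why u = 1 and u = -1 are treated apart.\<close>
    define t where "t = (Re u - 1) / Im u"
    have "f (z * u) = f (S1 t (S2 (Im u) (S1 t z)))" for z
    proof -
      have ts: "t * Im u = Re u - 1" using False by (simp add: t_def)
      have tc: "t * (1 + Re u) = - Im u"
      proof -
        have "t * (1 + Re u) * Im u = - Im u * Im u"
        proof -
          have "t * (1 + Re u) * Im u = (t * Im u) * (1 + Re u)" by simp
          also have "\<dots> = (Re u)\<^sup>2 - 1" unfolding ts by (simp add: algebra_simps power2_eq_square)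
          also have "\<dots> = - Im u * Im u" using uu by (simp add: power2_eq_square)
          finally show ?thesis .
        qed
        hence "t * (1 + Re u) * Im u = (- Im u) * Im u" by simp
        thus ?thesis using False by (metis mult_cancel_right)
      qed
      have "S1 t (S2 (Im u) (S1 t z)) = z * u"
      proof -
        have "Re z + t * Im z + t * (Im z + Im u * (Re z + t * Im z))
          = Re z + (t * Im u) * Re z + (t + (t * Im u) * t + t) * Im z" by (simp add: algebra_simps)
        also have "\<dots> = Re z * Re u + (t * (1 + Re u)) * Im z" unfolding ts by (simp add: algebra_simps)
        finally have 1: "Re z + t * Im z + t * (Im z + Im u * (Re z + t * Im z)) = Re z * Re u - Im u * Im z"
          unfolding tc by simp
        have "Im z + Im u * (Re z + t * Im z) = Im z + Im u * Re z + (t * Im u) * Im z" by (simp add: algebra_simps)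
        also have "\<dots> = Re z * Im u + Im z * Re u" unfolding ts by (simp add: algebra_simps)
        finally have 2: "Im z + Im u * (Re z + t * Im z) = Re z * Im u + Im z * Re u" .
        show ?thesis unfolding S1_def S2_def using 1 2 by (simp add: complex_eq_iff mult.commute)
      qed
      thus ?thesis by simp
    qed
    hence "(\<integral>\<^sup>+z. f (z * u) \<partial>lborel) = (\<integral>\<^sup>+z. f (S1 t (S2 (Im u) (S1 t z))) \<partial>lborel)" by simp
    also have "\<dots> = (\<integral>\<^sup>+z. f (S1 t (S2 (Im u) z)) \<partial>lborel)" by (rule s1) measurable
    also have "\<dots> = (\<integral>\<^sup>+z. f (S1 t z) \<partial>lborel)" by (rule s2) measurable
    also have "\<dots> = (\<integral>\<^sup>+z. f z \<partial>lborel)" by (rule s1) measurable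
    finally show ?thesis .
  next
    case True
    hence "Re u = 1 \<or> Re u = -1" using uu by (simp add: power2_eq_1_iff)
    hence "u = 1 \<or> u = -1" using True by (auto simp: complex_eq_iff)
    thus ?thesis
    proof
      assume "u = -1"
      have "(lborel :: complex measure) = distr lborel borel uminus"
        using lborel_affine[of "-1" "0::complex"] by (simp add: density_1)
      hence "(\<integral>\<^sup>+z. f z \<partial>lborel) = (\<integral>\<^sup>+z. f z \<partial>distr lborel borel uminus)" by simp
      thus ?thesis using \<open>u = -1\<close> by (subst (asm) nn_integral_distr) auto
    qed auto
  qed
qed

lemma nn_integral_lborel_cnj:
  assumes f [measurable]: "f \<in> borel_measurable borel"
  shows "(\<integral>\<^sup>+z. f (cnj z) \<partial>lborel) = (\<integral>\<^sup>+z. f z \<partial>lborel)"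
proof -
  have mC [measurable]: "Complex x \<in> borel \<rightarrow>\<^sub>M borel" for x
    unfolding Complex_eq by measurable
  have "(\<integral>\<^sup>+z. f (cnj z) \<partial>lborel) = (\<integral>\<^sup>+x. \<integral>\<^sup>+y. f (Complex x (0 + -1 * y)) \<partial>lborel \<partial>lborel)"
    by (subst nn_integral_lborel_complex) (auto simp: complex_cnj)
  also have "\<dots> = (\<integral>\<^sup>+x. \<integral>\<^sup>+y. f (Complex x y) \<partial>lborel \<partial>lborel)"
    by (rule nn_integral_cong, subst (2) nn_integral_real_affine[where c = "-1" and t = 0]) auto
  finally show ?thesis by (simp add: nn_integral_lborel_complex)
qed

subsection \<open>The Szego recursion\<close>

definition discrete_measure :: "complex set \<Rightarrow> (complex \<Rightarrow> real) \<Rightarrow> complex measure" where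
  "discrete_measure S w = distr (point_measure S (\<lambda>a. ennreal (w a))) borel (\<lambda>z. z)"

lemma sets_discrete_measure [simp, measurable_cong]: "sets (discrete_measure S w) = sets borel"
  by (simp add: discrete_measure_def)

lemma space_discrete_measure [simp]: "space (discrete_measure S w) = UNIV"
  by (simp add: discrete_measure_def)

context
  fixes S :: "complex set" and w :: "complex \<Rightarrow> real"
  assumes fin: "finite S" and w0: "\<And>a. a \<in> S \<Longrightarrow> 0 \<le> w a"
begin

lemma emeasure_discrete_measure:
  assumes "A \<in> sets borel"
  shows "emeasure (discrete_measure S w) A = ennreal (\<Sum>a\<in>S \<inter> A. w a)"
proof -
  have "emeasure (discrete_measure S w) A = emeasure (point_measure S (\<lambda>a. ennreal (w a))) (A \<inter> S)"
    unfolding discrete_measure_def using assms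
    by (subst emeasure_distr) (auto simp: space_point_measure measurable_point_measure_eq1)
  also have "\<dots> = (\<Sum>a\<in>A \<inter> S. ennreal (w a))"
    using fin by (intro emeasure_point_measure_finite) auto
  also have "\<dots> = ennreal (\<Sum>a\<in>A \<inter> S. w a)" by (rule sum_ennreal) (use w0 in auto)
  finally show ?thesis by (simp add: Int_commute)
qed

lemma measure_discrete_measure:
  assumes "A \<in> sets borel"
  shows "measure (discrete_measure S w) A = (\<Sum>a\<in>S \<inter> A. w a)"
  unfolding measure_def emeasure_discrete_measure[OF assms] using w0 sum_nonneg[of "S \<inter> A" w] by simp

lemma AE_discrete_measure: "AE z in discrete_measure S w. z \<in> S"
proof (rule AE_I[where N = "- S"])
  have "- S \<in> sets borel" using fin by (intro borel_comp) (auto simp: finite_imp_closed)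
  thus "emeasure (discrete_measure S w) (- S) = 0" "- S \<in> sets (discrete_measure S w)"
    by (auto simp: emeasure_discrete_measure)
qed auto

lemma integral_discrete_measure:
  fixes g :: "complex \<Rightarrow> 'b :: {banach, second_countable_topology}"
  assumes "g \<in> borel_measurable borel"
  shows "(\<integral>z. g z \<partial>discrete_measure S w) = (\<Sum>a\<in>S. w a *\<^sub>R g a)"
  unfolding discrete_measure_def using assms fin w0
  by (subst integral_distr) (auto simp: measurable_point_measure_eq1 lebesgue_integral_point_measure_finite)

lemma prob_space_discrete_measure: "sum w S = 1 \<Longrightarrow> prob_space (discrete_measure S w)"
  by (rule prob_spaceI) (simp add: emeasure_discrete_measure)

lemma circle_prob_discrete_measure:
  assumes "sum w S = 1" "S \<subseteq> sphere 0 1"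
  shows "circle_prob (discrete_measure S w)"
  unfolding circle_prob_def using prob_space_discrete_measure[OF assms(1)] AE_discrete_measure assms(2)
  by (auto elim!: eventually_mono)

lemma atoms_discrete_measure: "atoms (discrete_measure S w) = {a\<in>S. w a > 0}"
proof -
  have "measure (discrete_measure S w) {z} = (if z \<in> S then w z else 0)" for z
    by (subst measure_discrete_measure) auto
  thus ?thesis unfolding atoms_def by (auto split: if_splits)
qed

lemma supported_at_discrete_measure:
  assumes "sum w S = 1" "S \<subseteq> sphere 0 1"
  shows "supported_at (card {a\<in>S. w a > 0}) (discrete_measure S w)"
proof -
  let ?P = "{a\<in>S. w a > 0}"
  have "AE z in discrete_measure S w. z \<in> ?P"
  proof (rule AE_I[where N = "- ?P"])
    have "- ?P \<in> sets borel" using fin by (intro borel_comp) (auto simp: finite_imp_closed)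
    moreover have "sum w (S \<inter> - ?P) = 0" by (rule sum.neutral) (use w0 in \<open>auto simp: not_less intro: antisym\<close>)
    ultimately show "emeasure (discrete_measure S w) (- ?P) = 0" "- ?P \<in> sets (discrete_measure S w)"
      by (auto simp: emeasure_discrete_measure)
  qed auto
  thus ?thesis
    unfolding supported_at_def atoms_discrete_measure using fin circle_prob_discrete_measure[OF assms] by auto
qed

end

lemma finite_support_eq_discrete_measure:
  assumes ps: "prob_space \<mu>" and st: "sets \<mu> = sets borel" and fin: "finite S" and ae: "AE z in \<mu>. z \<in> S"
  shows "\<mu> = discrete_measure S (\<lambda>a. measure \<mu> {a})" and "(\<Sum>a\<in>S. measure \<mu> {a}) = 1"
proof -
  interpret prob_space \<mu> by fact
  have eq: "emeasure \<mu> A = ennreal (\<Sum>a\<in>S \<inter> A. measure \<mu> {a})" if "A \<in> sets borel" for A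
  proof -
    have fs: "S \<inter> A \<in> sets \<mu>" using fin by (simp add: st finite_imp_closed)
    have "emeasure \<mu> A = emeasure \<mu> (S \<inter> A)"
      using ae by (intro emeasure_eq_AE) (use that fs in \<open>auto simp: st\<close>)
    also have "\<dots> = ennreal (measure \<mu> (S \<inter> A))" by (rule emeasure_eq_measure)
    also have "measure \<mu> (S \<inter> A) = (\<Sum>a\<in>S \<inter> A. measure \<mu> {a})"
      by (rule finite_measure_eq_sum_singleton) (use fin in \<open>auto simp: st\<close>)
    finally show ?thesis .
  qed
  show "\<mu> = discrete_measure S (\<lambda>a. measure \<mu> {a})"
    by (rule measure_eqI) (use eq in \<open>auto simp: st emeasure_discrete_measure[OF fin]\<close>)
  have "space \<mu> = UNIV" using sets_eq_imp_space_eq[OF st] by simp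
  thus "(\<Sum>a\<in>S. measure \<mu> {a}) = 1" using eq[of UNIV] emeasure_space_1 by simp
qed

lemma poly_borel_measurable [measurable]: "poly (p :: complex poly) \<in> borel \<rightarrow>\<^sub>M borel"
  by (intro borel_measurable_continuous_onI continuous_intros)

lemma integral_supported_at:
  fixes g :: "complex \<Rightarrow> complex"
  assumes "supported_at m \<mu>" "g \<in> borel_measurable borel"
  shows "(\<integral>z. g z \<partial>\<mu>) = (\<Sum>a\<in>atoms \<mu>. of_real (measure \<mu> {a}) * g a)"
proof -
  have "\<mu> = discrete_measure (atoms \<mu>) (\<lambda>a. measure \<mu> {a})"
    by (rule finite_support_eq_discrete_measure) (use assms(1) in \<open>auto simp: supported_at_def circle_prob_def\<close>)
  hence "(\<integral>z. g z \<partial>\<mu>) = (\<integral>z. g z \<partial>discrete_measure (atoms \<mu>) (\<lambda>a. measure \<mu> {a}))"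
    by (rule arg_cong[where f = "\<lambda>M. integral\<^sup>L M g"])
  also have "\<dots> = (\<Sum>a\<in>atoms \<mu>. of_real (measure \<mu> {a}) * g a)"
    by (subst integral_discrete_measure) (use assms in \<open>auto simp: supported_at_def scaleR_conv_of_real\<close>)
  finally show ?thesis .
qed

lemma L2_inner_supported_at:
  assumes "supported_at m \<mu>"
  shows "L2_inner \<mu> p q = (\<Sum>a\<in>atoms \<mu>. of_real (measure \<mu> {a}) * (cnj (poly p a) * poly q a))"
  unfolding L2_inner_def by (rule integral_supported_at[OF assms]) measurable

lemma atoms_on_circle:
  assumes "circle_prob \<mu>" "a \<in> atoms \<mu>"
  shows "cmod a = 1"
proof (rule ccontr)
  assume a: "cmod a \<noteq> 1"
  have st: "sets \<mu> = sets borel" using assms by (simp add: circle_prob_def)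
  have "AE z in \<mu>. z \<notin> {a}" using assms(1) a by (auto simp: circle_prob_def elim!: eventually_mono)
  hence "emeasure \<mu> {a} = 0" by (subst (asm) AE_iff_null_sets[symmetric]) (auto simp: st)
  thus False using assms(2) by (simp add: atoms_def measure_def)
qed

lemma L2_inner_norm_eq_0_iff:
  assumes "supported_at m \<mu>"
  shows "L2_inner \<mu> p p = 0 \<longleftrightarrow> (\<forall>a\<in>atoms \<mu>. poly p a = 0)"
proof -
  have fin: "finite (atoms \<mu>)" using assms by (simp add: supported_at_def)
  have "L2_inner \<mu> p p = of_real (\<Sum>a\<in>atoms \<mu>. measure \<mu> {a} * (cmod (poly p a))\<^sup>2)"
    unfolding L2_inner_supported_at[OF assms] of_real_sum of_real_mult complex_norm_square
    by (intro sum.cong) (auto simp: mult_ac)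
  also have "\<dots> = 0 \<longleftrightarrow> (\<Sum>a\<in>atoms \<mu>. measure \<mu> {a} * (cmod (poly p a))\<^sup>2) = 0" by (rule of_real_eq_0_iff)
  also have "\<dots> \<longleftrightarrow> (\<forall>a\<in>atoms \<mu>. measure \<mu> {a} * (cmod (poly p a))\<^sup>2 = 0)"
    using fin by (intro sum_nonneg_eq_0_iff) auto
  also have "\<dots> \<longleftrightarrow> (\<forall>a\<in>atoms \<mu>. poly p a = 0)" by (auto simp: atoms_def)
  finally show ?thesis .
qed

lemma L2_inner_cnj:
  assumes "supported_at m \<mu>"
  shows "L2_inner \<mu> q p = cnj (L2_inner \<mu> p q)"
  unfolding L2_inner_supported_at[OF assms] by (simp add: mult_ac)

lemma L2_inner_linear:
  assumes "supported_at m \<mu>"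
  shows "L2_inner \<mu> p (q + r) = L2_inner \<mu> p q + L2_inner \<mu> p r"
    "L2_inner \<mu> p (q - r) = L2_inner \<mu> p q - L2_inner \<mu> p r"
    "L2_inner \<mu> p (Polynomial.smult c q) = c * L2_inner \<mu> p q"
    "L2_inner \<mu> (q + r) p = L2_inner \<mu> q p + L2_inner \<mu> r p"
    "L2_inner \<mu> (q - r) p = L2_inner \<mu> q p - L2_inner \<mu> r p"
    "L2_inner \<mu> (Polynomial.smult c q) p = cnj c * L2_inner \<mu> q p"
    "L2_inner \<mu> 0 p = 0" "L2_inner \<mu> p 0 = 0"
    "L2_inner \<mu> p (sum f I) = (\<Sum>i\<in>I. L2_inner \<mu> p (f i))"
    "L2_inner \<mu> (sum f I) p = (\<Sum>i\<in>I. L2_inner \<mu> (f i) p)"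
proof -
  note L = L2_inner_supported_at[OF assms]
  show "L2_inner \<mu> p (q + r) = L2_inner \<mu> p q + L2_inner \<mu> p r" "L2_inner \<mu> p (q - r) = L2_inner \<mu> p q - L2_inner \<mu> p r"
    "L2_inner \<mu> (q + r) p = L2_inner \<mu> q p + L2_inner \<mu> r p" "L2_inner \<mu> (q - r) p = L2_inner \<mu> q p - L2_inner \<mu> r p"
    unfolding L by (simp_all add: algebra_simps sum.distrib sum_subtractf)
  show "L2_inner \<mu> p (Polynomial.smult c q) = c * L2_inner \<mu> p q" "L2_inner \<mu> (Polynomial.smult c q) p = cnj c * L2_inner \<mu> q p"
    unfolding L by (simp_all add: sum_distrib_left mult_ac)
  show 0: "L2_inner \<mu> 0 p = 0" "L2_inner \<mu> p 0 = 0" unfolding L by simp_all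
  have add: "L2_inner \<mu> p (q + r) = L2_inner \<mu> p q + L2_inner \<mu> p r" "L2_inner \<mu> (q + r) p = L2_inner \<mu> q p + L2_inner \<mu> r p" for q r
    unfolding L by (simp_all add: algebra_simps sum.distrib)
  show "L2_inner \<mu> p (sum f I) = (\<Sum>i\<in>I. L2_inner \<mu> p (f i))" "L2_inner \<mu> (sum f I) p = (\<Sum>i\<in>I. L2_inner \<mu> (f i) p)"
    by (induction I rule: infinite_finite_induct) (simp_all add: 0 add)
qed

lemma cnj_mult_self_unit: "cmod a = 1 \<Longrightarrow> cnj a * a = 1"
  by (metis complex_norm_square mult.commute of_real_1 one_power2)

lemma L2_inner_shift:
  assumes "supported_at m \<mu>"
  shows "L2_inner \<mu> (pCons 0 p) (pCons 0 q) = L2_inner \<mu> p q"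
  unfolding L2_inner_supported_at[OF assms]
proof (rule sum.cong[OF refl])
  fix a assume "a \<in> atoms \<mu>"
  hence "cnj a * a = 1" using assms by (intro cnj_mult_self_unit atoms_on_circle) (auto simp: supported_at_def)
  thus "complex_of_real (measure \<mu> {a}) * (cnj (poly (pCons 0 p) a) * poly (pCons 0 q) a) =
      complex_of_real (measure \<mu> {a}) * (cnj (poly p a) * poly q a)"
    by (simp add: mult_ac)
qed

lemma coeff_reversed: "coeff (reversed p) k = (if k \<le> degree p then cnj (coeff p (degree p - k)) else 0)"
proof -
  have "degree (map_poly cnj p) = degree p" by (rule degree_map_poly) auto
  thus ?thesis unfolding reversed_def by (simp add: coeff_reflect_poly coeff_map_poly)
qed

lemma poly_reversed_unit:
  assumes "cmod z = 1"
  shows "poly (reversed p) z = z ^ degree p * cnj (poly p z)"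
proof -
  have z0: "z \<noteq> 0" using assms by auto
  have d: "degree (map_poly cnj p) = degree p" by (rule degree_map_poly) auto
  have i: "inverse z = cnj z" using cnj_mult_self_unit[OF assms] by (metis inverse_unique mult.commute)
  have "poly (map_poly cnj p) (cnj z) = cnj (poly p z)"
    by (simp add: poly_altdef d coeff_map_poly)
  thus ?thesis unfolding reversed_def poly_reflect_poly_nz[OF z0] d i by simp
qed

lemma poly_zero_of_many_roots:
  fixes p :: "complex poly"
  assumes "finite S" "degree p < card S" "\<And>a. a \<in> S \<Longrightarrow> poly p a = 0"
  shows "p = 0"
proof (rule ccontr)
  assume "p \<noteq> 0"
  hence "card S \<le> card {x. poly p x = 0}" using assms by (intro card_mono poly_roots_finite) auto
  also have "\<dots> \<le> degree p" using \<open>p \<noteq> 0\<close> by (rule card_poly_roots_bound)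
  finally show False using assms by simp
qed

section \<open>Monic orthogonal polynomials and the step of the recursion\<close>

definition monic_orthogonal :: "complex measure \<Rightarrow> nat \<Rightarrow> complex poly \<Rightarrow> bool" where
  "monic_orthogonal \<mu> j p \<longleftrightarrow> degree p = j \<and> lead_coeff p = 1 \<and> (\<forall>q. degree q < j \<longrightarrow> L2_inner \<mu> q p = 0)"

text \<open>The difference has degree below j and is orthogonal to itself, so it vanishes at all m
  atoms, more than its degree. The bound admits j = m, which is how the last \<open>szego\<close>
  polynomial is identified with the one vanishing at the atoms.\<close>

lemma monic_orthogonal_unique:
  assumes s: "supported_at m \<mu>" and j: "j \<le> m" and p: "monic_orthogonal \<mu> j p" and q: "monic_orthogonal \<mu> j q"
  shows "p = q"
proof (rule ccontr)
  assume ne: "p \<noteq> q"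
  have d: "degree (p - q) < j"
  proof -
    have "j \<noteq> 0"
    proof
      assume "j = 0"
      hence "p = 1" "q = 1" using p q unfolding monic_orthogonal_def by (auto elim!: degree_eq_zeroE)
      thus False using ne by simp
    qed
    have "coeff (p - q) i = 0" if "i \<ge> j" for i
      using p q that unfolding monic_orthogonal_def by (cases "i = j") (auto simp: coeff_eq_0)
    hence "degree (p - q) \<le> j - 1" by (intro degree_le) auto
    thus ?thesis using \<open>j \<noteq> 0\<close> by simp
  qed
  have "L2_inner \<mu> (p - q) (p - q) = L2_inner \<mu> (p - q) p - L2_inner \<mu> (p - q) q"
    by (simp add: L2_inner_linear[OF s])
  also have "\<dots> = 0" using d p q by (simp add: monic_orthogonal_def)
  finally have "\<forall>a\<in>atoms \<mu>. poly (p - q) a = 0" by (simp only: L2_inner_norm_eq_0_iff[OF s])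
  hence "p - q = 0" using s d j by (intro poly_zero_of_many_roots[of "atoms \<mu>"]) (auto simp: supported_at_def)
  thus False using ne by simp
qed

lemma Phi_eqI:
  assumes s: "supported_at m \<mu>" and j: "j < m" and p: "monic_orthogonal \<mu> j p"
  shows "Phi \<mu> j = p"
proof -
  have "Phi \<mu> j = (THE p. monic_orthogonal \<mu> j p)"
    using s j by (simp add: Phi_def supported_at_def monic_orthogonal_def)
  also have "\<dots> = p"
    by (rule the_equality, rule p, rule monic_orthogonal_unique[OF s less_imp_le[OF j] _ p])
  finally show ?thesis .
qed

text \<open>The recursion stops at the first polynomial of norm zero, which is the one vanishing at all
  atoms, so it agrees with \<^const>\<open>Phi\<close> at every index.\<close>

primrec szego :: "complex measure \<Rightarrow> nat \<Rightarrow> complex poly" where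
  "szego \<mu> 0 = 1"
| "szego \<mu> (Suc j) =
     (if L2_inner \<mu> (szego \<mu> j) (szego \<mu> j) = 0 then szego \<mu> j
      else pCons 0 (szego \<mu> j) - Polynomial.smult
        (L2_inner \<mu> 1 (pCons 0 (szego \<mu> j)) / L2_inner \<mu> (szego \<mu> j) (szego \<mu> j)) (reversed (szego \<mu> j)))"

lemma monic_orthogonal_norm_nz:
  assumes s: "supported_at m \<mu>" and j: "j < m" and p: "monic_orthogonal \<mu> j p"
  shows "L2_inner \<mu> p p \<noteq> 0"
proof
  assume "L2_inner \<mu> p p = 0"
  hence "p = 0" using s j p unfolding L2_inner_norm_eq_0_iff[OF s]
    by (intro poly_zero_of_many_roots[of "atoms \<mu>"]) (auto simp: supported_at_def monic_orthogonal_def)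
  thus False using p by (simp add: monic_orthogonal_def)
qed

text \<open>On the circle \<open>reversed p\<close> is z^(degree p) times the conjugate of p, and
  conjugating z^i means dividing by it. Consequently the reversal of an orthogonal polynomial of
  degree j is orthogonal to z, ..., z^j.\<close>

lemma L2_inner_monom_reversed:
  assumes s: "supported_at m \<mu>" and "i \<le> degree p"
  shows "L2_inner \<mu> (monom 1 i) (reversed p) = L2_inner \<mu> p (monom 1 (degree p - i))"
  unfolding L2_inner_supported_at[OF s]
proof (rule sum.cong[OF refl])
  fix a assume "a \<in> atoms \<mu>"
  hence a: "cmod a = 1" using s by (intro atoms_on_circle) (auto simp: supported_at_def)
  have "cnj (a ^ i) * a ^ degree p = (cnj a * a) ^ i * a ^ (degree p - i)"
    using assms(2) by (simp add: power_mult_distrib mult.assoc flip: power_add)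
  also have "\<dots> = a ^ (degree p - i)" by (simp add: cnj_mult_self_unit[OF a])
  finally have e: "cnj (a ^ i) * a ^ degree p = a ^ (degree p - i)" .
  have "cnj (a ^ i) * (a ^ degree p * cnj (poly p a)) = (cnj (a ^ i) * a ^ degree p) * cnj (poly p a)"
    by (simp only: mult.assoc)
  also have "\<dots> = cnj (poly p a) * a ^ (degree p - i)" unfolding e by (rule mult.commute)
  finally have "cnj (a ^ i) * (a ^ degree p * cnj (poly p a)) = cnj (poly p a) * a ^ (degree p - i)" .
  thus "complex_of_real (measure \<mu> {a}) * (cnj (poly (monom 1 i) a) * poly (reversed p) a) =
         complex_of_real (measure \<mu> {a}) * (cnj (poly p a) * poly (monom 1 (degree p - i)) a)"
    by (simp add: poly_monom poly_reversed_unit[OF a])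
qed

lemma degree_reversed_le: "degree (reversed p) \<le> degree p"
  by (rule degree_le) (simp add: coeff_reversed)

text \<open>Both z p and \<open>reversed p\<close> are orthogonal to z, ..., z^j: the first by
  invariance under multiplication by z, the second by reversal. Since 1 pairs with
  \<open>reversed p\<close> to the squared norm of p, the stated multiple removes the remaining
  component along 1.\<close>

lemma szego_step:
  assumes s: "supported_at m \<mu>" and j: "j < m" and p: "monic_orthogonal \<mu> j p"
  shows "monic_orthogonal \<mu> (Suc j) (pCons 0 p - Polynomial.smult (L2_inner \<mu> 1 (pCons 0 p) / L2_inner \<mu> p p) (reversed p))"
    (is "monic_orthogonal \<mu> _ ?P")
  unfolding monic_orthogonal_def
proof (intro conjI allI impI)
  have dp: "degree p = j" "coeff p j = 1" "\<And>q. degree q < j \<Longrightarrow> L2_inner \<mu> q p = 0"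
    using p by (auto simp: monic_orthogonal_def)
  note lin = L2_inner_linear[OF s]
  have cR: "coeff (reversed p) i = 0" if "i > j" for i using that dp by (simp add: coeff_reversed)
  have c1: "coeff ?P (Suc j) = 1" by (simp add: cR dp)
  have "coeff ?P i = 0" if "i > Suc j" for i
    using that by (simp add: cR coeff_pCons coeff_eq_0 dp split: nat.split)
  hence "degree ?P \<le> Suc j" by (intro degree_le) auto
  moreover have "degree ?P \<ge> Suc j" using c1 by (intro le_degree) simp
  ultimately show "degree ?P = Suc j" by simp
  thus "lead_coeff ?P = 1" using c1 by simp
  define N where "N = L2_inner \<mu> p p"
  have N: "N \<noteq> 0" using monic_orthogonal_norm_nz[OF s j p] by (simp add: N_def)
  have Ncnj: "cnj N = N" unfolding N_def using L2_inner_cnj[OF s, of p p] by simp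
  have rev: "L2_inner \<mu> (monom 1 i) (reversed p) = 0" if "0 < i" "i \<le> j" for i
  proof -
    have "L2_inner \<mu> (monom 1 i) (reversed p) = L2_inner \<mu> p (monom 1 (j - i))"
      using L2_inner_monom_reversed[OF s, of i p] that dp by simp
    also have "\<dots> = cnj (L2_inner \<mu> (monom 1 (j - i)) p)" by (rule L2_inner_cnj[OF s])
    also have "\<dots> = 0" using that by (subst dp(3)) (auto simp: degree_monom_eq)
    finally show ?thesis .
  qed
  have rev0: "L2_inner \<mu> 1 (reversed p) = N"
  proof -
    have "L2_inner \<mu> 1 (reversed p) = L2_inner \<mu> p (monom 1 j)"
      using L2_inner_monom_reversed[OF s, of 0 p] dp by (simp add: one_pCons monom_0)
    also have "\<dots> = cnj (L2_inner \<mu> (monom 1 j) p)" by (rule L2_inner_cnj[OF s])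
    also have "L2_inner \<mu> (monom 1 j) p = N"
    proof (cases "j = 0")
      case True
      hence "p = 1" using dp by (auto elim!: degree_eq_zeroE)
      thus ?thesis using True by (simp add: N_def monom_0 one_pCons)
    next
      case False
      have "coeff (p - monom 1 j) i = 0" if "i \<ge> j" for i using that dp by (cases "i = j") (auto simp: coeff_eq_0)
      hence "degree (p - monom 1 j) \<le> j - 1" by (intro degree_le) auto
      hence "L2_inner \<mu> (p - monom 1 j) p = 0" using False by (intro dp(3)) simp
      thus ?thesis by (simp add: lin N_def)
    qed
    finally show ?thesis using Ncnj by simp
  qed
  fix q :: "complex poly" assume q: "degree q < Suc j"
  obtain c r where qr: "q = pCons c r" by (cases q)
  have r: "r = 0 \<or> degree r < j" using q by (auto simp: qr split: if_splits)
  have r_P: "L2_inner \<mu> r p = 0" using r dp(3) by (auto simp: lin)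
  have r_rev: "L2_inner \<mu> (pCons 0 r) (reversed p) = 0"
  proof (cases "r = 0")
    case False
    have "pCons 0 r = (\<Sum>i\<le>degree r. Polynomial.smult (coeff r i) (monom 1 (Suc i)))"
    proof -
      have pC: "pCons 0 (\<Sum>i\<in>I. f i) = (\<Sum>i\<in>I. pCons 0 (f i))" for f :: "nat \<Rightarrow> complex poly" and I
      proof (induction I rule: infinite_finite_induct)
        case (insert x F)
        have "pCons 0 (f x + sum f F) = pCons 0 (f x) + pCons 0 (sum f F)" by simp
        thus ?case using insert by simp
      qed auto
      have "r = (\<Sum>i\<le>degree r. monom (coeff r i) i)" by (simp add: poly_as_sum_of_monoms)
      hence "pCons 0 r = (\<Sum>i\<le>degree r. pCons 0 (monom (coeff r i) i))"
        by (subst pC[symmetric]) (simp add: poly_as_sum_of_monoms)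
      thus ?thesis by (simp add: monom_Suc smult_monom)
    qed
    hence "L2_inner \<mu> (pCons 0 r) (reversed p) = (\<Sum>i\<le>degree r. cnj (coeff r i) * L2_inner \<mu> (monom 1 (Suc i)) (reversed p))"
      by (simp add: lin)
    also have "\<dots> = 0" using r False by (intro sum.neutral ballI) (simp add: rev)
    finally show ?thesis .
  qed (simp add: lin)
  have "q = Polynomial.smult c 1 + pCons 0 r" by (simp add: qr)
  hence "L2_inner \<mu> q ?P = cnj c * (L2_inner \<mu> 1 (pCons 0 p) - L2_inner \<mu> 1 (pCons 0 p) / N * N) + (L2_inner \<mu> (pCons 0 r) (pCons 0 p) - L2_inner \<mu> 1 (pCons 0 p) / N * 0)"
    by (simp only: lin rev0 r_rev N_def) (simp add: algebra_simps)
  also have "\<dots> = 0" using N by (simp add: L2_inner_shift[OF s] r_P)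
  finally show "L2_inner \<mu> q ?P = 0" .
qed

lemma szego_monic_orthogonal:
  assumes s: "supported_at m \<mu>" and j: "j \<le> m"
  shows "monic_orthogonal \<mu> j (szego \<mu> j)"
  using j
proof (induction j)
  case 0
  show ?case by (simp add: monic_orthogonal_def)
next
  case (Suc j)
  hence IH: "monic_orthogonal \<mu> j (szego \<mu> j)" "j < m" by auto
  thus ?case using szego_step[OF s, of j "szego \<mu> j"] monic_orthogonal_norm_nz[OF s IH(2,1)] by simp
qed

lemma nodal_monic_orthogonal:
  assumes s: "supported_at m \<mu>"
  shows "monic_orthogonal \<mu> m (\<Prod>a\<in>atoms \<mu>. [:- a, 1:])"
  unfolding monic_orthogonal_def
proof (intro conjI allI impI)
  have fin: "finite (atoms \<mu>)" "card (atoms \<mu>) = m" using s by (auto simp: supported_at_def)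
  show "degree (\<Prod>a\<in>atoms \<mu>. [:- a, 1:]) = m"
    using fin by (subst degree_prod_eq_sum_degree) auto
  show "lead_coeff (\<Prod>a\<in>atoms \<mu>. [:- a, 1:]) = 1" by (simp add: lead_coeff_prod)
  show "L2_inner \<mu> q (\<Prod>a\<in>atoms \<mu>. [:- a, 1:]) = 0" for q
    unfolding L2_inner_supported_at[OF s] using fin
    by (intro sum.neutral ballI) (auto simp: poly_prod intro!: prod_zero)
qed

text \<open>Trades the definite description for a recursion in inner products, hence in moments;
  this is the form in which measurability can be proved.\<close>

theorem Phi_eq_szego:
  assumes s: "supported_at m \<mu>"
  shows "Phi \<mu> j = szego \<mu> j"
proof -
  have card: "card (atoms \<mu>) = m" using s by (simp add: supported_at_def)
  have m: "szego \<mu> m = (\<Prod>a\<in>atoms \<mu>. [:- a, 1:])"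
    by (rule monic_orthogonal_unique[OF s order.refl szego_monic_orthogonal[OF s order.refl] nodal_monic_orthogonal[OF s]])
  have "L2_inner \<mu> (szego \<mu> m) (szego \<mu> m) = 0"
    unfolding m L2_inner_norm_eq_0_iff[OF s] using s by (auto simp: poly_prod supported_at_def intro!: prod_zero)
  hence ge: "szego \<mu> (m + i) = szego \<mu> m" for i by (induction i) auto
  show ?thesis
  proof (cases "j < m")
    case True
    thus ?thesis using Phi_eqI[OF s True szego_monic_orthogonal[OF s]] by simp
  next
    case False
    thus ?thesis using ge[of "j - m"] m by (simp add: Phi_def card)
  qed
qed

subsection \<open>Orthogonal polynomials with prescribed Verblunsky coefficients\<close>

text \<open>Built from the coefficients alone, before any measure exists; the measure is afterwards
  placed on the zeros of \<open>opuc \<alpha> n\<close>.\<close>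

primrec opuc :: "(nat \<Rightarrow> complex) \<Rightarrow> nat \<Rightarrow> complex poly" where
  "opuc \<alpha> 0 = 1"
| "opuc \<alpha> (Suc j) = pCons 0 (opuc \<alpha> j) - Polynomial.smult (cnj (\<alpha> j)) (reversed (opuc \<alpha> j))"

text \<open>These products will be the squared norms of the polynomials in the measure still to be
  built.\<close>

definition opuc_norm2 :: "(nat \<Rightarrow> complex) \<Rightarrow> nat \<Rightarrow> real" where
  "opuc_norm2 \<alpha> j = (\<Prod>i<j. 1 - (cmod (\<alpha> i))\<^sup>2)"

definition cd_kernel :: "(nat \<Rightarrow> complex) \<Rightarrow> nat \<Rightarrow> complex \<Rightarrow> complex \<Rightarrow> complex" where
  "cd_kernel \<alpha> m z w = (\<Sum>j<m. poly (opuc \<alpha> j) z * cnj (poly (opuc \<alpha> j) w) / of_real (opuc_norm2 \<alpha> j))"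

lemma degree_opuc_lead: "degree (opuc \<alpha> j) = j \<and> coeff (opuc \<alpha> j) j = 1"
proof (induction j)
  case (Suc j)
  have c: "coeff (reversed (opuc \<alpha> j)) i = 0" if "i > j" for i using that Suc by (simp add: coeff_reversed)
  have 1: "coeff (opuc \<alpha> (Suc j)) (Suc j) = 1" using Suc by (simp add: c)
  have "coeff (opuc \<alpha> (Suc j)) i = 0" if "i > Suc j" for i
    using that Suc by (simp add: c coeff_pCons coeff_eq_0 split: nat.split)
  hence "degree (opuc \<alpha> (Suc j)) \<le> Suc j" by (intro degree_le) auto
  moreover have "degree (opuc \<alpha> (Suc j)) \<ge> Suc j" by (intro le_degree) (simp only: 1, simp)
  ultimately have "degree (opuc \<alpha> (Suc j)) = Suc j" by (rule antisym)
  thus ?case using 1 by blast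
qed auto

lemma degree_opuc [simp]: "degree (opuc \<alpha> j) = j"
  and coeff_opuc_lead [simp]: "coeff (opuc \<alpha> j) j = 1"
  using degree_opuc_lead by auto

lemma reversed_opuc_Suc:
  "reversed (opuc \<alpha> (Suc j)) = reversed (opuc \<alpha> j) - Polynomial.smult (\<alpha> j) (pCons 0 (opuc \<alpha> j))"
proof (rule poly_eqI)
  fix k
  have d: "degree (opuc \<alpha> (Suc j)) = Suc j" by (rule degree_opuc)
  have L: "coeff (reversed (opuc \<alpha> (Suc j))) k = (if k \<le> Suc j then cnj (coeff (opuc \<alpha> (Suc j)) (Suc j - k)) else 0)"
    by (simp only: coeff_reversed d)
  show "coeff (reversed (opuc \<alpha> (Suc j))) k = coeff (reversed (opuc \<alpha> j) - Polynomial.smult (\<alpha> j) (pCons 0 (opuc \<alpha> j))) k"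
  proof (cases "k \<le> Suc j")
    case False
    thus ?thesis unfolding L by (cases k) (auto simp: coeff_reversed coeff_eq_0)
  next
    case True
    show ?thesis
    proof (cases k)
      case 0
      thus ?thesis unfolding L by (simp add: coeff_reversed)
    next
      case (Suc i)
      show ?thesis
      proof (cases "i = j")
        case False
        hence "j - i = Suc (j - Suc i)" using True Suc by simp
        thus ?thesis unfolding L using True Suc False by (simp add: coeff_reversed coeff_pCons)
      next
        case True
        thus ?thesis unfolding L using Suc by (simp add: coeff_reversed)
      qed
    qed
  qed
qed

lemma opuc_cong: "(\<And>i. i < j \<Longrightarrow> \<alpha> i = \<alpha>' i) \<Longrightarrow> opuc \<alpha> j = opuc \<alpha>' j"
  by (induction j) auto

lemma reversed_1 [simp]: "reversed 1 = (1 :: complex poly)"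
  by (simp add: reversed_def)

text \<open>Proved from the recursion alone, as no inner product is available yet. Passing from m to
  m + 1 multiplies the identity by 1 - |alpha_m|^2, the ratio of consecutive squared norms, and adds
  the new term of the kernel.\<close>

lemma christoffel_darboux:
  assumes "\<And>i. i < m \<Longrightarrow> cmod (\<alpha> i) < 1"
  shows "(1 - z * cnj w) * cd_kernel \<alpha> (Suc m) z w * of_real (opuc_norm2 \<alpha> m) =
    poly (reversed (opuc \<alpha> m)) z * cnj (poly (reversed (opuc \<alpha> m)) w)
    - z * cnj w * poly (opuc \<alpha> m) z * cnj (poly (opuc \<alpha> m) w)"
  using assms
proof (induction m)
  case 0
  show ?case by (simp add: cd_kernel_def opuc_norm2_def)
next
  case (Suc m)
  define P where "P = poly (opuc \<alpha> m) z"
  define Q where "Q = poly (opuc \<alpha> m) w"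
  define R where "R = poly (reversed (opuc \<alpha> m)) z"
  define T where "T = poly (reversed (opuc \<alpha> m)) w"
  define a where "a = \<alpha> m"
  define r where "r = complex_of_real (1 - (cmod a)\<^sup>2)"
  have r: "r = 1 - a * cnj a" by (simp add: r_def complex_norm_square[symmetric])
  define k where "k = complex_of_real (opuc_norm2 \<alpha> m)"
  have k': "complex_of_real (opuc_norm2 \<alpha> (Suc m)) = k * r" by (simp add: k_def opuc_norm2_def r_def a_def)
  have "(cmod (\<alpha> i))\<^sup>2 < 1" if "i < Suc m" for i using Suc.prems[OF that] by (simp add: abs_square_less_1)
  hence "opuc_norm2 \<alpha> (Suc m) \<noteq> 0" unfolding opuc_norm2_def by (subst prod_zero_iff) force+
  hence kr: "k * r \<noteq> 0" using k' by (metis of_real_eq_0_iff)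
  define K where "K = cd_kernel \<alpha> (Suc m) z w"
  have K': "cd_kernel \<alpha> (Suc (Suc m)) z w = K + (z * P - cnj a * R) * cnj (w * Q - cnj a * T) / (k * r)"
    unfolding cd_kernel_def K_def sum.lessThan_Suc[of _ "Suc m"] k'
    by (simp add: P_def Q_def R_def T_def a_def)
  have IH: "(1 - z * cnj w) * K * k = R * cnj T - z * cnj w * P * cnj Q"
    using Suc unfolding K_def k_def P_def Q_def R_def T_def by simp
  have "(1 - z * cnj w) * cd_kernel \<alpha> (Suc (Suc m)) z w * (k * r) =
     ((1 - z * cnj w) * K * k) * r + (1 - z * cnj w) * ((z * P - cnj a * R) * cnj (w * Q - cnj a * T))"
    unfolding K' using kr by (simp add: field_simps)
  also have "\<dots> = (R - a * (z * P)) * cnj (T - a * (w * Q)) - z * cnj w * (z * P - cnj a * R) * cnj (w * Q - cnj a * T)"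
    unfolding IH r by (simp add: algebra_simps)
  finally show ?case unfolding k' reversed_opuc_Suc
    by (simp add: P_def Q_def R_def T_def a_def mult.left_commute)
qed

lemma opuc_norm2_pos: "(\<And>i. i < m \<Longrightarrow> cmod (\<alpha> i) < 1) \<Longrightarrow> opuc_norm2 \<alpha> m > 0"
  unfolding opuc_norm2_def by (intro prod_pos) (auto simp: abs_square_less_1)

lemma cd_kernel_diag:
  assumes "\<And>i. i < m \<Longrightarrow> cmod (\<alpha> i) < 1"
  shows "cd_kernel \<alpha> (Suc m) z z = of_real (\<Sum>j\<le>m. (cmod (poly (opuc \<alpha> j) z))\<^sup>2 / opuc_norm2 \<alpha> j)"
    and "1 \<le> (\<Sum>j\<le>m. (cmod (poly (opuc \<alpha> j) z))\<^sup>2 / opuc_norm2 \<alpha> j)"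
proof -
  show "cd_kernel \<alpha> (Suc m) z z = of_real (\<Sum>j\<le>m. (cmod (poly (opuc \<alpha> j) z))\<^sup>2 / opuc_norm2 \<alpha> j)"
    unfolding cd_kernel_def lessThan_Suc_atMost of_real_sum of_real_divide complex_norm_square ..
  have "(\<Sum>j\<in>{0}. (cmod (poly (opuc \<alpha> j) z))\<^sup>2 / opuc_norm2 \<alpha> j) \<le> (\<Sum>j\<le>m. (cmod (poly (opuc \<alpha> j) z))\<^sup>2 / opuc_norm2 \<alpha> j)"
    by (intro sum_mono2) (auto intro!: divide_nonneg_pos opuc_norm2_pos assms)
  thus "1 \<le> (\<Sum>j\<le>m. (cmod (poly (opuc \<alpha> j) z))\<^sup>2 / opuc_norm2 \<alpha> j)" by (simp add: opuc_norm2_def)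
qed

text \<open>The term j = 0 of the kernel makes K at least 1. The real form on the diagonal compares
  z times \<open>opuc\<close> with the reversal in modulus: the reversal dominates inside the disc,
  and equality forces z onto the circle.\<close>

lemma christoffel_darboux_diag:
  assumes "\<And>i. i < m \<Longrightarrow> cmod (\<alpha> i) < 1"
  obtains K where "K \<ge> 1" "(1 - (cmod z)\<^sup>2) * K * opuc_norm2 \<alpha> m =
     (cmod (poly (reversed (opuc \<alpha> m)) z))\<^sup>2 - (cmod (z * poly (opuc \<alpha> m) z))\<^sup>2"
    "cd_kernel \<alpha> (Suc m) z z = of_real K"
proof
  let ?K = "\<Sum>j\<le>m. (cmod (poly (opuc \<alpha> j) z))\<^sup>2 / opuc_norm2 \<alpha> j"
  show "cd_kernel \<alpha> (Suc m) z z = of_real ?K" "?K \<ge> 1" using cd_kernel_diag[OF assms] by auto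
  have D: "cd_kernel \<alpha> (Suc m) z z = of_real ?K" by (rule cd_kernel_diag(1)) (rule assms)
  have "complex_of_real ((1 - (cmod z)\<^sup>2) * ?K * opuc_norm2 \<alpha> m) = (1 - z * cnj z) * cd_kernel \<alpha> (Suc m) z z * of_real (opuc_norm2 \<alpha> m)"
    unfolding D of_real_mult of_real_diff complex_norm_square[of z] of_real_1 ..
  also have "\<dots> = poly (reversed (opuc \<alpha> m)) z * cnj (poly (reversed (opuc \<alpha> m)) z)
    - z * cnj z * poly (opuc \<alpha> m) z * cnj (poly (opuc \<alpha> m) z)" by (rule christoffel_darboux) (rule assms)
  also have "\<dots> = complex_of_real ((cmod (poly (reversed (opuc \<alpha> m)) z))\<^sup>2 - (cmod (z * poly (opuc \<alpha> m) z))\<^sup>2)"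
    unfolding of_real_diff complex_norm_square by (simp add: mult_ac)
  finally show "(1 - (cmod z)\<^sup>2) * ?K * opuc_norm2 \<alpha> m =
     (cmod (poly (reversed (opuc \<alpha> m)) z))\<^sup>2 - (cmod (z * poly (opuc \<alpha> m) z))\<^sup>2" by (simp only: of_real_eq_iff)
qed

definition verblunsky_tuple :: "nat \<Rightarrow> (nat \<Rightarrow> complex) \<Rightarrow> bool" where
  "verblunsky_tuple m \<alpha> \<longleftrightarrow> (\<forall>i<m. cmod (\<alpha> i) < 1) \<and> cmod (\<alpha> m) = 1"

context
  fixes n m :: nat and \<alpha> :: "nat \<Rightarrow> complex"
  assumes n: "n = Suc m" and params: "verblunsky_tuple m \<alpha>"
begin

lemma inner_params: "i < m \<Longrightarrow> cmod (\<alpha> i) < 1" and last_param: "cmod (\<alpha> m) = 1"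
  using params by (auto simp: verblunsky_tuple_def)

lemma opuc_n: "opuc \<alpha> n = pCons 0 (opuc \<alpha> m) - Polynomial.smult (cnj (\<alpha> m)) (reversed (opuc \<alpha> m))"
  by (simp add: n)

definition opuc_zeros :: "complex set" where "opuc_zeros = {z. poly (opuc \<alpha> n) z = 0}"

lemma opuc_zeroD: "a \<in> opuc_zeros \<Longrightarrow> a * poly (opuc \<alpha> m) a = cnj (\<alpha> m) * poly (reversed (opuc \<alpha> m)) a"
  unfolding opuc_zeros_def opuc_n by simp

lemma cnj_last: "\<alpha> m * cnj (\<alpha> m) = 1"
  using cnj_mult_self_unit[OF last_param] by (simp add: mult.commute)

text \<open>At a zero of the last polynomial, \<open>opuc_zeroD\<close> and |alpha_m| = 1 turn the
  Christoffel-Darboux numerator into a constant times that polynomial. Evaluation at another zero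
  gives orthogonality; differentiation gives simplicity of the zeros.\<close>

lemma cd_kernel_at_zero:
  assumes a: "a \<in> opuc_zeros"
  shows "(1 - z * cnj a) * cd_kernel \<alpha> n z a * of_real (opuc_norm2 \<alpha> m) =
     - \<alpha> m * cnj (poly (reversed (opuc \<alpha> m)) a) * poly (opuc \<alpha> n) z"
proof -
  have "(1 - z * cnj a) * cd_kernel \<alpha> (Suc m) z a * of_real (opuc_norm2 \<alpha> m) =
     poly (reversed (opuc \<alpha> m)) z * cnj (poly (reversed (opuc \<alpha> m)) a)
    - z * poly (opuc \<alpha> m) z * cnj (a * poly (opuc \<alpha> m) a)"
    by (subst christoffel_darboux) (auto intro: inner_params)
  also have "\<dots> = (\<alpha> m * cnj (\<alpha> m)) * poly (reversed (opuc \<alpha> m)) z * cnj (poly (reversed (opuc \<alpha> m)) a)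
    - z * poly (opuc \<alpha> m) z * cnj (a * poly (opuc \<alpha> m) a)" by (simp add: cnj_last)
  also have "\<dots> = - \<alpha> m * cnj (poly (reversed (opuc \<alpha> m)) a) * poly (opuc \<alpha> n) z"
    unfolding opuc_zeroD[OF a] opuc_n by (simp add: algebra_simps)
  finally show ?thesis by (simp only: n)
qed

text \<open>|alpha_m| = 1 makes the right side of the diagonal formula vanish at a zero, while K and
  the norm are positive.\<close>

lemma opuc_zeros_on_circle: "a \<in> opuc_zeros \<Longrightarrow> cmod a = 1"
proof -
  assume a: "a \<in> opuc_zeros"
  obtain K where K: "K \<ge> 1" "(1 - (cmod a)\<^sup>2) * K * opuc_norm2 \<alpha> m =
     (cmod (poly (reversed (opuc \<alpha> m)) a))\<^sup>2 - (cmod (a * poly (opuc \<alpha> m) a))\<^sup>2"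
    by (rule christoffel_darboux_diag[of m \<alpha> a]) (auto intro: inner_params)
  have "(1 - (cmod a)\<^sup>2) * K * opuc_norm2 \<alpha> m = 0"
    unfolding K(2) opuc_zeroD[OF a] by (simp add: norm_mult last_param)
  moreover have "opuc_norm2 \<alpha> m > 0" by (intro opuc_norm2_pos inner_params)
  ultimately have "(cmod a)\<^sup>2 = 1" using K(1) by auto
  thus "cmod a = 1" by (simp add: power2_eq_1_iff) (smt (verit) norm_ge_zero)
qed

lemma cd_kernel_diag_pos: "Re (cd_kernel \<alpha> n a a) > 0" "cd_kernel \<alpha> n a a = of_real (Re (cd_kernel \<alpha> n a a))"
  using cd_kernel_diag[of m \<alpha> a] inner_params by (auto simp: n)

lemma cd_kernel_orthogonal:
  assumes "a \<in> opuc_zeros" "b \<in> opuc_zeros" "a \<noteq> b"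
  shows "cd_kernel \<alpha> n a b = 0"
proof -
  have "(1 - a * cnj b) * cd_kernel \<alpha> n a b * of_real (opuc_norm2 \<alpha> m) = 0"
    using cd_kernel_at_zero[OF assms(2), of a] assms(1) by (simp add: opuc_zeros_def)
  moreover have "opuc_norm2 \<alpha> m > 0" by (intro opuc_norm2_pos inner_params)
  moreover have "1 - a * cnj b \<noteq> 0"
  proof
    assume "1 - a * cnj b = 0"
    hence "b = a * (cnj b * b)" by simp
    thus False using assms cnj_mult_self_unit[OF opuc_zeros_on_circle[OF assms(2)]] by simp
  qed
  ultimately show ?thesis by simp
qed

text \<open>Differentiating \<open>cd_kernel_at_zero\<close> at z = a, where 1 - cnj a * a = 0,
  shows that a double zero would make the kernel vanish at (a, a).\<close>

lemma rsquarefree_opuc: "rsquarefree (opuc \<alpha> n)"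
  unfolding rsquarefree_roots
proof (intro allI notI, elim conjE)
  fix a assume "poly (opuc \<alpha> n) a = 0" and d: "poly (pderiv (opuc \<alpha> n)) a = 0"
  hence a: "a \<in> opuc_zeros" by (simp add: opuc_zeros_def)
  define Kp where "Kp = (\<Sum>j<n. Polynomial.smult (cnj (poly (opuc \<alpha> j) a) / of_real (opuc_norm2 \<alpha> j)) (opuc \<alpha> j))"
  have Kp: "poly Kp z = cd_kernel \<alpha> n z a" for z
    by (simp add: Kp_def cd_kernel_def poly_sum mult_ac)
  define c where "c = - \<alpha> m * cnj (poly (reversed (opuc \<alpha> m)) a)"
  define k where "k = complex_of_real (opuc_norm2 \<alpha> m)"
  have k0: "k \<noteq> 0" using opuc_norm2_pos[of m \<alpha>] inner_params by (simp add: k_def)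
  have "poly ([:1, - cnj a:] * Polynomial.smult k Kp) z = poly (Polynomial.smult c (opuc \<alpha> n)) z" for z
    using cd_kernel_at_zero[OF a, of z] by (simp add: Kp c_def k_def algebra_simps)
  hence eq: "[:1, - cnj a:] * Polynomial.smult k Kp = Polynomial.smult c (opuc \<alpha> n)"
    by (intro iffD1[OF poly_eq_poly_eq_iff] ext)
  have "poly (pderiv ([:1, - cnj a:] * Polynomial.smult k Kp)) a = 0"
    unfolding eq by (simp add: pderiv_smult d)
  moreover have "poly (pderiv ([:1, - cnj a:] * Polynomial.smult k Kp)) a =
      k * poly (pderiv Kp) a * (1 - cnj a * a) - cnj a * (k * poly Kp a)"
    unfolding pderiv_mult by (simp add: pderiv_pCons pderiv_smult algebra_simps)
  ultimately have "cnj a * (k * poly Kp a) = 0"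
    using cnj_mult_self_unit[OF opuc_zeros_on_circle[OF a]] by simp
  moreover have "poly Kp a \<noteq> 0" unfolding Kp using cd_kernel_diag_pos[of a] by auto
  moreover have "a \<noteq> 0" using opuc_zeros_on_circle[OF a] by auto
  ultimately show False using k0 by simp
qed

lemma opuc_factorization: "(\<Prod>a\<in>opuc_zeros. [:- a, 1:]) = opuc \<alpha> n"
  using complex_poly_decompose_rsquarefree[OF rsquarefree_opuc] by (simp add: opuc_zeros_def)

lemma finite_opuc_zeros: "finite opuc_zeros"
  unfolding opuc_zeros_def by (rule poly_roots_finite) (metis coeff_opuc_lead coeff_0 zero_neq_one)

lemma card_opuc_zeros: "card opuc_zeros = n"
proof -
  have "degree (\<Prod>a\<in>opuc_zeros. [:- a, 1:]) = card opuc_zeros"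
    using finite_opuc_zeros by (subst degree_prod_eq_sum_degree) auto
  thus ?thesis unfolding opuc_factorization by simp
qed

text \<open>The Christoffel number at a: the mass for which the row of the node a in
  \<open>opuc_mat\<close> is a unit vector.\<close>

definition opuc_weight :: "complex \<Rightarrow> real" where "opuc_weight a = 1 / Re (cd_kernel \<alpha> n a a)"

lemma opuc_weight_pos: "opuc_weight a > 0"
  using cd_kernel_diag_pos by (simp add: opuc_weight_def)

definition opuc_enum :: "nat \<Rightarrow> complex" where
  "opuc_enum = (SOME e. bij_betw e {..<n} opuc_zeros)"

lemma opuc_enum: "bij_betw opuc_enum {..<n} opuc_zeros"
proof -
  have "\<exists>e. bij_betw e {..<n} opuc_zeros"
    using ex_bij_betw_nat_finite[OF finite_opuc_zeros] by (simp add: card_opuc_zeros lessThan_atLeast0)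
  thus ?thesis unfolding opuc_enum_def by (rule someI_ex)
qed

text \<open>The Christoffel-Darboux kernel makes the rows of \<open>opuc_mat\<close> orthonormal; its columns are then
  orthonormal as well, which is the orthogonality of the polynomials.\<close>

definition opuc_mat :: "complex mat" where
  "opuc_mat = Matrix.mat n n (\<lambda>(i, j). of_real (sqrt (opuc_weight (opuc_enum i) / opuc_norm2 \<alpha> j)) * poly (opuc \<alpha> j) (opuc_enum i))"

definition opuc_mat_adj :: "complex mat" where
  "opuc_mat_adj = Matrix.mat n n (\<lambda>(i, j). cnj (opuc_mat $$ (j, i)))"

lemma opuc_mat_carrier [simp]: "opuc_mat \<in> carrier_mat n n" "opuc_mat_adj \<in> carrier_mat n n"
  by (simp_all add: opuc_mat_def opuc_mat_adj_def)

lemma opuc_norm2_pos': "j < n \<Longrightarrow> opuc_norm2 \<alpha> j > 0"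
  using n by (intro opuc_norm2_pos inner_params) simp

lemma opuc_mat_mult_adj: "opuc_mat * opuc_mat_adj = 1\<^sub>m n"
proof (rule eq_matI)
  fix i j assume "i < dim_row (1\<^sub>m n :: complex mat)" "j < dim_col (1\<^sub>m n :: complex mat)"
  hence ij: "i < n" "j < n" by auto
  let ?a = "opuc_enum i" and ?b = "opuc_enum j"
  have ab: "?a \<in> opuc_zeros" "?b \<in> opuc_zeros" using opuc_enum ij by (auto simp: bij_betw_def)
  have "(opuc_mat * opuc_mat_adj) $$ (i, j) = (\<Sum>l<n. opuc_mat $$ (i, l) * cnj (opuc_mat $$ (j, l)))"
    using ij by (simp add: scalar_prod_def opuc_mat_adj_def opuc_mat_def lessThan_atLeast0)
  also have "\<dots> = (\<Sum>l<n. of_real (sqrt (opuc_weight ?a) * sqrt (opuc_weight ?b)) *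
      (poly (opuc \<alpha> l) ?a * cnj (poly (opuc \<alpha> l) ?b) / of_real (opuc_norm2 \<alpha> l)))"
  proof (rule sum.cong[OF refl])
    fix l assume "l \<in> {..<n}"
    hence l: "l < n" by simp
    have "sqrt (opuc_weight ?a / opuc_norm2 \<alpha> l) * sqrt (opuc_weight ?b / opuc_norm2 \<alpha> l)
      = sqrt (opuc_weight ?a) * sqrt (opuc_weight ?b) / opuc_norm2 \<alpha> l"
      using opuc_norm2_pos'[OF l] by (simp add: real_sqrt_divide)
    hence "complex_of_real (sqrt (opuc_weight ?a / opuc_norm2 \<alpha> l)) * of_real (sqrt (opuc_weight ?b / opuc_norm2 \<alpha> l))
      = of_real (sqrt (opuc_weight ?a) * sqrt (opuc_weight ?b)) / of_real (opuc_norm2 \<alpha> l)"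
      by (simp only: of_real_mult[symmetric] of_real_divide[symmetric])
    thus "opuc_mat $$ (i, l) * cnj (opuc_mat $$ (j, l)) = of_real (sqrt (opuc_weight ?a) * sqrt (opuc_weight ?b)) *
      (poly (opuc \<alpha> l) ?a * cnj (poly (opuc \<alpha> l) ?b) / of_real (opuc_norm2 \<alpha> l))"
      using ij l by (simp add: opuc_mat_def field_simps)
  qed
  also have "\<dots> = of_real (sqrt (opuc_weight ?a) * sqrt (opuc_weight ?b)) * cd_kernel \<alpha> n ?a ?b"
    by (simp add: cd_kernel_def sum_distrib_left)
  also have "\<dots> = (if i = j then 1 else 0)"
  proof (cases "i = j")
    case True
    have "cd_kernel \<alpha> n ?a ?a = of_real (1 / opuc_weight ?a)"
      using cd_kernel_diag_pos[of ?a] by (simp add: opuc_weight_def)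
    thus ?thesis using True opuc_weight_pos[of ?a] by (simp flip: of_real_mult)
  next
    case False
    hence "?a \<noteq> ?b" using opuc_enum ij by (auto simp: bij_betw_def inj_on_def)
    thus ?thesis using False cd_kernel_orthogonal[OF ab] by simp
  qed
  finally show "(opuc_mat * opuc_mat_adj) $$ (i, j) = 1\<^sub>m n $$ (i, j)" using ij by simp
qed (auto simp: opuc_mat_def opuc_mat_adj_def)

lemma opuc_mat_adj_mult: "opuc_mat_adj * opuc_mat = 1\<^sub>m n"
  by (rule mat_mult_left_right_inverse[OF _ _ opuc_mat_mult_adj]) simp_all

lemma opuc_orthogonal:
  assumes ij: "i < n" "j < n"
  shows "(\<Sum>a\<in>opuc_zeros. of_real (opuc_weight a) * (cnj (poly (opuc \<alpha> i) a) * poly (opuc \<alpha> j) a)) =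
    (if i = j then of_real (opuc_norm2 \<alpha> j) else 0)"
proof -
  let ?k = "\<lambda>i. complex_of_real (sqrt (opuc_norm2 \<alpha> i))"
  have k: "?k i \<noteq> 0" "?k j \<noteq> 0" using opuc_norm2_pos' ij by force+
  have "(if i = j then 1 else 0) = (opuc_mat_adj * opuc_mat) $$ (i, j)" using ij by (simp add: opuc_mat_adj_mult)
  also have "\<dots> = (\<Sum>l<n. cnj (opuc_mat $$ (l, i)) * opuc_mat $$ (l, j))"
    using ij by (simp add: scalar_prod_def opuc_mat_adj_def opuc_mat_def lessThan_atLeast0)
  also have "\<dots> = (\<Sum>l<n. (\<lambda>a. of_real (opuc_weight a) * (cnj (poly (opuc \<alpha> i) a) * poly (opuc \<alpha> j) a) / (?k i * ?k j)) (opuc_enum l))"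
  proof (rule sum.cong[OF refl])
    fix l assume "l \<in> {..<n}"
    hence l: "l < n" by simp
    let ?w = "opuc_weight (opuc_enum l)"
    have w: "complex_of_real (sqrt ?w) * of_real (sqrt ?w) = of_real ?w"
      using opuc_weight_pos[of "opuc_enum l"] by (simp flip: of_real_mult)
    have "cnj (opuc_mat $$ (l, i)) * opuc_mat $$ (l, j) =
      (complex_of_real (sqrt ?w) * of_real (sqrt ?w)) * (cnj (poly (opuc \<alpha> i) (opuc_enum l)) * poly (opuc \<alpha> j) (opuc_enum l)) / (?k i * ?k j)"
      using ij l by (simp add: opuc_mat_def real_sqrt_divide)
    thus "cnj (opuc_mat $$ (l, i)) * opuc_mat $$ (l, j) = (\<lambda>a. of_real (opuc_weight a) * (cnj (poly (opuc \<alpha> i) a) * poly (opuc \<alpha> j) a) / (?k i * ?k j)) (opuc_enum l)"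
      unfolding w .
  qed
  also have "\<dots> = (\<Sum>a\<in>opuc_zeros. of_real (opuc_weight a) * (cnj (poly (opuc \<alpha> i) a) * poly (opuc \<alpha> j) a) / (?k i * ?k j))"
    by (rule sum.reindex_bij_betw[OF opuc_enum])
  also have "\<dots> = (\<Sum>a\<in>opuc_zeros. of_real (opuc_weight a) * (cnj (poly (opuc \<alpha> i) a) * poly (opuc \<alpha> j) a)) / (?k i * ?k j)"
    by (simp add: sum_divide_distrib)
  finally have *: "(\<Sum>a\<in>opuc_zeros. of_real (opuc_weight a) * (cnj (poly (opuc \<alpha> i) a) * poly (opuc \<alpha> j) a)) = (if i = j then 1 else 0) * (?k i * ?k j)"
    using k by (simp add: field_simps)
  show ?thesis unfolding * using opuc_norm2_pos'[OF ij(2)] by (auto simp flip: of_real_mult)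
qed

end

lemma opuc_expansion:
  assumes "degree q < j"
  shows "\<exists>c. q = (\<Sum>i<j. Polynomial.smult (c i) (opuc \<alpha> i))"
  using assms
proof (induction j arbitrary: q)
  case (Suc j)
  define r where "r = q - Polynomial.smult (coeff q j) (opuc \<alpha> j)"
  have rj: "coeff r i = 0" if "i \<ge> j" for i
    using that Suc.prems by (cases "i = j") (auto simp: r_def coeff_eq_0)
  have "\<exists>c. r = (\<Sum>i<j. Polynomial.smult (c i) (opuc \<alpha> i))"
  proof (cases "j = 0")
    case True
    hence "r = 0" using rj by (intro poly_eqI) auto
    thus ?thesis using True by simp
  next
    case False
    have "degree r \<le> j - 1" by (rule degree_le) (use rj in auto)
    thus ?thesis using False by (intro Suc.IH) simp
  qed
  then obtain c where c: "r = (\<Sum>i<j. Polynomial.smult (c i) (opuc \<alpha> i))" by blast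
  have "q = r + Polynomial.smult (coeff q j) (opuc \<alpha> j)" by (simp add: r_def)
  also have "r = (\<Sum>i<j. Polynomial.smult ((c(j := coeff q j)) i) (opuc \<alpha> i))" unfolding c by (intro sum.cong) auto
  also have "\<dots> + Polynomial.smult (coeff q j) (opuc \<alpha> j) = (\<Sum>i<Suc j. Polynomial.smult ((c(j := coeff q j)) i) (opuc \<alpha> i))" by simp
  finally show ?case by blast
qed auto

section \<open>Unitary conjugates of diagonal matrices\<close>

lemma mat_adjoint_eq:
  assumes "A \<in> carrier_mat n n"
  shows "mat_adjoint A = Matrix.mat n n (\<lambda>(i, j). cnj (A $$ (j, i)))"
  using assms by (intro eq_matI) (auto simp: mat_adjoint_def mat_of_rows_def)

definition diag_matrix :: "nat \<Rightarrow> (nat \<Rightarrow> complex) \<Rightarrow> complex mat" where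
  "diag_matrix n d = Matrix.mat n n (\<lambda>(i, j). if i = j then d i else 0)"

lemma diag_matrix_carrier [simp]: "diag_matrix n d \<in> carrier_mat n n"
  by (simp add: diag_matrix_def)

lemma diag_matrix_mult: "diag_matrix n d * diag_matrix n d' = diag_matrix n (\<lambda>i. d i * d' i)"
proof (rule eq_matI)
  fix i j assume "i < dim_row (diag_matrix n (\<lambda>i. d i * d' i))" "j < dim_col (diag_matrix n (\<lambda>i. d i * d' i))"
  hence ij: "i < n" "j < n" by (auto simp: diag_matrix_def)
  have "(diag_matrix n d * diag_matrix n d') $$ (i, j) = (\<Sum>l\<in>{0..<n}. (if i = l then d i else 0) * (if l = j then d' l else 0))"
    using ij unfolding diag_matrix_def by (simp add: scalar_prod_def)
  also have "\<dots> = (\<Sum>l\<in>{0..<n}. (if l = i then d i * (if i = j then d' i else 0) else 0))"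
    by (intro sum.cong) auto
  also have "\<dots> = d i * (if i = j then d' i else 0)" using ij by simp
  finally show "(diag_matrix n d * diag_matrix n d') $$ (i, j) = diag_matrix n (\<lambda>i. d i * d' i) $$ (i, j)"
    using ij by (simp add: diag_matrix_def)
qed (auto simp: diag_matrix_def)

lemma diag_matrix_one: "diag_matrix n (\<lambda>_. 1) = 1\<^sub>m n"
  by (intro eq_matI) (auto simp: diag_matrix_def)

context
  fixes n :: nat and V W :: "complex mat"
  assumes V: "V \<in> carrier_mat n n" and W: "W = Matrix.mat n n (\<lambda>(i, j). cnj (V $$ (j, i)))"
    and WV: "W * V = 1\<^sub>m n" and VW: "V * W = 1\<^sub>m n"
begin

lemma W_carrier: "W \<in> carrier_mat n n" by (simp add: W)

lemmas carriers = V W_carrier diag_matrix_carrier mult_carrier_mat[of _ n n _ n]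

definition conj_diag :: "(nat \<Rightarrow> complex) \<Rightarrow> complex mat" where
  "conj_diag d = W * diag_matrix n d * V"

lemma conj_diag_carrier: "conj_diag d \<in> carrier_mat n n"
  unfolding conj_diag_def by (intro carriers)

lemma conj_diag_entry:
  assumes "i < n" "j < n"
  shows "conj_diag d $$ (i, j) = (\<Sum>l<n. cnj (V $$ (l, i)) * d l * V $$ (l, j))"
proof -
  have 1: "(W * diag_matrix n d) $$ (i, l) = cnj (V $$ (l, i)) * d l" if "l < n" for l
  proof -
    have "(W * diag_matrix n d) $$ (i, l) = (\<Sum>k\<in>{0..<n}. cnj (V $$ (k, i)) * (if k = l then d k else 0))"
      using assms that by (simp add: scalar_prod_def diag_matrix_def W)
    also have "\<dots> = (\<Sum>k\<in>{0..<n}. if k = l then cnj (V $$ (l, i)) * d l else 0)"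
      by (intro sum.cong) auto
    finally have "(W * diag_matrix n d) $$ (i, l) = (\<Sum>k\<in>{0..<n}. if k = l then cnj (V $$ (l, i)) * d l else 0)" .
    thus ?thesis using that by simp
  qed
  have "conj_diag d $$ (i, j) = (\<Sum>l\<in>{0..<n}. (W * diag_matrix n d) $$ (i, l) * V $$ (l, j))"
    unfolding conj_diag_def using assms V W_carrier carrier_matD[OF carriers(4)[OF W_carrier diag_matrix_carrier[of n d]]]
    by (simp add: scalar_prod_def)
  also have "\<dots> = (\<Sum>l\<in>{0..<n}. cnj (V $$ (l, i)) * d l * V $$ (l, j))"
    by (intro sum.cong refl) (simp add: 1)
  finally show ?thesis by (simp add: lessThan_atLeast0)
qed

lemma conj_diag_mult: "conj_diag d * conj_diag d' = conj_diag (\<lambda>i. d i * d' i)"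
proof -
  note c = carriers
  note assoc = assoc_mult_mat[of _ n n _ n _ n]
  let ?A = "diag_matrix n d" and ?B = "diag_matrix n d'"
  have "conj_diag d * conj_diag d' = W * ?A * (V * (W * ?B * V))"
    unfolding conj_diag_def by (rule assoc) (intro c)+
  also have "W * ?B * V = W * (?B * V)" by (rule assoc) (intro c)+
  also have "V * (W * (?B * V)) = V * W * (?B * V)" by (rule assoc[symmetric]) (intro c)+
  also have "\<dots> = ?B * V" unfolding VW by (rule left_mult_one_mat[OF c(4)[OF c(3,1)]])
  also have "W * ?A * (?B * V) = W * ?A * ?B * V" by (rule assoc[symmetric]) (intro c)+
  also have "W * ?A * ?B = W * (?A * ?B)" by (rule assoc) (intro c)+
  finally show ?thesis by (simp add: conj_diag_def diag_matrix_mult)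
qed

lemma conj_diag_one: "conj_diag (\<lambda>_. 1) = 1\<^sub>m n"
  unfolding conj_diag_def diag_matrix_one using V W_carrier WV by simp

lemma conj_diag_pow: "conj_diag d ^\<^sub>m k = conj_diag (\<lambda>i. d i ^ k)"
proof (induction k)
  case 0
  show ?case using conj_diag_carrier[of d] by (simp add: conj_diag_one)
next
  case (Suc k)
  thus ?case by (simp add: conj_diag_mult mult.commute)
qed

lemma conj_diag_adjoint: "mat_adjoint (conj_diag d) = conj_diag (\<lambda>i. cnj (d i))"
  unfolding mat_adjoint_eq[OF conj_diag_carrier]
proof (rule eq_matI)
  fix i j assume "i < dim_row (conj_diag (\<lambda>i. cnj (d i)))" "j < dim_col (conj_diag (\<lambda>i. cnj (d i)))"
  hence "i < n" "j < n" using conj_diag_carrier[of "\<lambda>i. cnj (d i)"] by auto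
  thus "Matrix.mat n n (\<lambda>(i, j). cnj (conj_diag d $$ (j, i))) $$ (i, j) = conj_diag (\<lambda>i. cnj (d i)) $$ (i, j)"
    by (simp add: conj_diag_entry mult_ac)
qed (use conj_diag_carrier[of "\<lambda>i. cnj (d i)"] in auto)

lemma conj_diag_unitary:
  assumes "\<And>i. i < n \<Longrightarrow> cmod (d i) = 1"
  shows "conj_diag d \<in> unitary_mats n"
proof -
  have "conj_diag (\<lambda>i. cnj (d i) * d i) = conj_diag (\<lambda>_. 1)"
    unfolding conj_diag_def using assms
    by (intro arg_cong2[of _ _ _ _ "(*)"] refl) (auto simp: diag_matrix_def cnj_mult_self_unit intro!: eq_matI)
  thus ?thesis by (simp add: unitary_mats_def conj_diag_carrier conj_diag_adjoint conj_diag_mult conj_diag_one)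
qed

lemma conj_diag_char_poly: "char_poly (conj_diag d) = (\<Prod>i<n. [:- d i, 1:])"
proof -
  have "similar_mat (conj_diag d) (diag_matrix n d)"
    unfolding similar_mat_def similar_mat_wit_def
    by (rule exI[of _ W], rule exI[of _ V]) (use V W_carrier WV VW conj_diag_carrier[of d] in \<open>auto simp: conj_diag_def Let_def\<close>)
  hence "char_poly (conj_diag d) = char_poly (diag_matrix n d)" by (rule char_poly_similar)
  also have "\<dots> = (\<Prod>a\<leftarrow>diag_mat (diag_matrix n d). [:- a, 1:])"
    by (rule char_poly_upper_triangular[OF diag_matrix_carrier]) (auto simp: diag_matrix_def upper_triangular_def)
  also have "diag_mat (diag_matrix n d) = map d [0..<n]" by (auto simp: diag_mat_def diag_matrix_def)
  also have "(\<Prod>a\<leftarrow>map d [0..<n]. [:- a, 1:]) = (\<Prod>i<n. [:- d i, 1:])"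
    by (simp add: prod.list_conv_set_nth lessThan_atLeast0)
  finally show ?thesis .
qed

end

section \<open>The measure with prescribed Verblunsky coefficients\<close>

definition opuc_measure :: "nat \<Rightarrow> (nat \<Rightarrow> complex) \<Rightarrow> complex measure" where
  "opuc_measure n \<alpha> = discrete_measure (opuc_zeros n \<alpha>) (opuc_weight n \<alpha>)"

context
  fixes n m :: nat and \<alpha> :: "nat \<Rightarrow> complex"
  assumes n: "n = Suc m" and params: "verblunsky_tuple m \<alpha>"
begin

lemmas opuc_hyps = n params

lemma opuc_weight_sum: "(\<Sum>a\<in>opuc_zeros n \<alpha>. opuc_weight n \<alpha> a) = 1"
proof -
  have "complex_of_real (\<Sum>a\<in>opuc_zeros n \<alpha>. opuc_weight n \<alpha> a) = 1"
    using opuc_orthogonal[OF opuc_hyps, of 0 0] n by (simp add: opuc_norm2_def)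
  thus ?thesis by (simp only: of_real_eq_1_iff)
qed

lemma opuc_measure_props:
  shows "supported_at n (opuc_measure n \<alpha>)" and "atoms (opuc_measure n \<alpha>) = opuc_zeros n \<alpha>"
    and "a \<in> opuc_zeros n \<alpha> \<Longrightarrow> measure (opuc_measure n \<alpha>) {a} = opuc_weight n \<alpha> a"
proof -
  note fin = finite_opuc_zeros[OF opuc_hyps]
  have pos: "opuc_weight n \<alpha> a > 0" for a by (rule opuc_weight_pos[OF opuc_hyps])
  have eq: "{a \<in> opuc_zeros n \<alpha>. opuc_weight n \<alpha> a > 0} = opuc_zeros n \<alpha>" using pos by auto
  show "atoms (opuc_measure n \<alpha>) = opuc_zeros n \<alpha>" unfolding opuc_measure_def
    by (subst atoms_discrete_measure[OF fin]) (use pos in \<open>auto intro: less_imp_le\<close>)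
  have "opuc_zeros n \<alpha> \<subseteq> sphere 0 1" using opuc_zeros_on_circle[OF opuc_hyps] by auto
  thus "supported_at n (opuc_measure n \<alpha>)"
    using supported_at_discrete_measure[OF fin, of "opuc_weight n \<alpha>"] pos opuc_weight_sum
    unfolding opuc_measure_def by (simp add: card_opuc_zeros[OF opuc_hyps] less_imp_le)
  show "a \<in> opuc_zeros n \<alpha> \<Longrightarrow> measure (opuc_measure n \<alpha>) {a} = opuc_weight n \<alpha> a"
    unfolding opuc_measure_def by (subst measure_discrete_measure[OF fin]) (use pos in \<open>auto intro: less_imp_le\<close>)
qed

lemma L2_inner_opuc_measure:
  "L2_inner (opuc_measure n \<alpha>) p q = (\<Sum>a\<in>opuc_zeros n \<alpha>. of_real (opuc_weight n \<alpha> a) * (cnj (poly p a) * poly q a))"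
  unfolding L2_inner_supported_at[OF opuc_measure_props(1)] opuc_measure_props(2)
  by (intro sum.cong refl) (simp add: opuc_measure_props(3))

lemma L2_inner_opuc: "i < n \<Longrightarrow> j < n \<Longrightarrow>
   L2_inner (opuc_measure n \<alpha>) (opuc \<alpha> i) (opuc \<alpha> j) = (if i = j then of_real (opuc_norm2 \<alpha> j) else 0)"
  unfolding L2_inner_opuc_measure by (rule opuc_orthogonal[OF opuc_hyps])

lemma opuc_monic_orthogonal:
  assumes j: "j < n"
  shows "monic_orthogonal (opuc_measure n \<alpha>) j (opuc \<alpha> j)"
  unfolding monic_orthogonal_def
proof (intro conjI allI impI)
  fix q :: "complex poly" assume "degree q < j"
  then obtain c where c: "q = (\<Sum>i<j. Polynomial.smult (c i) (opuc \<alpha> i))" using opuc_expansion by blast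
  show "L2_inner (opuc_measure n \<alpha>) q (opuc \<alpha> j) = 0"
    unfolding c L2_inner_linear[OF opuc_measure_props(1)] using j
    by (intro sum.neutral ballI) (simp add: L2_inner_opuc)
qed simp_all

lemma Phi_opuc_measure:
  assumes "j \<le> n"
  shows "Phi (opuc_measure n \<alpha>) j = opuc \<alpha> j"
proof (cases "j = n")
  case True
  thus ?thesis using opuc_factorization[OF opuc_hyps]
    by (simp add: Phi_def opuc_measure_props(2) card_opuc_zeros[OF opuc_hyps])
next
  case False
  thus ?thesis using Phi_eqI[OF opuc_measure_props(1) _ opuc_monic_orthogonal] assms by simp
qed

lemma has_verblunsky_opuc_measure: "has_verblunsky n (opuc_measure n \<alpha>) \<alpha>"
  unfolding has_verblunsky_def by (auto simp: Phi_opuc_measure)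

text \<open>The coefficients determine all \<open>Phi\<close>, hence the atoms, as zeros of the last
  one. Both measures have mass 1 and annihilate the polynomials of index 1 to n - 1, so the
  difference of their weights kills every polynomial of degree below n.\<close>

lemma verblunsky_measure_unique:
  assumes s: "supported_at n \<mu>" and v: "has_verblunsky n \<mu> \<alpha>"
  shows "\<mu> = opuc_measure n \<alpha>"
proof -
  have P0: "Phi \<mu> 0 = 1" by (simp add: Phi_eq_szego[OF s])
  have P: "Phi \<mu> j = opuc \<alpha> j" if "j \<le> n" for j
    using that by (induction j) (use v in \<open>auto simp: P0 has_verblunsky_def\<close>)
  have card: "card (atoms \<mu>) = n" "finite (atoms \<mu>)" using s by (auto simp: supported_at_def)
  have "opuc \<alpha> n = (\<Prod>a\<in>atoms \<mu>. [:- a, 1:])" using P[of n] by (simp add: Phi_def card)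
  hence at: "atoms \<mu> = opuc_zeros n \<alpha>"
    using card by (auto simp: opuc_zeros_def[OF opuc_hyps] poly_prod)
  let ?w = "opuc_weight n \<alpha>"
  define D where "D = (\<lambda>p. \<Sum>a\<in>opuc_zeros n \<alpha>. complex_of_real (measure \<mu> {a} - ?w a) * poly p a)"
  have inner: "L2_inner \<mu> 1 (opuc \<alpha> j) = L2_inner (opuc_measure n \<alpha>) 1 (opuc \<alpha> j)" if "j < n" for j
  proof (cases "j = 0")
    case True
    have "complex_of_real (\<Sum>a\<in>atoms \<mu>. measure \<mu> {a}) = 1"
      using finite_support_eq_discrete_measure(2)[of \<mu> "atoms \<mu>"] s by (auto simp: supported_at_def circle_prob_def)
    thus ?thesis using True L2_inner_opuc[of 0 0] n
      by (simp add: L2_inner_supported_at[OF s] opuc_norm2_def)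
  next
    case False
    have "monic_orthogonal \<mu> j (opuc \<alpha> j)"
      using szego_monic_orthogonal[OF s, of j] that P[of j] Phi_eq_szego[OF s, of j] by simp
    hence "L2_inner \<mu> 1 (opuc \<alpha> j) = 0" using False by (simp add: monic_orthogonal_def)
    moreover have "L2_inner (opuc_measure n \<alpha>) 1 (opuc \<alpha> j) = 0"
      using opuc_monic_orthogonal[OF that] False by (simp add: monic_orthogonal_def)
    ultimately show ?thesis by simp
  qed
  have D0: "D (opuc \<alpha> j) = 0" if "j < n" for j
    using inner[OF that] unfolding L2_inner_supported_at[OF s] L2_inner_opuc_measure at D_def
    by (simp add: algebra_simps sum_subtractf)
  have Dq: "D q = 0" if "degree q < n" for q
  proof -
    obtain c where c: "q = (\<Sum>i<n. Polynomial.smult (c i) (opuc \<alpha> i))" using opuc_expansion[OF \<open>degree q < n\<close>] by blast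
    have "D q = (\<Sum>a\<in>opuc_zeros n \<alpha>. \<Sum>i<n. c i * (complex_of_real (measure \<mu> {a} - ?w a) * poly (opuc \<alpha> i) a))"
      unfolding D_def c poly_sum sum_distrib_left by (intro sum.cong refl) (simp add: mult_ac)
    also have "\<dots> = (\<Sum>i<n. c i * D (opuc \<alpha> i))"
      unfolding D_def sum_distrib_left by (rule sum.swap)
    also have "\<dots> = 0" by (simp add: D0)
    finally show ?thesis .
  qed
  have w: "measure \<mu> {a} = ?w a" if a: "a \<in> opuc_zeros n \<alpha>" for a
  proof -
    \<comment> \<open>The Lagrange polynomial of the node a has degree n - 1, just below the bound
      in \<open>Dq\<close>, and sees only the weight at a.\<close>
    define L where "L = (\<Prod>b\<in>opuc_zeros n \<alpha> - {a}. [:- b, 1:])"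
    have fin: "finite (opuc_zeros n \<alpha>)" using card at by simp
    have "degree L = card (opuc_zeros n \<alpha> - {a})" unfolding L_def by (subst degree_prod_eq_sum_degree) auto
    hence "degree L < n" using a card at n by simp
    hence "D L = 0" by (rule Dq)
    moreover have "D L = complex_of_real (measure \<mu> {a} - ?w a) * poly L a"
      unfolding D_def using fin a by (subst sum.remove[OF fin a]) (auto simp: L_def poly_prod intro!: sum.neutral prod_zero)
    moreover have "poly L a \<noteq> 0" using fin by (auto simp: L_def poly_prod)
    ultimately show ?thesis by (simp del: of_real_diff)
  qed
  have "\<mu> = discrete_measure (atoms \<mu>) (\<lambda>a. measure \<mu> {a})"
    by (rule finite_support_eq_discrete_measure(1)) (use s in \<open>auto simp: supported_at_def circle_prob_def\<close>)
  also have "\<dots> = opuc_measure n \<alpha>"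
    unfolding opuc_measure_def at
  proof (rule measure_eqI)
    fix A assume "A \<in> sets (discrete_measure (opuc_zeros n \<alpha>) (\<lambda>a. measure \<mu> {a}))"
    hence A: "A \<in> sets borel" by simp
    have fin: "finite (opuc_zeros n \<alpha>)" using card at by simp
    show "emeasure (discrete_measure (opuc_zeros n \<alpha>) (\<lambda>a. measure \<mu> {a})) A = emeasure (discrete_measure (opuc_zeros n \<alpha>) ?w) A"
      using w opuc_weight_pos[OF opuc_hyps]
      by (subst (1 2) emeasure_discrete_measure[OF fin _ A]) (auto intro!: arg_cong[of _ _ ennreal] sum.cong less_imp_le)
  qed simp
  finally show ?thesis .
qed

lemma verblunsky_measure_eq: "verblunsky_measure n \<alpha> = opuc_measure n \<alpha>"
  unfolding verblunsky_measure_def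
proof (rule the_equality)
  show "supported_at n (opuc_measure n \<alpha>) \<and> has_verblunsky n (opuc_measure n \<alpha>) \<alpha>"
    using opuc_measure_props(1) has_verblunsky_opuc_measure by blast
  show "\<mu> = opuc_measure n \<alpha>" if "supported_at n \<mu> \<and> has_verblunsky n \<mu> \<alpha>" for \<mu>
    using that by (elim conjE) (rule verblunsky_measure_unique)
qed

end

subsection \<open>GGT matrices\<close>

lemma poly_eq_sum_le:
  fixes p :: "complex poly"
  assumes "degree p \<le> N"
  shows "poly p z = (\<Sum>i\<le>N. coeff p i * z ^ i)"
  unfolding poly_altdef by (rule sum.mono_neutral_left) (use assms in \<open>auto simp: coeff_eq_0\<close>)

lemma circle_prob_integrable:
  fixes g :: "complex \<Rightarrow> complex"
  assumes \<mu>: "circle_prob \<mu>" and g: "g \<in> borel_measurable borel" and b: "\<And>z. cmod z = 1 \<Longrightarrow> cmod (g z) \<le> B"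
  shows "integrable \<mu> g"
proof -
  interpret prob_space \<mu> using \<mu> by (simp add: circle_prob_def)
  show ?thesis
    by (rule integrable_const_bound[of _ B])
       (use \<mu> g b in \<open>auto simp: circle_prob_def cong: measurable_cong_sets elim!: eventually_mono\<close>)
qed

text \<open>On the circle cnj z is 1 / z, so an inner product of polynomials is a finite combination
  of moments. Uniqueness of spectral measures and the measurability results both rest on
  this.\<close>

lemma L2_inner_moments:
  assumes \<mu>: "circle_prob \<mu>" and d: "degree p \<le> N" "degree q \<le> N"
  shows "L2_inner \<mu> p q = (\<Sum>i\<le>N. \<Sum>j\<le>N. cnj (coeff p i) * coeff q j * (\<integral>z. z powi (int j - int i) \<partial>\<mu>))"
proof -
  have st: "sets \<mu> = sets borel" using \<mu> by (simp add: circle_prob_def)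
  have pm: "(\<lambda>z::complex. z powi k) \<in> borel_measurable borel" for k :: int
    by (cases "0 \<le> k"; simp add: power_int_def, measurable)
  have int: "integrable \<mu> (\<lambda>z. z powi k)" for k :: int
    by (rule circle_prob_integrable[OF \<mu> pm, of _ 1]) (simp add: norm_power_int)
  have p: "poly p z = (\<Sum>i\<le>N. coeff p i * z ^ i)" for z by (rule poly_eq_sum_le) (rule d)
  have q: "poly q z = (\<Sum>i\<le>N. coeff q i * z ^ i)" for z by (rule poly_eq_sum_le) (rule d)
  have "L2_inner \<mu> p q = (\<integral>z. (\<Sum>i\<le>N. \<Sum>j\<le>N. cnj (coeff p i) * coeff q j * z powi (int j - int i)) \<partial>\<mu>)"
    unfolding L2_inner_def
  proof (rule integral_cong_AE)
    show "(\<lambda>z. cnj (poly p z) * poly q z) \<in> borel_measurable \<mu>"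
      using st by (simp cong: measurable_cong_sets)
    show "(\<lambda>z. \<Sum>i\<le>N. \<Sum>j\<le>N. cnj (coeff p i) * coeff q j * z powi (int j - int i)) \<in> borel_measurable \<mu>"
      using int by (intro borel_measurable_sum borel_measurable_times borel_measurable_const borel_measurable_integrable)
    have "AE z in \<mu>. cmod z = 1" using \<mu> by (auto simp: circle_prob_def elim!: eventually_mono)
    thus "AE z in \<mu>. cnj (poly p z) * poly q z = (\<Sum>i\<le>N. \<Sum>j\<le>N. cnj (coeff p i) * coeff q j * z powi (int j - int i))"
    proof eventually_elim
      case (elim z)
      have z0: "z \<noteq> 0" using elim by auto
      have cz: "cnj z = inverse z" using cnj_mult_self_unit[OF elim] by (metis inverse_unique mult.commute)
      have "cnj (z ^ i) * z ^ j = z powi (int j - int i)" for i j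
        using z0 by (simp add: cz power_int_diff field_simps power_inverse)
      hence e: "cnj (coeff p i * z ^ i) * (coeff q j * z ^ j) = cnj (coeff p i) * coeff q j * z powi (int j - int i)" for i j
        by (metis (no_types, opaque_lifting) complex_cnj_mult mult.assoc mult.left_commute)
      show ?case unfolding p q cnj_sum sum_product by (intro sum.cong refl) (rule e)
    qed
  qed
  also have "\<dots> = (\<Sum>i\<le>N. \<Sum>j\<le>N. cnj (coeff p i) * coeff q j * (\<integral>z. z powi (int j - int i) \<partial>\<mu>))"
    using int by (simp add: Bochner_Integration.integral_sum)
  finally show ?thesis .
qed

text \<open>The support of \<mu>' is found rather than assumed: the polynomial vanishing on S has
  norm zero under \<mu>, hence under \<mu>', because norms depend on the moments only. Lagrange
  polynomials then compare the weights.\<close>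

lemma circle_moments_unique:
  assumes \<mu>: "circle_prob \<mu>" and \<mu>': "circle_prob \<mu>'" and fin: "finite S" and ae: "AE z in \<mu>. z \<in> S"
    and eq: "\<And>k. (\<integral>z. z powi k \<partial>\<mu>) = (\<integral>z. z powi k \<partial>\<mu>')"
  shows "\<mu>' = \<mu>"
proof -
  have L: "L2_inner \<mu> p q = L2_inner \<mu>' p q" for p q
    by (subst (1 2) L2_inner_moments[where N = "max (degree p) (degree q)"]) (auto simp: eq \<mu> \<mu>')
  have st: "sets \<mu> = sets borel" "sets \<mu>' = sets borel" "prob_space \<mu>" "prob_space \<mu>'"
    using \<mu> \<mu>' by (auto simp: circle_prob_def)
  define N where "N = (\<Prod>a\<in>S. [:- a, 1:])"
  have N: "poly N z = 0 \<longleftrightarrow> z \<in> S" for z using fin by (auto simp: N_def poly_prod)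
  have "L2_inner \<mu> N N = (\<integral>z. 0 \<partial>\<mu>)" unfolding L2_inner_def
    by (rule integral_cong_AE) (use ae N st in \<open>auto cong: measurable_cong_sets elim!: eventually_mono\<close>)
  hence "L2_inner \<mu>' N N = 0" using L by simp
  moreover have "L2_inner \<mu>' N N = of_real (\<integral>z. (cmod (poly N z))\<^sup>2 \<partial>\<mu>')"
    unfolding L2_inner_def integral_complex_of_real[symmetric] complex_norm_square by (simp add: mult.commute)
  ultimately have 0: "(\<integral>z. (cmod (poly N z))\<^sup>2 \<partial>\<mu>') = 0" by simp
  obtain B where B: "\<And>z. cmod z = 1 \<Longrightarrow> cmod (poly N z) \<le> B"
  proof -
    have "compact (poly N ` sphere 0 1)" by (intro compact_continuous_image continuous_intros compact_sphere)
    then obtain B where "\<And>x. x \<in> poly N ` sphere 0 1 \<Longrightarrow> cmod x \<le> B" using compact_imp_bounded bounded_iff by metis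
    thus thesis by (intro that[of B]) auto
  qed
  have "integrable \<mu>' (\<lambda>z. complex_of_real ((cmod (poly N z))\<^sup>2))"
    by (rule circle_prob_integrable[OF \<mu>', of _ "B\<^sup>2"]) (auto simp: norm_power intro!: power_mono B)
  hence "integrable \<mu>' (\<lambda>z. (cmod (poly N z))\<^sup>2)" using integrable_Re by fastforce
  hence "AE z in \<mu>'. (cmod (poly N z))\<^sup>2 = 0" using 0 by (subst (asm) integral_nonneg_eq_0_iff_AE) auto
  hence ae': "AE z in \<mu>'. z \<in> S" by eventually_elim (simp add: N)
  have D: "\<mu> = discrete_measure S (\<lambda>a. measure \<mu> {a})" "\<mu>' = discrete_measure S (\<lambda>a. measure \<mu>' {a})"
    using finite_support_eq_discrete_measure(1) st fin ae ae' by blast+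
  have I: "L2_inner \<nu> p q = (\<Sum>a\<in>S. of_real (measure \<nu> {a}) * (cnj (poly p a) * poly q a))"
    if "\<nu> = discrete_measure S (\<lambda>a. measure \<nu> {a})" for \<nu> p q
  proof -
    have "L2_inner \<nu> p q = L2_inner (discrete_measure S (\<lambda>a. measure \<nu> {a})) p q" by (rule arg_cong[OF that])
    thus ?thesis unfolding L2_inner_def
      by (subst (asm) integral_discrete_measure) (use fin in \<open>auto simp: scaleR_conv_of_real\<close>)
  qed
  have w: "measure \<mu> {a} = measure \<mu>' {a}" if a: "a \<in> S" for a
  proof -
    define L where "L = (\<Prod>b\<in>S - {a}. [:- b, 1:])"
    have La: "poly L a \<noteq> 0" using fin by (auto simp: L_def poly_prod)
    have "L2_inner \<nu> 1 L = of_real (measure \<nu> {a}) * poly L a" if "\<nu> = discrete_measure S (\<lambda>a. measure \<nu> {a})" for \<nu>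
      unfolding I[OF that] using fin a
      by (subst sum.remove[OF fin a]) (auto simp: L_def poly_prod intro!: sum.neutral prod_zero)
    from this[OF D(1)] this[OF D(2)] show ?thesis using L[of 1 L] La by simp
  qed
  show ?thesis
  proof (rule measure_eqI)
    fix A assume "A \<in> sets \<mu>'"
    hence A: "A \<in> sets borel" using st by simp
    have E: "emeasure \<nu> A = ennreal (\<Sum>a\<in>S \<inter> A. measure \<nu> {a})" if "\<nu> = discrete_measure S (\<lambda>a. measure \<nu> {a})" for \<nu>
    proof -
      have "emeasure \<nu> A = emeasure (discrete_measure S (\<lambda>a. measure \<nu> {a})) A" by (rule arg_cong[OF that])
      thus ?thesis using fin A by (simp add: emeasure_discrete_measure)
    qed
    show "emeasure \<mu>' A = emeasure \<mu> A" unfolding E[OF D(1)] E[OF D(2)] using w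
      by (intro arg_cong[of _ _ ennreal] sum.cong) auto
  qed (use st in auto)
qed

lemma index_0_0_inner:
  fixes A :: "complex mat"
  assumes "A \<in> carrier_mat n n" "n > 0"
  shows "(A *\<^sub>v unit_vec n 0) \<bullet>c unit_vec n 0 = A $$ (0, 0)"
proof -
  have "conjugate (unit_vec n 0 :: complex vec) = unit_vec n 0" by (intro eq_vecI) (auto simp: unit_vec_def)
  thus ?thesis using assms by simp
qed

lemma spectral_measure_eqI:
  assumes A: "A \<in> carrier_mat n n" and n: "n > 0" and \<mu>: "circle_prob \<mu>" and fin: "finite S" and ae: "AE z in \<mu>. z \<in> S"
    and eq: "\<And>k. unitary_powi A k $$ (0, 0) = (\<integral>z. z powi k \<partial>\<mu>)"
  shows "spectral_measure A = \<mu>"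
proof -
  have dim: "dim_row A = n" using A by simp
  have carr: "unitary_powi A k \<in> carrier_mat n n" for k
    unfolding unitary_powi_def using A by (auto simp: mat_adjoint_eq intro!: pow_carrier_mat)
  show ?thesis unfolding spectral_measure_def dim index_0_0_inner[OF carr n]
  proof (rule the_equality)
    show "circle_prob \<mu> \<and> (\<forall>k. unitary_powi A k $$ (0, 0) = (\<integral>z. z powi k \<partial>\<mu>))" using \<mu> eq by blast
    fix \<mu>' assume "circle_prob \<mu>' \<and> (\<forall>k. unitary_powi A k $$ (0, 0) = (\<integral>z. z powi k \<partial>\<mu>'))"
    thus "\<mu>' = \<mu>" using circle_moments_unique[OF \<mu> _ fin ae] eq by simp
  qed
qed

text \<open>The measure-free form of \<open>deformed_verblunsky\<close>, from the recursion at 1,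
  where the reversal of p takes the value \<open>cnj (poly p 1)\<close>.\<close>

definition opuc_gamma :: "(nat \<Rightarrow> complex) \<Rightarrow> nat \<Rightarrow> complex" where
  "opuc_gamma \<alpha> k = cnj (\<alpha> k) * (cnj (poly (opuc \<alpha> k) 1) / poly (opuc \<alpha> k) 1)"

context
  fixes n m :: nat and \<alpha> :: "nat \<Rightarrow> complex"
  assumes n: "n = Suc m" and params: "verblunsky_tuple m \<alpha>"
begin

lemma L2_norm_opuc: "j < n \<Longrightarrow> L2_norm (opuc_measure n \<alpha>) (opuc \<alpha> j) = sqrt (opuc_norm2 \<alpha> j)"
proof -
  assume j: "j < n"
  have "complex_of_real (\<integral>z. (cmod (poly (opuc \<alpha> j) z))\<^sup>2 \<partial>opuc_measure n \<alpha>) = L2_inner (opuc_measure n \<alpha>) (opuc \<alpha> j) (opuc \<alpha> j)"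
    unfolding L2_inner_def integral_complex_of_real[symmetric] complex_norm_square by (simp add: mult.commute)
  also have "\<dots> = of_real (opuc_norm2 \<alpha> j)" using L2_inner_opuc[OF n params j j] by simp
  finally show ?thesis unfolding L2_norm_def by (simp only: of_real_eq_iff)
qed

lemmas opuc_mat_facts = opuc_mat_carrier(1)[OF n params] opuc_mat_adj_def[OF n params] opuc_mat_adj_mult[OF n params] opuc_mat_mult_adj[OF n params]

text \<open>Multiplication by z is diagonal in the basis of normalized indicator functions of the
  atoms; \<open>opuc_mat\<close> is the change of basis from the orthonormal polynomials.\<close>

lemma GGT_eq_conj_diag: "GGT n \<alpha> = conj_diag n (opuc_mat n \<alpha>) (opuc_mat_adj n \<alpha>) (opuc_enum n \<alpha>)"
proof (rule eq_matI)
  let ?\<mu> = "opuc_measure n \<alpha>" and ?C = "conj_diag n (opuc_mat n \<alpha>) (opuc_mat_adj n \<alpha>) (opuc_enum n \<alpha>)"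
  have C: "?C \<in> carrier_mat n n" by (rule conj_diag_carrier[OF opuc_mat_facts])
  thus "dim_row (GGT n \<alpha>) = dim_row ?C" "dim_col (GGT n \<alpha>) = dim_col ?C" by (auto simp: GGT_def Let_def)
  fix i j assume "i < dim_row ?C" "j < dim_col ?C"
  hence ij: "i < n" "j < n" using C by auto
  let ?e = "opuc_enum n \<alpha>" and ?w = "opuc_weight n \<alpha>"
  let ?ph = "\<lambda>j. Polynomial.smult (of_real (inverse (L2_norm ?\<mu> (Phi ?\<mu> j)))) (Phi ?\<mu> j)"
  have V: "opuc_mat n \<alpha> $$ (l, j) = of_real (sqrt (?w (?e l))) * poly (?ph j) (?e l)" if "l < n" "j < n" for l j
    using that by (simp add: opuc_mat_def[OF n params] Phi_opuc_measure[OF n params] L2_norm_opuc real_sqrt_divide field_simps)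
  have "GGT n \<alpha> $$ (i, j) = L2_inner ?\<mu> (?ph i) (pCons 0 (?ph j))"
    using ij by (simp add: GGT_def Let_def verblunsky_measure_eq[OF n params])
  also have "\<dots> = (\<Sum>a\<in>opuc_zeros n \<alpha>. of_real (?w a) * (cnj (poly (?ph i) a) * (a * poly (?ph j) a)))"
    unfolding L2_inner_opuc_measure[OF n params] poly_pCons add_0 ..
  also have "\<dots> = (\<Sum>l<n. of_real (?w (?e l)) * (cnj (poly (?ph i) (?e l)) * (?e l * poly (?ph j) (?e l))))"
    by (rule sum.reindex_bij_betw[OF opuc_enum[OF n params], symmetric])
  also have "\<dots> = (\<Sum>l<n. cnj (opuc_mat n \<alpha> $$ (l, i)) * ?e l * opuc_mat n \<alpha> $$ (l, j))"
  proof (rule sum.cong[OF refl])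
    fix l assume "l \<in> {..<n}"
    hence l: "l < n" by simp
    have "complex_of_real (?w (?e l)) = of_real (sqrt (?w (?e l))) * of_real (sqrt (?w (?e l)))"
      using opuc_weight_pos[OF n params, of "?e l"] by (simp flip: of_real_mult)
    thus "of_real (?w (?e l)) * (cnj (poly (?ph i) (?e l)) * (?e l * poly (?ph j) (?e l))) = cnj (opuc_mat n \<alpha> $$ (l, i)) * ?e l * opuc_mat n \<alpha> $$ (l, j)"
      unfolding V[OF l ij(1)] V[OF l ij(2)] by (simp add: mult_ac)
  qed
  also have "\<dots> = ?C $$ (i, j)" by (rule conj_diag_entry[OF opuc_mat_facts ij, symmetric])
  finally show "GGT n \<alpha> $$ (i, j) = ?C $$ (i, j)" .
qed

lemma opuc_enum_unit: "l < n \<Longrightarrow> cmod (opuc_enum n \<alpha> l) = 1"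
  using opuc_enum[OF n params] opuc_zeros_on_circle[OF n params] by (auto simp: bij_betw_def)

lemma GGT_unitary: "GGT n \<alpha> \<in> unitary_mats n"
  unfolding GGT_eq_conj_diag by (rule conj_diag_unitary[OF opuc_mat_facts opuc_enum_unit])

text \<open>\<open>opuc \<alpha> 0\<close> is 1, so column 0 of \<open>opuc_mat\<close> consists of
  the square roots of the weights: the first basis vector is the constant function 1, and its
  moments are those of the measure.\<close>

lemma spectral_measure_GGT: "spectral_measure (GGT n \<alpha>) = opuc_measure n \<alpha>"
proof (rule spectral_measure_eqI)
  let ?V = "opuc_mat n \<alpha>" and ?W = "opuc_mat_adj n \<alpha>" and ?e = "opuc_enum n \<alpha>"
  show "GGT n \<alpha> \<in> carrier_mat n n" using GGT_unitary by (simp add: unitary_mats_def)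
  show n0: "0 < n" using n by simp
  note s = opuc_measure_props(1)[OF n params]
  show "circle_prob (opuc_measure n \<alpha>)" "finite (atoms (opuc_measure n \<alpha>))" "AE z in opuc_measure n \<alpha>. z \<in> atoms (opuc_measure n \<alpha>)"
    using s by (auto simp: supported_at_def)
  fix k :: int
  have "unitary_powi (GGT n \<alpha>) k = conj_diag n ?V ?W (\<lambda>l. if 0 \<le> k then ?e l ^ nat k else cnj (?e l) ^ nat (- k))"
    unfolding unitary_powi_def GGT_eq_conj_diag conj_diag_adjoint[OF opuc_mat_facts] conj_diag_pow[OF opuc_mat_facts] by simp
  hence "unitary_powi (GGT n \<alpha>) k $$ (0, 0) = (\<Sum>l<n. cnj (?V $$ (l, 0)) * (if 0 \<le> k then ?e l ^ nat k else cnj (?e l) ^ nat (- k)) * ?V $$ (l, 0))"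
    by (simp only: conj_diag_entry[OF opuc_mat_facts n0 n0])
  also have "\<dots> = (\<Sum>l<n. of_real (opuc_weight n \<alpha> (?e l)) * (?e l) powi k)"
  proof (rule sum.cong[OF refl])
    fix l assume "l \<in> {..<n}"
    hence l: "l < n" by simp
    have V: "?V $$ (l, 0) = of_real (sqrt (opuc_weight n \<alpha> (?e l)))"
      using l n0 by (simp add: opuc_mat_def[OF n params] opuc_norm2_def)
    have w: "complex_of_real (opuc_weight n \<alpha> (?e l)) = of_real (sqrt (opuc_weight n \<alpha> (?e l))) * of_real (sqrt (opuc_weight n \<alpha> (?e l)))"
      using opuc_weight_pos[OF n params, of "?e l"] by (simp flip: of_real_mult)
    have "cnj (?e l) = inverse (?e l)"
      using cnj_mult_self_unit[OF opuc_enum_unit[OF l]] by (metis inverse_unique mult.commute)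
    hence "(if 0 \<le> k then ?e l ^ nat k else cnj (?e l) ^ nat (- k)) = ?e l powi k" by (simp add: power_int_def)
    thus "cnj (?V $$ (l, 0)) * (if 0 \<le> k then ?e l ^ nat k else cnj (?e l) ^ nat (- k)) * ?V $$ (l, 0) = of_real (opuc_weight n \<alpha> (?e l)) * (?e l) powi k"
      unfolding V w by simp
  qed
  also have "\<dots> = (\<Sum>a\<in>opuc_zeros n \<alpha>. of_real (opuc_weight n \<alpha> a) * a powi k)"
    by (rule sum.reindex_bij_betw[OF opuc_enum[OF n params]])
  also have "\<dots> = (\<integral>z. z powi k \<partial>opuc_measure n \<alpha>)"
    by (subst integral_supported_at[OF s])
       (auto simp: opuc_measure_props[OF n params] power_int_def)
  finally show "unitary_powi (GGT n \<alpha>) k $$ (0, 0) = (\<integral>z. z powi k \<partial>opuc_measure n \<alpha>)" .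
qed

lemma proots_char_poly_GGT: "proots (char_poly (GGT n \<alpha>)) = mset_set (opuc_zeros n \<alpha>)"
proof -
  have fin: "finite (opuc_zeros n \<alpha>)" by (rule finite_opuc_zeros[OF n params])
  have "char_poly (GGT n \<alpha>) = (\<Prod>l<n. [:- opuc_enum n \<alpha> l, 1:])"
    unfolding GGT_eq_conj_diag by (rule conj_diag_char_poly[OF opuc_mat_facts])
  also have "\<dots> = (\<Prod>a\<in>opuc_zeros n \<alpha>. [:- a, 1:])" by (rule prod.reindex_bij_betw[OF opuc_enum[OF n params]])
  also have "proots \<dots> = mset_set (opuc_zeros n \<alpha>)"
    by (subst proots_prod) (auto simp: sum_multiset_singleton)
  finally show ?thesis .
qed

lemma det_delta_GGT:
  "det_delta \<delta> (GGT n \<alpha>) = (\<Prod>a\<in>opuc_zeros n \<alpha>. (1 - a) powr cnj \<delta> * (1 - cnj a) powr \<delta>)"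
  unfolding det_delta_def proots_char_poly_GGT by (simp add: prod_unfold_prod_mset)

lemma det_one_minus_GGT: "Determinant.det (1\<^sub>m n - GGT n \<alpha>) = poly (opuc \<alpha> n) 1"
proof -
  let ?V = "opuc_mat n \<alpha>" and ?W = "opuc_mat_adj n \<alpha>" and ?e = "opuc_enum n \<alpha>"
  have W: "?W \<in> carrier_mat n n" by (rule W_carrier[OF opuc_mat_facts])
  note c = conj_diag_carrier[OF opuc_mat_facts]
  have "1\<^sub>m n - GGT n \<alpha> = conj_diag n ?V ?W (\<lambda>l. 1 - ?e l)"
  proof (rule eq_matI)
    fix i j assume "i < dim_row (conj_diag n ?V ?W (\<lambda>l. 1 - ?e l))" "j < dim_col (conj_diag n ?V ?W (\<lambda>l. 1 - ?e l))"
    hence ij: "i < n" "j < n" using c[of "\<lambda>l. 1 - ?e l"] by auto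
    have "(1\<^sub>m n - GGT n \<alpha>) $$ (i, j) = conj_diag n ?V ?W (\<lambda>_. 1) $$ (i, j) - conj_diag n ?V ?W ?e $$ (i, j)"
      using ij c[of ?e] by (simp add: conj_diag_one[OF opuc_mat_facts] GGT_eq_conj_diag)
    thus "(1\<^sub>m n - GGT n \<alpha>) $$ (i, j) = conj_diag n ?V ?W (\<lambda>l. 1 - ?e l) $$ (i, j)"
      using ij by (simp add: conj_diag_entry[OF opuc_mat_facts] algebra_simps sum_subtractf)
  qed (use c[of "\<lambda>l. 1 - ?e l"] c[of ?e] in \<open>auto simp: GGT_eq_conj_diag\<close>)
  also have "Determinant.det \<dots> = Determinant.det ?W * Determinant.det (diag_matrix n (\<lambda>l. 1 - ?e l)) * Determinant.det ?V"
    unfolding conj_diag_def[OF opuc_mat_facts] using W opuc_mat_facts(1)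
    by (subst det_mult[of _ n]; (subst det_mult[of _ n])?) auto
  also have "\<dots> = (Determinant.det ?W * Determinant.det ?V) * Determinant.det (diag_matrix n (\<lambda>l. 1 - ?e l))" by simp
  also have "Determinant.det ?W * Determinant.det ?V = 1"
    using det_mult[OF W opuc_mat_facts(1)] opuc_mat_facts(3) by simp
  also have "Determinant.det (diag_matrix n (\<lambda>l. 1 - ?e l)) = (\<Prod>l<n. 1 - ?e l)"
    by (subst det_upper_triangular[OF _ diag_matrix_carrier])
       (auto simp: diag_matrix_def upper_triangular_def diag_mat_def prod.list_conv_set_nth lessThan_atLeast0)
  also have "\<dots> = (\<Prod>a\<in>opuc_zeros n \<alpha>. 1 - a)" by (rule prod.reindex_bij_betw[OF opuc_enum[OF n params]])
  also have "\<dots> = poly (\<Prod>a\<in>opuc_zeros n \<alpha>. [:- a, 1:]) 1" by (simp add: poly_prod)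
  finally show ?thesis by (simp add: opuc_factorization[OF n params])
qed

text \<open>Up to index m the subtracted term has strictly smaller modulus, because |alpha_k| < 1
  for k < m. At index n the value may vanish, namely when 1 is an eigenvalue.\<close>

lemma poly_opuc_1_nz: "k \<le> m \<Longrightarrow> poly (opuc \<alpha> k) 1 \<noteq> 0"
proof (induction k)
  case (Suc k)
  have "cmod (\<alpha> k) < 1" using params Suc.prems by (simp add: verblunsky_tuple_def)
  hence lt: "cmod (cnj (\<alpha> k) * cnj (poly (opuc \<alpha> k) 1)) < cmod (poly (opuc \<alpha> k) 1)"
    using Suc by (simp add: norm_mult)
  have "poly (opuc \<alpha> (Suc k)) 1 = poly (opuc \<alpha> k) 1 - cnj (\<alpha> k) * cnj (poly (opuc \<alpha> k) 1)"
    by (simp add: poly_reversed_unit)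
  thus ?case using lt by (metis less_irrefl right_minus_eq)
qed auto

lemma opuc_Suc_1: "k \<le> m \<Longrightarrow> poly (opuc \<alpha> (Suc k)) 1 = poly (opuc \<alpha> k) 1 * (1 - opuc_gamma \<alpha> k)"
  using poly_opuc_1_nz[of k] by (simp add: poly_reversed_unit opuc_gamma_def field_simps)

lemma deformed_verblunsky_opuc: "k < n \<Longrightarrow> deformed_verblunsky (opuc_measure n \<alpha>) k = opuc_gamma \<alpha> k"
proof -
  assume k: "k < n"
  have "Phi (opuc_measure n \<alpha>) (Suc k) = opuc \<alpha> (Suc k)" "Phi (opuc_measure n \<alpha>) k = opuc \<alpha> k"
    using k by (intro Phi_opuc_measure[OF n params]; simp)+
  thus ?thesis using opuc_Suc_1[of k] poly_opuc_1_nz[of k] n k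
    unfolding deformed_verblunsky_def by (simp del: opuc.simps)
qed

lemma opuc_n_1: "poly (opuc \<alpha> n) 1 = (\<Prod>k<n. 1 - opuc_gamma \<alpha> k)"
proof -
  have "poly (opuc \<alpha> j) 1 = (\<Prod>k<j. 1 - opuc_gamma \<alpha> k)" if "j \<le> n" for j
    using that by (induction j) (use n in \<open>auto simp: opuc_Suc_1 simp del: opuc.simps(2)\<close>)
  thus ?thesis by simp
qed

lemma norm_opuc_gamma: "k \<le> m \<Longrightarrow> cmod (opuc_gamma \<alpha> k) = cmod (\<alpha> k)"
  using poly_opuc_1_nz[of k] by (simp add: opuc_gamma_def norm_mult norm_divide)

lemma reversed_mult: "reversed (p * q) = reversed p * reversed q"
proof -
  have "map_poly cnj (p * q) = map_poly cnj p * map_poly cnj q"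
    by (rule poly_eqI) (simp add: coeff_map_poly coeff_mult)
  thus ?thesis by (simp add: reversed_def reflect_poly_mult)
qed

lemma reversed_opuc_n: "poly (reversed (opuc \<alpha> n)) z = (\<Prod>a\<in>opuc_zeros n \<alpha>. 1 - cnj a * z)"
proof -
  have l: "poly (reversed [:- a, 1:]) z = 1 - cnj a * z" for a
  proof -
    have "reversed [:- a, 1:] = [:1, - cnj a:]"
      by (rule poly_eqI) (auto simp: coeff_reversed coeff_pCons split: nat.split)
    thus ?thesis by simp
  qed
  have "poly (reversed (\<Prod>a\<in>S. [:- a, 1:])) z = (\<Prod>a\<in>S. 1 - cnj a * z)" for S
    by (induction S rule: infinite_finite_induct) (auto simp: reversed_mult l simp del: mult_pCons_left)
  thus ?thesis using opuc_factorization[OF n params] by metis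
qed

text \<open>Both sums are values at \<open>r = 1\<close> of continuous logarithms on \<open>[0, 1]\<close> of the conjugate of the
  reversed polynomial of \<open>opuc \<alpha> n\<close>, and both vanish at \<open>r = 0\<close>: one comes from its zeros, the other
  from the recursion.\<close>

lemma sum_Ln_zeros_eq:
  assumes nz: "poly (opuc \<alpha> n) 1 \<noteq> 0"
  shows "(\<Sum>a\<in>opuc_zeros n \<alpha>. Ln (1 - a)) = (\<Sum>k<n. Ln (1 - opuc_gamma \<alpha> k))"
proof -
  let ?P = "\<lambda>k r. poly (opuc \<alpha> k) (complex_of_real r)"
  let ?R = "\<lambda>k r. poly (reversed (opuc \<alpha> k)) (complex_of_real r)"
  let ?Z = "opuc_zeros n \<alpha>"
  have fin: "finite ?Z" by (rule finite_opuc_zeros[OF n params])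
  have in1: "i < m \<Longrightarrow> cmod (\<alpha> i) < 1" and last: "cmod (\<alpha> m) = 1" for i using params by (auto simp: verblunsky_tuple_def)
  have R1: "?R k 1 = cnj (?P k 1)" for k by (simp add: poly_reversed_unit)
  \<comment> \<open>The diagonal Christoffel-Darboux formula bounds r P_k / R_k by 1 in modulus on
    [0, 1], strictly for r < 1. It does not exclude a zero of R_k at r = 1, where
    \<open>poly_opuc_1_nz\<close> takes over.\<close>
  have le: "cmod (of_real r * ?P k r) \<le> cmod (?R k r)" "?R k r \<noteq> 0" "r < 1 \<Longrightarrow> cmod (of_real r * ?P k r) < cmod (?R k r)"
    if "r \<in> {0..1}" "k \<le> m" for k r
  proof -
    have ik: "cmod (\<alpha> i) < 1" if "i < k" for i using in1[of i] that \<open>k \<le> m\<close> by simp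
    obtain K where K: "K \<ge> 1" "(1 - (cmod (of_real r))\<^sup>2) * K * opuc_norm2 \<alpha> k = (cmod (?R k r))\<^sup>2 - (cmod (of_real r * ?P k r))\<^sup>2"
      by (rule christoffel_darboux_diag[of k \<alpha> "complex_of_real r", OF ik]) (assumption, simp)
    have k: "opuc_norm2 \<alpha> k > 0" using that by (intro opuc_norm2_pos in1) simp
    have r2: "r\<^sup>2 \<le> 1" using that by (simp add: power_le_one)
    have "0 \<le> (1 - (cmod (of_real r))\<^sup>2) * K * opuc_norm2 \<alpha> k"
      using K(1) k r2 by (intro mult_nonneg_nonneg) auto
    hence "(cmod (of_real r * ?P k r))\<^sup>2 \<le> (cmod (?R k r))\<^sup>2" unfolding K(2) by linarith
    thus "cmod (of_real r * ?P k r) \<le> cmod (?R k r)" by (rule power2_le_imp_le) (rule norm_ge_zero)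
    show lt: "cmod (of_real r * ?P k r) < cmod (?R k r)" if "r < 1"
    proof -
      have "r\<^sup>2 < 1\<^sup>2" using that \<open>r \<in> {0..1}\<close> by (intro power_strict_mono) auto
      hence "0 < (1 - (cmod (of_real r))\<^sup>2) * K * opuc_norm2 \<alpha> k"
        using K(1) k by (intro mult_pos_pos) auto
      hence "(cmod (of_real r * ?P k r))\<^sup>2 < (cmod (?R k r))\<^sup>2" unfolding K(2) by linarith
      thus ?thesis by (rule power2_less_imp_less) (rule norm_ge_zero)
    qed
    show "?R k r \<noteq> 0"
    proof (cases "r < 1")
      case True
      have "0 \<le> cmod (of_real r * ?P k r)" by (rule norm_ge_zero)
      with lt[OF True] have "cmod (?R k r) \<noteq> 0" by linarith
      thus ?thesis by simp
    next
      case False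
      hence "r = 1" using that(1) by simp
      thus ?thesis using poly_opuc_1_nz[OF that(2)] R1[of k] by simp
    qed
  qed
  \<comment> \<open>The ratio of consecutive reversed polynomials; at r = 1 it is the conjugate of 1
    - gamma_k.\<close>
  define q where "q = (\<lambda>k r. 1 - \<alpha> k * (of_real r * ?P k r / ?R k r))"
  have q1: "q k 1 = 1 - cnj (opuc_gamma \<alpha> k)" for k
    using R1[of k] by (simp add: q_def opuc_gamma_def)
  have Re1: "Re (1 - z) > 0" if "cmod z < 1 \<or> (cmod z = 1 \<and> z \<noteq> 1)" for z
  proof -
    have "Re z \<le> cmod z" by (rule complex_Re_le_cmod)
    moreover have "Re z \<noteq> 1" if "cmod z = 1" "z \<noteq> 1"
    proof
      assume "Re z = 1"
      hence "Im z = 0" using cmod_power2[of z] that by simp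
      thus False using \<open>Re z = 1\<close> that by (simp add: complex_eq_iff)
    qed
    ultimately show ?thesis using that by force
  qed
  have gne: "opuc_gamma \<alpha> k \<noteq> 1" if "k < n" for k
    using nz that unfolding opuc_n_1 by auto
  \<comment> \<open>The modulus bound is strict except at k = m, r = 1. There q lies on the unit
    circle around 1, which meets the closed left half plane only in 0, and \<open>nz\<close>
    excludes 0.\<close>
  have qpos: "Re (q k r) > 0" if r: "r \<in> {0..1}" and k: "k < n" for k r
  proof (cases "k = m \<and> r = 1")
    case True
    hence "q k r = 1 - cnj (opuc_gamma \<alpha> k)" by (simp add: q1)
    moreover have "cmod (opuc_gamma \<alpha> k) = 1" using True norm_opuc_gamma[of m] last by simp
    ultimately show ?thesis using Re1[of "opuc_gamma \<alpha> k"] gne[OF k] by simp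
  next
    case False
    have km: "k \<le> m" using k n by simp
    note l = le[OF r km]
    have "cmod (\<alpha> k * (of_real r * ?P k r / ?R k r)) < 1"
    proof (cases "k = m")
      case True
      hence "r < 1" using False r by auto
      thus ?thesis using l last True by (simp add: norm_mult norm_divide)
    next
      case False
      have "cmod (\<alpha> k * (of_real r * ?P k r / ?R k r)) = cmod (\<alpha> k) * (cmod (of_real r * ?P k r) / cmod (?R k r))"
        by (simp add: norm_mult norm_divide)
      also have "\<dots> \<le> cmod (\<alpha> k) * 1" using l by (intro mult_left_mono) auto
      also have "\<dots> < 1" using in1[of k] km False by simp
      finally show ?thesis .
    qed
    thus ?thesis unfolding q_def by (intro Re1) simp
  qed
  have zpos: "Re (1 - cnj a * of_real r) > 0" if a: "a \<in> ?Z" and r: "r \<in> {0..1}" for a r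
  proof -
    have "cmod a = 1" "a \<noteq> 1" using a nz opuc_zeros_on_circle[OF n params a] by (auto simp: opuc_zeros_def[OF n params])
    hence "cmod (cnj a * of_real r) < 1 \<or> (cmod (cnj a * of_real r) = 1 \<and> cnj a * of_real r \<noteq> 1)"
      using r by (cases "r = 1") (auto simp: norm_mult)
    thus ?thesis by (rule Re1)
  qed
  have Rprod: "j \<le> n \<Longrightarrow> ?R j r = (\<Prod>k<j. q k r)" if r: "r \<in> {0..1}" for j r
  proof (induction j)
    case (Suc j)
    have "?R (Suc j) r = ?R j r * q j r"
      unfolding reversed_opuc_Suc using le(2)[OF r, of j] Suc n by (simp add: q_def field_simps)
    thus ?case using Suc by simp
  qed simp
  define f where "f = (\<lambda>r::real. (\<Sum>a\<in>?Z. Ln (1 - cnj a * of_real r)) - (\<Sum>k<n. Ln (q k r)))"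
  have Rep: "z \<notin> \<real>\<^sub>\<le>\<^sub>0 \<and> z \<noteq> 0" if "Re z > 0" for z using that by (auto simp: complex_nonpos_Reals_iff)
  have expf: "exp (f r) = 1" if r: "r \<in> {0..1}" for r
  proof -
    have "exp (\<Sum>a\<in>?Z. Ln (1 - cnj a * of_real r)) = (\<Prod>a\<in>?Z. 1 - cnj a * of_real r)"
      unfolding exp_sum[OF fin] using zpos[OF _ r] Rep by (intro prod.cong refl exp_Ln) blast
    also have "\<dots> = ?R n r" by (simp add: reversed_opuc_n)
    also have "\<dots> = (\<Prod>k<n. q k r)" by (rule Rprod[OF r]) simp
    also have "\<dots> = exp (\<Sum>k<n. Ln (q k r))"
      unfolding exp_sum[OF finite_lessThan] using qpos[OF r] Rep by (intro prod.cong refl exp_Ln[symmetric]) simp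
    finally show ?thesis by (simp add: f_def exp_diff)
  qed
  have cont: "continuous_on {0..1} f"
  proof -
    have "continuous_on {0..1} (q k)" if "k < n" for k
      unfolding q_def using le(2) that n by (intro continuous_intros) auto
    thus ?thesis unfolding f_def using qpos zpos Rep
      by (intro continuous_intros) auto
  qed
  \<comment> \<open>exp f = 1 forces the values into 2 pi i times the integers, whose points are at
    mutual distance at least 2 pi; a continuous function on an interval cannot jump between
    them.\<close>
  have "f constant_on {0..1}"
  proof (rule continuous_discrete_range_constant[OF _ cont])
    fix r :: real assume r: "r \<in> {0..1}"
    have "2 * pi \<le> cmod (f s - f r)" if s: "s \<in> {0..1}" "f s \<noteq> f r" for s
    proof -
      have "exp (f s - f r) = 1" using expf[OF r] expf[OF s(1)] by (simp add: exp_diff)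
      then obtain k :: int where k: "Re (f s - f r) = 0" "Im (f s - f r) = of_int (2 * k) * pi"
        unfolding exp_eq_1 by blast
      have "k \<noteq> 0" using k s(2) by (auto simp: complex_eq_iff)
      hence "\<bar>real_of_int k\<bar> \<ge> 1" by linarith
      hence "2 * pi \<le> \<bar>of_int (2 * k) * pi\<bar>" by (simp add: abs_mult)
      also have "\<dots> \<le> cmod (f s - f r)" unfolding k(2)[symmetric] by (rule abs_Im_le_cmod)
      finally show ?thesis .
    qed
    thus "\<exists>e>0. \<forall>s. s \<in> {0..1} \<and> f s \<noteq> f r \<longrightarrow> e \<le> cmod (f s - f r)"
      by (intro exI[of _ "2 * pi"]) auto
  qed auto
  hence "f 1 = f 0" unfolding constant_on_def by force
  also have "f 0 = 0" by (simp add: f_def q_def)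
  finally have *: "(\<Sum>a\<in>?Z. Ln (1 - cnj a)) = (\<Sum>k<n. Ln (1 - cnj (opuc_gamma \<alpha> k)))"
    by (simp add: f_def q1)
  have c1: "cnj (Ln (1 - cnj a)) = Ln (1 - a)" if "a \<in> ?Z" for a
    using zpos[OF that, of 1] Rep[of "1 - cnj a"] by (simp add: cnj_Ln)
  have c2: "cnj (Ln (1 - cnj (opuc_gamma \<alpha> k))) = Ln (1 - opuc_gamma \<alpha> k)" if "k < n" for k
    using qpos[OF _ that, of 1] Rep[of "1 - cnj (opuc_gamma \<alpha> k)"] unfolding q1 by (simp add: cnj_Ln)
  have "cnj (\<Sum>a\<in>?Z. Ln (1 - cnj a)) = (\<Sum>a\<in>?Z. Ln (1 - a))" by (simp add: c1)
  moreover have "cnj (\<Sum>k<n. Ln (1 - cnj (opuc_gamma \<alpha> k))) = (\<Sum>k<n. Ln (1 - opuc_gamma \<alpha> k))" by (simp add: c2)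
  ultimately show ?thesis using * by simp
qed

text \<open>For a point of the closed disc other than 1, 1 - g stays off the branch cut, so its
  logarithm commutes with conjugation. The product then depends only on the sum of the logarithms,
  and eigenvalues and deformed coefficients have the same sum.\<close>

lemma prod_powr_mult_cnj_powr:
  assumes "finite I" and g: "\<And>i. i \<in> I \<Longrightarrow> cmod (g i) \<le> 1 \<and> g i \<noteq> 1"
  shows "(\<Prod>i\<in>I. (1 - g i) powr cnj \<delta> * (1 - cnj (g i)) powr \<delta>) =
    exp (cnj \<delta> * (\<Sum>i\<in>I. Ln (1 - g i)) + \<delta> * cnj (\<Sum>i\<in>I. Ln (1 - g i)))"
proof -
  have "(1 - g i) powr cnj \<delta> * (1 - cnj (g i)) powr \<delta> = exp (cnj \<delta> * Ln (1 - g i) + \<delta> * cnj (Ln (1 - g i)))" if "i \<in> I" for i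
  proof -
    have gi: "cmod (g i) \<le> 1" "g i \<noteq> 1" using g[OF that] by auto
    have 1: "1 - g i \<noteq> 0" using gi(2) by simp
    hence "cnj (1 - g i) \<noteq> 0" by (simp only: complex_cnj_zero_iff not_False_eq_True)
    hence 2: "1 - cnj (g i) \<noteq> 0" by simp
    have "Re (g i) \<le> 1" using gi(1) complex_Re_le_cmod[of "g i"] by linarith
    have "1 - g i \<notin> \<real>\<^sub>\<le>\<^sub>0"
    proof
      assume "1 - g i \<in> \<real>\<^sub>\<le>\<^sub>0"
      hence "Re (1 - g i) \<le> 0" "Im (1 - g i) = 0" by (simp_all add: complex_nonpos_Reals_iff)
      with \<open>Re (g i) \<le> 1\<close> have "1 - g i = 0" by (simp add: complex_eq_iff)
      with 1 show False ..
    qed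
    hence "Ln (1 - cnj (g i)) = cnj (Ln (1 - g i))" by (simp add: cnj_Ln)
    thus ?thesis using 1 2 by (simp add: powr_def exp_add)
  qed
  hence "(\<Prod>i\<in>I. (1 - g i) powr cnj \<delta> * (1 - cnj (g i)) powr \<delta>) = (\<Prod>i\<in>I. exp (cnj \<delta> * Ln (1 - g i) + \<delta> * cnj (Ln (1 - g i))))"
    by (intro prod.cong refl)
  also have "\<dots> = exp (\<Sum>i\<in>I. cnj \<delta> * Ln (1 - g i) + \<delta> * cnj (Ln (1 - g i)))"
    by (rule exp_sum[symmetric]) (rule assms(1))
  also have "(\<Sum>i\<in>I. cnj \<delta> * Ln (1 - g i) + \<delta> * cnj (Ln (1 - g i))) =
    cnj \<delta> * (\<Sum>i\<in>I. Ln (1 - g i)) + \<delta> * cnj (\<Sum>i\<in>I. Ln (1 - g i))"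
    by (simp add: sum.distrib sum_distrib_left)
  finally show ?thesis .
qed

lemma det_delta_GGT_gamma:
  "det_delta \<delta> (GGT n \<alpha>) = (\<Prod>k<n. (1 - opuc_gamma \<alpha> k) powr cnj \<delta> * (1 - cnj (opuc_gamma \<alpha> k)) powr \<delta>)"
proof (cases "poly (opuc \<alpha> n) 1 = 0")
  \<comment> \<open>If 1 is an eigenvalue, both products contain a factor \<open>0 powr _\<close>,
    which is 0.\<close>
  case True
  have fin: "finite (opuc_zeros n \<alpha>)" by (rule finite_opuc_zeros[OF n params])
  have "1 \<in> opuc_zeros n \<alpha>" using True by (simp add: opuc_zeros_def[OF n params])
  hence "det_delta \<delta> (GGT n \<alpha>) = 0" unfolding det_delta_GGT using fin by (intro prod_zero bexI[of _ 1]) auto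
  moreover have "\<exists>k\<in>{..<n}. 1 - opuc_gamma \<alpha> k = 0"
    using True unfolding opuc_n_1 by (subst (asm) prod_zero_iff) simp_all
  then obtain k where k: "k \<in> {..<n}" "1 - opuc_gamma \<alpha> k = 0" by (rule bexE)
  have "opuc_gamma \<alpha> k = 1" using k(2) by (simp only: right_minus_eq)
  hence "(\<Prod>k<n. (1 - opuc_gamma \<alpha> k) powr cnj \<delta> * (1 - cnj (opuc_gamma \<alpha> k)) powr \<delta>) = 0"
    using k(1) by (intro prod_zero finite_lessThan bexI[of _ k]) simp_all
  ultimately show ?thesis by simp
next
  case False
  have "det_delta \<delta> (GGT n \<alpha>) = exp (cnj \<delta> * (\<Sum>a\<in>opuc_zeros n \<alpha>. Ln (1 - a)) + \<delta> * cnj (\<Sum>a\<in>opuc_zeros n \<alpha>. Ln (1 - a)))"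
    unfolding det_delta_GGT
  proof (rule prod_powr_mult_cnj_powr[OF finite_opuc_zeros[OF n params]])
    fix a assume a: "a \<in> opuc_zeros n \<alpha>"
    hence "a \<noteq> 1" using False unfolding opuc_zeros_def[OF n params] by blast
    thus "cmod a \<le> 1 \<and> a \<noteq> 1" using opuc_zeros_on_circle[OF n params a] by (intro conjI) linarith+
  qed
  also have "\<dots> = (\<Prod>k<n. (1 - opuc_gamma \<alpha> k) powr cnj \<delta> * (1 - cnj (opuc_gamma \<alpha> k)) powr \<delta>)"
    unfolding sum_Ln_zeros_eq[OF False]
  proof (rule prod_powr_mult_cnj_powr[symmetric])
    fix k assume "k \<in> {..<n}"
    hence k: "k \<le> m" "k < n" using n by auto
    have "cmod (\<alpha> k) \<le> 1" using k params by (cases "k = m") (auto simp: verblunsky_tuple_def less_imp_le)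
    moreover have "opuc_gamma \<alpha> k \<noteq> 1"
    proof
      assume "opuc_gamma \<alpha> k = 1"
      hence "poly (opuc \<alpha> n) 1 = 0" unfolding opuc_n_1 using k(2) by (intro prod_zero finite_lessThan bexI[of _ k]) simp_all
      with False show False ..
    qed
    ultimately show "cmod (opuc_gamma \<alpha> k) \<le> 1 \<and> opuc_gamma \<alpha> k \<noteq> 1" unfolding norm_opuc_gamma[OF k(1)] by (rule conjI)
  qed simp
  finally show ?thesis .
qed

end

subsection \<open>Spectral measures of unitary matrices\<close>

text \<open>For a form invariant under multiplication by \<open>z\<close> with a null polynomial \<open>p\<close> of minimal degree,
  every factor \<open>q = p / (z - \<zeta>)\<close> satisfies \<open>H(q, r) = r(\<zeta>) H(q, 1)\<close>. Hence the zeros of \<open>p\<close> are simple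
  and on the circle, and Lagrange interpolation of \<open>1\<close> by the \<open>q\<close> yields the spectral weights.\<close>

lemma isometric_form_spectral:
  fixes H :: "complex poly \<Rightarrow> complex poly \<Rightarrow> complex"
  assumes add: "\<And>p q r. H p (q + r) = H p q + H p r"
    and smult: "\<And>p q c. H p (Polynomial.smult c q) = c * H p q"
    and herm: "\<And>p q. H q p = cnj (H p q)"
    and shift: "\<And>p q. H (pCons 0 p) (pCons 0 q) = H p q"
    and null: "\<And>p q. H p p = 0 \<Longrightarrow> H p q = 0"
    and nonneg: "\<And>p. 0 \<le> Re (H p p)"
    and one: "H 1 1 = 1"
    and ex: "p0 \<noteq> 0" "H p0 p0 = 0"
  shows "\<exists>S w. finite S \<and> S \<subseteq> sphere 0 1 \<and> (\<forall>\<zeta>\<in>S. 0 \<le> w \<zeta>) \<and> (\<forall>r. H 1 r = (\<Sum>\<zeta>\<in>S. of_real (w \<zeta>) * poly r \<zeta>))"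
proof -
  have addl: "H (q + r) p = H q p + H r p" and smultl: "H (Polynomial.smult c q) p = cnj c * H q p" for p q r c
    by (metis add herm complex_cnj_add) (metis smult herm complex_cnj_mult)
  have zero: "H p 0 = 0" "H 0 p = 0" for p using smult[of p 0 0] smultl[of 0 0 p] by auto
  \<comment> \<open>\<open>p\<close> plays the role of a minimal polynomial: every nonzero
    polynomial of smaller degree has nonzero norm.\<close>
  obtain p where p: "p \<noteq> 0" "H p p = 0" and min: "\<And>q. q \<noteq> 0 \<Longrightarrow> H q q = 0 \<Longrightarrow> degree p \<le> degree q"
    using ex_has_least_nat[of "\<lambda>p. p \<noteq> 0 \<and> H p p = 0" p0 degree] ex by blast
  define S where "S = {z. poly p z = 0}"
  have fin: "finite S" unfolding S_def by (rule poly_roots_finite[OF p(1)])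
  define q where "q = (\<lambda>\<zeta>. synthetic_div p \<zeta>)"
  have pq: "p = pCons 0 (q \<zeta>) + Polynomial.smult (- \<zeta>) (q \<zeta>)" if "\<zeta> \<in> S" for \<zeta>
    using synthetic_div_correct'[of \<zeta> p] that by (simp add: S_def q_def)
  have pz: "poly p z = (z - \<zeta>) * poly (q \<zeta>) z" if "\<zeta> \<in> S" for \<zeta> z
    by (subst pq[OF that]) (simp add: algebra_simps)
  have dp: "degree p > 0"
  proof (rule ccontr)
    assume "\<not> degree p > 0"
    then obtain c where c: "p = [:c:]" by (auto elim: degree_eq_zeroE)
    hence "p = Polynomial.smult c 1" by simp
    hence "H p p = c * (cnj c * H 1 1)" by (simp only: smult smultl)
    thus False using p one c by simp
  qed
  have q0: "H (q \<zeta>) (q \<zeta>) \<noteq> 0" if "\<zeta> \<in> S" for \<zeta>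
  proof
    assume "H (q \<zeta>) (q \<zeta>) = 0"
    moreover have "q \<zeta> \<noteq> 0" using pq[OF that] p(1) by auto
    ultimately have "degree p \<le> degree (q \<zeta>)" by (intro min)
    thus False using dp by (simp add: q_def degree_synthetic_div)
  qed
  \<comment> \<open>A null vector pairs to 0 with everything, so for H multiplication by z acts on
    \<open>q \<zeta>\<close> as the scalar \<open>\<zeta>\<close>: an eigenvector.\<close>
  have Hz: "H (pCons 0 (q \<zeta>)) r = cnj \<zeta> * H (q \<zeta>) r" if "\<zeta> \<in> S" for \<zeta> r
  proof -
    have "0 = H (pCons 0 (q \<zeta>) + Polynomial.smult (- \<zeta>) (q \<zeta>)) r" using null[OF p(2), of r] pq[OF that] by simp
    thus ?thesis by (simp add: addl smultl del: smult_minus_left)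
  qed
  have unit: "cmod \<zeta> = 1" if "\<zeta> \<in> S" for \<zeta>
  proof -
    have "H (q \<zeta>) (q \<zeta>) = H (pCons 0 (q \<zeta>)) (pCons 0 (q \<zeta>))" by (rule shift[symmetric])
    also have "\<dots> = cnj \<zeta> * H (q \<zeta>) (pCons 0 (q \<zeta>))" by (rule Hz[OF that])
    also have "H (q \<zeta>) (pCons 0 (q \<zeta>)) = cnj (cnj \<zeta> * H (q \<zeta>) (q \<zeta>))" by (metis herm Hz[OF that])
    also have "\<dots> = \<zeta> * H (q \<zeta>) (q \<zeta>)" by (simp add: herm[of "q \<zeta>" "q \<zeta>", symmetric])
    finally have "(cnj \<zeta> * \<zeta>) * H (q \<zeta>) (q \<zeta>) = 1 * H (q \<zeta>) (q \<zeta>)" by simp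
    hence "cnj \<zeta> * \<zeta> = 1" using q0[OF that] by (simp only: mult_cancel_right) blast
    hence "complex_of_real ((cmod \<zeta>)\<^sup>2) = 1" by (simp only: complex_norm_square mult.commute)
    hence "(cmod \<zeta>)\<^sup>2 = 1" by (simp only: of_real_eq_1_iff)
    thus ?thesis by (simp add: power2_eq_1_iff) (smt (verit) norm_ge_zero)
  qed
  have eval: "H (q \<zeta>) r = poly r \<zeta> * H (q \<zeta>) 1" if "\<zeta> \<in> S" for \<zeta> r
  proof (induction r)
    case (pCons a r)
    have "H (q \<zeta>) r = cnj \<zeta> * H (q \<zeta>) (pCons 0 r)" using shift[of "q \<zeta>" r] Hz[OF that] by simp
    hence "\<zeta> * H (q \<zeta>) r = (cnj \<zeta> * \<zeta>) * H (q \<zeta>) (pCons 0 r)" by simp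
    hence zr: "H (q \<zeta>) (pCons 0 r) = \<zeta> * H (q \<zeta>) r" using cnj_mult_self_unit[OF unit[OF that]] by simp
    have "pCons a r = Polynomial.smult a 1 + pCons 0 r" by simp
    hence "H (q \<zeta>) (pCons a r) = a * H (q \<zeta>) 1 + H (q \<zeta>) (pCons 0 r)" by (simp only: add smult)
    thus ?case using pCons.IH by (simp add: zr algebra_simps)
  qed (simp add: zero)
  have qz: "poly (q \<zeta>) \<zeta> \<noteq> 0" if "\<zeta> \<in> S" for \<zeta>
    using q0[OF that] eval[OF that, of "q \<zeta>"] by auto
  have "rsquarefree p"
    unfolding rsquarefree_roots
  proof (intro allI notI, elim conjE)
    fix \<zeta> assume "poly p \<zeta> = 0" and d: "poly (pderiv p) \<zeta> = 0"
    hence z: "\<zeta> \<in> S" by (simp add: S_def)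
    have "poly (pderiv p) \<zeta> = poly (q \<zeta>) \<zeta>"
      by (subst pq[OF z]) (simp add: pderiv_pCons pderiv_add pderiv_smult pderiv_diff pderiv_minus)
    thus False using d qz[OF z] by simp
  qed
  from complex_poly_decompose_rsquarefree[OF this]
  have fac: "Polynomial.smult (lead_coeff p) (\<Prod>z\<in>S. [:- z, 1:]) = p" by (simp add: S_def)
  have "degree (\<Prod>z\<in>S. [:- z, 1:]) = card S" using fin by (subst degree_prod_eq_sum_degree) auto
  hence card: "card S = degree p" using fac p(1) by (metis degree_smult_eq leading_coeff_0_iff)
  \<comment> \<open>The Lagrange interpolant of 1 at the zeros of \<open>p\<close>. It equals 1,
    since the difference vanishes on S and has degree below \<open>card S\<close>.\<close>
  define L where "L = (\<Sum>\<zeta>\<in>S. Polynomial.smult (inverse (poly (q \<zeta>) \<zeta>)) (q \<zeta>))"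
  have "1 - L = 0"
  proof (rule poly_zero_of_many_roots[OF fin])
    have "degree L \<le> degree p - 1" unfolding L_def
      by (intro degree_sum_le fin order.trans[OF degree_smult_le]) (simp add: q_def degree_synthetic_div)
    hence "degree (1 - L) \<le> degree p - 1" by (intro degree_diff_le) auto
    thus "degree (1 - L) < card S" using card dp by simp
    fix \<xi> assume x: "\<xi> \<in> S"
    have "poly (q \<zeta>) \<xi> = 0" if "\<zeta> \<in> S" "\<zeta> \<noteq> \<xi>" for \<zeta>
      using pz[OF that(1), of \<xi>] x that(2) by (simp add: S_def)
    hence "poly L \<xi> = (\<Sum>\<zeta>\<in>S. if \<zeta> = \<xi> then 1 else 0)"
      unfolding L_def poly_sum poly_smult by (intro sum.cong refl) (use qz in auto)
    also have "\<dots> = 1" using fin x by simp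
    finally show "poly (1 - L) \<xi> = 0" by simp
  qed
  hence L1: "1 = L" by simp
  have sum: "H (sum f I) r = (\<Sum>i\<in>I. H (f i) r)" for f :: "complex \<Rightarrow> complex poly" and I r
    by (induction I rule: infinite_finite_induct) (simp_all add: zero addl)
  \<comment> \<open>This equals |H(q, 1)|^2 / H(q, q), the squared length of the projection of 1
    onto the eigenvector.\<close>
  define w where "w = (\<lambda>\<zeta>. Re (H (q \<zeta>) (q \<zeta>)) / (cmod (poly (q \<zeta>) \<zeta>))\<^sup>2)"
  have w: "cnj (inverse (poly (q \<zeta>) \<zeta>)) * H (q \<zeta>) r = of_real (w \<zeta>) * poly r \<zeta>" if "\<zeta> \<in> S" for \<zeta> r
  proof -
    let ?x = "poly (q \<zeta>) \<zeta>"
    have "Im (H (q \<zeta>) (q \<zeta>)) = 0" using herm[of "q \<zeta>" "q \<zeta>"] by (simp add: complex_eq_iff)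
    hence re: "H (q \<zeta>) (q \<zeta>) = of_real (Re (H (q \<zeta>) (q \<zeta>)))" by (simp add: complex_eq_iff)
    have h1: "H (q \<zeta>) 1 = H (q \<zeta>) (q \<zeta>) / ?x" using eval[OF that, of "q \<zeta>"] qz[OF that] by simp
    have "cnj (inverse ?x) * H (q \<zeta>) r = poly r \<zeta> * (H (q \<zeta>) (q \<zeta>) / (?x * cnj ?x))"
      unfolding eval[OF that, of r] h1 by (simp add: field_simps)
    also have "H (q \<zeta>) (q \<zeta>) / (?x * cnj ?x) = of_real (w \<zeta>)"
      unfolding w_def of_real_divide complex_norm_square re[symmetric] ..
    finally show ?thesis by (simp only: mult.commute)
  qed
  have "H 1 r = (\<Sum>\<zeta>\<in>S. of_real (w \<zeta>) * poly r \<zeta>)" for r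
  proof -
    have "H 1 r = H L r" using L1 by simp
    also have "\<dots> = (\<Sum>\<zeta>\<in>S. cnj (inverse (poly (q \<zeta>) \<zeta>)) * H (q \<zeta>) r)"
      unfolding L_def sum smultl ..
    finally show ?thesis using w by simp
  qed
  moreover have "\<forall>\<zeta>\<in>S. 0 \<le> w \<zeta>" using nonneg by (simp add: w_def)
  moreover have "S \<subseteq> sphere 0 1" using unit by auto
  ultimately show ?thesis using fin by blast
qed

section \<open>Powers of a matrix applied to the first basis vector\<close>

context
  fixes A :: "complex mat" and n :: nat
  assumes A: "A \<in> carrier_mat n n"
begin

lemma pow_mat_Suc_entry:
  assumes "i < n" "j < n"
  shows "(A ^\<^sub>m Suc k) $$ (i, j) = (\<Sum>l<n. (A ^\<^sub>m k) $$ (i, l) * A $$ (l, j))"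
  using assms A pow_carrier_mat[OF A, of k] by (simp add: scalar_prod_def lessThan_atLeast0)

lemma pow_mat_commute: "A * A ^\<^sub>m k = A ^\<^sub>m k * A"
proof (induction k)
  case (Suc k)
  have "A * A ^\<^sub>m Suc k = A * A ^\<^sub>m k * A"
    using assoc_mult_mat[OF A pow_carrier_mat[OF A, of k] A] by simp
  thus ?case using Suc by simp
qed (use A in auto)

lemma pow_mat_Suc_entry':
  assumes "i < n" "j < n"
  shows "(A ^\<^sub>m Suc k) $$ (i, j) = (\<Sum>l<n. A $$ (i, l) * (A ^\<^sub>m k) $$ (l, j))"
proof -
  have "(A ^\<^sub>m Suc k) $$ (i, j) = (A * A ^\<^sub>m k) $$ (i, j)" by (simp add: pow_mat_commute)
  thus ?thesis using assms A pow_carrier_mat[OF A, of k] by (simp add: scalar_prod_def lessThan_atLeast0)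
qed

lemma adjoint_pow_entry:
  assumes "i < n" "j < n"
  shows "(mat_adjoint A ^\<^sub>m k) $$ (i, j) = cnj ((A ^\<^sub>m k) $$ (j, i))"
  using assms
proof (induction k arbitrary: i j)
  case 0
  thus ?case using A by (auto simp: mat_adjoint_eq[OF A])
next
  case (Suc k)
  have A': "mat_adjoint A \<in> carrier_mat n n" by (simp add: mat_adjoint_eq[OF A])
  have e: "mat_adjoint A $$ (l, j) = cnj (A $$ (j, l))" if "l < n" for l
    using that Suc.prems by (simp add: mat_adjoint_eq[OF A])
  have "(mat_adjoint A ^\<^sub>m Suc k) $$ (i, j) = (\<Sum>l<n. (mat_adjoint A ^\<^sub>m k) $$ (i, l) * mat_adjoint A $$ (l, j))"
    using Suc.prems A' pow_carrier_mat[OF A', of k] by (simp add: scalar_prod_def lessThan_atLeast0)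
  also have "\<dots> = (\<Sum>l<n. cnj (A $$ (j, l) * (A ^\<^sub>m k) $$ (l, i)))"
    using Suc.prems by (intro sum.cong refl) (simp add: Suc.IH e)
  also have "\<dots> = cnj ((A ^\<^sub>m Suc k) $$ (j, i))"
    using Suc.prems by (simp only: pow_mat_Suc_entry' cnj_sum)
  finally show ?case .
qed

text \<open>Entry i of p(A) applied to the first basis vector.\<close>

definition krylov :: "nat \<Rightarrow> complex poly \<Rightarrow> complex" where
  "krylov i p = (\<Sum>k\<le>degree p. coeff p k * (A ^\<^sub>m k) $$ (i, 0))"

lemma krylov_eq: "degree p \<le> N \<Longrightarrow> krylov i p = (\<Sum>k\<le>N. coeff p k * (A ^\<^sub>m k) $$ (i, 0))"
  unfolding krylov_def by (rule sum.mono_neutral_left) (auto simp: coeff_eq_0)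

lemma krylov_add: "krylov i (p + q) = krylov i p + krylov i q"
proof -
  let ?N = "max (degree p) (degree q)"
  have "degree (p + q) \<le> ?N" by (rule degree_add_le) auto
  thus ?thesis by (subst (1 2 3) krylov_eq[where N = ?N]) (auto simp: algebra_simps sum.distrib)
qed

lemma krylov_smult: "krylov i (Polynomial.smult c p) = c * krylov i p"
  by (subst (1 2) krylov_eq[where N = "degree p"]) (auto simp: sum_distrib_left mult_ac)

lemma krylov_shift:
  assumes "i < n" "n > 0"
  shows "krylov i (pCons 0 p) = (\<Sum>l<n. A $$ (i, l) * krylov l p)"
proof -
  have "krylov i (pCons 0 p) = (\<Sum>k\<le>Suc (degree p). coeff (pCons 0 p) k * (A ^\<^sub>m k) $$ (i, 0))"
    by (rule krylov_eq) (rule degree_pCons_le)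
  also have "\<dots> = (\<Sum>k\<le>degree p. coeff p k * (A ^\<^sub>m Suc k) $$ (i, 0))"
    by (subst sum.atMost_Suc_shift) simp
  also have "\<dots> = (\<Sum>k\<le>degree p. \<Sum>l<n. A $$ (i, l) * (coeff p k * (A ^\<^sub>m k) $$ (l, 0)))"
    using assms by (intro sum.cong refl) (simp add: pow_mat_Suc_entry' sum_distrib_left mult_ac del: pow_mat.simps)
  also have "\<dots> = (\<Sum>l<n. A $$ (i, l) * krylov l p)"
    unfolding krylov_def sum_distrib_left by (rule sum.swap)
  finally show ?thesis .
qed

lemma krylov_dependent:
  assumes "n > 0"
  shows "\<exists>p. p \<noteq> 0 \<and> (\<forall>i<n. krylov i p = 0)"
proof -
  \<comment> \<open>The n + 1 vectors A^k e_1 as columns, padded by a zero row to a square matrix,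
    which is therefore singular. A kernel vector gives the coefficients of the polynomial.\<close>
  define B where "B = Matrix.mat (Suc n) (Suc n) (\<lambda>(i, k). if i < n then (A ^\<^sub>m k) $$ (i, 0) else 0)"
  have B: "B \<in> carrier_mat (Suc n) (Suc n)" by (simp add: B_def)
  have "transpose_mat B *\<^sub>v unit_vec (Suc n) n = 0\<^sub>v (Suc n)"
    by (rule eq_vecI) (auto simp: B_def)
  moreover have "(unit_vec (Suc n) n :: complex vec) \<noteq> 0\<^sub>v (Suc n)"
  proof
    assume "(unit_vec (Suc n) n :: complex vec) = 0\<^sub>v (Suc n)"
    hence "(unit_vec (Suc n) n :: complex vec) $ n = 0\<^sub>v (Suc n) $ n" by (rule arg_cong)
    thus False by simp
  qed
  ultimately have "Determinant.det (transpose_mat B) = 0"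
    using B by (subst det_0_iff_vec_prod_zero[of _ "Suc n"]) (auto intro!: exI[of _ "unit_vec (Suc n) n"])
  hence "Determinant.det B = 0" using B by (simp add: det_transpose)
  then obtain v where v: "v \<in> carrier_vec (Suc n)" "v \<noteq> 0\<^sub>v (Suc n)" "B *\<^sub>v v = 0\<^sub>v (Suc n)"
    using det_0_iff_vec_prod_zero[OF B] by blast
  define p where "p = (\<Sum>k\<le>n. monom (v $ k) k)"
  have c: "coeff p k = (if k \<le> n then v $ k else 0)" for k
    unfolding p_def coeff_sum coeff_monom by simp
  have "degree p \<le> n" by (rule degree_le) (simp add: c)
  have "krylov i p = 0" if "i < n" for i
  proof -
    have "krylov i p = (\<Sum>k\<le>n. v $ k * (A ^\<^sub>m k) $$ (i, 0))"
      by (subst krylov_eq[OF \<open>degree p \<le> n\<close>]) (simp add: c)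
    also have "\<dots> = (B *\<^sub>v v) $ i"
      using that v(1) by (simp add: B_def scalar_prod_def lessThan_Suc_atMost[symmetric] lessThan_atLeast0 mult.commute)
    also have "\<dots> = 0" unfolding v(3) using that by simp
    finally show ?thesis .
  qed
  moreover have "p \<noteq> 0"
  proof
    assume "p = 0"
    hence "v $ k = 0" if "k < Suc n" for k using c[of k] that by simp
    hence "v = 0\<^sub>v (Suc n)" using v(1) by (intro eq_vecI) auto
    thus False using v(2) by simp
  qed
  ultimately show ?thesis by blast
qed

end

text \<open>H(p, q) is the inner product of p(A) e_1 and q(A) e_1, invariant under multiplication by
  z because A is unitary. All unitary matrices are covered because the deformed coefficients have to
  be measurable on the whole of \<open>unitary_borel n\<close>.\<close>

lemma unitary_spectral:
  assumes A: "A \<in> unitary_mats n" and n: "n > 0"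
  shows "\<exists>m. supported_at m (spectral_measure A)"
    and "\<And>k. (\<integral>z. z powi k \<partial>spectral_measure A) = unitary_powi A k $$ (0, 0)"
proof -
  have Ac: "A \<in> carrier_mat n n" and uA: "mat_adjoint A * A = 1\<^sub>m n" using A by (auto simp: unitary_mats_def)
  let ?F = "krylov A"
  define H where "H = (\<lambda>p q. \<Sum>i<n. cnj (?F i p) * ?F i q)"
  have Hre: "H p p = of_real (\<Sum>i<n. (cmod (?F i p))\<^sup>2)" for p
    unfolding H_def of_real_sum complex_norm_square by (simp add: mult.commute)
  have orth: "(\<Sum>i<n. cnj (A $$ (i, j)) * A $$ (i, l)) = (if j = l then 1 else 0)" if "j < n" "l < n" for j l
  proof -
    have "(mat_adjoint A * A) $$ (j, l) = (\<Sum>i<n. cnj (A $$ (i, j)) * A $$ (i, l))"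
      using that Ac by (simp add: mat_adjoint_eq[OF Ac] scalar_prod_def lessThan_atLeast0)
    thus ?thesis using that by (simp add: uA)
  qed
  have F0: "?F i 1 = (if i = 0 then 1 else 0)" if "i < n" for i
    using that n Ac by (simp add: krylov_def[OF Ac])
  obtain p0 where p0: "p0 \<noteq> 0" "\<And>i. i < n \<Longrightarrow> ?F i p0 = 0" using krylov_dependent[OF Ac n] by blast
  have "\<exists>S w. finite S \<and> S \<subseteq> sphere 0 1 \<and> (\<forall>\<zeta>\<in>S. 0 \<le> w \<zeta>) \<and> (\<forall>r. H 1 r = (\<Sum>\<zeta>\<in>S. of_real (w \<zeta>) * poly r \<zeta>))"
  proof (rule isometric_form_spectral)
    show "H p (q + r) = H p q + H p r" for p q r by (simp add: H_def krylov_add[OF Ac] algebra_simps sum.distrib)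
    show "H p (Polynomial.smult c q) = c * H p q" for p q c by (simp add: H_def krylov_smult[OF Ac] sum_distrib_left mult_ac)
    show "H q p = cnj (H p q)" for p q by (simp add: H_def mult.commute)
    show "H (pCons 0 p) (pCons 0 q) = H p q" for p q
    proof -
      have "H (pCons 0 p) (pCons 0 q) = (\<Sum>i<n. (\<Sum>j<n. cnj (A $$ (i, j)) * cnj (?F j p)) * (\<Sum>l<n. A $$ (i, l) * ?F l q))"
        unfolding H_def using n by (intro sum.cong refl) (simp add: krylov_shift[OF Ac])
      also have "\<dots> = (\<Sum>i<n. \<Sum>j<n. \<Sum>l<n. cnj (?F j p) * ?F l q * (cnj (A $$ (i, j)) * A $$ (i, l)))"
        unfolding sum_product by (intro sum.cong refl) (simp add: mult_ac)
      also have "\<dots> = (\<Sum>j<n. \<Sum>i<n. \<Sum>l<n. cnj (?F j p) * ?F l q * (cnj (A $$ (i, j)) * A $$ (i, l)))"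
        by (rule sum.swap)
      also have "\<dots> = (\<Sum>j<n. \<Sum>l<n. \<Sum>i<n. cnj (?F j p) * ?F l q * (cnj (A $$ (i, j)) * A $$ (i, l)))"
        by (intro sum.cong refl sum.swap)
      also have "\<dots> = (\<Sum>j<n. \<Sum>l<n. if j = l then cnj (?F j p) * ?F l q else 0)"
        by (intro sum.cong refl) (simp add: sum_distrib_left[symmetric] orth)
      also have "\<dots> = H p q" unfolding H_def by (intro sum.cong refl) simp
      finally show ?thesis .
    qed
    show "H p q = 0" if "H p p = 0" for p q
    proof -
      have "(\<Sum>i<n. (cmod (?F i p))\<^sup>2) = 0" using that unfolding Hre by (simp only: of_real_eq_0_iff)
      hence "\<forall>i\<in>{..<n}. (cmod (?F i p))\<^sup>2 = 0" by (subst (asm) sum_nonneg_eq_0_iff) auto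
      thus ?thesis by (simp add: H_def)
    qed
    show "0 \<le> Re (H p p)" for p unfolding Hre by (simp add: sum_nonneg)
    have "H 1 1 = (\<Sum>i<n. if i = 0 then 1 else 0)" unfolding H_def by (intro sum.cong refl) (simp add: F0)
    thus "H 1 1 = 1" using n by simp
    show "p0 \<noteq> 0" by fact
    show "H p0 p0 = 0" by (simp add: H_def p0)
  qed
  then obtain S w where S: "finite S" "S \<subseteq> sphere 0 1" "\<And>\<zeta>. \<zeta> \<in> S \<Longrightarrow> 0 \<le> w \<zeta>"
    and Hr: "\<And>r. H 1 r = (\<Sum>\<zeta>\<in>S. of_real (w \<zeta>) * poly r \<zeta>)" by blast
  have H1: "H 1 r = ?F 0 r" for r
  proof -
    have "H 1 r = (\<Sum>i<n. if i = 0 then ?F i r else 0)" unfolding H_def by (intro sum.cong refl) (simp add: F0)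
    thus ?thesis using n by simp
  qed
  have mom: "(A ^\<^sub>m k) $$ (0, 0) = (\<Sum>\<zeta>\<in>S. of_real (w \<zeta>) * \<zeta> ^ k)" for k
  proof -
    have "?F 0 (monom 1 k) = (\<Sum>j\<le>k. if j = k then (A ^\<^sub>m j) $$ (0, 0) else 0)"
      unfolding krylov_def[OF Ac] by (intro sum.cong) (auto simp: degree_monom_eq)
    hence "(A ^\<^sub>m k) $$ (0, 0) = H 1 (monom 1 k)" by (simp add: H1)
    thus ?thesis by (simp add: Hr poly_monom)
  qed
  have "complex_of_real (sum w S) = 1" using mom[of 0] n Ac by simp
  hence sw: "sum w S = 1" by (simp only: of_real_eq_1_iff)
  let ?\<mu> = "discrete_measure S w"
  have int: "(\<integral>z. z powi k \<partial>?\<mu>) = unitary_powi A k $$ (0, 0)" for k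
  proof -
    have pm: "(\<lambda>z::complex. z powi k) \<in> borel_measurable borel"
      by (cases "0 \<le> k"; simp add: power_int_def, measurable)
    have "(\<integral>z. z powi k \<partial>?\<mu>) = (\<Sum>a\<in>S. w a *\<^sub>R a powi k)"
      by (rule integral_discrete_measure[OF S(1) S(3) pm])
    also have "\<dots> = unitary_powi A k $$ (0, 0)"
    proof (cases "0 \<le> k")
      case True
      thus ?thesis by (simp add: unitary_powi_def power_int_def mom scaleR_conv_of_real)
    next
      case False
      have "w a *\<^sub>R a powi k = cnj (of_real (w a) * a ^ nat (- k))" if "a \<in> S" for a
      proof -
        have "cmod a = 1" using S(2) that by auto
        hence "inverse a = cnj a" using cnj_mult_self_unit[of a] by (metis inverse_unique mult.commute)
        thus ?thesis using False by (simp add: power_int_def scaleR_conv_of_real)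
      qed
      hence "(\<Sum>a\<in>S. w a *\<^sub>R a powi k) = cnj ((A ^\<^sub>m nat (- k)) $$ (0, 0))" by (simp add: mom)
      thus ?thesis using False n by (simp add: unitary_powi_def adjoint_pow_entry[OF Ac])
    qed
    finally show ?thesis .
  qed
  have sm: "spectral_measure A = ?\<mu>"
  proof (rule spectral_measure_eqI[OF Ac n _ S(1)])
    show "circle_prob ?\<mu>" by (rule circle_prob_discrete_measure[OF S(1,3) sw S(2)])
    show "AE z in ?\<mu>. z \<in> S" by (rule AE_discrete_measure[OF S(1,3)])
  qed (simp add: int)
  show "\<exists>m. supported_at m (spectral_measure A)"
    unfolding sm using supported_at_discrete_measure[OF S(1,3) sw S(2)] by blast
  show "(\<integral>z. z powi k \<partial>spectral_measure A) = unitary_powi A k $$ (0, 0)" for k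
    unfolding sm by (rule int)
qed

subsection \<open>Measurability\<close>

lemma space_unitary_borel [simp]: "space (unitary_borel n) = unitary_mats n"
  by (simp add: unitary_borel_def)

lemma measurable_mat_entry:
  assumes "i < n" "j < n"
  shows "(\<lambda>A. A $$ (i, j)) \<in> borel_measurable (unitary_borel n)"
proof -
  have "(\<lambda>A. \<lambda>p\<in>{..<n} \<times> {..<n}. A $$ p) \<in> unitary_borel n \<rightarrow>\<^sub>M PiM ({..<n} \<times> {..<n}) (\<lambda>_. borel :: complex measure)"
    unfolding unitary_borel_def by (rule measurable_vimage_algebra1) (auto simp: space_PiM)
  moreover have "(\<lambda>f. f (i, j)) \<in> PiM ({..<n} \<times> {..<n}) (\<lambda>_. borel :: complex measure) \<rightarrow>\<^sub>M borel"
    by (rule measurable_component_singleton) (use assms in auto)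
  ultimately have "(\<lambda>A. (\<lambda>p\<in>{..<n} \<times> {..<n}. A $$ p) (i, j)) \<in> borel_measurable (unitary_borel n)"
    by (rule measurable_compose)
  thus ?thesis using assms by simp
qed

lemma measurable_unitary_borelI:
  assumes "\<And>x. x \<in> space N \<Longrightarrow> F x \<in> unitary_mats n"
    and "\<And>i j. i < n \<Longrightarrow> j < n \<Longrightarrow> (\<lambda>x. F x $$ (i, j)) \<in> borel_measurable N"
  shows "F \<in> N \<rightarrow>\<^sub>M unitary_borel n"
  unfolding unitary_borel_def
  by (rule measurable_vimage_algebra2) (use assms in \<open>auto intro!: measurable_restrict\<close>)

lemma measurable_mat_pow_entry:
  assumes "i < n" "j < n"
  shows "(\<lambda>A. (A ^\<^sub>m k) $$ (i, j)) \<in> borel_measurable (unitary_borel n)"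
  using assms
proof (induction k arbitrary: j)
  case 0
  have "(\<lambda>_. (1\<^sub>m n :: complex mat) $$ (i, j)) \<in> borel_measurable (unitary_borel n)" by simp
  thus ?case
    by (rule measurable_cong[THEN iffD1, rotated]) (auto simp: unitary_mats_def)
next
  case (Suc k)
  have "(\<lambda>A. \<Sum>l<n. (A ^\<^sub>m k) $$ (i, l) * A $$ (l, j)) \<in> borel_measurable (unitary_borel n)"
    using Suc by (intro borel_measurable_sum borel_measurable_times measurable_mat_entry) auto
  thus ?case
    by (rule measurable_cong[THEN iffD1, rotated])
       (use Suc.prems in \<open>auto simp: unitary_mats_def pow_mat_Suc_entry simp del: pow_mat.simps\<close>)
qed

lemma measurable_moment:
  assumes "n > 0"
  shows "(\<lambda>A. \<integral>z. z powi k \<partial>spectral_measure A) \<in> borel_measurable (unitary_borel n)"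
proof -
  have "(\<lambda>A. if 0 \<le> k then (A ^\<^sub>m nat k) $$ (0, 0) else cnj ((A ^\<^sub>m nat (- k)) $$ (0, 0))) \<in> borel_measurable (unitary_borel n)"
    using measurable_mat_pow_entry[of 0 n 0 "nat k"] measurable_mat_pow_entry[of 0 n 0 "nat (- k)"] assms
    by (cases "0 \<le> k") auto
  thus ?thesis
    by (rule measurable_cong[THEN iffD1, rotated])
       (use assms in \<open>auto simp: unitary_spectral(2) unitary_powi_def adjoint_pow_entry unitary_mats_def\<close>)
qed

lemma unitary_spectral_circle_prob: "A \<in> unitary_mats n \<Longrightarrow> n > 0 \<Longrightarrow> circle_prob (spectral_measure A)"
  using unitary_spectral(1) by (auto simp: supported_at_def)

text \<open>A random polynomial is handled through its coefficients together with a common degree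
  bound, so that inner products become finite sums over moments.\<close>

lemma measurable_L2_inner_coeffs:
  assumes P: "\<And>i. (\<lambda>x. coeff (P x) i) \<in> borel_measurable N" "\<And>x. x \<in> space N \<Longrightarrow> degree (P x) \<le> d"
    and Q: "\<And>i. (\<lambda>x. coeff (Q x) i) \<in> borel_measurable N" "\<And>x. x \<in> space N \<Longrightarrow> degree (Q x) \<le> d"
    and \<mu>: "\<And>x. x \<in> space N \<Longrightarrow> circle_prob (\<mu> x)"
    and mom: "\<And>k. \<bar>k\<bar> \<le> int d \<Longrightarrow> (\<lambda>x. \<integral>z. z powi k \<partial>\<mu> x) \<in> borel_measurable N"
  shows "(\<lambda>x. L2_inner (\<mu> x) (P x) (Q x)) \<in> borel_measurable N"
proof -
  have cnjm: "(\<lambda>x. cnj (f x)) \<in> borel_measurable N" if "f \<in> borel_measurable N" for f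
    using that by measurable
  have "(\<lambda>x. \<Sum>i\<le>d. \<Sum>j\<le>d. cnj (coeff (P x) i) * coeff (Q x) j * (\<integral>z. z powi (int j - int i) \<partial>\<mu> x)) \<in> borel_measurable N"
    by (intro borel_measurable_sum borel_measurable_times cnjm P Q mom) auto
  thus ?thesis
    by (rule measurable_cong[THEN iffD1, rotated]) (use P(2) Q(2) \<mu> in \<open>auto intro!: L2_inner_moments[symmetric]\<close>)
qed

lemma degree_szego_le: "degree (szego \<mu> j) \<le> j"
proof (induction j)
  case (Suc j)
  have "degree (reversed (szego \<mu> j)) \<le> j" using degree_reversed_le Suc by (rule order.trans)
  thus ?case using Suc by (auto intro!: degree_diff_le order.trans[OF degree_pCons_le] order.trans[OF degree_smult_le])
qed auto

text \<open>\<open>reversed\<close> depends on the degree, so along the recursion the degree has to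
  be a fixed number in each branch; a nonzero norm places j below the number of atoms, where the
  degree is j.\<close>

lemma degree_szego:
  assumes s: "supported_at m \<mu>" and "L2_inner \<mu> (szego \<mu> j) (szego \<mu> j) \<noteq> 0"
  shows "degree (szego \<mu> j) = j"
proof -
  have "j < m"
  proof (rule ccontr)
    assume "\<not> j < m"
    hence "szego \<mu> j = (\<Prod>a\<in>atoms \<mu>. [:- a, 1:])"
      using Phi_eq_szego[OF s, of j] s by (simp add: Phi_def supported_at_def)
    hence "\<forall>a\<in>atoms \<mu>. poly (szego \<mu> j) a = 0"
      using s by (auto simp: poly_prod supported_at_def intro!: prod_zero)
    thus False using assms(2) L2_inner_norm_eq_0_iff[OF s] by blast
  qed
  thus ?thesis using szego_monic_orthogonal[OF s, of j] by (simp add: monic_orthogonal_def)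
qed

lemma measurable_szego_coeff:
  assumes n: "n > 0"
  shows "(\<lambda>A. coeff (szego (spectral_measure A) j) i) \<in> borel_measurable (unitary_borel n)"
proof (induction j arbitrary: i)
  case (Suc j)
  let ?N = "unitary_borel n" and ?P = "\<lambda>A. szego (spectral_measure A) j"
  have cp: "circle_prob (spectral_measure A)" if "A \<in> space ?N" for A
    using that n by (auto intro: unitary_spectral_circle_prob)
  have cP: "(\<lambda>A. coeff (pCons 0 (?P A)) i) \<in> borel_measurable ?N" for i
    using Suc by (cases i) auto
  have [measurable]: "(\<lambda>A. L2_inner (spectral_measure A) (?P A) (?P A)) \<in> borel_measurable ?N"
    by (rule measurable_L2_inner_coeffs[where d = j]) (use cp Suc degree_szego_le measurable_moment[OF n] in auto)
  have [measurable]: "(\<lambda>A. L2_inner (spectral_measure A) 1 (pCons 0 (?P A))) \<in> borel_measurable ?N"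
    by (rule measurable_L2_inner_coeffs[where d = "Suc j"])
       (use cp cP degree_szego_le measurable_moment[OF n] in \<open>auto intro!: order.trans[OF degree_pCons_le]\<close>)
  have [measurable]: "(\<lambda>A. coeff (?P A) i) \<in> borel_measurable ?N" for i by (rule Suc)
  have [measurable]: "(\<lambda>A. coeff (pCons 0 (?P A)) i) \<in> borel_measurable ?N" for i by (rule cP)
  have [measurable]: "(\<lambda>A. if i \<le> j then cnj (coeff (?P A) (j - i)) else 0) \<in> borel_measurable ?N"
    by (cases "i \<le> j") auto
  have "(\<lambda>A. if L2_inner (spectral_measure A) (?P A) (?P A) = 0 then coeff (?P A) i
      else coeff (pCons 0 (?P A)) i - (L2_inner (spectral_measure A) 1 (pCons 0 (?P A)) / L2_inner (spectral_measure A) (?P A) (?P A))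
         * (if i \<le> j then cnj (coeff (?P A) (j - i)) else 0)) \<in> borel_measurable ?N"
    by measurable
  moreover have "coeff (szego (spectral_measure A) (Suc j)) i = (if L2_inner (spectral_measure A) (?P A) (?P A) = 0 then coeff (?P A) i
      else coeff (pCons 0 (?P A)) i - (L2_inner (spectral_measure A) 1 (pCons 0 (?P A)) / L2_inner (spectral_measure A) (?P A) (?P A))
         * (if i \<le> j then cnj (coeff (?P A) (j - i)) else 0))" if "A \<in> space ?N" for A
  proof -
    have "A \<in> unitary_mats n" using that by simp
    from unitary_spectral(1)[OF this n] obtain m where "supported_at m (spectral_measure A)" ..
    from degree_szego[OF this, of j] show ?thesis by (auto simp: coeff_reversed)
  qed
  ultimately show ?case by (subst measurable_cong) auto
qed (auto simp: coeff_1)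

lemma measurable_Phi_coeff:
  assumes n: "n > 0"
  shows "(\<lambda>A. coeff (Phi (spectral_measure A) j) i) \<in> borel_measurable (unitary_borel n)"
  using measurable_szego_coeff[OF n, of j i]
proof (rule measurable_cong[THEN iffD1, rotated])
  fix A assume "A \<in> space (unitary_borel n)"
  hence "A \<in> unitary_mats n" by simp
  from unitary_spectral(1)[OF this n] obtain m where "supported_at m (spectral_measure A)" ..
  thus "coeff (szego (spectral_measure A) j) i = coeff (Phi (spectral_measure A) j) i" by (simp add: Phi_eq_szego)
qed

lemma degree_Phi_le:
  assumes n: "n > 0" and A: "A \<in> unitary_mats n"
  shows "degree (Phi (spectral_measure A) j) \<le> j"
proof -
  obtain m where "supported_at m (spectral_measure A)" using unitary_spectral(1)[OF A n] by auto
  thus ?thesis by (simp add: Phi_eq_szego degree_szego_le)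
qed

lemma measurable_deformed_verblunsky:
  assumes n: "n > 0"
  shows "(\<lambda>A. deformed_verblunsky (spectral_measure A) k) \<in> borel_measurable (unitary_borel n)"
proof -
  have "(\<lambda>A. \<Sum>i\<le>j. coeff (Phi (spectral_measure A) j) i) \<in> borel_measurable (unitary_borel n)" for j
    by (intro borel_measurable_sum measurable_Phi_coeff[OF n])
  hence [measurable]: "(\<lambda>A. poly (Phi (spectral_measure A) j) 1) \<in> borel_measurable (unitary_borel n)" for j
  proof (rule measurable_cong[THEN iffD1, rotated])
    fix A assume "A \<in> space (unitary_borel n)"
    thus "(\<Sum>i\<le>j. coeff (Phi (spectral_measure A) j) i) = poly (Phi (spectral_measure A) j) 1"
      using poly_eq_sum_le[OF degree_Phi_le[OF n, of A j], of 1] by simp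
  qed
  show ?thesis unfolding deformed_verblunsky_def by measurable
qed

text \<open>The mean of \<open>opuc \<alpha> k\<close> is 0, by orthogonality to 1 for k < n and
  because it vanishes at the atoms for k = n. Each moment is thus a polynomial expression in the
  coefficients of \<open>opuc\<close>, which bypasses a measurable choice of zeros.\<close>

lemma opuc_moment_rec:
  assumes n: "n = Suc m" and params: "verblunsky_tuple m \<alpha>" and k: "0 < k" "k \<le> n"
  shows "(\<integral>z. z ^ k \<partial>opuc_measure n \<alpha>) = - (\<Sum>j<k. coeff (opuc \<alpha> k) j * (\<integral>z. z ^ j \<partial>opuc_measure n \<alpha>))"
proof -
  note s = opuc_measure_props(1)[OF n params]
  have mom: "L2_inner (opuc_measure n \<alpha>) 1 (monom 1 j) = (\<integral>z. z ^ j \<partial>opuc_measure n \<alpha>)" for j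
    by (simp add: L2_inner_def poly_monom)
  have "L2_inner (opuc_measure n \<alpha>) 1 (opuc \<alpha> k) = 0"
  proof (cases "k < n")
    case True
    thus ?thesis using opuc_monic_orthogonal[OF n params True] k by (simp add: monic_orthogonal_def)
  next
    case False
    hence "k = n" using k by simp
    thus ?thesis unfolding L2_inner_opuc_measure[OF n params]
      by (intro sum.neutral ballI) (simp add: opuc_zeros_def[OF n params])
  qed
  moreover have "opuc \<alpha> k = (\<Sum>j<k. Polynomial.smult (coeff (opuc \<alpha> k) j) (monom 1 j)) + monom 1 k"
  proof -
    have "opuc \<alpha> k = (\<Sum>j\<le>k. monom (coeff (opuc \<alpha> k) j) j)" using poly_as_sum_of_monoms[of "opuc \<alpha> k"] by simp
    thus ?thesis by (simp add: smult_monom lessThan_Suc_atMost[symmetric])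
  qed
  ultimately have "0 = L2_inner (opuc_measure n \<alpha>) 1 ((\<Sum>j<k. Polynomial.smult (coeff (opuc \<alpha> k) j) (monom 1 j)) + monom 1 k)"
    by metis
  also have "\<dots> = (\<Sum>j<k. coeff (opuc \<alpha> k) j * (\<integral>z. z ^ j \<partial>opuc_measure n \<alpha>)) + (\<integral>z. z ^ k \<partial>opuc_measure n \<alpha>)"
    by (simp only: L2_inner_linear[OF s] mom)
  finally show ?thesis by (simp add: eq_neg_iff_add_eq_0 add.commute)
qed

lemma measurable_opuc_coeff:
  assumes "\<And>k. k < j \<Longrightarrow> (\<lambda>x. a x k) \<in> borel_measurable N"
  shows "(\<lambda>x. coeff (opuc (a x) j) i) \<in> borel_measurable N"
  using assms
proof (induction j arbitrary: i)
  case (Suc j)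
  have [measurable]: "(\<lambda>x. coeff (opuc (a x) j) i) \<in> borel_measurable N" for i using Suc by simp
  have [measurable]: "(\<lambda>x. coeff (pCons 0 (opuc (a x) j)) i) \<in> borel_measurable N"
    by (cases i) auto
  have [measurable]: "(\<lambda>x. coeff (reversed (opuc (a x) j)) i) \<in> borel_measurable N"
    unfolding coeff_reversed degree_opuc by (cases "i \<le> j") auto
  have [measurable]: "(\<lambda>x. a x j) \<in> borel_measurable N" using Suc.prems by simp
  show ?case unfolding opuc.simps coeff_diff coeff_smult by measurable
qed (simp add: coeff_1)

context
  fixes N :: "'b measure" and a :: "'b \<Rightarrow> nat \<Rightarrow> complex" and n m :: nat
  assumes n: "n = Suc m" and a: "\<And>k. k < n \<Longrightarrow> (\<lambda>x. a x k) \<in> borel_measurable N"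
    and tuple: "\<And>x. x \<in> space N \<Longrightarrow> verblunsky_tuple m (a x)"
begin

lemma measurable_opuc_moment:
  assumes "\<bar>k\<bar> \<le> int n"
  shows "(\<lambda>x. \<integral>z. z powi k \<partial>opuc_measure n (a x)) \<in> borel_measurable N"
proof -
  have s: "supported_at n (opuc_measure n (a x))" if "x \<in> space N" for x
    by (rule opuc_measure_props(1)[OF n tuple[OF that]])
  have nat: "(\<lambda>x. \<integral>z. z ^ j \<partial>opuc_measure n (a x)) \<in> borel_measurable N" if "j \<le> n" for j
    using that
  proof (induction j rule: less_induct)
    case (less j)
    show ?case
    proof (cases "j = 0")
      case True
      have "(\<integral>z. 1 \<partial>opuc_measure n (a x)) = (1 :: complex)" if "x \<in> space N" for x
      proof -
        interpret prob_space "opuc_measure n (a x)" using s[OF that] by (simp add: supported_at_def circle_prob_def)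
        show ?thesis by (simp add: prob_space)
      qed
      thus ?thesis using True by (simp cong: measurable_cong)
    next
      case False
      have "(\<lambda>x. - (\<Sum>i<j. coeff (opuc (a x) j) i * (\<integral>z. z ^ i \<partial>opuc_measure n (a x)))) \<in> borel_measurable N"
        using less a by (intro borel_measurable_uminus borel_measurable_sum borel_measurable_times measurable_opuc_coeff) auto
      thus ?thesis
        by (rule measurable_cong[THEN iffD1, rotated]) (use False less.prems in \<open>simp add: opuc_moment_rec[OF n tuple]\<close>)
    qed
  qed
  show ?thesis
  proof (cases "0 \<le> k")
    case True
    thus ?thesis using nat[of "nat k"] assms by (simp add: power_int_def)
  next
    case False
    have [measurable]: "(\<lambda>x. \<integral>z. z ^ nat (- k) \<partial>opuc_measure n (a x)) \<in> borel_measurable N"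
      using False assms by (intro nat) simp
    have "(\<lambda>x. cnj (\<integral>z. z ^ nat (- k) \<partial>opuc_measure n (a x))) \<in> borel_measurable N" by measurable
    thus ?thesis
    proof (rule measurable_cong[THEN iffD1, rotated])
      fix x assume x: "x \<in> space N"
      have pm: "(\<lambda>z::complex. z powi k) \<in> borel_measurable borel" using False by (simp add: power_int_def)
      have c: "cnj (b ^ nat (- k)) = b powi k" if "b \<in> atoms (opuc_measure n (a x))" for b
      proof -
        have "cmod b = 1" using that s[OF x] by (auto intro: atoms_on_circle simp: supported_at_def)
        hence "inverse b = cnj b" using cnj_mult_self_unit[of b] by (metis inverse_unique mult.commute)
        thus ?thesis using False by (simp add: power_int_def)
      qed
      show "cnj (\<integral>z. z ^ nat (- k) \<partial>opuc_measure n (a x)) = (\<integral>z. z powi k \<partial>opuc_measure n (a x))"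
        unfolding integral_supported_at[OF s[OF x] pm]
        by (subst integral_supported_at[OF s[OF x]]) (auto simp: c simp del: complex_cnj_power intro!: sum.cong)
    qed
  qed
qed

text \<open>The entries are inner products of polynomials of degree at most n, divided by norms that
  are explicit products, so moments up to order n determine them.\<close>

lemma measurable_GGT: "(\<lambda>x. GGT n (a x)) \<in> N \<rightarrow>\<^sub>M unitary_borel n"
proof (rule measurable_unitary_borelI)
  show "GGT n (a x) \<in> unitary_mats n" if "x \<in> space N" for x by (rule GGT_unitary[OF n tuple[OF that]])
  fix i j assume ij: "i < n" "j < n"
  have s: "supported_at n (opuc_measure n (a x))" if "x \<in> space N" for x
    by (rule opuc_measure_props(1)[OF n tuple[OF that]])
  have am: "k < n \<Longrightarrow> (\<lambda>x. opuc_norm2 (a x) k) \<in> borel_measurable N" for k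
    unfolding opuc_norm2_def using a by (intro borel_measurable_prod) auto
  have [measurable]: "(\<lambda>x. opuc_norm2 (a x) i) \<in> borel_measurable N" "(\<lambda>x. opuc_norm2 (a x) j) \<in> borel_measurable N"
    using am ij by auto
  have [measurable]: "(\<lambda>x. L2_inner (opuc_measure n (a x)) (opuc (a x) i) (pCons 0 (opuc (a x) j))) \<in> borel_measurable N"
  proof (rule measurable_L2_inner_coeffs[where d = n])
    show "(\<lambda>x. coeff (opuc (a x) i) l) \<in> borel_measurable N" for l using ij a by (intro measurable_opuc_coeff) simp
    show "(\<lambda>x. coeff (pCons 0 (opuc (a x) j)) l) \<in> borel_measurable N" for l
      using ij a by (cases l) (auto intro: measurable_opuc_coeff)
    show "degree (pCons 0 (opuc (a x) j)) \<le> n" for x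
      using ij by (intro order.trans[OF degree_pCons_le]) simp
    show "circle_prob (opuc_measure n (a x))" if "x \<in> space N" for x using s[OF that] by (simp add: supported_at_def)
  qed (use ij measurable_opuc_moment in auto)
  have "(\<lambda>x. complex_of_real (inverse (sqrt (opuc_norm2 (a x) i)) * inverse (sqrt (opuc_norm2 (a x) j))) *
      L2_inner (opuc_measure n (a x)) (opuc (a x) i) (pCons 0 (opuc (a x) j))) \<in> borel_measurable N" by measurable
  thus "(\<lambda>x. GGT n (a x) $$ (i, j)) \<in> borel_measurable N"
  proof (rule measurable_cong[THEN iffD1, rotated])
    fix x assume x: "x \<in> space N"
    note hyps = n tuple[OF x]
    have sh: "pCons 0 (Polynomial.smult c p) = Polynomial.smult c (pCons 0 p)" for c and p :: "complex poly" by simp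
    have "GGT n (a x) $$ (i, j) = L2_inner (opuc_measure n (a x))
        (Polynomial.smult (of_real (inverse (sqrt (opuc_norm2 (a x) i)))) (opuc (a x) i))
        (pCons 0 (Polynomial.smult (of_real (inverse (sqrt (opuc_norm2 (a x) j)))) (opuc (a x) j)))"
      using ij by (simp add: GGT_def Let_def verblunsky_measure_eq[OF hyps] Phi_opuc_measure[OF hyps] L2_norm_opuc[OF hyps])
    also have "\<dots> = complex_of_real (inverse (sqrt (opuc_norm2 (a x) i)) * inverse (sqrt (opuc_norm2 (a x) j))) *
      L2_inner (opuc_measure n (a x)) (opuc (a x) i) (pCons 0 (opuc (a x) j))"
      unfolding sh L2_inner_linear[OF s[OF x]] by simp
    finally show "complex_of_real (inverse (sqrt (opuc_norm2 (a x) i)) * inverse (sqrt (opuc_norm2 (a x) j))) *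
      L2_inner (opuc_measure n (a x)) (opuc (a x) i) (pCons 0 (opuc (a x) j)) = GGT n (a x) $$ (i, j)" ..
  qed
qed

end

text \<open>At 0 the recursion reads Phi_(k+1)(0) = - cnj alpha_k, because the reversal of a monic
  polynomial is 1 there. This inverts \<open>GGT\<close>.\<close>

definition recovered_params :: "complex mat \<Rightarrow> nat \<Rightarrow> complex" where
  "recovered_params A k = - cnj (coeff (Phi (spectral_measure A) (Suc k)) 0)"

lemma recovered_params_GGT:
  assumes n: "n = Suc m" and params: "verblunsky_tuple m \<alpha>" and k: "k < n"
  shows "recovered_params (GGT n \<alpha>) k = \<alpha> k"
  unfolding recovered_params_def spectral_measure_GGT[OF n params]
  using k by (simp add: Phi_opuc_measure[OF n params] coeff_reversed del: opuc.simps) (simp add: coeff_reversed)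

lemma GGT_cong:
  assumes "\<And>k. k < n \<Longrightarrow> \<alpha> k = \<alpha>' k"
  shows "GGT n \<alpha> = GGT n \<alpha>'"
proof -
  have "has_verblunsky n \<mu> \<alpha> = has_verblunsky n \<mu> \<alpha>'" for \<mu> using assms by (simp add: has_verblunsky_def)
  thus ?thesis by (simp add: GGT_def verblunsky_measure_def)
qed

text \<open>The GGT matrices form a measurable set on which \<^const>\<open>det_delta\<close> is a measurable function of the
  deformed Verblunsky coefficients; measurability of \<^const>\<open>det_delta\<close> itself is never needed.\<close>

definition GGT_range :: "nat \<Rightarrow> complex mat set" where
  "GGT_range n = {A \<in> unitary_mats n. verblunsky_tuple (n - 1) (recovered_params A) \<and> GGT n (recovered_params A) = A}"

lemma GGT_in_range:
  assumes n: "n = Suc m" and params: "verblunsky_tuple m \<alpha>"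
  shows "GGT n \<alpha> \<in> GGT_range n"
proof -
  have "GGT n (recovered_params (GGT n \<alpha>)) = GGT n \<alpha>"
    by (rule GGT_cong) (rule recovered_params_GGT[OF n params])
  moreover have "verblunsky_tuple m (recovered_params (GGT n \<alpha>))"
  proof -
    have "recovered_params (GGT n \<alpha>) i = \<alpha> i" if "i \<le> m" for i
      by (rule recovered_params_GGT[OF n params]) (use that n in simp)
    thus ?thesis using params unfolding verblunsky_tuple_def by simp
  qed
  ultimately show ?thesis using GGT_unitary[OF n params] n by (simp add: GGT_range_def)
qed

text \<open>Membership is an equality of matrix entries, measurable once
  \<open>GGT n (recovered_params A)\<close> is. The latter is known on admissible tuples, hence the
  detour through \<open>restrict_space\<close>.\<close>

lemma GGT_range_measurable:
  assumes n: "n = Suc m"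
  shows "GGT_range n \<in> sets (unitary_borel n)"
proof -
  let ?N = "unitary_borel n"
  have am [measurable]: "(\<lambda>A. recovered_params A k) \<in> borel_measurable ?N" for k
  proof -
    have [measurable]: "(\<lambda>A. coeff (Phi (spectral_measure A) (Suc k)) 0) \<in> borel_measurable ?N"
      using n by (intro measurable_Phi_coeff) simp
    show ?thesis unfolding recovered_params_def by measurable
  qed
  define T where "T = {A \<in> space ?N. verblunsky_tuple m (recovered_params A)}"
  have T: "T \<in> sets ?N" unfolding T_def verblunsky_tuple_def by measurable
  let ?R = "restrict_space ?N T"
  have Ts: "space ?R = T" using T sets.sets_into_space[OF T] by (auto simp: space_restrict_space)
  have "(\<lambda>A. GGT n (recovered_params A)) \<in> ?R \<rightarrow>\<^sub>M unitary_borel n"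
  proof (rule measurable_GGT[OF n])
    show "(\<lambda>A. recovered_params A k) \<in> borel_measurable ?R" for k
      by (rule measurable_restrict_space1) (rule am)
    show "verblunsky_tuple m (recovered_params A)" if "A \<in> space ?R" for A
      using that unfolding Ts by (simp add: T_def)
  qed
  hence g: "(\<lambda>A. GGT n (recovered_params A) $$ (i, j)) \<in> borel_measurable ?R" if "i < n" "j < n" for i j
    by (rule measurable_compose) (rule measurable_mat_entry[OF that])
  have e: "(\<lambda>A. A $$ (i, j)) \<in> borel_measurable ?R" if "i < n" "j < n" for i j
    by (rule measurable_restrict_space1) (rule measurable_mat_entry[OF that])
  have "{A \<in> space ?R. \<forall>i\<in>{..<n}. \<forall>j\<in>{..<n}. GGT n (recovered_params A) $$ (i, j) = A $$ (i, j)} \<in> sets ?R"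
    by (intro sets.sets_Collect_finite_All' borel_measurable_eq) (use g e n in auto)
  moreover have "{A \<in> space ?R. \<forall>i\<in>{..<n}. \<forall>j\<in>{..<n}. GGT n (recovered_params A) $$ (i, j) = A $$ (i, j)} = GGT_range n"
  proof -
    have "(\<forall>i\<in>{..<n}. \<forall>j\<in>{..<n}. GGT n (recovered_params A) $$ (i, j) = A $$ (i, j)) \<longleftrightarrow> GGT n (recovered_params A) = A"
      if "A \<in> T" for A
    proof -
      have "A \<in> carrier_mat n n" using that by (simp add: T_def unitary_mats_def)
      moreover have "GGT n (recovered_params A) \<in> carrier_mat n n" by (simp add: GGT_def Let_def)
      ultimately show ?thesis by (auto intro!: eq_matI)
    qed
    thus ?thesis unfolding Ts GGT_range_def using n by (auto simp: T_def)
  qed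
  ultimately have R: "GGT_range n \<in> sets ?R" by simp
  have "T \<inter> space ?N \<in> sets ?N" using T by (simp only: sets.Int_space_eq2)
  from iffD1[OF sets_restrict_space_iff[OF this] R] show ?thesis by simp
qed

subsection \<open>Rotation invariance of the laws of the Verblunsky coefficients\<close>

text \<open>\<open>nu s\<close> regarded as a measure on the whole plane, so that the laws for s > 1
  and s = 1 share one measurable space, the one in which the deformed coefficients take their
  values.\<close>

definition nu_borel :: "real \<Rightarrow> complex measure" where
  "nu_borel s = (if s = 1 then uniform_circle else density lborel
     (\<lambda>z. ennreal (indicator (ball 0 1) z * ((s - 1) / (2 * pi) * (1 - (cmod z)\<^sup>2) powr ((s - 3) / 2)))))"

lemma nu_borel_1: "nu_borel 1 = uniform_circle"
  by (simp add: nu_borel_def)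

lemma nu_borel_disc: "s \<noteq> 1 \<Longrightarrow> nu_borel s = density lborel
     (\<lambda>z. ennreal (indicator (ball 0 1) z * ((s - 1) / (2 * pi) * (1 - (cmod z)\<^sup>2) powr ((s - 3) / 2))))"
  by (simp only: nu_borel_def if_False)

lemma Re_pos_not_nonpos_Ints: "Re z > 0 \<Longrightarrow> z \<notin> \<int>\<^sub>\<le>\<^sub>0"
  by (auto elim!: nonpos_Ints_cases)

lemma sets_nu_borel [simp, measurable_cong]: "sets (nu_borel s) = sets borel"
  by (simp add: nu_borel_def)

lemma space_nu_borel [simp]: "space (nu_borel s) = UNIV"
  by (simp add: nu_borel_def)

lemma ball_borel [measurable]: "ball (0::complex) 1 \<in> sets borel" and sphere_borel [measurable]: "sphere (0::complex) 1 \<in> sets borel"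
  by (simp_all add: borel_closed)

lemma space_nu: "space (nu s) = (if s = 1 then sphere 0 1 else ball 0 1)"
  by (simp add: nu_def space_restrict_space)

lemma sets_nu: "sets (nu s) = sets (restrict_space borel (if s = 1 then sphere 0 1 else ball 0 1))"
  by (simp add: nu_def sets_restrict_space)

lemma measurable_nu: "f \<in> borel_measurable borel \<Longrightarrow> f \<in> nu s \<rightarrow>\<^sub>M borel"
  unfolding measurable_cong_sets[OF sets_nu refl] by (rule measurable_restrict_space1)

lemma nn_integral_nu:
  fixes f :: "complex \<Rightarrow> ennreal"
  assumes [measurable]: "f \<in> borel_measurable borel"
  shows "(\<integral>\<^sup>+z. f z \<partial>nu s) = (\<integral>\<^sup>+z. f z \<partial>nu_borel s)"
proof (cases "s = 1")
  case True
  have "(\<integral>\<^sup>+z. f z \<partial>nu s) = (\<integral>\<^sup>+z. f z * indicator (sphere 0 1) z \<partial>uniform_circle)"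
    unfolding nu_def using True by (simp add: nn_integral_restrict_space)
  also have "\<dots> = (\<integral>\<^sup>+z. f z \<partial>uniform_circle)"
    by (rule nn_integral_cong_AE) (use AE_uniform_circle_sphere in \<open>auto elim!: eventually_mono\<close>)
  finally show ?thesis using True by (simp add: nu_borel_def)
next
  case False
  define w where "w = (\<lambda>z::complex. (s - 1) / (2 * pi) * (1 - (cmod z)\<^sup>2) powr ((s - 3) / 2))"
  have [measurable]: "w \<in> borel_measurable borel" unfolding w_def by measurable
  have "(\<integral>\<^sup>+z. f z \<partial>nu s) = (\<integral>\<^sup>+z. ennreal (w z) * f z \<partial>restrict_space lborel (ball 0 1))"
    unfolding nu_def if_not_P[OF False] w_def
    by (subst nn_integral_density) (auto intro: measurable_restrict_space1)
  also have "\<dots> = (\<integral>\<^sup>+z. ennreal (w z) * f z * indicator (ball 0 1) z \<partial>lborel)"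
    by (subst nn_integral_restrict_space) auto
  also have "\<dots> = (\<integral>\<^sup>+z. ennreal (indicator (ball 0 1) z * w z) * f z \<partial>lborel)"
    by (intro nn_integral_cong) (auto simp: indicator_def)
  also have "\<dots> = (\<integral>\<^sup>+z. f z \<partial>nu_borel s)"
    unfolding nu_borel_disc[OF False] w_def by (subst nn_integral_density) auto
  finally show ?thesis .
qed

lemma AE_nu_borel_cball: "AE z in nu_borel s. cmod z \<le> 1"
proof (cases "s = 1")
  case True
  show ?thesis unfolding True nu_borel_1 using AE_uniform_circle_sphere by (auto elim!: eventually_mono)
next
  case False
  show ?thesis unfolding nu_borel_disc[OF False] by (subst AE_density) (auto simp: indicator_def)
qed

lemma AE_nu_borel_neq_1: "AE z in nu_borel s. z \<noteq> 1"
proof (cases "s = 1")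
  case True
  show ?thesis unfolding True nu_borel_1 by (rule AE_uniform_circle_neq)
next
  case False
  have "AE z in lborel. z \<noteq> (1::complex)" by (rule AE_lborel_singleton)
  thus ?thesis unfolding nu_borel_disc[OF False] by (subst AE_density) (auto elim!: eventually_mono)
qed

text \<open>One formula for the disc and the circle: the normalization b / pi turns
  \<open>Gamma b\<close> into \<open>Gamma (b + 1)\<close>, which is finite also at b = 0.\<close>

lemma kernel_integral_nu_borel:
  assumes s: "s \<ge> 1" and pq: "Re (p + q) > -1" and b: "b = (s - 1) / 2"
  shows "integrable (nu_borel s) (\<lambda>z. (1 - z) powr p * (1 - cnj z) powr q)"
    and "(LINT z|nu_borel s. (1 - z) powr p * (1 - cnj z) powr q) =
      Gamma (of_real b + 1) * Gamma (of_real b + 1 + p + q) * rGamma (of_real b + 1 + p) * rGamma (of_real b + 1 + q)"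
proof -
  let ?f = "\<lambda>z. (1 - z) powr p * (1 - cnj z) powr q"
  have "integrable (nu_borel s) ?f \<and> (LINT z|nu_borel s. ?f z) =
      Gamma (of_real b + 1) * Gamma (of_real b + 1 + p + q) * rGamma (of_real b + 1 + p) * rGamma (of_real b + 1 + q)"
  proof (cases "s = 1")
    case True
    show ?thesis unfolding True nu_borel_1 using circle_kernel_integral[OF pq] b True by (simp add: add_ac)
  next
    case False
    have b0: "b > 0" using s False b by simp
    have e: "(s - 1) / (2 * pi) = b / pi" "(s - 3) / 2 = b - 1" by (simp_all add: b field_simps)
    define w where "w = (\<lambda>z::complex. indicator (ball 0 1) z * (b / pi * (1 - (cmod z)\<^sup>2) powr (b - 1)))"
    have [measurable]: "w \<in> borel_measurable borel" unfolding w_def by measurable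
    have w0: "w z \<ge> 0" for z using b0 by (simp add: w_def)
    have nb: "nu_borel s = density lborel (\<lambda>z. ennreal (w z))"
      unfolding nu_borel_disc[OF False] e w_def ..
    have pq': "Re (p + q) + b + 1 > 0" using pq b0 by simp
    note D = disc_kernel_integral[OF b0 pq']
    have wf: "w z *\<^sub>R ?f z = of_real (b / pi) * (indicator (ball 0 1) z *\<^sub>R disc_kernel p q b z)" for z
      by (simp add: w_def disc_kernel_def scaleR_conv_of_real)
    have 1: "integrable (nu_borel s) ?f"
    proof -
      have "integrable lborel (\<lambda>z. w z *\<^sub>R ?f z)" unfolding wf by (rule integrable_mult_right[OF D(1)])
      thus ?thesis unfolding nb using w0 by (subst integrable_density) auto
    qed
    have "(LINT z|nu_borel s. ?f z) = (LINT z|lborel. w z *\<^sub>R ?f z)"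
      unfolding nb using w0 by (intro integral_density) auto
    also have "\<dots> = of_real (b / pi) * (of_real pi * Gamma (of_real b) * Gamma (p + q + of_real b + 1) * rGamma (of_real b + 1 + p) * rGamma (of_real b + 1 + q))"
      unfolding wf integral_mult_right_zero D(2) ..
    also have "\<dots> = (of_real b * Gamma (of_real b)) * Gamma (p + q + of_real b + 1) * rGamma (of_real b + 1 + p) * rGamma (of_real b + 1 + q)"
      by simp
    also have "of_real b * Gamma (of_real b) = Gamma (complex_of_real b + 1)"
      using b0 by (intro Gamma_plus1[symmetric]) (auto elim!: nonpos_Ints_cases simp: complex_eq_iff)
    finally show ?thesis using 1 by (simp add: add_ac)
  qed
  thus "integrable (nu_borel s) ?f" "(LINT z|nu_borel s. ?f z) =
      Gamma (of_real b + 1) * Gamma (of_real b + 1 + p + q) * rGamma (of_real b + 1 + p) * rGamma (of_real b + 1 + q)" by auto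
qed

lemma prob_space_nu:
  assumes "s \<ge> 1"
  shows "prob_space (nu s)"
proof (rule prob_spaceI)
  define b where "b = complex_of_real ((s - 1) / 2)"
  have G: "Gamma (b + 1) \<noteq> 0"
  proof -
    have "Re (b + 1) = (s + 1) / 2" by (simp add: b_def field_simps)
    hence "Re (b + 1) > 0" using assms by simp
    thus ?thesis by (simp only: Gamma_eq_zero_iff Re_pos_not_nonpos_Ints not_False_eq_True)
  qed
  note K = kernel_integral_nu_borel[OF assms, of 0 0, OF _ refl, folded b_def]
  \<comment> \<open>\<open>0 powr 0\<close> is 0, so the kernel with p = q = 0 equals 1 only off z =
    1.\<close>
  have ae: "AE z in nu_borel s. (1 - z) powr 0 * (1 - cnj z) powr 0 = 1"
    using AE_nu_borel_neq_1[of s] by eventually_elim auto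
  have "integrable (nu_borel s) (\<lambda>_. 1 :: complex)"
    using K(1) by (subst integrable_cong_AE[OF _ _ ae, symmetric]) auto
  hence fin: "emeasure (nu_borel s) UNIV < \<infinity>" by (simp add: integrable_iff_bounded)
  have "(LINT z|nu_borel s. 1 :: complex) = (LINT z|nu_borel s. (1 - z) powr 0 * (1 - cnj z) powr 0)"
    by (rule integral_cong_AE) (use ae in \<open>auto elim!: eventually_mono\<close>)
  also have "\<dots> = Gamma (b + 1) * Gamma (b + 1 + 0 + 0) * rGamma (b + 1 + 0) * rGamma (b + 1 + 0)"
    by (rule K(2)) simp
  also have "\<dots> = 1" using G by (simp add: rGamma_inverse_Gamma field_simps)
  finally have "measure (nu_borel s) UNIV = 1" using fin by (simp add: scaleR_conv_of_real)
  hence "emeasure (nu_borel s) UNIV = 1" using fin by (simp add: emeasure_eq_ennreal_measure)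
  hence "(\<integral>\<^sup>+z. 1 \<partial>nu_borel s) = 1" by simp
  hence "(\<integral>\<^sup>+z. 1 \<partial>nu s) = 1" by (simp only: nn_integral_nu[OF borel_measurable_const])
  thus "emeasure (nu s) (space (nu s)) = 1" by simp
qed

lemma nn_integral_nu_reflect_rotate:
  assumes f [measurable]: "f \<in> borel_measurable borel" and u: "cmod u = 1"
  shows "(\<integral>\<^sup>+z. f (cnj z * u) \<partial>nu s) = (\<integral>\<^sup>+z. f z \<partial>nu s)"
proof (cases "s = 1")
  case True
  have "(\<lambda>z. f (cnj z * u)) \<in> borel_measurable borel" by measurable
  thus ?thesis unfolding True
    by (simp only: nn_integral_nu[OF f] nn_integral_nu nu_borel_1 nn_integral_uniform_circle_reflect_rotate[OF f u])
next
  case False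
  define w where "w = (\<lambda>z::complex. ennreal (indicator (ball 0 1) z * ((s - 1) / (2 * pi) * (1 - (cmod z)\<^sup>2) powr ((s - 3) / 2))))"
  have [measurable]: "w \<in> borel_measurable borel" unfolding w_def by measurable
  have nb: "(\<integral>\<^sup>+z. g z \<partial>nu s) = (\<integral>\<^sup>+z. w z * g z \<partial>lborel)" if [measurable]: "g \<in> borel_measurable borel" for g
    unfolding nn_integral_nu[OF that] nu_borel_disc[OF False] w_def by (subst nn_integral_density) auto
  have w: "w (cnj z * u) = w z" for z
    using u by (simp add: w_def norm_mult indicator_def)
  have "(\<integral>\<^sup>+z. f (cnj z * u) \<partial>nu s) = (\<integral>\<^sup>+z. w (cnj z * u) * f (cnj z * u) \<partial>lborel)"
    unfolding w by (rule nb) measurable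
  also have "\<dots> = (\<integral>\<^sup>+z. w (z * u) * f (z * u) \<partial>lborel)"
    by (rule nn_integral_lborel_cnj[of "\<lambda>z. w (z * u) * f (z * u)"]) measurable
  also have "\<dots> = (\<integral>\<^sup>+z. w z * f z \<partial>lborel)"
    by (rule nn_integral_lborel_rotate[OF _ u, of "\<lambda>z. w z * f z"]) measurable
  also have "\<dots> = (\<integral>\<^sup>+z. f z \<partial>nu s)" by (simp add: nb)
  finally show ?thesis .
qed

lemma opuc_gamma_cong: "(\<And>i. i \<le> k \<Longrightarrow> \<alpha> i = \<alpha>' i) \<Longrightarrow> opuc_gamma \<alpha> k = opuc_gamma \<alpha>' k"
  using opuc_cong[of k \<alpha> \<alpha>'] by (simp add: opuc_gamma_def)

lemma measurable_opuc_gamma: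
  assumes "\<And>i. i \<le> k \<Longrightarrow> (\<lambda>x. a x i) \<in> borel_measurable N"
  shows "(\<lambda>x. opuc_gamma (a x) k) \<in> borel_measurable N"
proof -
  have "(\<lambda>x. \<Sum>i\<le>k. coeff (opuc (a x) k) i) \<in> borel_measurable N"
    using assms by (intro borel_measurable_sum measurable_opuc_coeff) auto
  hence [measurable]: "(\<lambda>x. poly (opuc (a x) k) 1) \<in> borel_measurable N"
    by (rule measurable_cong[THEN iffD1, rotated]) (simp add: poly_altdef)
  have [measurable]: "(\<lambda>x. a x k) \<in> borel_measurable N" using assms by simp
  show ?thesis unfolding opuc_gamma_def by measurable
qed

text \<open>The last coordinate is integrated first: with the others fixed, its deformed coefficient
  is its conjugate times a fixed unimodular number, and \<open>nu\<close> is invariant under that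
  map, so the last factor splits off. \<open>s1\<close> keeps all but the last coordinate inside the
  open disc, where the phase of the next coefficient is defined.\<close>

lemma nn_integral_prod_opuc_gamma:
  fixes s :: "nat \<Rightarrow> real" and g :: "nat \<Rightarrow> complex \<Rightarrow> ennreal"
  assumes s: "\<And>k. s k \<ge> 1" and s1: "\<And>k. Suc k < m \<Longrightarrow> s k \<noteq> 1"
    and g: "\<And>k. g k \<in> borel_measurable borel"
  shows "(\<integral>\<^sup>+\<alpha>. (\<Prod>k<m. g k (opuc_gamma \<alpha> k)) \<partial>PiM {..<m} (\<lambda>k. nu (s k))) = (\<Prod>k<m. \<integral>\<^sup>+z. g k z \<partial>nu_borel (s k))"
  using s1
proof (induction m)
  case 0
  show ?case by (simp add: PiM_empty)
next
  case (Suc m)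
  interpret product_sigma_finite "\<lambda>k. nu (s k)"
    unfolding product_sigma_finite_def by (intro allI prob_space_imp_sigma_finite prob_space_nu s)
  have gm: "(\<lambda>\<alpha>. g k (opuc_gamma \<alpha> k)) \<in> borel_measurable (PiM I (\<lambda>k. nu (s k)))" if "{..k} \<subseteq> I" for k I
  proof (rule measurable_compose[OF _ g])
    show "(\<lambda>\<alpha>. opuc_gamma \<alpha> k) \<in> borel_measurable (PiM I (\<lambda>k. nu (s k)))"
    proof (rule measurable_opuc_gamma)
      fix i assume "i \<le> k"
      hence "i \<in> I" using that by auto
      hence c: "(\<lambda>\<alpha>. \<alpha> i) \<in> PiM I (\<lambda>k. nu (s k)) \<rightarrow>\<^sub>M nu (s i)" by (rule measurable_component_singleton)
      have "(\<lambda>z. z) \<in> nu (s i) \<rightarrow>\<^sub>M (borel :: complex measure)" by (rule measurable_nu) simp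
      from measurable_compose[OF c this] show "(\<lambda>\<alpha>. \<alpha> i) \<in> borel_measurable (PiM I (\<lambda>k. nu (s k)))" .
    qed
  qed
  let ?C = "\<integral>\<^sup>+z. g m z \<partial>nu_borel (s m)"
  have "(\<integral>\<^sup>+\<alpha>. (\<Prod>k<Suc m. g k (opuc_gamma \<alpha> k)) \<partial>PiM {..<Suc m} (\<lambda>k. nu (s k))) =
     (\<integral>\<^sup>+x. \<integral>\<^sup>+y. (\<Prod>k<Suc m. g k (opuc_gamma (x(m := y)) k)) \<partial>nu (s m) \<partial>PiM {..<m} (\<lambda>k. nu (s k)))"
    unfolding lessThan_Suc
    by (rule product_nn_integral_insert) (auto intro!: borel_measurable_times_ennreal borel_measurable_prod_ennreal gm)
  also have "\<dots> = (\<integral>\<^sup>+x. (\<Prod>k<m. g k (opuc_gamma x k)) * ?C \<partial>PiM {..<m} (\<lambda>k. nu (s k)))"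
  proof (rule nn_integral_cong)
    fix x assume x: "x \<in> space (PiM {..<m} (\<lambda>k. nu (s k)))"
    define P where "P = poly (opuc x m) 1"
    have lt: "cmod (x i) < 1" if "i < m" for i
    proof -
      have "x i \<in> space (nu (s i))" using x that by (auto simp: space_PiM PiE_def Pi_def)
      thus ?thesis using Suc.prems[of i] that by (simp add: space_nu)
    qed
    \<comment> \<open>Any point of the circle completes \<open>x\<close> to an admissible tuple, to
      which the nonvanishing of \<open>opuc\<close> at 1 applies.\<close>
    have "verblunsky_tuple m (x(m := 1))" using lt by (simp add: verblunsky_tuple_def)
    from poly_opuc_1_nz[OF refl this, of m] have "P \<noteq> 0"
      using opuc_cong[of m x "x(m := 1)"] by (simp add: P_def)
    hence u: "cmod (cnj P / P) = 1" by (simp add: norm_divide)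
    have "opuc_gamma (x(m := y)) k = opuc_gamma x k" if "k < m" for k y
      using that by (intro opuc_gamma_cong) auto
    moreover have "opuc_gamma (x(m := y)) m = cnj y * (cnj P / P)" for y
      using opuc_cong[of m "x(m := y)" x] by (simp add: opuc_gamma_def P_def)
    ultimately have "(\<integral>\<^sup>+y. (\<Prod>k<Suc m. g k (opuc_gamma (x(m := y)) k)) \<partial>nu (s m)) =
        (\<integral>\<^sup>+y. (\<Prod>k<m. g k (opuc_gamma x k)) * g m (cnj y * (cnj P / P)) \<partial>nu (s m))"
      by simp
    also have "\<dots> = (\<Prod>k<m. g k (opuc_gamma x k)) * (\<integral>\<^sup>+y. g m (cnj y * (cnj P / P)) \<partial>nu (s m))"
      by (rule nn_integral_cmult, rule measurable_nu, rule measurable_compose[OF _ g]) measurable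
    also have "(\<integral>\<^sup>+y. g m (cnj y * (cnj P / P)) \<partial>nu (s m)) = ?C"
      unfolding nn_integral_nu_reflect_rotate[OF g u] by (rule nn_integral_nu[OF g])
    finally show "(\<integral>\<^sup>+y. (\<Prod>k<Suc m. g k (opuc_gamma (x(m := y)) k)) \<partial>nu (s m)) = (\<Prod>k<m. g k (opuc_gamma x k)) * ?C" .
  qed
  also have "\<dots> = (\<integral>\<^sup>+x. (\<Prod>k<m. g k (opuc_gamma x k)) \<partial>PiM {..<m} (\<lambda>k. nu (s k))) * ?C"
    by (rule nn_integral_multc) (auto intro!: borel_measurable_prod_ennreal gm)
  also have "(\<integral>\<^sup>+x. (\<Prod>k<m. g k (opuc_gamma x k)) \<partial>PiM {..<m} (\<lambda>k. nu (s k))) = (\<Prod>k<m. \<integral>\<^sup>+z. g k z \<partial>nu_borel (s k))"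
    by (rule Suc.IH) (use Suc.prems in simp)
  finally show ?case by simp
qed

subsection \<open>The circular Jacobi ensemble\<close>

definition delta_weight :: "complex \<Rightarrow> complex \<Rightarrow> real" where
  "delta_weight \<delta> z = Re ((1 - z) powr cnj \<delta> * (1 - cnj z) powr \<delta>)"

lemma delta_weight_measurable [measurable]: "delta_weight \<delta> \<in> borel_measurable borel"
  unfolding delta_weight_def[abs_def] by measurable

lemma Ln_one_minus_cnj:
  assumes "cmod z \<le> 1" "z \<noteq> 1"
  shows "1 - z \<noteq> 0" "1 - cnj z \<noteq> 0" "Ln (1 - cnj z) = cnj (Ln (1 - z))"
proof -
  show 1: "1 - z \<noteq> 0" using assms(2) by simp
  hence "cnj (1 - z) \<noteq> 0" by (simp only: complex_cnj_zero_iff not_False_eq_True)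
  thus "1 - cnj z \<noteq> 0" by simp
  have "Re z \<le> 1" using assms(1) complex_Re_le_cmod[of z] by linarith
  have "1 - z \<notin> \<real>\<^sub>\<le>\<^sub>0"
  proof
    assume "1 - z \<in> \<real>\<^sub>\<le>\<^sub>0"
    hence "Re (1 - z) \<le> 0" "Im (1 - z) = 0" by (simp_all add: complex_nonpos_Reals_iff)
    with \<open>Re z \<le> 1\<close> have "1 - z = 0" by (simp add: complex_eq_iff)
    with 1 show False ..
  qed
  thus "Ln (1 - cnj z) = cnj (Ln (1 - z))" by (simp add: cnj_Ln)
qed

text \<open>On the closed disc minus 1 the two factors are complex conjugates of each other, so
  their product is a squared modulus; at z = 1 all powers are 0.\<close>

lemma delta_weight:
  assumes "cmod z \<le> 1"
  shows "(1 - z) powr cnj \<delta> * (1 - cnj z) powr \<delta> = of_real (delta_weight \<delta> z)" "0 \<le> delta_weight \<delta> z"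
proof -
  have "(1 - z) powr cnj \<delta> * (1 - cnj z) powr \<delta> = of_real (delta_weight \<delta> z) \<and> 0 \<le> delta_weight \<delta> z"
  proof (cases "z = 1")
    case False
    note L = Ln_one_minus_cnj[OF assms False]
    have "(1 - cnj z) powr \<delta> = cnj ((1 - z) powr cnj \<delta>)"
      using L by (simp add: powr_def exp_cnj)
    hence e: "(1 - z) powr cnj \<delta> * (1 - cnj z) powr \<delta> = of_real ((cmod ((1 - z) powr cnj \<delta>))\<^sup>2)"
      by (simp only: complex_norm_square)
    have "delta_weight \<delta> z = (cmod ((1 - z) powr cnj \<delta>))\<^sup>2" unfolding delta_weight_def e by simp
    thus ?thesis using e by simp
  qed (simp add: delta_weight_def)
  thus "(1 - z) powr cnj \<delta> * (1 - cnj z) powr \<delta> = of_real (delta_weight \<delta> z)" "0 \<le> delta_weight \<delta> z" by auto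
qed

lemma GGT_rangeE:
  assumes A: "A \<in> GGT_range n" and n: "n = Suc m"
  obtains \<alpha> where "verblunsky_tuple m \<alpha>" "A = GGT n \<alpha>"
    "\<And>k. k < n \<Longrightarrow> deformed_verblunsky (spectral_measure A) k = opuc_gamma \<alpha> k" "\<And>k. k < n \<Longrightarrow> cmod (opuc_gamma \<alpha> k) \<le> 1"
proof -
  define \<alpha> where "\<alpha> = recovered_params A"
  have p: "verblunsky_tuple m \<alpha>" and A: "A = GGT n \<alpha>" using A n by (auto simp: GGT_range_def \<alpha>_def)
  show ?thesis
  proof (rule that[OF p A])
    fix k assume k: "k < n"
    show "deformed_verblunsky (spectral_measure A) k = opuc_gamma \<alpha> k"
      unfolding A spectral_measure_GGT[OF n p] by (rule deformed_verblunsky_opuc[OF n p k])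
    have km: "k \<le> m" using k n by simp
    have "cmod (\<alpha> k) \<le> 1" using p km by (cases "k = m") (auto simp: verblunsky_tuple_def less_imp_le)
    thus "cmod (opuc_gamma \<alpha> k) \<le> 1" using norm_opuc_gamma[OF n p km] by simp
  qed
qed

definition nu_index :: "nat \<Rightarrow> real \<Rightarrow> nat \<Rightarrow> real" where
  "nu_index n \<beta> k = \<beta> * real (n - k - 1) + 1"

text \<open>Equal to (\<open>nu_index\<close> - 1) / 2, the parameter b of
  \<open>kernel_integral_nu_borel\<close>; among k < n it is 0 exactly at the last index.\<close>

definition half_index :: "nat \<Rightarrow> real \<Rightarrow> nat \<Rightarrow> real" where
  "half_index n \<beta> k = \<beta> / 2 * real (n - k - 1)"

definition weight_norm :: "nat \<Rightarrow> real \<Rightarrow> complex \<Rightarrow> nat \<Rightarrow> real" where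
  "weight_norm n \<beta> \<delta> k = (LINT z|nu_borel (nu_index n \<beta> k). delta_weight \<delta> z)"

text \<open>\<open>det_delta\<close> as seen through the deformed coefficients; the two agree on
  \<open>GGT_range\<close>.\<close>

definition gamma_weight :: "nat \<Rightarrow> complex \<Rightarrow> complex mat \<Rightarrow> ennreal" where
  "gamma_weight n \<delta> A = (\<Prod>k<n. ennreal (delta_weight \<delta> (deformed_verblunsky (spectral_measure A) k)))"

definition deformed_law :: "nat \<Rightarrow> real \<Rightarrow> complex \<Rightarrow> nat \<Rightarrow> complex measure" where
  "deformed_law n \<beta> \<delta> k = density (nu_borel (nu_index n \<beta> k)) (\<lambda>z. ennreal (delta_weight \<delta> z / weight_norm n \<beta> \<delta> k))"

context
  fixes n m :: nat and \<beta> :: real and \<delta> :: complex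
  assumes n: "n = Suc m" and \<beta>: "\<beta> > 0" and \<delta>: "Re \<delta> > - 1 / 2"
begin

abbreviation (input) idx :: "nat \<Rightarrow> real" where "idx \<equiv> nu_index n \<beta>"

abbreviation (input) half_idx :: "nat \<Rightarrow> real" where "half_idx \<equiv> half_index n \<beta>"

lemma idx: "idx k \<ge> 1" "half_idx k = (idx k - 1) / 2" "idx m = 1" "k < m \<Longrightarrow> idx k \<noteq> 1" "half_idx k \<ge> 0" "k < m \<Longrightarrow> half_idx k > 0"
  using n \<beta> by (auto simp: nu_index_def half_index_def less_diff_conv)

abbreviation (input) norm_const :: "nat \<Rightarrow> real" where "norm_const \<equiv> weight_norm n \<beta> \<delta>"

lemma two_Re_delta: "\<delta> + cnj \<delta> = of_real (2 * Re \<delta>)" "Re (cnj \<delta> + \<delta>) > -1"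
  using \<delta> by (auto simp: complex_eq_iff)

lemma AE_delta_weight:
  "AE z in nu_borel s. (1 - z) powr cnj \<delta> * (1 - cnj z) powr \<delta> = of_real (delta_weight \<delta> z)"
  "AE z in nu_borel s. 0 \<le> delta_weight \<delta> z"
  using AE_nu_borel_cball by (eventually_elim, use delta_weight in auto)+

text \<open>Positivity holds because the integral is nonnegative and its Gamma expression is
  nonzero, all arguments having positive real part.\<close>

lemma norm_const:
  "integrable (nu_borel (idx k)) (delta_weight \<delta>)"
  "of_real (norm_const k) = Gamma (of_real (half_idx k) + 1) * Gamma (of_real (half_idx k) + 1 + \<delta> + cnj \<delta>) * rGamma (of_real (half_idx k) + 1 + cnj \<delta>) * rGamma (of_real (half_idx k) + 1 + \<delta>)"
  "norm_const k > 0"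
proof -
  note K = kernel_integral_nu_borel[OF idx(1) two_Re_delta(2) idx(2), of k]
  have "integrable (nu_borel (idx k)) (\<lambda>z. complex_of_real (delta_weight \<delta> z))"
    using K(1) by (subst integrable_cong_AE[OF _ _ AE_delta_weight(1), symmetric]) measurable
  thus i: "integrable (nu_borel (idx k)) (delta_weight \<delta>)" by (simp add: complex_of_real_integrable_eq)
  have "complex_of_real (norm_const k) = (LINT z|nu_borel (idx k). (1 - z) powr cnj \<delta> * (1 - cnj z) powr \<delta>)"
    unfolding weight_norm_def integral_complex_of_real[symmetric]
    by (rule integral_cong_AE[OF _ _ AE_delta_weight(1), symmetric]) measurable
  thus e: "of_real (norm_const k) = Gamma (of_real (half_idx k) + 1) * Gamma (of_real (half_idx k) + 1 + \<delta> + cnj \<delta>) * rGamma (of_real (half_idx k) + 1 + cnj \<delta>) * rGamma (of_real (half_idx k) + 1 + \<delta>)"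
    unfolding K(2) by (simp add: add_ac)
  have np: "of_real (half_idx k) + 1 \<notin> (\<int>\<^sub>\<le>\<^sub>0 :: complex set)" "of_real (half_idx k) + 1 + \<delta> + cnj \<delta> \<notin> \<int>\<^sub>\<le>\<^sub>0"
    "of_real (half_idx k) + 1 + cnj \<delta> \<notin> \<int>\<^sub>\<le>\<^sub>0" "of_real (half_idx k) + 1 + \<delta> \<notin> \<int>\<^sub>\<le>\<^sub>0"
    using idx(5)[of k] \<delta> by (auto intro!: Re_pos_not_nonpos_Ints)
  have "complex_of_real (norm_const k) \<noteq> 0" unfolding e using np by (simp add: Gamma_eq_zero_iff rGamma_eq_zero_iff)
  moreover have "norm_const k \<ge> 0" unfolding weight_norm_def
    by (rule integral_nonneg_AE) (rule AE_delta_weight(2))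
  ultimately show "norm_const k > 0" by simp
qed

lemma nn_integral_delta_weight: "(\<integral>\<^sup>+z. ennreal (delta_weight \<delta> z) \<partial>nu_borel (idx k)) = ennreal (norm_const k)"
  unfolding weight_norm_def
  by (rule nn_integral_eq_integral[OF norm_const(1)]) (rule AE_delta_weight(2))

abbreviation (input) verblunsky_law :: "(nat \<Rightarrow> complex) measure" where "verblunsky_law \<equiv> PiM {..<n} (\<lambda>k. nu (idx k))"

lemma verblunsky_law_tuple: "\<alpha> \<in> space verblunsky_law \<Longrightarrow> verblunsky_tuple m \<alpha>"
proof -
  assume a: "\<alpha> \<in> space verblunsky_law"
  have sp: "\<alpha> k \<in> space (nu (idx k))" if "k < n" for k using a that by (auto simp: space_PiM PiE_def Pi_def)
  have "cmod (\<alpha> k) < 1" if "k < m" for k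
    using sp[of k] that n idx(4)[OF that] by (simp add: space_nu)
  moreover have "cmod (\<alpha> m) = 1" using sp[of m] n idx(3) by (simp add: space_nu)
  ultimately show ?thesis by (simp add: verblunsky_tuple_def)
qed

lemma verblunsky_law_component: "k < n \<Longrightarrow> (\<lambda>\<alpha>. \<alpha> k) \<in> borel_measurable verblunsky_law"
proof -
  assume "k < n"
  hence c: "(\<lambda>\<alpha>. \<alpha> k) \<in> verblunsky_law \<rightarrow>\<^sub>M nu (idx k)" by (intro measurable_component_singleton) simp
  have "(\<lambda>z. z) \<in> nu (idx k) \<rightarrow>\<^sub>M (borel :: complex measure)" by (rule measurable_nu) simp
  from measurable_compose[OF c this] show ?thesis .
qed

lemma GGT_measurable: "GGT n \<in> verblunsky_law \<rightarrow>\<^sub>M unitary_borel n"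
  using measurable_GGT[OF n verblunsky_law_component verblunsky_law_tuple] by simp

lemma CJ0_eq: "CJ0 n \<beta> = distr verblunsky_law (unitary_borel n) (GGT n)"
  unfolding CJ0_def nu_index_def ..

lemma sets_CJ0 [simp, measurable_cong]: "sets (CJ0 n \<beta>) = sets (unitary_borel n)"
  by (simp add: CJ0_eq)

abbreviation (input) gamma_of :: "nat \<Rightarrow> complex mat \<Rightarrow> complex" where "gamma_of k A \<equiv> deformed_verblunsky (spectral_measure A) k"

lemma gamma_of_measurable [measurable]: "gamma_of k \<in> borel_measurable (unitary_borel n)"
  using n by (intro measurable_deformed_verblunsky) simp

lemma AE_CJ0_range: "AE A in CJ0 n \<beta>. A \<in> GGT_range n"
proof -
  have "{A \<in> space (unitary_borel n). A \<in> GGT_range n} = GGT_range n" by (auto simp: GGT_range_def)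
  thus ?thesis unfolding CJ0_eq using GGT_range_measurable[OF n] GGT_in_range[OF n verblunsky_law_tuple]
    by (subst AE_distr_iff[OF GGT_measurable]) auto
qed

abbreviation (input) det_weight :: "complex mat \<Rightarrow> ennreal" where "det_weight \<equiv> gamma_weight n \<delta>"

lemma det_weight_measurable [measurable]: "det_weight \<in> borel_measurable (unitary_borel n)"
  unfolding gamma_weight_def[abs_def] by measurable

lemma det_delta_range: "A \<in> GGT_range n \<Longrightarrow> ennreal (Re (det_delta \<delta> A)) = det_weight A"
proof -
  assume "A \<in> GGT_range n"
  then obtain \<alpha> where a: "verblunsky_tuple m \<alpha>" "A = GGT n \<alpha>" "\<And>k. k < n \<Longrightarrow> gamma_of k A = opuc_gamma \<alpha> k"
    "\<And>k. k < n \<Longrightarrow> cmod (opuc_gamma \<alpha> k) \<le> 1" by (rule GGT_rangeE[OF _ n]) blast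
  have "det_delta \<delta> A = (\<Prod>k<n. of_real (delta_weight \<delta> (gamma_of k A)))"
    unfolding a(2) det_delta_GGT_gamma[OF n a(1)]
    by (intro prod.cong refl) (use a delta_weight(1) in auto)
  hence "Re (det_delta \<delta> A) = (\<Prod>k<n. delta_weight \<delta> (gamma_of k A))" by (simp flip: of_real_prod)
  moreover have "(\<Prod>k<n. ennreal (delta_weight \<delta> (gamma_of k A))) = ennreal (\<Prod>k<n. delta_weight \<delta> (gamma_of k A))"
    by (rule prod_ennreal) (use a(3,4) delta_weight(2) in auto)
  ultimately show ?thesis unfolding gamma_weight_def by simp
qed

lemma nn_integral_CJ0_gamma_of:
  assumes g: "\<And>k. g k \<in> borel_measurable borel"
  shows "(\<integral>\<^sup>+A. (\<Prod>k<n. g k (gamma_of k A)) \<partial>CJ0 n \<beta>) = (\<Prod>k<n. \<integral>\<^sup>+z. g k z \<partial>nu_borel (idx k))"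
proof -
  have "(\<lambda>A. g k (gamma_of k A)) \<in> borel_measurable (unitary_borel n)" for k
    by (rule measurable_compose[OF gamma_of_measurable g])
  hence "(\<integral>\<^sup>+A. (\<Prod>k<n. g k (gamma_of k A)) \<partial>CJ0 n \<beta>) = (\<integral>\<^sup>+\<alpha>. (\<Prod>k<n. g k (gamma_of k (GGT n \<alpha>))) \<partial>verblunsky_law)"
    unfolding CJ0_eq by (intro nn_integral_distr GGT_measurable borel_measurable_prod_ennreal) simp
  also have "\<dots> = (\<integral>\<^sup>+\<alpha>. (\<Prod>k<n. g k (opuc_gamma \<alpha> k)) \<partial>verblunsky_law)"
  proof (intro nn_integral_cong prod.cong refl)
    fix \<alpha> k assume "\<alpha> \<in> space verblunsky_law" "k \<in> {..<n}"
    thus "g k (gamma_of k (GGT n \<alpha>)) = g k (opuc_gamma \<alpha> k)"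
      using spectral_measure_GGT[OF n verblunsky_law_tuple] deformed_verblunsky_opuc[OF n verblunsky_law_tuple] by simp
  qed
  also have "\<dots> = (\<Prod>k<n. \<integral>\<^sup>+z. g k z \<partial>nu_borel (idx k))"
    by (rule nn_integral_prod_opuc_gamma) (use idx n g in auto)
  finally show ?thesis .
qed

lemma nn_integral_det_weight: "(\<integral>\<^sup>+A. ennreal (Re (det_delta \<delta> A)) \<partial>CJ0 n \<beta>) = ennreal (\<Prod>k<n. norm_const k)"
proof -
  have "(\<integral>\<^sup>+A. ennreal (Re (det_delta \<delta> A)) \<partial>CJ0 n \<beta>) = (\<integral>\<^sup>+A. det_weight A \<partial>CJ0 n \<beta>)"
    by (rule nn_integral_cong_AE) (use AE_CJ0_range det_delta_range in \<open>auto elim!: eventually_mono\<close>)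
  also have "\<dots> = (\<Prod>k<n. \<integral>\<^sup>+z. ennreal (delta_weight \<delta> z) \<partial>nu_borel (idx k))"
    unfolding gamma_weight_def by (rule nn_integral_CJ0_gamma_of) measurable
  also have "\<dots> = ennreal (\<Prod>k<n. norm_const k)"
    unfolding nn_integral_delta_weight by (rule prod_ennreal) (use norm_const(3) in \<open>auto intro: less_imp_le\<close>)
  finally show ?thesis .
qed

text \<open>A density is built from integrals against indicators, which see the weight only almost
  everywhere; so \<open>det_delta\<close> can be exchanged for \<open>det_weight\<close> through
  their agreement on \<open>GGT_range\<close>.\<close>

lemma CJ_eq: "CJ n \<delta> \<beta> = density (CJ0 n \<beta>) (\<lambda>A. det_weight A / ennreal (\<Prod>k<n. norm_const k))"
proof -
  have "(\<integral>\<^sup>+A. ennreal (Re (det_delta \<delta> A)) / ennreal (\<Prod>k<n. norm_const k) * indicator B A \<partial>CJ0 n \<beta>) =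
     (\<integral>\<^sup>+A. det_weight A / ennreal (\<Prod>k<n. norm_const k) * indicator B A \<partial>CJ0 n \<beta>)" for B
    by (rule nn_integral_cong_AE) (use AE_CJ0_range det_delta_range in \<open>auto elim!: eventually_mono\<close>)
  thus ?thesis unfolding CJ_def nn_integral_det_weight density_def by simp
qed

abbreviation (input) gamma_law :: "nat \<Rightarrow> complex measure" where "gamma_law \<equiv> deformed_law n \<beta> \<delta>"

lemma gamma_law_UNIV: "emeasure (gamma_law k) UNIV = 1"
proof -
  have "emeasure (gamma_law k) UNIV = (\<integral>\<^sup>+z. ennreal (delta_weight \<delta> z / norm_const k) \<partial>nu_borel (idx k))"
    unfolding deformed_law_def by (subst emeasure_density) auto
  also have "\<dots> = (\<integral>\<^sup>+z. ennreal (delta_weight \<delta> z) / ennreal (norm_const k) \<partial>nu_borel (idx k))"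
  proof (rule nn_integral_cong_AE)
    show "AE z in nu_borel (idx k). ennreal (delta_weight \<delta> z / norm_const k) = ennreal (delta_weight \<delta> z) / ennreal (norm_const k)"
      using AE_delta_weight(2) by eventually_elim (simp add: divide_ennreal norm_const(3))
  qed
  also have "\<dots> = ennreal (norm_const k) / ennreal (norm_const k)"
    by (subst nn_integral_divide) (auto simp: nn_integral_delta_weight)
  also have "\<dots> = 1" using norm_const(3)[of k] by (simp add: divide_ennreal)
  finally show ?thesis .
qed

text \<open>On boxes both the weight and the indicator are products over k, and the total
  normalization is the product of the individual ones, so the measure factorizes.\<close>

lemma emeasure_CJ_box:
  assumes B: "\<And>k. k < n \<Longrightarrow> B k \<in> sets borel"
  shows "emeasure (CJ n \<delta> \<beta>) {A \<in> unitary_mats n. \<forall>k<n. gamma_of k A \<in> B k} = (\<Prod>k<n. emeasure (gamma_law k) (B k))"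
proof -
  \<comment> \<open>\<open>B\<close> is measurable only below n; the empty set elsewhere makes every
    index measurable, as \<open>nn_integral_CJ0_gamma_of\<close> requires.\<close>
  define B' where "B' = (\<lambda>k. if k < n then B k else {})"
  have B' [measurable]: "B' k \<in> sets borel" for k using B by (simp add: B'_def)
  let ?S = "{A \<in> unitary_mats n. \<forall>k<n. gamma_of k A \<in> B k}"
  have Seq: "?S = {A \<in> space (unitary_borel n). \<forall>k\<in>{..<n}. gamma_of k A \<in> B' k}" by (auto simp: B'_def)
  have S: "?S \<in> sets (unitary_borel n)" unfolding Seq by measurable
  let ?C = "\<Prod>k<n. norm_const k"
  have C: "?C > 0" by (intro prod_pos) (simp add: norm_const(3))
  have ind: "indicator ?S A = (\<Prod>k<n. indicator (B k) (gamma_of k A) :: ennreal)" if A: "A \<in> unitary_mats n" for A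
  proof (cases "A \<in> ?S")
    case True
    thus ?thesis by (simp add: indicator_def)
  next
    case False
    then obtain k where "k < n" "gamma_of k A \<notin> B k" using A by auto
    hence "(\<Prod>k<n. indicator (B k) (gamma_of k A) :: ennreal) = 0" by (intro prod_zero finite_lessThan bexI[of _ k]) auto
    thus ?thesis using False by simp
  qed
  have "emeasure (CJ n \<delta> \<beta>) ?S = (\<integral>\<^sup>+A. det_weight A / ennreal ?C * indicator ?S A \<partial>CJ0 n \<beta>)"
    unfolding CJ_eq
  proof (rule emeasure_density)
    show "(\<lambda>A. det_weight A / ennreal ?C) \<in> borel_measurable (CJ0 n \<beta>)" by measurable
    show "?S \<in> sets (CJ0 n \<beta>)" unfolding sets_CJ0 by (rule S)
  qed
  also have "\<dots> = (\<integral>\<^sup>+A. (\<Prod>k<n. ennreal (delta_weight \<delta> (gamma_of k A)) * indicator (B' k) (gamma_of k A)) / ennreal ?C \<partial>CJ0 n \<beta>)"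
  proof (rule nn_integral_cong)
    fix A assume "A \<in> space (CJ0 n \<beta>)"
    hence A: "A \<in> unitary_mats n" by (simp add: CJ0_eq)
    have "det_weight A / ennreal ?C * indicator ?S A = det_weight A * indicator ?S A / ennreal ?C"
      by (simp only: ennreal_divide_times ennreal_times_divide)
    also have "det_weight A * indicator ?S A = (\<Prod>k<n. ennreal (delta_weight \<delta> (gamma_of k A)) * indicator (B' k) (gamma_of k A))"
      unfolding ind[OF A] gamma_weight_def prod.distrib[symmetric]
      by (intro prod.cong refl) (simp only: B'_def lessThan_iff if_True)
    finally show "det_weight A / ennreal ?C * indicator ?S A = (\<Prod>k<n. ennreal (delta_weight \<delta> (gamma_of k A)) * indicator (B' k) (gamma_of k A)) / ennreal ?C" .
  qed
  also have "\<dots> = (\<integral>\<^sup>+A. (\<Prod>k<n. ennreal (delta_weight \<delta> (gamma_of k A)) * indicator (B' k) (gamma_of k A)) \<partial>CJ0 n \<beta>) / ennreal ?C"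
    by (rule nn_integral_divide) measurable
  also have "(\<integral>\<^sup>+A. (\<Prod>k<n. ennreal (delta_weight \<delta> (gamma_of k A)) * indicator (B' k) (gamma_of k A)) \<partial>CJ0 n \<beta>) =
     (\<Prod>k<n. \<integral>\<^sup>+z. ennreal (delta_weight \<delta> z) * indicator (B' k) z \<partial>nu_borel (idx k))"
    by (rule nn_integral_CJ0_gamma_of) measurable
  also have "\<dots> = (\<Prod>k<n. ennreal (norm_const k) * emeasure (gamma_law k) (B k))"
  proof (intro prod.cong refl)
    fix k assume "k \<in> {..<n}"
    hence "B k = B' k" by (simp add: B'_def)
    have "emeasure (gamma_law k) (B' k) = (\<integral>\<^sup>+z. ennreal (delta_weight \<delta> z / norm_const k) * indicator (B' k) z \<partial>nu_borel (idx k))"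
      unfolding deformed_law_def by (subst emeasure_density) auto
    hence "ennreal (norm_const k) * emeasure (gamma_law k) (B' k) = (\<integral>\<^sup>+z. ennreal (norm_const k) * (ennreal (delta_weight \<delta> z / norm_const k) * indicator (B' k) z) \<partial>nu_borel (idx k))"
      by (simp add: nn_integral_cmult)
    also have "\<dots> = (\<integral>\<^sup>+z. ennreal (delta_weight \<delta> z) * indicator (B' k) z \<partial>nu_borel (idx k))"
    proof (rule nn_integral_cong_AE)
      show "AE z in nu_borel (idx k). ennreal (norm_const k) * (ennreal (delta_weight \<delta> z / norm_const k) * indicator (B' k) z) = ennreal (delta_weight \<delta> z) * indicator (B' k) z"
        using AE_delta_weight(2)
      proof eventually_elim
        case (elim z)
        have "ennreal (norm_const k) * ennreal (delta_weight \<delta> z / norm_const k) = ennreal (delta_weight \<delta> z)"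
          using norm_const(3)[of k] elim by (simp flip: ennreal_mult)
        thus ?case by (simp flip: mult.assoc)
      qed
    qed
    finally show "(\<integral>\<^sup>+z. ennreal (delta_weight \<delta> z) * indicator (B' k) z \<partial>nu_borel (idx k)) = ennreal (norm_const k) * emeasure (gamma_law k) (B k)"
      using \<open>B k = B' k\<close> by simp
  qed
  also have "\<dots> = ennreal ?C * (\<Prod>k<n. emeasure (gamma_law k) (B k))"
    unfolding prod.distrib by (subst prod_ennreal) (use norm_const(3) in \<open>auto intro: less_imp_le\<close>)
  also have "\<dots> / ennreal ?C = (ennreal ?C / ennreal ?C) * (\<Prod>k<n. emeasure (gamma_law k) (B k))"
    by (simp only: ennreal_divide_times ennreal_times_divide)
  also have "ennreal ?C / ennreal ?C = ennreal (?C / ?C)" by (rule divide_ennreal) (use C in auto)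
  also have "?C / ?C = 1" using C by (intro divide_self) linarith
  finally show ?thesis by simp
qed

section \<open>A random matrix with the circular Jacobi law\<close>

context
  fixes M :: "'a measure" and U :: "'a \<Rightarrow> complex mat"
  assumes M: "prob_space M" and U: "U \<in> M \<rightarrow>\<^sub>M unitary_borel n" and law: "distr M (unitary_borel n) U = CJ n \<delta> \<beta>"
begin

lemma AE_range: "AE \<omega> in M. U \<omega> \<in> GGT_range n"
proof -
  have "AE A in CJ n \<delta> \<beta>. A \<in> GGT_range n"
    unfolding CJ_eq using AE_CJ0_range by (subst AE_density) (auto elim!: eventually_mono)
  thus ?thesis unfolding law[symmetric] by (rule AE_distrD[OF U])
qed

lemma AE_det_eq: "AE \<omega> in M. Determinant.det (1\<^sub>m n - U \<omega>) = (\<Prod>k<n. 1 - gamma_of k (U \<omega>)) \<and> (\<forall>k<n. cmod (gamma_of k (U \<omega>)) \<le> 1)"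
  using AE_range
proof eventually_elim
  case (elim \<omega>)
  obtain \<alpha> where a: "verblunsky_tuple m \<alpha>" "U \<omega> = GGT n \<alpha>" "\<And>k. k < n \<Longrightarrow> gamma_of k (U \<omega>) = opuc_gamma \<alpha> k"
    "\<And>k. k < n \<Longrightarrow> cmod (opuc_gamma \<alpha> k) \<le> 1" by (rule GGT_rangeE[OF elim n]) (rule that; assumption)
  have "Determinant.det (1\<^sub>m n - U \<omega>) = (\<Prod>k<n. 1 - opuc_gamma \<alpha> k)"
    unfolding a(2) det_one_minus_GGT[OF n a(1)] by (rule opuc_n_1[OF n a(1)])
  also have "\<dots> = (\<Prod>k<n. 1 - gamma_of k (U \<omega>))" by (intro prod.cong refl) (simp only: a(3) lessThan_iff)
  finally show ?case using a(3,4) by (intro conjI allI impI) (assumption, simp only:)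
qed

lemma gamma_of_U_measurable: "(\<lambda>\<omega>. gamma_of k (U \<omega>)) \<in> borel_measurable M"
  by (rule measurable_compose[OF U gamma_of_measurable])

lemma emeasure_gamma_of_box:
  assumes B: "\<And>k. k < n \<Longrightarrow> B k \<in> sets borel"
  shows "emeasure M {\<omega> \<in> space M. \<forall>k<n. gamma_of k (U \<omega>) \<in> B k} = (\<Prod>k<n. emeasure (gamma_law k) (B k))"
proof -
  let ?S = "{A \<in> space (unitary_borel n). \<forall>k\<in>{..<n}. gamma_of k A \<in> B k}"
  have S: "?S \<in> sets (unitary_borel n)"
    by (intro sets.sets_Collect_finite_All' measurable_sets_Collect[OF gamma_of_measurable]) (use B n in auto)
  have "emeasure M {\<omega> \<in> space M. \<forall>k<n. gamma_of k (U \<omega>) \<in> B k} = emeasure M (U -` ?S \<inter> space M)"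
    using measurable_space[OF U] by (intro arg_cong[of _ _ "emeasure M"]) auto
  also have "\<dots> = emeasure (distr M (unitary_borel n) U) ?S" using U S by (simp add: emeasure_distr)
  also have "\<dots> = emeasure (CJ n \<delta> \<beta>) {A \<in> unitary_mats n. \<forall>k<n. gamma_of k A \<in> B k}"
    unfolding law by (intro arg_cong[of _ _ "emeasure (CJ n \<delta> \<beta>)"]) auto
  also have "\<dots> = (\<Prod>k<n. emeasure (gamma_law k) (B k))" by (rule emeasure_CJ_box) (rule B)
  finally show ?thesis .
qed

text \<open>The marginal is read off from the box with B at index k and the whole plane elsewhere,
  the other laws having mass 1.\<close>

lemma distr_gamma_of:
  assumes k: "k < n"
  shows "distr M borel (\<lambda>\<omega>. gamma_of k (U \<omega>)) = gamma_law k"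
proof (rule measure_eqI)
  fix B assume "B \<in> sets (distr M borel (\<lambda>\<omega>. gamma_of k (U \<omega>)))"
  hence B: "B \<in> sets borel" by simp
  let ?B = "\<lambda>j. if j = k then B else UNIV"
  have "emeasure (distr M borel (\<lambda>\<omega>. gamma_of k (U \<omega>))) B = emeasure M {\<omega> \<in> space M. \<forall>j<n. gamma_of j (U \<omega>) \<in> ?B j}"
    using B gamma_of_U_measurable k by (subst emeasure_distr) (auto intro!: arg_cong[of _ _ "emeasure M"])
  also have "\<dots> = (\<Prod>j<n. emeasure (gamma_law j) (?B j))" using B by (intro emeasure_gamma_of_box) simp
  also have "\<dots> = (\<Prod>j<n. if j = k then emeasure (gamma_law k) B else 1)"
    by (intro prod.cong refl) (simp add: gamma_law_UNIV)
  also have "\<dots> = emeasure (gamma_law k) B" using k by simp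
  finally show "emeasure (distr M borel (\<lambda>\<omega>. gamma_of k (U \<omega>))) B = emeasure (gamma_law k) B" .
qed (simp add: deformed_law_def)

lemma indep_gamma_of: "prob_space.indep_vars M (\<lambda>_. borel) (\<lambda>k \<omega>. gamma_of k (U \<omega>)) {..<n}"
proof -
  interpret prob_space M by (rule M)
  interpret PP: product_sigma_finite "\<lambda>k. distr M borel (\<lambda>\<omega>. gamma_of k (U \<omega>))"
    unfolding product_sigma_finite_def
    by (intro allI prob_space_imp_sigma_finite prob_space_distr gamma_of_U_measurable)
  have "distr M (PiM {..<n} (\<lambda>_. borel)) (\<lambda>\<omega>. \<lambda>k\<in>{..<n}. gamma_of k (U \<omega>)) = PiM {..<n} (\<lambda>k. distr M borel (\<lambda>\<omega>. gamma_of k (U \<omega>)))"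
  proof (rule PP.PiM_eqI)
    show "finite {..<n}" by simp
    show "sets (distr M (PiM {..<n} (\<lambda>_. borel)) (\<lambda>\<omega>. \<lambda>k\<in>{..<n}. gamma_of k (U \<omega>))) = sets (PiM {..<n} (\<lambda>k. distr M borel (\<lambda>\<omega>. gamma_of k (U \<omega>))))"
      by (simp cong: sets_PiM_cong)
    fix B assume B: "\<And>k. k \<in> {..<n} \<Longrightarrow> B k \<in> sets (distr M borel (\<lambda>\<omega>. gamma_of k (U \<omega>)))"
    have m: "(\<lambda>\<omega>. \<lambda>k\<in>{..<n}. gamma_of k (U \<omega>)) \<in> M \<rightarrow>\<^sub>M PiM {..<n} (\<lambda>_. borel)"
      by (rule measurable_restrict) (rule gamma_of_U_measurable)
    have "emeasure (distr M (PiM {..<n} (\<lambda>_. borel)) (\<lambda>\<omega>. \<lambda>k\<in>{..<n}. gamma_of k (U \<omega>))) (PiE {..<n} B) = emeasure M {\<omega> \<in> space M. \<forall>k<n. gamma_of k (U \<omega>) \<in> B k}"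
      using B by (subst emeasure_distr[OF m]) (auto intro!: arg_cong[of _ _ "emeasure M"] sets_PiM_I_finite simp: PiE_iff)
    also have "\<dots> = (\<Prod>k<n. emeasure (gamma_law k) (B k))" using B by (intro emeasure_gamma_of_box) simp
    also have "\<dots> = (\<Prod>k<n. emeasure (distr M borel (\<lambda>\<omega>. gamma_of k (U \<omega>))) (B k))"
      by (intro prod.cong refl) (simp add: distr_gamma_of)
    finally show "emeasure (distr M (PiM {..<n} (\<lambda>_. borel)) (\<lambda>\<omega>. \<lambda>k\<in>{..<n}. gamma_of k (U \<omega>))) (PiE {..<n} B) = (\<Prod>k\<in>{..<n}. emeasure (distr M borel (\<lambda>\<omega>. gamma_of k (U \<omega>))) (B k))" .
  qed
  thus ?thesis using n by (subst indep_vars_iff_distr_eq_PiM) (auto intro: gamma_of_U_measurable)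
qed

lemma distributed_gamma_of_disc:
  assumes k: "k < m"
    and c: "c = Gamma (of_real (half_idx k) + 1 + \<delta>) * Gamma (of_real (half_idx k) + 1 + cnj \<delta>)
       / (of_real pi * Gamma (of_real (half_idx k)) * Gamma (of_real (half_idx k) + 1 + \<delta> + cnj \<delta>))"
  shows "distributed M lborel (\<lambda>\<omega>. gamma_of k (U \<omega>)) (\<lambda>z. indicator (ball 0 1) z *
    ennreal (Re (c * of_real ((1 - (cmod z)\<^sup>2) powr (half_idx k - 1)) * (1 - z) powr cnj \<delta> * (1 - cnj z) powr \<delta>)))"
    (is "distributed M lborel _ ?f")
proof -
  have b0: "half_idx k > 0" using idx(6)[OF k] .
  have e: "(idx k - 1) / (2 * pi) = half_idx k / pi" "(idx k - 3) / 2 = half_idx k - 1" by (simp_all add: idx(2) field_simps)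
  have nz: "Gamma (complex_of_real (half_idx k)) \<noteq> 0" "Gamma (of_real (half_idx k) + 1 + \<delta> + cnj \<delta>) \<noteq> 0"
    "Gamma (of_real (half_idx k) + 1 + cnj \<delta>) \<noteq> 0" "Gamma (of_real (half_idx k) + 1 + \<delta>) \<noteq> 0"
    using b0 \<delta> unfolding Gamma_eq_zero_iff by (auto intro!: Re_pos_not_nonpos_Ints)
  have Gp: "Gamma (complex_of_real (half_idx k) + 1) = of_real (half_idx k) * Gamma (of_real (half_idx k))"
    using b0 by (intro Gamma_plus1 Re_pos_not_nonpos_Ints) simp
  have "c * of_real (norm_const k) = of_real (half_idx k) / of_real pi"
    unfolding c norm_const(2) Gp rGamma_inverse_Gamma using nz by (simp add: field_simps)
  \<comment> \<open>The stated constant is the normalization b / pi of \<open>nu\<close> divided by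
    that of the tilt. In particular it is real and positive, and \<open>Re\<close> loses
    nothing.\<close>
  hence c': "c = of_real (half_idx k / pi / norm_const k)"
    using norm_const(3)[of k] by (simp add: field_simps)
  have feq: "ennreal (indicator (ball 0 1) z * (half_idx k / pi * (1 - (cmod z)\<^sup>2) powr (half_idx k - 1))) * ennreal (delta_weight \<delta> z / norm_const k) = ?f z" for z
  proof (cases "z \<in> ball 0 1")
    case True
    hence dw: "(1 - z) powr cnj \<delta> * (1 - cnj z) powr \<delta> = of_real (delta_weight \<delta> z)" "0 \<le> delta_weight \<delta> z"
      using delta_weight[of z \<delta>] by auto
    have "c * of_real ((1 - (cmod z)\<^sup>2) powr (half_idx k - 1)) * (1 - z) powr cnj \<delta> * (1 - cnj z) powr \<delta>
       = of_real (half_idx k / pi / norm_const k * (1 - (cmod z)\<^sup>2) powr (half_idx k - 1) * delta_weight \<delta> z)"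
      unfolding c' mult.assoc dw by simp
    thus ?thesis using True b0 dw(2) norm_const(3)[of k] by (simp add: ennreal_mult'[symmetric] mult_ac)
  qed simp
  have "distr M lborel (\<lambda>\<omega>. gamma_of k (U \<omega>)) = distr M borel (\<lambda>\<omega>. gamma_of k (U \<omega>))" by (rule distr_cong) auto
  also have "\<dots> = gamma_law k" using k n by (intro distr_gamma_of) simp
  also have "\<dots> = density lborel ?f"
  proof -
    let ?w = "\<lambda>z::complex. ennreal (indicator (ball 0 1) z * (half_idx k / pi * (1 - (cmod z)\<^sup>2) powr (half_idx k - 1)))"
      and ?d = "\<lambda>z. ennreal (delta_weight \<delta> z / norm_const k)"
    have "density (density lborel ?w) ?d = density lborel (\<lambda>z. ?w z * ?d z)"
      by (rule density_density_eq) measurable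
    thus ?thesis unfolding deformed_law_def nu_borel_disc[OF idx(4)[OF k]] e feq .
  qed
  finally have "distr M lborel (\<lambda>\<omega>. gamma_of k (U \<omega>)) = density lborel ?f" .
  moreover have "?f \<in> borel_measurable lborel" by measurable
  ultimately show ?thesis unfolding distributed_def using gamma_of_U_measurable[of k] by simp
qed

lemma distributed_gamma_of_circle:
  "distributed M uniform_circle (\<lambda>\<omega>. gamma_of m (U \<omega>)) (\<lambda>\<zeta>. ennreal (Re (Gamma (1 + \<delta>) * Gamma (1 + cnj \<delta>) / Gamma (1 + \<delta> + cnj \<delta>)
     * (1 - \<zeta>) powr cnj \<delta> * (1 - cnj \<zeta>) powr \<delta>)))"
    (is "distributed M uniform_circle _ ?f")
proof -
  have b0: "half_idx m = 0" using n by (simp add: half_index_def)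
  have nz: "Gamma (1 + \<delta> + cnj \<delta>) \<noteq> 0" "Gamma (1 + cnj \<delta>) \<noteq> 0" "Gamma (1 + \<delta>) \<noteq> 0"
    using \<delta> unfolding Gamma_eq_zero_iff by (auto intro!: Re_pos_not_nonpos_Ints)
  have "Gamma (1 + \<delta>) * Gamma (1 + cnj \<delta>) / Gamma (1 + \<delta> + cnj \<delta>) * of_real (norm_const m) = 1"
    unfolding norm_const(2) b0 rGamma_inverse_Gamma using nz by (simp add: field_simps)
  hence c: "Gamma (1 + \<delta>) * Gamma (1 + cnj \<delta>) / Gamma (1 + \<delta> + cnj \<delta>) = of_real (1 / norm_const m)"
    using norm_const(3)[of m] by (simp add: field_simps)
  have meas: "?f \<in> borel_measurable uniform_circle" by measurable
  have "distr M uniform_circle (\<lambda>\<omega>. gamma_of m (U \<omega>)) = distr M borel (\<lambda>\<omega>. gamma_of m (U \<omega>))" by (rule distr_cong) auto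
  also have "\<dots> = gamma_law m" using n by (intro distr_gamma_of) simp
  also have "\<dots> = density uniform_circle ?f"
    unfolding deformed_law_def idx(3) nu_borel_1
  proof (rule density_cong)
    show "AE z in uniform_circle. ennreal (delta_weight \<delta> z / norm_const m) = ?f z"
      using AE_delta_weight(1)[of 1] unfolding nu_borel_1
    proof eventually_elim
      case (elim z)
      show ?case unfolding c mult.assoc elim by simp
    qed
    show "(\<lambda>z. ennreal (delta_weight \<delta> z / norm_const m)) \<in> borel_measurable uniform_circle" by measurable
  qed (rule meas)
  finally have "distr M uniform_circle (\<lambda>\<omega>. gamma_of m (U \<omega>)) = density uniform_circle ?f" .
  thus ?thesis unfolding distributed_def using gamma_of_U_measurable[of m] meas by simp
qed

end

end

subsection \<open>The Mellin-Fourier transform\<close>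

lemma powr_of_real_prod:
  assumes "\<And>k. k \<in> I \<Longrightarrow> (0::real) \<le> f k" "finite I"
  shows "complex_of_real (\<Prod>k\<in>I. f k) powr t = (\<Prod>k\<in>I. of_real (f k) powr t) \<or> I = {}"
  using assms(2,1)
proof (induction I rule: finite_induct)
  case (insert k I)
  have "complex_of_real (\<Prod>k\<in>insert k I. f k) powr t = of_real (f k) powr t * of_real (\<Prod>k\<in>I. f k) powr t"
    using insert by (simp add: powr_times_real prod_nonneg flip: of_real_prod)
  thus ?case using insert by (cases "I = {}") auto
qed auto

definition mellin_factor :: "complex \<Rightarrow> complex \<Rightarrow> complex \<Rightarrow> complex" where
  "mellin_factor t s z = of_real (cmod (1 - z)) powr t * exp (\<i> * s * of_real (Arg (1 - z)))"

lemma borel_measurable_Arg [measurable]: "Arg \<in> borel_measurable borel"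
proof -
  have "Arg = (\<lambda>z. if z = 0 then 0 else Im (Ln z))" by (auto simp: Arg_eq_Im_Ln Arg_zero fun_eq_iff)
  moreover have "(\<lambda>z. if z = 0 then 0 else Im (Ln z)) \<in> borel_measurable borel" by measurable
  ultimately show ?thesis by simp
qed

lemma mellin_factor_measurable [measurable]: "mellin_factor t s \<in> borel_measurable borel"
  unfolding mellin_factor_def[abs_def] by measurable

text \<open>The factor \<open>|w|^t exp(i s arg w)\<close> with \<open>w = 1 - z\<close> is \<open>w^a (cnj w)^b\<close> for \<open>a = (t + s) / 2\<close> and
  \<open>b = (t - s) / 2\<close>, so it only shifts the exponents of the weight.\<close>

lemma mellin_factor_times_weight:
  assumes "cmod z \<le> 1" "z \<noteq> 1"
  shows "of_real (delta_weight \<delta> z) * mellin_factor t s z =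
    (1 - z) powr (cnj \<delta> + (t + s) / 2) * (1 - cnj z) powr (\<delta> + (t - s) / 2)"
proof -
  note L = Ln_one_minus_cnj[OF assms]
  define l where "l = complex_of_real (ln (cmod (1 - z)))"
  define a where "a = complex_of_real (Arg (1 - z))"
  have Ln: "Ln (1 - z) = l + \<i> * a" using L(1) by (simp add: Ln_Arg l_def a_def)
  hence Ln': "Ln (1 - cnj z) = l - \<i> * a" unfolding L(3) by (simp add: l_def a_def)
  have l: "complex_of_real (cmod (1 - z)) powr t = exp (t * l)"
    using L(1) by (simp add: powr_def l_def Ln_of_real)
  have "of_real (delta_weight \<delta> z) = exp (cnj \<delta> * (l + \<i> * a) + \<delta> * (l - \<i> * a))"
    unfolding delta_weight(1)[OF assms(1), symmetric] using L(1,2) by (simp add: powr_def Ln Ln' exp_add)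
  hence "of_real (delta_weight \<delta> z) * mellin_factor t s z = exp (cnj \<delta> * (l + \<i> * a) + \<delta> * (l - \<i> * a) + t * l + \<i> * s * a)"
    unfolding mellin_factor_def l a_def[symmetric] by (simp add: exp_add)
  also have "cnj \<delta> * (l + \<i> * a) + \<delta> * (l - \<i> * a) + t * l + \<i> * s * a =
     (cnj \<delta> + (t + s) / 2) * (l + \<i> * a) + (\<delta> + (t - s) / 2) * (l - \<i> * a)"
    by (simp add: algebra_simps add_divide_distrib diff_divide_distrib)
  also have "exp \<dots> = (1 - z) powr (cnj \<delta> + (t + s) / 2) * (1 - cnj z) powr (\<delta> + (t - s) / 2)"
    using L(1,2) by (simp add: powr_def Ln Ln' exp_add)
  finally show ?thesis .
qed

context
  fixes n m :: nat and \<beta> :: real and \<delta> s t :: complex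
  assumes n: "n = Suc m" and \<beta>: "\<beta> > 0" and \<delta>: "Re \<delta> > - 1 / 2" and t: "Re (\<delta> + cnj \<delta> + t) > -1"
begin

lemma mellin_factor_integral:
  shows "integrable (deformed_law n \<beta> \<delta> k) (mellin_factor t s)"
    and "(LINT z|deformed_law n \<beta> \<delta> k. mellin_factor t s z) =
      Gamma (of_real (half_index n \<beta> k) + 1 + \<delta>) * Gamma (of_real (half_index n \<beta> k) + 1 + cnj \<delta>)
      * Gamma (of_real (half_index n \<beta> k) + 1 + \<delta> + cnj \<delta> + t)
      / (Gamma (of_real (half_index n \<beta> k) + 1 + \<delta> + cnj \<delta>)
        * Gamma (of_real (half_index n \<beta> k) + 1 + \<delta> + (t - s) / 2)
        * Gamma (of_real (half_index n \<beta> k) + 1 + cnj \<delta> + (t + s) / 2))"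
proof -
  let ?b = "half_index n \<beta> k" and ?N = "nu_borel (nu_index n \<beta> k)" and ?J = "weight_norm n \<beta> \<delta> k"
  let ?p = "cnj \<delta> + (t + s) / 2" and ?q = "\<delta> + (t - s) / 2"
  note ix = idx[OF n \<beta> \<delta>] and J = norm_const[OF n \<beta> \<delta>, of k]
  \<comment> \<open>s drops out of the sum of the exponents, so integrability is governed by delta
    and t alone.\<close>
  have pqs: "?p + ?q = \<delta> + cnj \<delta> + t" by (simp add: add_divide_distrib diff_divide_distrib)
  have pq: "Re (?p + ?q) > -1" unfolding pqs by (rule t)
  note K = kernel_integral_nu_borel[OF ix(1) pq ix(2), of k]
  have ae: "AE z in ?N. (1 - z) powr ?p * (1 - cnj z) powr ?q = of_real (delta_weight \<delta> z) * mellin_factor t s z"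
    using AE_nu_borel_cball AE_nu_borel_neq_1 by eventually_elim (rule mellin_factor_times_weight[symmetric])
  have i: "integrable ?N (\<lambda>z. of_real (delta_weight \<delta> z) * mellin_factor t s z)"
    using K(1) by (subst integrable_cong_AE[OF _ _ ae, symmetric]) measurable
  have I: "(LINT z|?N. of_real (delta_weight \<delta> z) * mellin_factor t s z) =
      Gamma (of_real ?b + 1) * Gamma (of_real ?b + 1 + ?p + ?q) * rGamma (of_real ?b + 1 + ?p) * rGamma (of_real ?b + 1 + ?q)"
    unfolding K(2)[symmetric] by (rule integral_cong_AE[OF _ _ ae, symmetric]) measurable
  have J0: "AE z in ?N. 0 \<le> delta_weight \<delta> z / ?J"
    using AE_delta_weight(2)[OF n \<beta> \<delta>] by eventually_elim (use J(3) in simp)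
  have sc: "(delta_weight \<delta> z / ?J) *\<^sub>R mellin_factor t s z = (1 / of_real ?J) * (of_real (delta_weight \<delta> z) * mellin_factor t s z)" for z
    by (simp add: scaleR_conv_of_real)
  show "integrable (deformed_law n \<beta> \<delta> k) (mellin_factor t s)"
    unfolding deformed_law_def
  proof (subst integrable_density)
    show "integrable ?N (\<lambda>z. (delta_weight \<delta> z / ?J) *\<^sub>R mellin_factor t s z)"
      unfolding sc by (rule integrable_mult_right[OF i])
  qed (use J0 in measurable)
  have "(LINT z|deformed_law n \<beta> \<delta> k. mellin_factor t s z) = (LINT z|?N. (delta_weight \<delta> z / ?J) *\<^sub>R mellin_factor t s z)"
    unfolding deformed_law_def by (rule integral_density) (use J0 in measurable)
  also have "\<dots> = (1 / of_real ?J) * (Gamma (of_real ?b + 1) * Gamma (of_real ?b + 1 + ?p + ?q) * rGamma (of_real ?b + 1 + ?p) * rGamma (of_real ?b + 1 + ?q))"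
    unfolding sc integral_mult_right_zero I ..
  finally have *: "(LINT z|deformed_law n \<beta> \<delta> k. mellin_factor t s z) = \<dots>" .
  have nz: "Gamma (complex_of_real ?b + 1) \<noteq> 0" "Gamma (of_real ?b + 1 + \<delta> + cnj \<delta>) \<noteq> 0"
    "Gamma (of_real ?b + 1 + cnj \<delta>) \<noteq> 0" "Gamma (of_real ?b + 1 + \<delta>) \<noteq> 0"
    using ix(5)[of k] \<delta> unfolding Gamma_eq_zero_iff by (auto intro!: Re_pos_not_nonpos_Ints)
  have e: "of_real ?b + 1 + ?p + ?q = of_real ?b + 1 + \<delta> + cnj \<delta> + t"
    "of_real ?b + 1 + ?p = of_real ?b + 1 + cnj \<delta> + (t + s) / 2" "of_real ?b + 1 + ?q = of_real ?b + 1 + \<delta> + (t - s) / 2"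
    using pqs by (simp_all add: algebra_simps)
  \<comment> \<open>X and Y may sit at poles, where \<open>Gamma\<close> is 0 by convention and
    division by it gives 0, which is the value of \<open>rGamma\<close>.\<close>
  define X where "X = Gamma (of_real ?b + 1 + cnj \<delta> + (t + s) / 2)"
  define Y where "Y = Gamma (of_real ?b + 1 + \<delta> + (t - s) / 2)"
  show "(LINT z|deformed_law n \<beta> \<delta> k. mellin_factor t s z) =
      Gamma (of_real ?b + 1 + \<delta>) * Gamma (of_real ?b + 1 + cnj \<delta>) * Gamma (of_real ?b + 1 + \<delta> + cnj \<delta> + t)
      / (Gamma (of_real ?b + 1 + \<delta> + cnj \<delta>) * Gamma (of_real ?b + 1 + \<delta> + (t - s) / 2) * Gamma (of_real ?b + 1 + cnj \<delta> + (t + s) / 2))"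
    unfolding * e(1)
    unfolding e(2,3) J(2) rGamma_inverse_Gamma X_def[symmetric] Y_def[symmetric]
    using nz by (simp add: field_simps)
qed

context
  fixes M :: "'a measure" and U :: "'a \<Rightarrow> complex mat"
  assumes M: "prob_space M" and U: "U \<in> M \<rightarrow>\<^sub>M unitary_borel n" and law: "distr M (unitary_borel n) U = CJ n \<delta> \<beta>"
begin

text \<open>The argument of Z is by definition the sum of the arguments of its factors, so almost
  surely both modulus and phase factor over k, and independence turns the expectation into a
  product.\<close>

lemma mellin_transform:
  defines "\<gamma> \<equiv> \<lambda>k \<omega>. deformed_verblunsky (spectral_measure (U \<omega>)) k"
    and "Z \<equiv> \<lambda>\<omega>. Determinant.det (1\<^sub>m n - U \<omega>)"
  shows "integrable M (\<lambda>\<omega>. of_real (cmod (Z \<omega>)) powr t * exp (\<i> * s * of_real (\<Sum>k<n. Arg (1 - \<gamma> k \<omega>))))"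
    and "(\<integral>\<omega>. of_real (cmod (Z \<omega>)) powr t * exp (\<i> * s * of_real (\<Sum>k<n. Arg (1 - \<gamma> k \<omega>))) \<partial>M) =
      (\<Prod>k<n. LINT z|deformed_law n \<beta> \<delta> k. mellin_factor t s z)"
proof -
  interpret prob_space M by (rule M)
  note hyps = n \<beta> \<delta> M U law
  let ?F = "\<lambda>\<omega>. of_real (cmod (Z \<omega>)) powr t * exp (\<i> * s * of_real (\<Sum>k<n. Arg (1 - \<gamma> k \<omega>)))"
  have g [measurable]: "\<gamma> k \<in> borel_measurable M" for k
    unfolding \<gamma>_def by (rule gamma_of_U_measurable[OF hyps])
  have d: "distr M borel (\<gamma> k) = deformed_law n \<beta> \<delta> k" if "k < n" for k
    unfolding \<gamma>_def by (rule distr_gamma_of[OF hyps that])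
  have ind: "indep_vars (\<lambda>_. borel) (\<lambda>k \<omega>. mellin_factor t s (\<gamma> k \<omega>)) {..<n}"
    using indep_gamma_of[OF hyps] unfolding \<gamma>_def by (rule indep_vars_compose2) measurable
  have int: "integrable M (\<lambda>\<omega>. mellin_factor t s (\<gamma> k \<omega>))" if "k \<in> {..<n}" for k
  proof -
    have "integrable (distr M borel (\<gamma> k)) (mellin_factor t s)"
      unfolding d[OF that[unfolded lessThan_iff]] by (rule mellin_factor_integral(1))
    thus ?thesis by (subst (asm) integrable_distr_eq) measurable
  qed
  have val: "(\<integral>\<omega>. mellin_factor t s (\<gamma> k \<omega>) \<partial>M) = (LINT z|deformed_law n \<beta> \<delta> k. mellin_factor t s z)" if "k < n" for k
    unfolding d[OF that, symmetric] by (rule integral_distr[symmetric]) measurable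
  have "AE \<omega> in M. ?F \<omega> = (\<Prod>k<n. mellin_factor t s (\<gamma> k \<omega>))"
    using AE_det_eq[OF hyps]
  proof eventually_elim
    case (elim \<omega>)
    have Z: "Z \<omega> = (\<Prod>k<n. 1 - \<gamma> k \<omega>)" using elim by (simp add: Z_def \<gamma>_def)
    have "complex_of_real (cmod (Z \<omega>)) powr t = (\<Prod>k<n. of_real (cmod (1 - \<gamma> k \<omega>)) powr t)"
      unfolding Z prod_norm[symmetric] using powr_of_real_prod[of "{..<n}" "\<lambda>k. cmod (1 - \<gamma> k \<omega>)" t] n by auto
    moreover have "exp (\<i> * s * of_real (\<Sum>k<n. Arg (1 - \<gamma> k \<omega>))) = (\<Prod>k<n. exp (\<i> * s * of_real (Arg (1 - \<gamma> k \<omega>))))"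
      unfolding of_real_sum sum_distrib_left by (rule exp_sum) simp
    ultimately show ?case unfolding mellin_factor_def prod.distrib by simp
  qed
  note ae = this
  have Uc: "U \<omega> \<in> carrier_mat n n" if "\<omega> \<in> space M" for \<omega>
    using measurable_space[OF U that] by (simp add: unitary_mats_def)
  \<comment> \<open>Almost sure equality with the product of the 1 - gamma_k does not give
    measurability of Z on all of M. The Leibniz formula does, as the determinant is polynomial in
    the entries.\<close>
  have Zm: "Z \<in> borel_measurable M"
  proof -
    have "(\<lambda>\<omega>. (1\<^sub>m n - U \<omega>) $$ (i, j)) \<in> borel_measurable M" if "i < n" "j < n" for i j
    proof -
      have [measurable]: "(\<lambda>\<omega>. U \<omega> $$ (i, j)) \<in> borel_measurable M"
        by (rule measurable_compose[OF U measurable_mat_entry[OF that]])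
      have "(\<lambda>\<omega>. 1\<^sub>m n $$ (i, j) - U \<omega> $$ (i, j)) \<in> borel_measurable M" by measurable
      thus ?thesis
      proof (rule measurable_cong[THEN iffD1, rotated])
        fix \<omega> assume "\<omega> \<in> space M"
        from carrier_matD[OF Uc[OF this]] that
        show "1\<^sub>m n $$ (i, j) - U \<omega> $$ (i, j) = (1\<^sub>m n - U \<omega>) $$ (i, j)" by simp
      qed
    qed
    hence "(\<lambda>\<omega>. \<Sum>p | p permutes {0..<n}. signof p * (\<Prod>i = 0..<n. (1\<^sub>m n - U \<omega>) $$ (i, p i))) \<in> borel_measurable M"
      by (intro borel_measurable_sum borel_measurable_times borel_measurable_const borel_measurable_prod) (auto dest: permutes_in_image)
    thus ?thesis unfolding Z_def
      by (rule measurable_cong[THEN iffD1, rotated]) (intro det_def'[symmetric] minus_carrier_mat Uc)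
  qed
  have Fm: "?F \<in> borel_measurable M"
  proof -
    note Zm [measurable]
    show ?thesis by measurable
  qed
  have ip: "integrable M (\<lambda>\<omega>. \<Prod>k<n. mellin_factor t s (\<gamma> k \<omega>))"
    by (rule indep_vars_integrable[OF _ ind int]) simp_all
  show "integrable M ?F"
    using ip by (subst integrable_cong_AE[OF Fm _ ae]) measurable
  have "(\<integral>\<omega>. ?F \<omega> \<partial>M) = (\<integral>\<omega>. (\<Prod>k<n. mellin_factor t s (\<gamma> k \<omega>)) \<partial>M)"
    by (rule integral_cong_AE[OF Fm _ ae]) measurable
  also have "\<dots> = (\<Prod>k<n. \<integral>\<omega>. mellin_factor t s (\<gamma> k \<omega>) \<partial>M)"
    by (rule indep_vars_lebesgue_integral[OF _ ind int]) simp_all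
  also have "\<dots> = (\<Prod>k<n. LINT z|deformed_law n \<beta> \<delta> k. mellin_factor t s z)"
    by (intro prod.cong refl) (simp add: val)
  finally show "(\<integral>\<omega>. ?F \<omega> \<partial>M) = (\<Prod>k<n. LINT z|deformed_law n \<beta> \<delta> k. mellin_factor t s z)" .
qed

end

end

text \<open>In the Mellin part, the condition on Re (delta + cnj delta + t) is the integrability at
  1 of |1 - z|^(2 Re delta + Re t) on the circle, where gamma_(n-1) lives. The bounds Re delta >
  -1/2 and Re t > -1/2 only give a value above -3/2, so it is a separate requirement.\<close>

theorem proposition4p3:
  fixes \<delta> :: complex and \<beta> \<beta>' :: real and n :: nat
    and M :: "'a measure" and U :: "'a \<Rightarrow> complex mat"
    and Z :: "'a \<Rightarrow> complex" and \<gamma> :: "nat \<Rightarrow> 'a \<Rightarrow> complex" and argZ :: "'a \<Rightarrow> real"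
    and c :: "nat \<Rightarrow> complex"
  assumes "Re \<delta> > - 1 / 2" and "\<beta> > 0" and "n \<ge> 1"
    and "prob_space M"
    and "U \<in> M \<rightarrow>\<^sub>M unitary_borel n"
    and "distr M (unitary_borel n) U = CJ n \<delta> \<beta>"
  defines "\<beta>' \<equiv> \<beta> / 2"
    and "Z \<equiv> \<lambda>\<omega>. Determinant.det (1\<^sub>m n - U \<omega>)"
    and "\<gamma> \<equiv> \<lambda>k \<omega>. deformed_verblunsky (spectral_measure (U \<omega>)) k"
    and "argZ \<equiv> \<lambda>\<omega>. \<Sum>k<n. Arg (1 - \<gamma> k \<omega>)"
    and "c \<equiv> \<lambda>k. Gamma (of_real (\<beta>' * real (n - k - 1)) + 1 + \<delta>)
                  * Gamma (of_real (\<beta>' * real (n - k - 1)) + 1 + cnj \<delta>)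
                / (of_real pi * Gamma (of_real (\<beta>' * real (n - k - 1)))
                  * Gamma (of_real (\<beta>' * real (n - k - 1)) + 1 + \<delta> + cnj \<delta>))"
  shows "(AE \<omega> in M. Z \<omega> = (\<Prod>k<n. 1 - \<gamma> k \<omega>))
    \<and> prob_space.indep_vars M (\<lambda>_. borel) \<gamma> {..<n}
    \<and> (\<forall>k<n - 1. distributed M lborel (\<gamma> k)
         (\<lambda>z. indicator (ball 0 1) z *
              ennreal (Re (c k * of_real ((1 - (cmod z)\<^sup>2) powr (\<beta>' * real (n - k - 1) - 1))
                           * (1 - z) powr cnj \<delta> * (1 - cnj z) powr \<delta>))))
    \<and> distributed M uniform_circle (\<gamma> (n - 1))
         (\<lambda>\<zeta>. ennreal (Re (Gamma (1 + \<delta>) * Gamma (1 + cnj \<delta>) / Gamma (1 + \<delta> + cnj \<delta>)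
                           * (1 - \<zeta>) powr cnj \<delta> * (1 - cnj \<zeta>) powr \<delta>)))
    \<and> (\<forall>s t :: complex. Re t > - 1 / 2 \<longrightarrow> Re (\<delta> + cnj \<delta> + t) > - 1 \<longrightarrow>
         integrable M (\<lambda>\<omega>. of_real (cmod (Z \<omega>)) powr t * exp (\<i> * s * of_real (argZ \<omega>)))
         \<and> (\<integral>\<omega>. of_real (cmod (Z \<omega>)) powr t * exp (\<i> * s * of_real (argZ \<omega>)) \<partial>M)
           = (\<Prod>k<n. Gamma (of_real (\<beta>' * real k) + 1 + \<delta>)
                     * Gamma (of_real (\<beta>' * real k) + 1 + cnj \<delta>)
                     * Gamma (of_real (\<beta>' * real k) + 1 + \<delta> + cnj \<delta> + t)
                   / (Gamma (of_real (\<beta>' * real k) + 1 + \<delta> + cnj \<delta>)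
                     * Gamma (of_real (\<beta>' * real k) + 1 + \<delta> + (t - s) / 2)
                     * Gamma (of_real (\<beta>' * real k) + 1 + cnj \<delta> + (t + s) / 2))))"
proof -
  define m where "m = n - 1"
  have n: "n = Suc m" using assms(3) by (simp add: m_def)
  note \<delta> = assms(1) and \<beta> = assms(2)
  note hyps = n \<beta> \<delta> assms(4-6)
  have b: "\<beta>' * real (n - k - 1) = half_index n \<beta> k" for k by (simp add: \<beta>'_def half_index_def)
  have "AE \<omega> in M. Z \<omega> = (\<Prod>k<n. 1 - \<gamma> k \<omega>)"
    using AE_det_eq[OF hyps] unfolding Z_def \<gamma>_def by eventually_elim simp
  moreover have "prob_space.indep_vars M (\<lambda>_. borel) \<gamma> {..<n}"
    unfolding \<gamma>_def by (rule indep_gamma_of[OF hyps])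
  moreover have "\<forall>k<n - 1. distributed M lborel (\<gamma> k)
         (\<lambda>z. indicator (ball 0 1) z *
              ennreal (Re (c k * of_real ((1 - (cmod z)\<^sup>2) powr (\<beta>' * real (n - k - 1) - 1))
                           * (1 - z) powr cnj \<delta> * (1 - cnj z) powr \<delta>)))"
  proof (intro allI impI)
    fix k assume "k < n - 1"
    hence k: "k < m" by (simp add: m_def)
    have "c k = Gamma (of_real (half_index n \<beta> k) + 1 + \<delta>) * Gamma (of_real (half_index n \<beta> k) + 1 + cnj \<delta>)
       / (of_real pi * Gamma (of_real (half_index n \<beta> k)) * Gamma (of_real (half_index n \<beta> k) + 1 + \<delta> + cnj \<delta>))"
      unfolding c_def b ..
    from distributed_gamma_of_disc[OF hyps k this]
    show "distributed M lborel (\<gamma> k)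
         (\<lambda>z. indicator (ball 0 1) z *
              ennreal (Re (c k * of_real ((1 - (cmod z)\<^sup>2) powr (\<beta>' * real (n - k - 1) - 1))
                           * (1 - z) powr cnj \<delta> * (1 - cnj z) powr \<delta>)))"
      unfolding \<gamma>_def b .
  qed
  moreover have "distributed M uniform_circle (\<gamma> (n - 1))
         (\<lambda>\<zeta>. ennreal (Re (Gamma (1 + \<delta>) * Gamma (1 + cnj \<delta>) / Gamma (1 + \<delta> + cnj \<delta>)
                           * (1 - \<zeta>) powr cnj \<delta> * (1 - cnj \<zeta>) powr \<delta>)))"
    unfolding \<gamma>_def m_def[symmetric] by (rule distributed_gamma_of_circle[OF hyps])
  moreover have "integrable M (\<lambda>\<omega>. of_real (cmod (Z \<omega>)) powr t * exp (\<i> * s * of_real (argZ \<omega>)))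
         \<and> (\<integral>\<omega>. of_real (cmod (Z \<omega>)) powr t * exp (\<i> * s * of_real (argZ \<omega>)) \<partial>M)
           = (\<Prod>k<n. Gamma (of_real (\<beta>' * real k) + 1 + \<delta>)
                     * Gamma (of_real (\<beta>' * real k) + 1 + cnj \<delta>)
                     * Gamma (of_real (\<beta>' * real k) + 1 + \<delta> + cnj \<delta> + t)
                   / (Gamma (of_real (\<beta>' * real k) + 1 + \<delta> + cnj \<delta>)
                     * Gamma (of_real (\<beta>' * real k) + 1 + \<delta> + (t - s) / 2)
                     * Gamma (of_real (\<beta>' * real k) + 1 + cnj \<delta> + (t + s) / 2)))"
    if t: "Re (\<delta> + cnj \<delta> + t) > - 1" for s t
  proof -
    let ?G = "\<lambda>k. Gamma (of_real (\<beta>' * real k) + 1 + \<delta>)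
                     * Gamma (of_real (\<beta>' * real k) + 1 + cnj \<delta>)
                     * Gamma (of_real (\<beta>' * real k) + 1 + \<delta> + cnj \<delta> + t)
                   / (Gamma (of_real (\<beta>' * real k) + 1 + \<delta> + cnj \<delta>)
                     * Gamma (of_real (\<beta>' * real k) + 1 + \<delta> + (t - s) / 2)
                     * Gamma (of_real (\<beta>' * real k) + 1 + cnj \<delta> + (t + s) / 2))"
    note MT = mellin_transform[OF n \<beta> \<delta> t assms(4-6), of s, folded Z_def \<gamma>_def, folded argZ_def]
    have "(\<Prod>k<n. LINT z|deformed_law n \<beta> \<delta> k. mellin_factor t s z) = (\<Prod>k<n. ?G (n - k - 1))"
      by (intro prod.cong refl) (simp only: mellin_factor_integral(2)[OF n \<beta> \<delta> t] b)
    \<comment> \<open>The law of gamma_k carries the index n - k - 1, while the claimed product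
      counts upwards from 0; the order of the factors is reversed.\<close>
    also have "\<dots> = (\<Prod>k<n. ?G k)" using prod.nat_diff_reindex[of ?G n] by simp
    finally show ?thesis using MT unfolding Z_def \<gamma>_def argZ_def by simp
  qed
  ultimately show ?thesis by blast
qed

end
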